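(* Let $K$ be a field, $q,Q\in K^{\times}$, $n,d\ge1$, and suppose $f^{\mathrm B}_d(Q,q)=\prod_{i=1-d}^{d-1}(Q^{-2}+q^{2i})$ is invertible in $K$. For all $N,D$ fix a cell datum $(\Lambda_{N,D},M_{N,D},C_{N,D},* )$ of the type A $q$-Schur algebra $S^{\mathrm A}_q(N,D)$. Then $S^{\mathrm B}_{Q,q}(n,d)$ is a cellular algebra with cell datum $(\Lambda^{\mathrm B},M^{\mathrm B},C^{\mathrm B},* )$, where, identifying $S^{\mathrm B}_{Q,q}(n,d)$ with $\bigoplus_{i=0}^dS^{\mathrm A}_q(\lceil n/2\rceil,i)\otimes S^{\mathrm A}_q(\lfloor n/2\rfloor,d-i)$: (1) $\Lambda^{\mathrm B}=\bigsqcup_{i=0}^d\Lambda_{\lceil n/2\rceil,i}\times\Lambda_{\lfloor n/2\rfloor,d-i}$, as a poset with the lexicographical order; (2) for $\lambda=(\lambda^{(1)},\lambda^{(2)})\in\Lambda_{\lceil n/2\rceil,i}\times\Lambda_{\lfloor n/2\rfloor,d-i}$, $M^{\mathrm B}(\lambda)=M_{\lceil n/2\rceil,i}(\lambda^{(1)})\times M_{\lfloor n/2\rfloor,d-i}(\lambda^{(2)})$; (3) for $\mathfrak s=(\mathfrak s^{(1)},\mathfrak s^{(2)})$, $\mathfrak t=(\mathfrak t^{(1)},\mathfrak t^{(2)})\in M^{\mathrm B}(\lambda)$, $(C^{\mathrm B})^{\lambda}_{\mathfrak s,\mathfrak t}=(C_{\lceil n/2\rceil,i})^{\lambda^{(1)}}_{\mathfrak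 s^{(1)},\mathfrak t^{(1)}}\otimes(C_{\lfloor n/2\rfloor,d-i})^{\lambda^{(2)}}_{\mathfrak s^{(2)},\mathfrak t^{(2)}}$; (4) $*$ is the $K$-linear map sending $(C^{\mathrm B})^\lambda_{\mathfrak s,\mathfrak t}$ to $(C^{\mathrm B})^\lambda_{\mathfrak t,\mathfrak s}$.
   Context: Cellular algebra: a $K$-algebra $A$ is cellular with cell datum $(\Lambda,M,C,* )$ if $\Lambda$ is a poset, $M$ assigns to each $\lambda\in\Lambda$ a finite set $M(\lambda)$, $C$ assigns to each $\lambda$ and $(\mathfrak s,\mathfrak t)\in M(\lambda)^2$ an element $C^\lambda_{\mathfrak s,\mathfrak t}\in A$, and $*$ is a $K$-linear involutory anti-automorphism of $A$ such that: (C1) $C$ is injective with image a $K$-basis of $A$; (C2) $(C^\lambda_{\mathfrak s,\mathfrak t})^*=C^\lambda_{\mathfrak t,\mathfrak s}$; (C3) there are $r_a(\mathfrak s',\mathfrak s)\in K$ with $aC^\lambda_{\mathfrak s,\mathfrak t}\equiv\sum_{\mathfrak s'\in M(\lambda)}r_a(\mathfrak s',\mathfrak s)C^\lambda_{\mathfrak s',\mathfrak t}$ modulo $A_{<\lambda}$ for all $a\in A$, $\mathfrak s,\mathfrak t\in M(\lambda)$, where $A_{<\lambda}$ is spanned by the $C^\mu_{\mathfrak s'',\mathfrak t''}$ with $\mu<\lambda$. Type A $q$-Schur algebras are known to be cellular. In the lexicographical order on $\Lambda^{\mathrm B}$, $(\lambda^{(1)},\lambda^{(2)})<(\mu^{(1)},\mu^{(2)})$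 (in the same component $i$) iff $\lambda^{(1)}<\mu^{(1)}$, or $\lambda^{(1)}=\mu^{(1)}$ and $\lambda^{(2)}<\mu^{(2)}$. Schur algebras: $I(n)=[-r,r]\cap\mathbb Z$ if $n=2r+1$ and $I(n)=([-r,r]\cap\mathbb Z)\setminus\{0\}$ if $n=2r$. $\mathcal H^{\mathrm B}_{Q,q}(d)$ is the $K$-algebra generated by $T_0,\dots,T_{d-1}$ with relations $T_iT_{i+1}T_i=T_{i+1}T_iT_{i+1}$ $(1\le i\le d-2)$, $(T_0T_1)^2=(T_1T_0)^2$, $T_iT_j=T_jT_i$ $(|i-j|>1)$, $T_0^2=(Q^{-1}-Q)T_0+1$, $T_i^2=(q^{-1}-q)T_i+1$ $(i\ge1)$; $\mathcal H_q(\Sigma_d)$ is the subalgebra generated by $T_1,\dots,T_{d-1}$. $V=V(n)$ has basis $\{v_i\mid i\in I(n)\}$ and $v_\mu=v_{\mu_1}\otimes\cdots\otimes v_{\mu_d}$; $\mu\cdot s_t$ exchanges $\mu_t,\mu_{t+1}$ and $\mu\cdot s_0=(-\mu_1,\mu_2,\dots,\mu_d)$. $V^{\otimes d}$ is a right module via $v_\mu T_t=v_{\mu\cdot s_t}$, $q^{-1}v_{\mu\cdot s_t}$, $v_{\mu\cdot s_t}+(q^{-1}-q)v_\mu$ according as $\mu_t<\mu_{t+1}$, $\mu_t=\mu_{t+1}$, $\mu_t>\mu_{t+1}$, and $v_\mu T_0=v_{\mu\cdot s_0}$, $Q^{-1}v_{\mu\cdot s_0}$, $v_{\mu\cdot s_0}+(Q^{-1}-Q)v_\mu$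 according as $\mu_1>0$, $\mu_1=0$, $\mu_1<0$. $S^{\mathrm B}_{Q,q}(n,d)=\operatorname{End}_{\mathcal H^{\mathrm B}_{Q,q}(d)}(V(n)^{\otimes d})$, $S^{\mathrm A}_q(m,i)=\operatorname{End}_{\mathcal H_q(\Sigma_i)}(V(m)^{\otimes i})$, with $S^{\mathrm A}_q(m,0)=K$ and $S^{\mathrm A}_q(0,i)=0$ for $i\ge1$. When $f^{\mathrm B}_d(Q,q)\ne0$ there is a $K$-algebra isomorphism $S^{\mathrm B}_{Q,q}(n,d)\cong\bigoplus_{i=0}^dS^{\mathrm A}_q(\lceil n/2\rceil,i)\otimes S^{\mathrm A}_q(\lfloor n/2\rfloor,d-i)$, which is the identification used. *)

theory Defs
  imports
    "HOL-Algebra.QuotRing"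
    "HOL-Algebra.Subrings"
    "HOL-Library.Poly_Mapping"
    "Jordan_Normal_Form.VS_Connect"
begin

text \<open>
  Scalars form a type of class \<open>field\<close>; algebras over it are records of HOL-Algebra type
  \<open>module\<close>, whose ring part need not be commutative, so the locale \<open>algebra\<close> of HOL-Algebra
  does not apply. Vector space notions (\<open>vectorspace.basis\<close>, \<open>module.span\<close>, \<open>module_hom\<close>) are
  those of the AFP entry VectorSpace over \<open>class_ring\<close>, the field type as a ring record. Names that
  also exist for the type class based modules of HOL are qualified.
\<close>

section \<open>Algebras over a field\<close>

locale k_algebra =
  fixes A :: "('k::field, 'a, 'm) module_scheme" (structure)
  assumes ring: "ring A"
    and vectorspace: "vectorspace (class_ring :: 'k ring) A"
    and smult_mult_left: "\<lbrakk>x \<in> carrier A; y \<in> carrier A\<rbrakk> \<Longrightarrow> (c \<odot> x) \<otimes> y = c \<odot> (x \<otimes> y)"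
    and smult_mult_right: "\<lbrakk>x \<in> carrier A; y \<in> carrier A\<rbrakk> \<Longrightarrow> x \<otimes> (c \<odot> y) = c \<odot> (x \<otimes> y)"

abbreviation k_linear ::
    "('k::field, 'a, 'm) module_scheme \<Rightarrow> ('k, 'b, 'n) module_scheme \<Rightarrow> ('a \<Rightarrow> 'b) set" where
  "k_linear A B \<equiv> LinearCombinations.module_hom (class_ring :: 'k ring) A B"

definition alg_iso ::
    "('k::field, 'a, 'm) module_scheme \<Rightarrow> ('k, 'b, 'n) module_scheme \<Rightarrow> ('a \<Rightarrow> 'b) set" where
  "alg_iso A B = ring_iso A B \<inter> k_linear A B"

definition k_subalgebra :: "'a set \<Rightarrow> ('k::field, 'a, 'm) module_scheme \<Rightarrow> bool" where
  "k_subalgebra S A \<longleftrightarrow> subring S A \<and> (\<forall>c. \<forall>x\<in>S. c \<odot>\<^bsub>A\<^esub> x \<in> S)"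

definition quot_alg :: "('k::field, 'a, 'm) module_scheme \<Rightarrow> 'a set \<Rightarrow> ('k, 'a set) module" where
  "quot_alg A I =
    \<lparr>carrier = carrier (A Quot I), mult = mult (A Quot I), one = one (A Quot I),
     zero = zero (A Quot I), add = add (A Quot I),
     smult = (\<lambda>c X. \<Union>x\<in>X. I +>\<^bsub>A\<^esub> (c \<odot>\<^bsub>A\<^esub> x))\<rparr>"

definition dirsum_alg ::
    "'i set \<Rightarrow> ('i \<Rightarrow> ('k::field, 'a, 'm) module_scheme) \<Rightarrow> ('k, 'i \<Rightarrow> 'a) module" where
  "dirsum_alg I A =
    \<lparr>carrier = (\<Pi>\<^sub>E i\<in>I. carrier (A i)),
     mult = (\<lambda>x y. \<lambda>i\<in>I. x i \<otimes>\<^bsub>A i\<^esub> y i),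
     one = (\<lambda>i\<in>I. \<one>\<^bsub>A i\<^esub>),
     zero = (\<lambda>i\<in>I. \<zero>\<^bsub>A i\<^esub>),
     add = (\<lambda>x y. \<lambda>i\<in>I. x i \<oplus>\<^bsub>A i\<^esub> y i),
     smult = (\<lambda>c x. \<lambda>i\<in>I. c \<odot>\<^bsub>A i\<^esub> x i)\<rparr>"

definition dirsum_in ::
    "'i set \<Rightarrow> ('i \<Rightarrow> ('k::field, 'a, 'm) module_scheme) \<Rightarrow> 'i \<Rightarrow> 'a \<Rightarrow> 'i \<Rightarrow> 'a" where
  "dirsum_in I A i x = (\<lambda>j\<in>I. if j = i then x else \<zero>\<^bsub>A j\<^esub>)"


section \<open>Free vector spaces and monoid algebras\<close>

text \<open>The free vector space on a set \<open>X\<close> consists of the finitely supported functions \<open>x\<close> with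
  \<open>keys x \<subseteq> X\<close>; the basis vector of \<open>p\<close> is \<open>Poly_Mapping.single p 1\<close>.\<close>

definition scale :: "'k::field \<Rightarrow> ('x \<Rightarrow>\<^sub>0 'k) \<Rightarrow> ('x \<Rightarrow>\<^sub>0 'k)" where
  "scale c x = Poly_Mapping.map ((*) c) x"

definition lin_ext :: "('x \<Rightarrow> ('y \<Rightarrow>\<^sub>0 'k::field)) \<Rightarrow> ('x \<Rightarrow>\<^sub>0 'k) \<Rightarrow> ('y \<Rightarrow>\<^sub>0 'k)" where
  "lin_ext f x = (\<Sum>p\<in>Poly_Mapping.keys x. scale (Poly_Mapping.lookup x p) (f p))"

definition monoid_alg :: "('x, 'm) monoid_scheme \<Rightarrow> ('k::field, 'x \<Rightarrow>\<^sub>0 'k) module" where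
  "monoid_alg G =
    \<lparr>carrier = {x. Poly_Mapping.keys x \<subseteq> carrier G},
     mult = (\<lambda>x y. \<Sum>p\<in>Poly_Mapping.keys x. \<Sum>r\<in>Poly_Mapping.keys y.
       Poly_Mapping.single (p \<otimes>\<^bsub>G\<^esub> r) (Poly_Mapping.lookup x p * Poly_Mapping.lookup y r)),
     one = Poly_Mapping.single \<one>\<^bsub>G\<^esub> 1,
     zero = 0,
     add = (+),
     smult = scale\<rparr>"

definition free_monoid :: "'x set \<Rightarrow> 'x list monoid" where
  "free_monoid X = \<lparr>carrier = lists X, mult = (@), one = []\<rparr>"


section \<open>Tensor products of algebras\<close>

text \<open>\<open>A \<otimes> B\<close> is the free vector space on \<open>A \<times> B\<close> modulo bilinearity. As the product is
  \<open>(a \<otimes> b)(a' \<otimes> b') = aa' \<otimes> bb'\<close>, that free space is taken as the monoid algebra of the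
  multiplicative monoid of \<open>A \<times> B\<close>. The span of the bilinearity relations is a two-sided ideal
  there, so it equals the ideal they generate.\<close>

definition tensor_rels ::
    "('k::field, 'a, 'm) module_scheme \<Rightarrow> ('k, 'b, 'n) module_scheme \<Rightarrow> ('a \<times> 'b \<Rightarrow>\<^sub>0 'k) set" where
  "tensor_rels A B =
    {Poly_Mapping.single (a \<oplus>\<^bsub>A\<^esub> a', b) 1 - Poly_Mapping.single (a, b) 1 - Poly_Mapping.single (a', b) 1
      | a a' b. a \<in> carrier A \<and> a' \<in> carrier A \<and> b \<in> carrier B} \<union>
    {Poly_Mapping.single (a, b \<oplus>\<^bsub>B\<^esub> b') 1 - Poly_Mapping.single (a, b) 1 - Poly_Mapping.single (a, b') 1
      | a b b'. a \<in> carrier A \<and> b \<in> carrier B \<and> b' \<in> carrier B} \<union>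
    {Poly_Mapping.single (c \<odot>\<^bsub>A\<^esub> a, b) 1 - Poly_Mapping.single (a, b) c
      | c a b. a \<in> carrier A \<and> b \<in> carrier B} \<union>
    {Poly_Mapping.single (a, c \<odot>\<^bsub>B\<^esub> b) 1 - Poly_Mapping.single (a, b) c
      | c a b. a \<in> carrier A \<and> b \<in> carrier B}"

definition tensor_ideal ::
    "('k::field, 'a, 'm) module_scheme \<Rightarrow> ('k, 'b, 'n) module_scheme \<Rightarrow> ('a \<times> 'b \<Rightarrow>\<^sub>0 'k) set" where
  "tensor_ideal A B = Idl\<^bsub>monoid_alg (A \<times>\<times> B)\<^esub> (tensor_rels A B)"

definition tensor_alg ::
    "('k::field, 'a, 'm) module_scheme \<Rightarrow> ('k, 'b, 'n) module_scheme
      \<Rightarrow> ('k, ('a \<times> 'b \<Rightarrow>\<^sub>0 'k) set) module" where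
  "tensor_alg A B = quot_alg (monoid_alg (A \<times>\<times> B)) (tensor_ideal A B)"

definition tensor_elem ::
    "('k::field, 'a, 'm) module_scheme \<Rightarrow> ('k, 'b, 'n) module_scheme
      \<Rightarrow> 'a \<Rightarrow> 'b \<Rightarrow> ('a \<times> 'b \<Rightarrow>\<^sub>0 'k) set" where
  "tensor_elem A B a b =
    tensor_ideal A B +>\<^bsub>(monoid_alg (A \<times>\<times> B) :: ('k, _) module)\<^esub> Poly_Mapping.single (a, b) 1"


section \<open>Cellular algebras\<close>

text \<open>\<open>R\<close> is the (reflexive) order relation of the poset \<open>L\<close>; \<open>C l s t\<close> is only constrained for
  \<open>l \<in> L\<close> and \<open>s, t \<in> M l\<close>.\<close>

definition cell_lower ::
    "('k::field, 'a, 'm) module_scheme \<Rightarrow> 'l set \<Rightarrow> 'l rel \<Rightarrow> ('l \<Rightarrow> 's set) \<Rightarrow>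
      ('l \<Rightarrow> 's \<Rightarrow> 's \<Rightarrow> 'a) \<Rightarrow> 'l \<Rightarrow> 'a set" where
  "cell_lower A L R M C l =
    LinearCombinations.module.span (class_ring :: 'k ring) A
      {C m s t | m s t. m \<in> L \<and> (m, l) \<in> R \<and> m \<noteq> l \<and> s \<in> M m \<and> t \<in> M m}"

locale cell_datum = k_algebra A
  for A :: "('k::field, 'a, 'm) module_scheme" (structure) +
  fixes L :: "'l set"
    and R :: "'l rel"
    and M :: "'l \<Rightarrow> 's set"
    and C :: "'l \<Rightarrow> 's \<Rightarrow> 's \<Rightarrow> 'a"
    and star :: "'a \<Rightarrow> 'a"
  assumes poset: "partial_order_on L R"
    and finite_M: "l \<in> L \<Longrightarrow> finite (M l)"
    and C_closed: "\<lbrakk>l \<in> L; s \<in> M l; t \<in> M l\<rbrakk> \<Longrightarrow> C l s t \<in> carrier A"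
    and star_linear: "star \<in> k_linear A A"
    and star_involution: "x \<in> carrier A \<Longrightarrow> star (star x) = x"
    and star_mult: "\<lbrakk>x \<in> carrier A; y \<in> carrier A\<rbrakk> \<Longrightarrow> star (x \<otimes> y) = star y \<otimes> star x"
    and C1_inj: "inj_on (\<lambda>(l, s, t). C l s t) (SIGMA l:L. M l \<times> M l)"
    and C1_basis: "vectorspace.basis (class_ring :: 'k ring) A
          ((\<lambda>(l, s, t). C l s t) ` (SIGMA l:L. M l \<times> M l))"
    and C2: "\<lbrakk>l \<in> L; s \<in> M l; t \<in> M l\<rbrakk> \<Longrightarrow> star (C l s t) = C l t s"
    and C3: "\<lbrakk>l \<in> L; a \<in> carrier A\<rbrakk> \<Longrightarrow>
          \<exists>r :: 's \<Rightarrow> 's \<Rightarrow> 'k. \<forall>s \<in> M l. \<forall>t \<in> M l.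
            (a \<otimes> C l s t) \<ominus> (\<Oplus>s' \<in> M l. r s' s \<odot> C l s' t) \<in> cell_lower A L R M C l"


section \<open>Hecke algebras\<close>

text \<open>Monomials of the free algebra on \<open>T\<^sub>0, \<dots>, T\<^bsub>d-1\<^esub>\<close> are lists of indices, so
  \<open>single [i, j] 1\<close> is \<open>T\<^sub>i T\<^sub>j\<close> and \<open>single [] c\<close> is the constant \<open>c\<close>.\<close>

definition hecke_free :: "nat \<Rightarrow> ('k::field, nat list \<Rightarrow>\<^sub>0 'k) module" where
  "hecke_free d = monoid_alg (free_monoid {0..<d})"

definition hecke_rels :: "'k::field \<Rightarrow> 'k \<Rightarrow> nat \<Rightarrow> (nat list \<Rightarrow>\<^sub>0 'k) set" where
  "hecke_rels Q q d =
    {Poly_Mapping.single [i, Suc i, i] 1 - Poly_Mapping.single [Suc i, i, Suc i] 1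
      | i. 1 \<le> i \<and> Suc i < d} \<union>
    (if 1 < d then {Poly_Mapping.single [0, 1, 0, 1] 1 - Poly_Mapping.single [1, 0, 1, 0] 1} else {}) \<union>
    {Poly_Mapping.single [i, j] 1 - Poly_Mapping.single [j, i] 1
      | i j. i < d \<and> j < d \<and> 1 < \<bar>int i - int j\<bar>} \<union>
    (if 0 < d then
      {Poly_Mapping.single [0, 0] 1 - Poly_Mapping.single [0] (inverse Q - Q) - Poly_Mapping.single [] 1}
     else {}) \<union>
    {Poly_Mapping.single [i, i] 1 - Poly_Mapping.single [i] (inverse q - q) - Poly_Mapping.single [] 1
      | i. 1 \<le> i \<and> i < d}"

definition hecke_ideal :: "'k::field \<Rightarrow> 'k \<Rightarrow> nat \<Rightarrow> (nat list \<Rightarrow>\<^sub>0 'k) set" where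
  "hecke_ideal Q q d = Idl\<^bsub>hecke_free d\<^esub> (hecke_rels Q q d)"

definition hecke_B :: "'k::field \<Rightarrow> 'k \<Rightarrow> nat \<Rightarrow> ('k, (nat list \<Rightarrow>\<^sub>0 'k) set) module" where
  "hecke_B Q q d = quot_alg (hecke_free d) (hecke_ideal Q q d)"

definition hecke_gen :: "'k::field \<Rightarrow> 'k \<Rightarrow> nat \<Rightarrow> nat \<Rightarrow> (nat list \<Rightarrow>\<^sub>0 'k) set" where
  "hecke_gen Q q d t =
    hecke_ideal Q q d +>\<^bsub>(hecke_free d :: ('k, _) module)\<^esub> Poly_Mapping.single [t] 1"

definition hecke_A :: "'k::field \<Rightarrow> 'k \<Rightarrow> nat \<Rightarrow> (nat list \<Rightarrow>\<^sub>0 'k) set set" where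
  "hecke_A Q q d = (\<lambda>S. k_subalgebra S (hecke_B Q q d)) hull (hecke_gen Q q d ` {1..<d})"


section \<open>Tensor space and Schur algebras\<close>

definition index_set :: "nat \<Rightarrow> int set" where
  "index_set n =
    (if odd n then {- int (n div 2)..int (n div 2)} else {- int (n div 2)..int (n div 2)} - {0})"

text \<open>\<open>V(n)\<^sup>\<otimes>\<^sup>d\<close> is the free vector space on its basis of words \<open>\<mu>\<close>, with
  \<open>\<mu>\<^sub>t = \<mu> ! (t - 1)\<close>.\<close>

definition tensor_space :: "nat \<Rightarrow> nat \<Rightarrow> (int list \<Rightarrow>\<^sub>0 'k::field) set" where
  "tensor_space n d = {x. Poly_Mapping.keys x \<subseteq> {\<mu>. length \<mu> = d \<and> set \<mu> \<subseteq> index_set n}}"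

definition word_swap :: "nat \<Rightarrow> int list \<Rightarrow> int list" where
  "word_swap t \<mu> =
    (if t = 0 then \<mu>[0 := - \<mu> ! 0] else \<mu>[t - 1 := \<mu> ! t, t := \<mu> ! (t - 1)])"

definition T_basis :: "'k::field \<Rightarrow> 'k \<Rightarrow> nat \<Rightarrow> int list \<Rightarrow> (int list \<Rightarrow>\<^sub>0 'k)" where
  "T_basis Q q t \<mu> =
    (if t = 0 then
       (if \<mu> ! 0 > 0 then Poly_Mapping.single (word_swap 0 \<mu>) 1
        else if \<mu> ! 0 = 0 then Poly_Mapping.single (word_swap 0 \<mu>) (inverse Q)
        else Poly_Mapping.single (word_swap 0 \<mu>) 1 + Poly_Mapping.single \<mu> (inverse Q - Q))
     else
       (if \<mu> ! (t - 1) < \<mu> ! t then Poly_Mapping.single (word_swap t \<mu>) 1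
        else if \<mu> ! (t - 1) = \<mu> ! t then Poly_Mapping.single (word_swap t \<mu>) (inverse q)
        else Poly_Mapping.single (word_swap t \<mu>) 1 + Poly_Mapping.single \<mu> (inverse q - q)))"

definition act_monomial ::
    "'k::field \<Rightarrow> 'k \<Rightarrow> (int list \<Rightarrow>\<^sub>0 'k) \<Rightarrow> nat list \<Rightarrow> (int list \<Rightarrow>\<^sub>0 'k)" where
  "act_monomial Q q x w = fold (\<lambda>t. lin_ext (T_basis Q q t)) w x"

text \<open>The right action of an element of the Hecke algebra, a coset, is the common value of the
  actions of its representatives in the free algebra.\<close>

definition act ::
    "'k::field \<Rightarrow> 'k \<Rightarrow> (int list \<Rightarrow>\<^sub>0 'k) \<Rightarrow> (nat list \<Rightarrow>\<^sub>0 'k) set \<Rightarrow> (int list \<Rightarrow>\<^sub>0 'k)" where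
  "act Q q x h = the_elem (lin_ext (act_monomial Q q x) ` h)"

type_synonym 'k endo = "(int list \<Rightarrow>\<^sub>0 'k) \<Rightarrow> (int list \<Rightarrow>\<^sub>0 'k)"

definition End_alg ::
    "'k::field \<Rightarrow> 'k \<Rightarrow> (nat list \<Rightarrow>\<^sub>0 'k) set set \<Rightarrow> nat \<Rightarrow> nat \<Rightarrow> ('k, 'k endo) module" where
  "End_alg Q q H n d =
    \<lparr>carrier = {\<phi> \<in> tensor_space n d \<rightarrow>\<^sub>E tensor_space n d.
       (\<forall>x \<in> tensor_space n d. \<forall>y \<in> tensor_space n d. \<phi> (x + y) = \<phi> x + \<phi> y) \<and>
       (\<forall>c. \<forall>x \<in> tensor_space n d. \<phi> (scale c x) = scale c (\<phi> x)) \<and>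
       (\<forall>h \<in> H. \<forall>x \<in> tensor_space n d. \<phi> (act Q q x h) = act Q q (\<phi> x) h)},
     mult = compose (tensor_space n d),
     one = (\<lambda>x \<in> tensor_space n d. x),
     zero = (\<lambda>x \<in> tensor_space n d. 0),
     add = (\<lambda>\<phi> \<psi>. \<lambda>x \<in> tensor_space n d. \<phi> x + \<psi> x),
     smult = (\<lambda>c \<phi>. \<lambda>x \<in> tensor_space n d. scale c (\<phi> x))\<rparr>"

definition schur_B :: "'k::field \<Rightarrow> 'k \<Rightarrow> nat \<Rightarrow> nat \<Rightarrow> ('k, 'k endo) module" where
  "schur_B Q q n d = End_alg Q q (carrier (hecke_B Q q d)) n d"

text \<open>\<open>Q\<close> occurs only because the type A Hecke algebra is a subalgebra of the type B one; the
  elements of that subalgebra act by operators that do not involve \<open>Q\<close>. For \<open>D = 0\<close> tensor space is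
  one-dimensional and for \<open>N = 0 < D\<close> it is zero, so the algebra is then \<open>K\<close> and \<open>0\<close>.\<close>

definition schur_A :: "'k::field \<Rightarrow> 'k \<Rightarrow> nat \<Rightarrow> nat \<Rightarrow> ('k, 'k endo) module" where
  "schur_A Q q N D = End_alg Q q (hecke_A Q q D) N D"

definition f_B :: "'k::field \<Rightarrow> 'k \<Rightarrow> nat \<Rightarrow> 'k" where
  "f_B Q q d = (\<Prod>i = 1 - int d..int d - 1. Q powi (- 2) + q powi (2 * i))"


section \<open>The direct sum of tensor products and its cell datum\<close>

text \<open>\<open>(n + 1) div 2\<close> and \<open>n div 2\<close> stand for \<open>\<lceil>n/2\<rceil>\<close> and \<open>\<lfloor>n/2\<rfloor>\<close>. In \<open>(i, l1, l2)\<close> the first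
  entry is the component of the disjoint union. \<open>C_B\<close> takes values in the direct sum \<open>schur_sum\<close>; an
  isomorphism of algebras carries it to \<open>schur_B\<close>.\<close>

definition schur_tensor ::
    "'k::field \<Rightarrow> 'k \<Rightarrow> nat \<Rightarrow> nat \<Rightarrow> nat \<Rightarrow> ('k, ('k endo \<times> 'k endo \<Rightarrow>\<^sub>0 'k) set) module" where
  "schur_tensor Q q n d i =
    tensor_alg (schur_A Q q ((n + 1) div 2) i) (schur_A Q q (n div 2) (d - i))"

definition schur_sum ::
    "'k::field \<Rightarrow> 'k \<Rightarrow> nat \<Rightarrow> nat \<Rightarrow> ('k, nat \<Rightarrow> ('k endo \<times> 'k endo \<Rightarrow>\<^sub>0 'k) set) module" where
  "schur_sum Q q n d = dirsum_alg {..d} (schur_tensor Q q n d)"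

definition L_B :: "(nat \<Rightarrow> nat \<Rightarrow> 'l set) \<Rightarrow> nat \<Rightarrow> nat \<Rightarrow> (nat \<times> 'l \<times> 'l) set" where
  "L_B L n d = (SIGMA i:{..d}. L ((n + 1) div 2) i \<times> L (n div 2) (d - i))"

definition R_B ::
    "(nat \<Rightarrow> nat \<Rightarrow> 'l set) \<Rightarrow> (nat \<Rightarrow> nat \<Rightarrow> 'l rel) \<Rightarrow> nat \<Rightarrow> nat \<Rightarrow> (nat \<times> 'l \<times> 'l) rel" where
  "R_B L R n d =
    {((i, l1, l2), (j, m1, m2)). (i, l1, l2) \<in> L_B L n d \<and> (j, m1, m2) \<in> L_B L n d \<and> i = j \<and>
      ((l1, m1) \<in> R ((n + 1) div 2) i \<and> l1 \<noteq> m1 \<or>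
       l1 = m1 \<and> (l2, m2) \<in> R (n div 2) (d - i))}"

fun M_B :: "(nat \<Rightarrow> nat \<Rightarrow> 'l \<Rightarrow> 's set) \<Rightarrow> nat \<Rightarrow> nat \<Rightarrow> nat \<times> 'l \<times> 'l \<Rightarrow> ('s \<times> 's) set" where
  "M_B M n d (i, l1, l2) = M ((n + 1) div 2) i l1 \<times> M (n div 2) (d - i) l2"

fun C_B ::
    "'k::field \<Rightarrow> 'k \<Rightarrow> (nat \<Rightarrow> nat \<Rightarrow> 'l \<Rightarrow> 's \<Rightarrow> 's \<Rightarrow> 'k endo) \<Rightarrow> nat \<Rightarrow> nat \<Rightarrow>
      nat \<times> 'l \<times> 'l \<Rightarrow> 's \<times> 's \<Rightarrow> 's \<times> 's \<Rightarrow> nat \<Rightarrow> ('k endo \<times> 'k endo \<Rightarrow>\<^sub>0 'k) set" where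
  "C_B Q q C n d (i, l1, l2) (s1, s2) (t1, t2) =
    dirsum_in {..d} (schur_tensor Q q n d) i
      (tensor_elem (schur_A Q q ((n + 1) div 2) i) (schur_A Q q (n div 2) (d - i))
        (C ((n + 1) div 2) i l1 s1 t1) (C (n div 2) (d - i) l2 s2 t2))"

end

theory Submission
  imports Defs
begin

text \<open>
  The proof has two independent halves: an isomorphism of algebras, and the stability of cellularity
  under tensor products, direct sums and isomorphisms.

  \<^emph>\<open>The isomorphism.\<close> The type B Hecke algebra acts on the tensor space \<open>V(n)\<^sup>\<otimes>\<^sup>d\<close> through
  operators \<open>T\<^sub>0, \<dots>, T\<^bsub>d-1\<^esub>\<close>, and the Schur algebra is their commutant (\<open>schur_B_eq\<close>). Let
  \<open>L\<^sub>p = T\<^sub>p \<dots> T\<^sub>1 T\<^sub>0 T\<^sub>1 \<dots> T\<^sub>p\<close> be the commuting Jucys-Murphy elements. The eigenvalues of \<open>L\<^sub>p\<close> have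
  the form \<open>Q\<^sup>-\<^sup>1 q\<^sup>2\<^sup>k\<close> or \<open>- Q q\<^sup>2\<^sup>k\<close>, and \<open>f_B Q q d \<noteq> 0\<close> says that for the relevant \<open>k\<close> the two families
  do not meet. So tensor space is the direct sum, over the sign sequences \<open>\<epsilon>\<close> of length \<open>d\<close>, of the
  generalized eigenspaces on which \<open>L\<^sub>p\<close> has eigenvalues of the kind \<open>\<epsilon>\<^sub>p\<close>. The proof writes these
  spaces down explicitly, which avoids eigenvalues altogether. Let \<open>X\<^sub>i\<close> be the span of the words whose
  first \<open>i\<close> letters are nonnegative and whose last \<open>d - i\<close> letters are positive. For every \<open>\<epsilon>\<close> with
  \<open>i\<close> plus signs there is an element \<open>f\<^sub>\<epsilon>\<close> of the Hecke algebra with \<open>f\<^sub>\<epsilon> L\<^sub>p = D\<^sub>p f\<^sub>\<epsilon>\<close>, where \<open>D\<^sub>p\<close>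
  (which depends on \<open>\<epsilon>\<close>) is a type A Jucys-Murphy element of the parabolic subalgebra without \<open>T\<^sub>0\<close> and \<open>T\<^sub>i\<close>;
  \<open>f\<^sub>\<epsilon>\<close> is built from the Dipper-James element \<open>v\<close> by intertwiners \<open>\<phi>\<^sub>p\<close> that exchange \<open>L\<^sub>p\<close> and
  \<open>L\<^bsub>p+1\<^esub>\<close>. Right multiplication by \<open>f\<^sub>\<epsilon>\<close> is injective on \<open>X\<^sub>i\<close>, the images are independent, and
  counting words shows that they span. An endomorphism commuting with the Hecke algebra is then
  the same thing as a family of endomorphisms of the spaces \<open>X\<^sub>0, \<dots>, X\<^sub>d\<close> commuting with the
  parabolic subalgebras (\<open>glue_endo\<close>, \<open>restrict_endo\<close>). The words spanning \<open>X\<^sub>i\<close> are pairs of words of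
  lengths \<open>i\<close> and \<open>d - i\<close> in alphabets of sizes \<open>\<lceil>n/2\<rceil>\<close> and \<open>\<lfloor>n/2\<rfloor>\<close>, and the parabolic subalgebra acts
  factorwise, so the commutant on \<open>X\<^sub>i\<close> is the tensor product of two type A Schur algebras
  (\<open>tensor_commutant_iso\<close>, \<open>parabolic_commutant_iso\<close>). Together this is \<open>schur_sum_iso\<close>.

  \<^emph>\<open>Cellularity.\<close> A family is a basis exactly when forming linear combinations is a bijection from
  the finitely supported coordinate vectors, which turns the axioms of a cell datum into statements
  about coordinates (\<open>cell_datum_iff\<close>). In this form tensor products with the lexicographic order
  (\<open>cell_datum_tensor\<close>), direct sums (\<open>cell_datum_dirsum\<close>) and isomorphic images
  (\<open>cell_datum_transport\<close>) are cellular with the evident bases, and the theorem holds for every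
  isomorphism from the direct sum to the Schur algebra.
\<close>

section \<open>Jucys-Murphy elements and intertwiners\<close>

lemma mult_shift:
  fixes x :: "'r::semigroup_mult"
  shows "x * y = y' * x' \<Longrightarrow> x * (y * r) = y' * (x' * r)"
  by (simp add: mult.assoc[symmetric])

text \<open>The relations of the type B Hecke algebra, stated for elements of any ring, because they are
  needed for operators on tensor space and again, with \<open>T 0\<close> a scalar, for the subalgebras
  on the letters after position \<open>s\<close> (see \<open>shifted\<close>). Positions are counted
  from 0, so \<open>T (Suc p)\<close> exchanges the positions \<open>p\<close> and \<open>p + 1\<close>.\<close>
locale hecke_elements =
  fixes T :: "nat \<Rightarrow> 'r::ring_1" and sc :: "'k::field \<Rightarrow> 'r" and d :: nat and Q q :: 'k
  assumes sc_add: "sc (x + y) = sc x + sc y"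
    and sc_mult: "sc (x * y) = sc x * sc y"
    and sc_one: "sc 1 = 1"
    and sc_central: "sc x * r = r * sc x"
    and nonzero: "q \<noteq> 0" "Q \<noteq> 0"
    and braid: "\<lbrakk>1 \<le> t; Suc t < d\<rbrakk> \<Longrightarrow> T t * T (Suc t) * T t = T (Suc t) * T t * T (Suc t)"
    and braid_B: "1 < d \<Longrightarrow> T 0 * T 1 * T 0 * T 1 = T 1 * T 0 * T 1 * T 0"
    and far: "\<lbrakk>t < d; Suc s < t\<rbrakk> \<Longrightarrow> T s * T t = T t * T s"
    and quadratic_0: "0 < d \<Longrightarrow> T 0 * T 0 = sc (inverse Q - Q) * T 0 + 1"
    and quadratic: "\<lbrakk>1 \<le> t; t < d\<rbrakk> \<Longrightarrow> T t * T t = sc (inverse q - q) * T t + 1"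
begin

lemma sc_left: "NO_MATCH (sc y) r \<Longrightarrow> r * sc x = sc x * r"
  by (simp add: sc_central)

lemma sc_left': "NO_MATCH (sc y) r \<Longrightarrow> r * (sc x * s) = sc x * (r * s)"
  by (simp add: sc_central[of x r] mult.assoc[symmetric])

lemma sc_zero: "sc 0 = 0"
  using sc_add[of 0 0] by simp

lemma sc_uminus: "sc (- x) = - sc x"
  using sc_add[of x "- x"] sc_zero by (simp add: add_eq_0_iff)

abbreviation z :: 'r where "z \<equiv> sc (inverse q - q)"

text \<open>The Jucys-Murphy elements; they commute with each other (\<open>L_L\<close>) and
  \<open>L p\<close> commutes with every generator other than \<open>T p\<close> and
  \<open>T (p + 1)\<close>.\<close>
primrec L :: "nat \<Rightarrow> 'r" where
  "L 0 = T 0"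
| "L (Suc p) = T (Suc p) * L p * T (Suc p)"

lemmas L_Suc = L.simps(2)
declare L.simps(2) [simp del]

lemma T_L_above: "\<lbrakk>k < d; Suc p < k\<rbrakk> \<Longrightarrow> T k * L p = L p * T k"
proof (induction p)
  case 0
  then show ?case using far[of k 0] by simp
next
  case (Suc p)
  have 1: "T k * T (Suc p) = T (Suc p) * T k" using far[of k "Suc p"] Suc by simp
  have 2: "T k * L p = L p * T k" using Suc by simp
  have "T k * L (Suc p) = (T k * T (Suc p)) * L p * T (Suc p)" by (simp add: mult.assoc L_Suc)
  also have "\<dots> = T (Suc p) * (T k * L p) * T (Suc p)" unfolding 1 by (simp add: mult.assoc)
  also have "\<dots> = T (Suc p) * L p * (T k * T (Suc p))" unfolding 2 by (simp add: mult.assoc)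
  finally show ?case unfolding 1 by (simp add: mult.assoc L_Suc)
qed

lemma T_L_below: "\<lbrakk>p < d; k < p\<rbrakk> \<Longrightarrow> T k * L p = L p * T k"
proof (induction p)
  case (Suc r)
  show ?case
  proof (cases "k < r")
    case True
    have 1: "T k * T (Suc r) = T (Suc r) * T k" using far[of "Suc r" k] True Suc by simp
    have 2: "T k * L r = L r * T k" using Suc True by simp
    have "T k * L (Suc r) = (T k * T (Suc r)) * L r * T (Suc r)" by (simp add: mult.assoc L_Suc)
    also have "\<dots> = T (Suc r) * (T k * L r) * T (Suc r)" unfolding 1 by (simp add: mult.assoc)
    also have "\<dots> = T (Suc r) * L r * (T k * T (Suc r))" unfolding 2 by (simp add: mult.assoc)
    finally show ?thesis unfolding 1 by (simp add: mult.assoc L_Suc)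
  next
    case False
    then have k: "k = r" using Suc by simp
    show ?thesis
    proof (cases r)
      case 0
      then show ?thesis using braid_B Suc k by (simp add: mult.assoc L_Suc)
    next
      case (Suc s)
      let ?S = "T (Suc r)" let ?T = "T r" let ?X = "L s"
      have b: "?T * ?S * ?T = ?S * ?T * ?S" using braid[of r] Suc Suc.prems \<open>Suc r < d\<close> by simp
      have c: "?S * ?X = ?X * ?S" using T_L_above[of "Suc r" s] Suc \<open>Suc r < d\<close> by simp
      have "?T * L (Suc r) = (?T * ?S * ?T) * ?X * ?T * ?S" using Suc by (simp add: mult.assoc L_Suc)
      also have "\<dots> = ?S * ?T * (?S * ?X) * ?T * ?S" unfolding b by (simp add: mult.assoc)
      also have "\<dots> = ?S * ?T * ?X * (?S * ?T * ?S)" unfolding c by (simp add: mult.assoc)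
      also have "\<dots> = L (Suc r) * ?T" unfolding b[symmetric] using Suc by (simp add: mult.assoc L_Suc)
      finally show ?thesis using k by simp
    qed
  qed
qed simp

lemma T_L: "\<lbrakk>p < d; k < d; k \<noteq> p; k \<noteq> Suc p\<rbrakk> \<Longrightarrow> T k * L p = L p * T k"
  by (cases "k < p") (auto intro: T_L_above T_L_below)

lemma L_L: "\<lbrakk>p < d; r < d\<rbrakk> \<Longrightarrow> L p * L r = L r * L p"
proof -
  have main: "L p * L r = L r * L p" if "p < r" "r < d" for p r
    using that
  proof (induction p)
    case 0
    then show ?case using T_L_below[of r 0] by simp
  next
    case (Suc p)
    have 1: "T (Suc p) * L r = L r * T (Suc p)" using T_L_below Suc by simp
    have 2: "L p * L r = L r * L p" using Suc by simp
    show ?case unfolding L.simps by (metis 1 2 mult.assoc)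
  qed
  assume "p < d" "r < d"
  then show ?thesis using main[of p r] main[of r p] by (cases p r rule: linorder_cases) auto
qed

text \<open>The intertwiner: it exchanges \<open>L p\<close> and \<open>L (p + 1)\<close>
  (\<open>phi_X\<close>, \<open>phi_Y\<close>), its square is a polynomial in them
  (\<open>phi_phi\<close>), and it satisfies the braid-like relations \<open>phi_phi_T\<close> and
  \<open>phi_phi_T'\<close>.\<close>
definition \<phi> :: "nat \<Rightarrow> 'r" where
  "\<phi> p = T (Suc p) * L p - L p * T (Suc p)"

context
  fixes p :: nat
  assumes p: "Suc p < d"
begin

lemma TT: "T (Suc p) * T (Suc p) = z * T (Suc p) + 1"
  using quadratic[of "Suc p"] p by simp

lemma XY: "L (Suc p) * L p = L p * L (Suc p)"
  using L_L[of p "Suc p"] p by simp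

lemma T_X: "T (Suc p) * L p = L (Suc p) * T (Suc p) - z * L (Suc p)"
proof -
  have "L (Suc p) * T (Suc p) = T (Suc p) * L p * (T (Suc p) * T (Suc p))" by (simp add: mult.assoc L_Suc)
  also have "\<dots> = z * L (Suc p) + T (Suc p) * L p"
    unfolding TT L_Suc by (simp add: distrib_left) (metis sc_central mult.assoc)
  finally show ?thesis by simp
qed

lemma X_T: "L p * T (Suc p) = T (Suc p) * L (Suc p) - z * L (Suc p)"
proof -
  have "T (Suc p) * L (Suc p) = (T (Suc p) * T (Suc p)) * L p * T (Suc p)" by (simp add: mult.assoc L_Suc)
  also have "\<dots> = z * L (Suc p) + L p * T (Suc p)"
    unfolding TT L_Suc by (simp add: distrib_right mult.assoc)
  finally show ?thesis by simp
qed

lemma T_Y: "T (Suc p) * L (Suc p) = L p * T (Suc p) + z * L (Suc p)"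
  using X_T by simp

lemma phi_alt: "\<phi> p = L (Suc p) * T (Suc p) - T (Suc p) * L (Suc p)"
  unfolding \<phi>_def T_X X_T by simp

lemma phi_alt': "\<phi> p = (L (Suc p) - L p) * T (Suc p) - z * L (Suc p)"
  unfolding \<phi>_def T_X by (simp add: algebra_simps)

lemma phi_X: "\<phi> p * L p = L (Suc p) * \<phi> p"
proof -
  have "\<phi> p * L p = L (Suc p) * T (Suc p) * L p - T (Suc p) * (L (Suc p) * L p)"
    unfolding phi_alt by (simp add: left_diff_distrib mult.assoc)
  also have "T (Suc p) * (L (Suc p) * L p) = T (Suc p) * L p * L (Suc p)"
    unfolding XY by (simp add: mult.assoc)
  also have "T (Suc p) * L p * L (Suc p) = L (Suc p) * (T (Suc p) * L (Suc p)) - L (Suc p) * (z * L (Suc p))"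
    unfolding T_X by (simp add: left_diff_distrib mult.assoc) (metis sc_central mult.assoc)
  also have "\<dots> = L (Suc p) * (L p * T (Suc p))"
    unfolding T_Y by (simp add: distrib_left)
  finally show ?thesis unfolding \<phi>_def by (simp add: right_diff_distrib mult.assoc)
qed

lemma phi_Y: "\<phi> p * L (Suc p) = L p * \<phi> p"
proof -
  have "\<phi> p * L (Suc p) = T (Suc p) * (L p * L (Suc p)) - L p * (T (Suc p) * L (Suc p))"
    unfolding \<phi>_def by (simp add: left_diff_distrib mult.assoc)
  also have "T (Suc p) * (L p * L (Suc p)) = (T (Suc p) * L (Suc p)) * L p"
    unfolding XY[symmetric] by (simp add: mult.assoc)
  also have "\<dots> = L p * (T (Suc p) * L p) + z * (L p * L (Suc p))"
    unfolding T_Y by (simp add: distrib_right mult.assoc XY)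
  also have "L p * (T (Suc p) * L (Suc p)) = L p * L p * T (Suc p) + z * (L p * L (Suc p))"
    unfolding T_Y by (simp add: distrib_left mult.assoc) (metis sc_central mult.assoc)
  finally show ?thesis unfolding \<phi>_def by (simp add: right_diff_distrib mult.assoc)
qed

text \<open>With \<open>T_prod\<close>: all symmetric functions of \<open>L p\<close> and
  \<open>L (p + 1)\<close> commute with \<open>T (p + 1)\<close>.\<close>
lemma T_sum: "T (Suc p) * (L p + L (Suc p)) = (L p + L (Suc p)) * T (Suc p)"
  unfolding distrib_left T_X T_Y by (simp add: algebra_simps)

lemma T_prod: "T (Suc p) * (L p * L (Suc p)) = L p * L (Suc p) * T (Suc p)"
proof -
  have "T (Suc p) * (L p * L (Suc p)) = L (Suc p) * (T (Suc p) * L (Suc p)) - z * L (Suc p) * L (Suc p)"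
    unfolding mult.assoc[symmetric] T_X by (simp add: left_diff_distrib mult.assoc)
  also have "\<dots> = L (Suc p) * L p * T (Suc p)"
    unfolding T_Y by (simp add: distrib_left mult.assoc) (metis sc_central mult.assoc)
  finally show ?thesis unfolding XY .
qed

lemma q_trace: "z * z + sc 2 = sc (q\<^sup>2) + sc (inverse q ^ 2)"
proof -
  have "(inverse q - q) * (inverse q - q) + 2 = q\<^sup>2 + inverse q ^ 2"
    using nonzero by (simp add: field_simps power2_eq_square)
  then show ?thesis by (metis sc_add sc_mult)
qed

text \<open>The square vanishes only where the two eigenvalues differ by the factor
  \<open>q\<^sup>2\<close> or \<open>q\<^sup>-\<^sup>2\<close>. This is what makes the intertwiner
  invertible between subspaces with separated eigenvalues.\<close>
lemma phi_phi:
  "\<phi> p * \<phi> p = - ((L p - sc (q\<^sup>2) * L (Suc p)) * (L p - sc (inverse q ^ 2) * L (Suc p)))"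
proof -
  let ?X = "L p" and ?Y = "L (Suc p)" and ?T = "T (Suc p)"
  have T\<phi>: "?T * \<phi> p = z * ?T * ?X + ?X - ?Y"
    unfolding \<phi>_def right_diff_distrib mult.assoc[symmetric] TT by (simp add: algebra_simps L_Suc)
  have "\<phi> p * \<phi> p = ?Y * (?T * \<phi> p) - ?T * (\<phi> p * ?X)"
    unfolding phi_X by (subst phi_alt) (simp add: left_diff_distrib mult.assoc)
  also have "\<dots> = ?Y * (?T * \<phi> p) - (?T * \<phi> p) * ?X" by (simp add: mult.assoc)
  also have "\<dots> = z * ((?Y * ?T - ?T * ?X) * ?X) + ?Y * ?X - ?Y * ?Y - ?X * ?X + ?Y * ?X"
  proof -
    have "?Y * (z * ?T * ?X) = z * (?Y * ?T * ?X)" by (metis sc_central mult.assoc)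
    then show ?thesis unfolding T\<phi> by (simp add: algebra_simps)
  qed
  also have "?Y * ?T - ?T * ?X = z * ?Y" unfolding T_X by simp
  also have "z * (z * ?Y * ?X) + ?Y * ?X - ?Y * ?Y - ?X * ?X + ?Y * ?X
      = (z * z + sc 2) * (?X * ?Y) - ?Y * ?Y - ?X * ?X"
  proof -
    have "sc 2 = 2" by (metis sc_add sc_one one_add_one)
    then show ?thesis by (simp add: distrib_right mult.assoc XY mult_2)
  qed
  also have "\<dots> = - ((?X - sc (q\<^sup>2) * ?Y) * (?X - sc (inverse q ^ 2) * ?Y))"
  proof -
    have 1: "?X * (sc (inverse q ^ 2) * ?Y) = sc (inverse q ^ 2) * (?X * ?Y)" by (metis sc_central mult.assoc)
    have 2: "sc (q\<^sup>2) * ?Y * (sc (inverse q ^ 2) * ?Y) = sc (q\<^sup>2) * sc (inverse q ^ 2) * (?Y * ?Y)"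
      by (simp only: mult.assoc sc_central[of "inverse q ^ 2"])
    have 3: "sc (q\<^sup>2) * sc (inverse q ^ 2) = 1"
      using nonzero by (simp add: sc_mult[symmetric] sc_one power_mult_distrib[symmetric])
    show ?thesis
      unfolding q_trace left_diff_distrib right_diff_distrib 1 2 3
      by (simp add: distrib_right mult.assoc XY)
  qed
  finally show ?thesis .
qed

end

lemma phi_L_far: "\<lbrakk>Suc p < d; r < d; r \<noteq> p; r \<noteq> Suc p\<rbrakk> \<Longrightarrow> \<phi> p * L r = L r * \<phi> p"
proof -
  assume a: "Suc p < d" "r < d" "r \<noteq> p" "r \<noteq> Suc p"
  have 1: "T (Suc p) * L r = L r * T (Suc p)" using T_L[of r "Suc p"] a by simp
  have 2: "L p * L r = L r * L p" using L_L a by simp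
  show ?thesis unfolding \<phi>_def left_diff_distrib right_diff_distrib
    by (metis 1 2 mult.assoc)
qed

lemma phi_T_far: "\<lbrakk>Suc p < d; k < d; k < p \<or> Suc (Suc p) < k\<rbrakk> \<Longrightarrow> \<phi> p * T k = T k * \<phi> p"
proof -
  assume a: "Suc p < d" "k < d" "k < p \<or> Suc (Suc p) < k"
  have 1: "T (Suc p) * T k = T k * T (Suc p)" using far[of k "Suc p"] far[of "Suc p" k] a by auto
  have 2: "T k * L p = L p * T k" using T_L[of p k] a by auto
  show ?thesis unfolding \<phi>_def left_diff_distrib right_diff_distrib
    by (metis 1 2 mult.assoc)
qed

lemma phi_phi_far: "\<lbrakk>Suc p < r; Suc r < d\<rbrakk> \<Longrightarrow> \<phi> p * \<phi> r = \<phi> r * \<phi> p"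
proof -
  assume a: "Suc p < r" "Suc r < d"
  have 1: "\<phi> p * T (Suc r) = T (Suc r) * \<phi> p" using phi_T_far[of p "Suc r"] a by simp
  have 2: "\<phi> p * L r = L r * \<phi> p" using phi_L_far[of p r] a by simp
  show ?thesis by (subst (1 2) \<phi>_def[of r]) (simp add: left_diff_distrib right_diff_distrib, metis 1 2 mult.assoc)
qed

context
  fixes p :: nat
  assumes p: "Suc (Suc p) < d"
begin

private lemma S_X: "T (Suc (Suc p)) * L p = L p * T (Suc (Suc p))"
  using T_L[of p "Suc (Suc p)"] p by simp

private lemma pd: "Suc p < d" using p by simp

private lemma br: "T (Suc p) * T (Suc (Suc p)) * T (Suc p) = T (Suc (Suc p)) * T (Suc p) * T (Suc (Suc p))"
  using braid[of "Suc p"] p by simp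

text \<open>Expanding the product of the two intertwiners gives three terms, each of which is carried
  from \<open>T (p + 1)\<close> to \<open>T (p + 2)\<close> by the braid relation and the symmetric
  functions above.\<close>
lemma phi_phi_T: "\<phi> p * \<phi> (Suc p) * T (Suc p) = T (Suc (Suc p)) * (\<phi> p * \<phi> (Suc p))"
proof -
  let ?T = "T (Suc p)" and ?S = "T (Suc (Suc p))" and ?X = "L p" and ?Y = "L (Suc p)"
  have \<phi>S: "\<phi> p * ?S = ?T * ?S * ?X - ?X * ?T * ?S"
    unfolding \<phi>_def left_diff_distrib by (metis S_X mult.assoc)
  have e: "\<phi> p * \<phi> (Suc p) = ?T * ?S * (?X * ?Y) - ?X * ?T * ?S * (?X + ?Y) + ?X * ?X * ?T * ?S"
  proof -
    have "\<phi> p * \<phi> (Suc p) = (\<phi> p * ?S) * ?Y - (\<phi> p * ?Y) * ?S"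
      by (subst \<phi>_def[of "Suc p"]) (simp add: right_diff_distrib mult.assoc)
    also have "\<dots> = (\<phi> p * ?S) * ?Y - ?X * (\<phi> p * ?S)" unfolding phi_Y[OF pd] by (simp add: mult.assoc)
    finally show ?thesis unfolding \<phi>S by (simp add: algebra_simps)
  qed
  have t1: "?T * ?S * (?X * ?Y) * ?T = ?S * (?T * ?S * (?X * ?Y))"
    unfolding mult.assoc[of "?T * ?S"] T_prod[OF pd, symmetric] by (simp add: mult.assoc[symmetric] br)
  have t2: "?X * ?T * ?S * (?X + ?Y) * ?T = ?S * (?X * ?T * ?S * (?X + ?Y))"
  proof -
    have "?X * ?T * ?S * (?X + ?Y) * ?T = ?X * (?T * ?S * ?T) * (?X + ?Y)"
      by (simp add: mult.assoc T_sum[OF pd])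
    also have "\<dots> = (?S * ?X) * ?T * ?S * (?X + ?Y)" unfolding br S_X by (simp add: mult.assoc)
    finally show ?thesis by (simp add: mult.assoc)
  qed
  have t3: "?X * ?X * ?T * ?S * ?T = ?S * (?X * ?X * ?T * ?S)"
  proof -
    have "?X * ?X * ?T * ?S * ?T = ?X * ?X * (?T * ?S * ?T)" by (simp add: mult.assoc)
    also have "\<dots> = ?X * (?X * ?S) * ?T * ?S" unfolding br by (simp add: mult.assoc)
    also have "\<dots> = (?X * ?S) * ?X * ?T * ?S" by (simp only: S_X[symmetric] mult.assoc[symmetric])
    also have "\<dots> = ?S * (?X * ?X * ?T * ?S)" unfolding S_X[symmetric] by (simp add: mult.assoc)
    finally show ?thesis .
  qed
  show ?thesis
    unfolding e by (simp only: distrib_right[of _ _ ?T] left_diff_distrib[of _ _ ?T]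
      distrib_left[of ?S] right_diff_distrib[of ?S] t1 t2 t3)
qed

lemma phi_phi_T': "\<phi> (Suc p) * \<phi> p * T (Suc (Suc p)) = T (Suc p) * (\<phi> (Suc p) * \<phi> p)"
proof -
  let ?T = "T (Suc p)" and ?S = "T (Suc (Suc p))" and ?X = "L p" and ?Y = "L (Suc p)"
  have S\<phi>: "?S * \<phi> p = ?S * ?T * ?X - ?X * ?S * ?T"
    unfolding \<phi>_def right_diff_distrib by (metis S_X mult.assoc)
  have e: "\<phi> (Suc p) * \<phi> p = ?S * ?T * ?X * ?X - (?X + ?Y) * ?S * ?T * ?X + ?X * ?Y * ?S * ?T"
  proof -
    have "\<phi> (Suc p) * \<phi> p = ?S * (?Y * \<phi> p) - ?Y * (?S * \<phi> p)"
      by (subst \<phi>_def[of "Suc p"]) (simp add: left_diff_distrib mult.assoc)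
    also have "\<dots> = (?S * \<phi> p) * ?X - ?Y * (?S * \<phi> p)"
      unfolding phi_X[OF pd, symmetric] by (simp add: mult.assoc)
    finally have "\<phi> (Suc p) * \<phi> p = (?S * \<phi> p) * ?X - ?Y * (?S * \<phi> p)" .
    then show ?thesis unfolding S\<phi>
      by (simp add: distrib_right left_diff_distrib right_diff_distrib mult.assoc[symmetric] XY[OF pd]
          diff_diff_eq)
  qed
  have t1: "?X * ?Y * ?S * ?T * ?S = ?T * (?X * ?Y * ?S * ?T)"
  proof -
    have "?X * ?Y * ?S * ?T * ?S = ?X * ?Y * (?S * ?T * ?S)" by (simp add: mult.assoc)
    also have "\<dots> = (?X * ?Y * ?T) * ?S * ?T" unfolding br[symmetric] by (simp add: mult.assoc)
    also have "\<dots> = (?T * (?X * ?Y)) * ?S * ?T" unfolding T_prod[OF pd] ..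
    finally show ?thesis by (simp add: mult.assoc)
  qed
  have t2: "(?X + ?Y) * ?S * ?T * ?X * ?S = ?T * ((?X + ?Y) * ?S * ?T * ?X)"
  proof -
    have "(?X + ?Y) * ?S * ?T * ?X * ?S = (?X + ?Y) * (?S * ?T * ?S) * ?X"
      by (simp add: mult.assoc S_X)
    also have "\<dots> = ((?X + ?Y) * ?T) * ?S * ?T * ?X" unfolding br[symmetric] by (simp add: mult.assoc)
    also have "\<dots> = (?T * (?X + ?Y)) * ?S * ?T * ?X" unfolding T_sum[OF pd] ..
    finally show ?thesis by (simp add: mult.assoc)
  qed
  have t3: "?S * ?T * ?X * ?X * ?S = ?T * (?S * ?T * ?X * ?X)"
  proof -
    have "?S * ?T * ?X * ?X * ?S = ?S * ?T * (?X * (?X * ?S))" by (simp add: mult.assoc)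
    also have "\<dots> = ?S * ?T * ((?X * ?S) * ?X)" by (metis S_X mult.assoc)
    also have "\<dots> = (?S * ?T * ?S) * ?X * ?X" unfolding S_X[symmetric] by (simp add: mult.assoc)
    finally show ?thesis unfolding br[symmetric] by (simp add: mult.assoc)
  qed
  show ?thesis
    unfolding e distrib_right[of "_ - _" _ ?S] left_diff_distrib[of _ _ ?S]
      distrib_left[of ?T "_ - _"] right_diff_distrib[of ?T] t1 t2 t3 ..
qed

end

section \<open>The Dipper-James element\<close>

text \<open>As \<open>inverse Q\<close> and \<open>- Q\<close> are the roots of the quadratic relation
  of \<open>T 0\<close>, \<open>U\<close> for one of them absorbs \<open>T 0\<close> as the other
  (\<open>U_T0\<close>).\<close>
primrec U :: "'k \<Rightarrow> nat \<Rightarrow> 'r" where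
  "U c 0 = 1"
| "U c (Suc i) = U c i * (L i - sc c)"

text \<open>\<open>R s m = T (s + 1) \<dots> T (s + m)\<close> moves the letter in position
  \<open>s\<close> past the next \<open>m\<close> letters, and \<open>W i j\<close> moves a block of
  \<open>i\<close> letters past a block of \<open>j\<close> letters.\<close>
primrec R :: "nat \<Rightarrow> nat \<Rightarrow> 'r" where
  "R s 0 = 1"
| "R s (Suc m) = R s m * T (Suc (s + m))"

primrec W :: "nat \<Rightarrow> nat \<Rightarrow> 'r" where
  "W 0 j = 1"
| "W (Suc i) j = R i j * W i j"

lemma U_commute:
  assumes "\<And>p. p < i \<Longrightarrow> r * L p = L p * r"
  shows "r * U c i = U c i * r"
  using assms
proof (induction i)
  case (Suc i)
  have 1: "r * U c i = U c i * r" using Suc by simp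
  have 2: "r * (L i - sc c) = (L i - sc c) * r"
    using Suc.prems[of i] by (simp add: left_diff_distrib right_diff_distrib sc_central)
  show ?case by (simp add: mult.assoc[symmetric] 1) (simp add: mult.assoc 2)
qed simp

lemma U_L: "\<lbrakk>i \<le> d; p < d\<rbrakk> \<Longrightarrow> L p * U c i = U c i * L p"
  by (rule U_commute) (simp add: L_L)

text \<open>For \<open>0 < k < i\<close> the two factors at \<open>k - 1\<close> and \<open>k\<close>
  form a symmetric function of two neighbouring Jucys-Murphy elements, which is why the product commutes
  with \<open>T k\<close> although neither factor does.\<close>
lemma T_U: "\<lbrakk>k < d; i \<le> d; k \<noteq> i \<or> i = 0\<rbrakk> \<Longrightarrow> T k * U c i = U c i * T k"
proof (induction i)
  case (Suc i)
  show ?case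
  proof (cases "k = i")
    case False
    have 1: "T k * U c i = U c i * T k" using Suc False by simp
    have 2: "T k * (L i - sc c) = (L i - sc c) * T k"
      using T_L[of i k] Suc False by (simp add: left_diff_distrib right_diff_distrib sc_central)
    show ?thesis by (simp add: mult.assoc[symmetric] 1) (simp add: mult.assoc 2)
  next
    case True
    show ?thesis
    proof (cases i)
      case 0
      then show ?thesis using True by (simp add: left_diff_distrib right_diff_distrib sc_central)
    next
      case (Suc h)
      have h: "Suc h < d" using \<open>Suc i \<le> d\<close> Suc by simp
      let ?T = "T (Suc h)" and ?X = "L h" and ?Y = "L (Suc h)"
      have 1: "?T * U c h = U c h * ?T"
        by (rule U_commute) (use h T_L in simp)
      have e: "(?X - sc c) * (?Y - sc c) = ?X * ?Y - sc c * (?X + ?Y) + sc c * sc c"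
        by (simp add: left_diff_distrib right_diff_distrib distrib_left sc_left)
      have 2: "?T * ((?X - sc c) * (?Y - sc c)) = (?X - sc c) * (?Y - sc c) * ?T"
      proof -
        have s: "?T * (sc c * (?X + ?Y)) = sc c * (?X + ?Y) * ?T"
          by (simp add: mult.assoc sc_left' T_sum[OF h] del: distrib_left distrib_right)
        have s2: "?T * (sc c * sc c) = sc c * sc c * ?T" by (simp add: mult.assoc sc_left sc_left')
        show ?thesis
          unfolding e distrib_left[of ?T] right_diff_distrib[of ?T] distrib_right[of _ _ ?T]
            left_diff_distrib[of _ _ ?T] s s2 T_prod[OF h] ..
      qed
      show ?thesis using Suc True
        by (simp add: mult.assoc mult_shift[OF 1] 2[unfolded mult.assoc])
    qed
  qed
qed simp

lemma U_T0:
  assumes "c * c' = - 1" "c + c' = inverse Q - Q" "0 < i" "i \<le> d"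
  shows "U c i * T 0 = sc c' * U c i"
  using assms(3,4)
proof (induction i)
  case (Suc i)
  show ?case
  proof (cases i)
    case 0
    have "(T 0 - sc c) * T 0 = sc (inverse Q - Q) * T 0 + 1 - sc c * T 0"
      using quadratic_0 Suc by (simp add: left_diff_distrib)
    also have "\<dots> = sc c' * T 0 - sc c' * sc c"
    proof -
      have "sc c' * sc c = -1" using assms(1) by (metis sc_mult mult.commute sc_one sc_uminus)
      then show ?thesis unfolding assms(2)[symmetric] sc_add by (simp add: distrib_right)
    qed
    finally show ?thesis using 0 by (simp add: right_diff_distrib)
  next
    case (Suc h)
    have 1: "(L i - sc c) * T 0 = T 0 * (L i - sc c)"
      using T_L_below[of i 0] Suc.prems Suc by (simp add: left_diff_distrib right_diff_distrib sc_central)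
    have "U c (Suc i) * T 0 = (U c i * T 0) * (L i - sc c)" by (simp add: mult.assoc 1)
    also have "\<dots> = sc c' * U c i * (L i - sc c)" using Suc.IH Suc.prems Suc by simp
    finally show ?thesis by (simp add: mult.assoc)
  qed
qed simp

lemma U_head: "Suc i \<le> d \<Longrightarrow> \<exists>r. U c (Suc i) = r * (T 0 - sc c)"
proof (induction i)
  case (Suc i)
  then obtain r where r: "U c (Suc i) = r * (T 0 - sc c)" by (meson Suc_leD)
  have 1: "(T 0 - sc c) * (L (Suc i) - sc c) = (L (Suc i) - sc c) * (T 0 - sc c)"
    using T_L_below[of "Suc i" 0] Suc.prems by (simp add: left_diff_distrib right_diff_distrib sc_left)
  have "U c (Suc (Suc i)) = r * (T 0 - sc c) * (L (Suc i) - sc c)" using r by simp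
  also have "\<dots> = (r * (L (Suc i) - sc c)) * (T 0 - sc c)" by (simp only: mult.assoc 1)
  finally show ?case by blast
next
  case 0
  show ?case by (rule exI[of _ 1]) simp
qed

lemma T_R_far: "\<lbrakk>k < d; s + m < d; k < s \<or> Suc (s + m) < k\<rbrakk> \<Longrightarrow> T k * R s m = R s m * T k"
proof (induction m)
  case (Suc m)
  have 1: "T k * R s m = R s m * T k" using Suc by auto
  have 2: "T k * T (Suc (s + m)) = T (Suc (s + m)) * T k"
    using far[of "Suc (s + m)" k] far[of k "Suc (s + m)"] Suc.prems by auto
  show ?case by (simp add: mult.assoc[symmetric] 1) (simp add: mult.assoc 2)
qed simp

lemma T_R: "\<lbrakk>s + m < d; s < k; k < s + m\<rbrakk> \<Longrightarrow> T (Suc k) * R s m = R s m * T k"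
proof (induction m)
  case (Suc m)
  show ?case
  proof (cases "k < s + m")
    case True
    have 1: "T (Suc k) * R s m = R s m * T k" using Suc True by auto
    have 2: "T k * T (Suc (s + m)) = T (Suc (s + m)) * T k"
      using far[of "Suc (s + m)" k] Suc.prems True by auto
    show ?thesis by (simp add: mult.assoc[symmetric] 1) (simp add: mult.assoc 2)
  next
    case False
    then obtain h where h: "m = Suc h" using Suc.prems by (cases m) auto
    have k: "k = Suc (s + h)" using False Suc.prems h by simp
    have 1: "T (Suc k) * R s h = R s h * T (Suc k)" using T_R_far[of "Suc k" s h] Suc.prems h k by auto
    have 2: "T k * T (Suc k) * T k = T (Suc k) * T k * T (Suc k)" using braid[of k] Suc.prems h k by auto
    have "T (Suc k) * R s (Suc m) = T (Suc k) * R s h * T k * T (Suc k)" using h k by (simp add: mult.assoc)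
    also have "\<dots> = R s h * (T (Suc k) * T k * T (Suc k))" by (simp add: 1 mult.assoc)
    finally show ?thesis unfolding 2[symmetric] using h k by (simp add: mult.assoc)
  qed
qed simp

lemma T_W_far: "\<lbrakk>k < d; i + j < k\<rbrakk> \<Longrightarrow> T k * W i j = W i j * T k"
proof (induction i)
  case (Suc i)
  have 1: "T k * R i j = R i j * T k" using T_R_far[of k i j] Suc.prems by simp
  have 2: "T k * W i j = W i j * T k" using Suc by simp
  show ?case by (simp add: mult.assoc[symmetric] 1) (simp add: mult.assoc 2)
qed simp

lemma T_R_R:
  "Suc k + j < d \<Longrightarrow> T (Suc k) * (R (Suc k) j * R k j) = R (Suc k) j * R k j * T (Suc k + j)"
proof (induction j)
  case (Suc j)
  let ?t = "T (Suc (k + j))" and ?t' = "T (Suc (Suc (k + j)))"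
  have IH: "T (Suc k) * (R (Suc k) j * R k j) = R (Suc k) j * R k j * ?t" using Suc by simp
  have 1: "?t' * R k j = R k j * ?t'" using T_R_far[of "Suc (Suc (k + j))" k j] Suc.prems by simp
  have 2: "?t * ?t' * ?t = ?t' * ?t * ?t'" using braid[of "Suc (k + j)"] Suc.prems by simp
  have e: "R (Suc k) (Suc j) * R k (Suc j) = R (Suc k) j * R k j * ?t' * ?t"
    by (simp add: mult.assoc) (simp add: mult.assoc[symmetric], simp add: mult.assoc[of _ ?t'] 1, simp add: mult.assoc)
  have "T (Suc k) * (R (Suc k) (Suc j) * R k (Suc j)) = T (Suc k) * (R (Suc k) j * R k j) * ?t' * ?t"
    unfolding e by (simp add: mult.assoc)
  also have "\<dots> = R (Suc k) j * R k j * (?t * ?t' * ?t)" unfolding IH by (simp add: mult.assoc)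
  also have "\<dots> = R (Suc k) (Suc j) * R k (Suc j) * ?t'" unfolding 2 e by (simp add: mult.assoc)
  finally show ?case by simp
qed simp

lemma T_W_left: "\<lbrakk>1 \<le> k; k < i; i + j \<le> d\<rbrakk> \<Longrightarrow> T k * W i j = W i j * T (k + j)"
proof (induction i)
  case (Suc i)
  show ?case
  proof (cases "k < i")
    case True
    have 1: "T k * R i j = R i j * T k" using T_R_far[of k i j] Suc.prems True by simp
    have 2: "T k * W i j = W i j * T (k + j)" using Suc True by simp
    show ?thesis by (simp add: mult.assoc[symmetric] 1) (simp add: mult.assoc 2)
  next
    case False
    then obtain h where h: "i = Suc h" "k = Suc h" using Suc.prems by (cases k) auto
    have 1: "T k * (R (Suc h) j * R h j) = R (Suc h) j * R h j * T (Suc (h + j))"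
      using T_R_R[of h j] h Suc.prems by simp
    have 2: "T (Suc (h + j)) * W h j = W h j * T (Suc (h + j))" using T_W_far[of "k + j" h j] h Suc.prems by simp
    have "T k * W (Suc i) j = T k * (R (Suc h) j * R h j) * W h j" using h by (simp add: mult.assoc)
    then show ?thesis unfolding 1 using h by (simp add: mult.assoc 2)
  qed
qed simp

lemma T_W_right: "\<lbrakk>i + j \<le> d; 1 \<le> k; k < j\<rbrakk> \<Longrightarrow> T (i + k) * W i j = W i j * T k"
proof (induction i)
  case (Suc i)
  have 1: "T (Suc (i + k)) * R i j = R i j * T (i + k)" using T_R[of i j "i + k"] Suc.prems by simp
  have 2: "T (i + k) * W i j = W i j * T k" using Suc by simp
  show ?case by (simp add: mult.assoc[symmetric] 1) (simp add: mult.assoc 2)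
qed simp

lemma W_last: "Suc i + j \<le> d \<Longrightarrow> \<exists>r. W (Suc i) j = r * R 0 j \<and> r * T 0 = T 0 * r"
proof (induction i)
  case (Suc i)
  then obtain r where r: "W (Suc i) j = r * R 0 j" "r * T 0 = T 0 * r" by auto
  have c: "T 0 * R (Suc i) j = R (Suc i) j * T 0" using T_R_far[of 0 "Suc i" j] Suc.prems by simp
  have "W (Suc (Suc i)) j = R (Suc i) j * W (Suc i) j" by simp
  then have "W (Suc (Suc i)) j = (R (Suc i) j * r) * R 0 j \<and> (R (Suc i) j * r) * T 0 = T 0 * (R (Suc i) j * r)"
    unfolding r(1) by (simp add: mult.assoc r(2) mult_shift[OF c])
  then show ?case by blast
qed (auto intro: exI[of _ 1])

text \<open>The element of Dipper and James. It intertwines the parabolic subalgebra of type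
  \<open>(i, j)\<close> with that of type \<open>(j, i)\<close> (\<open>T_v_left\<close>,
  \<open>T_v_right\<close>).\<close>
definition v :: "nat \<Rightarrow> nat \<Rightarrow> 'r" where
  "v i j = U (- Q) i * W i j * U (inverse Q) j"

lemma QQ: "- Q * inverse Q = - 1" "- Q + inverse Q = inverse Q - Q"
  "inverse Q * - Q = - 1" "inverse Q + - Q = inverse Q - Q"
  using nonzero by auto

lemma T_v_left:
  assumes "1 \<le> k" "k < i" "i + j \<le> d" shows "T k * v i j = v i j * T (k + j)"
proof -
  have 1: "T k * U (- Q) i = U (- Q) i * T k" using T_U[of k i] assms by simp
  have 2: "T k * W i j = W i j * T (k + j)" using T_W_left assms by simp
  have 3: "T (k + j) * U (inverse Q) j = U (inverse Q) j * T (k + j)" using T_U[of "k + j" j] assms by simp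
  show ?thesis unfolding v_def by (simp add: mult.assoc mult_shift[OF 1] mult_shift[OF 2] 3)
qed

lemma T_v_right:
  assumes "i + j \<le> d" "1 \<le> k" "k < j" shows "T (i + k) * v i j = v i j * T k"
proof -
  have 1: "T (i + k) * U (- Q) i = U (- Q) i * T (i + k)" using T_U[of "i + k" i] assms by simp
  have 2: "T (i + k) * W i j = W i j * T k" using T_W_right assms by simp
  have 3: "T k * U (inverse Q) j = U (inverse Q) j * T k" using T_U[of k j] assms by simp
  show ?thesis unfolding v_def by (simp add: mult.assoc mult_shift[OF 1] mult_shift[OF 2] 3)
qed

lemma v_T0: "\<lbrakk>i + j \<le> d; 0 < j\<rbrakk> \<Longrightarrow> v i j * L 0 = sc (- Q) * v i j"
  unfolding v_def using U_T0[OF QQ(3,4), of j] by (simp add: mult.assoc sc_left')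

text \<open>In \<open>T\<^sub>j L\<^sub>j = L\<^bsub>j-1\<^esub> T\<^sub>j + z L\<^sub>j\<close> the
  second term contributes nothing: by induction the left factor is an eigenvector of
  \<open>L\<^bsub>j-1\<^esub>\<close> for the eigenvalue \<open>inverse Q\<close>, so it is killed by
  the factor \<open>L\<^bsub>j-1\<^esub> - inverse Q\<close> of \<open>U (inverse Q) j\<close>.\<close>
lemma R_U_L:
  "j < d \<Longrightarrow> (T 0 - sc (- Q)) * R 0 j * U (inverse Q) j * L j
     = sc (inverse Q) * ((T 0 - sc (- Q)) * R 0 j * U (inverse Q) j)"
proof (induction j)
  case 0
  then show ?case using U_T0[OF QQ(1,2), of 1] by simp
next
  case (Suc j)
  let ?a = "sc (inverse Q)" and ?e = "T 0 - sc (- Q)" and ?T = "T (Suc j)" and ?X = "L j" and ?Y = "L (Suc j)"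
  let ?U = "U (inverse Q) j" and ?R = "R 0 j"
  have IH: "?e * ?R * ?U * ?X = ?a * (?e * ?R * ?U)" using Suc by simp
  have TU: "?T * ?U = ?U * ?T" using T_U[of "Suc j" j] Suc.prems by simp
  have UY: "?U * ?Y = ?Y * ?U" using U_L[of j "Suc j"] Suc.prems by simp
  have XY: "(?X - ?a) * ?Y = ?Y * (?X - ?a)"
    using L_L[of j "Suc j"] Suc.prems by (simp add: left_diff_distrib right_diff_distrib sc_central)
  define g where "g = ?e * ?R * ?U"
  have IH': "g * ?X = ?a * g" using IH unfolding g_def .
  have gT: "?e * R 0 (Suc j) * U (inverse Q) (Suc j) = g * ?T * (?X - ?a)"
    unfolding g_def by (simp add: mult.assoc mult_shift[OF TU])
  have "g * ?T * (?X - ?a) * ?Y = g * (?T * ?Y) * (?X - ?a)"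
    by (simp add: mult.assoc XY)
  also have "\<dots> = (g * ?X) * ?T * (?X - ?a) + g * (z * ?Y) * (?X - ?a)"
    unfolding T_Y[OF Suc.prems] distrib_left distrib_right by (simp only: mult.assoc)
  also have "g * (z * ?Y) * (?X - ?a) = z * ((g * (?X - ?a)) * ?Y)"
    by (simp add: mult.assoc XY) (metis sc_central mult.assoc)
  also have "g * (?X - ?a) = 0"
    unfolding right_diff_distrib IH' by (simp add: sc_central)
  finally show ?case unfolding gT IH' by (simp add: mult.assoc)
qed

lemma v_L:
  assumes "i + j \<le> d" "0 < i" shows "v i j * L j = sc (inverse Q) * v i j"
proof -
  obtain h where h: "i = Suc h" using assms by (cases i) auto
  obtain r where r: "U (- Q) i = r * (T 0 - sc (- Q))" using U_head[of h "- Q"] h assms by auto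
  obtain w where w: "W i j = w * R 0 j" "w * T 0 = T 0 * w" using W_last[of h j] h assms by auto
  have w': "(T 0 - sc (- Q)) * w = w * (T 0 - sc (- Q))"
    using w(2) by (simp add: left_diff_distrib right_diff_distrib sc_central)
  have e: "v i j = r * w * ((T 0 - sc (- Q)) * R 0 j * U (inverse Q) j)"
    unfolding v_def r w(1) by (simp only: mult.assoc mult_shift[OF w'])
  have "j < d" using assms by simp
  note R_U_L[OF this]
  then have "v i j * L j = r * w * (sc (inverse Q) * ((T 0 - sc (- Q)) * R 0 j * U (inverse Q) j))"
    unfolding e by (simp only: mult.assoc)
  then show ?thesis unfolding e by (metis sc_central mult.assoc)
qed

text \<open>The Jucys-Murphy element of the subalgebra generated by
  \<open>T (s + 1), T (s + 2), \<dots>\<close> in which \<open>c\<close> takes the place of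
  \<open>T 0\<close>. Moving \<open>L\<close> across \<open>v\<close> from right to left turns it into
  such an element, with \<open>c = - Q\<close> for the first \<open>j\<close> positions and
  \<open>c = inverse Q\<close> for the others (\<open>v_L_minus\<close>, \<open>v_L_plus\<close>).\<close>
primrec J :: "'k \<Rightarrow> nat \<Rightarrow> nat \<Rightarrow> 'r" where
  "J c s 0 = sc c"
| "J c s (Suc m) = T (Suc (s + m)) * J c s m * T (Suc (s + m))"

lemma v_L_minus: "\<lbrakk>i + j \<le> d; m < j\<rbrakk> \<Longrightarrow> v i j * L m = J (- Q) i m * v i j"
proof (induction m)
  case 0
  then show ?case using v_T0 by simp
next
  case (Suc m)
  have 1: "T (Suc (i + m)) * v i j = v i j * T (Suc m)" using T_v_right[of i j "Suc m"] Suc.prems by simp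
  have 2: "v i j * L m = J (- Q) i m * v i j" using Suc by simp
  have "v i j * L (Suc m) = T (Suc (i + m)) * (v i j * L m) * T (Suc m)"
    by (simp add: L_Suc mult.assoc[symmetric] 1)
  also have "\<dots> = J (- Q) i (Suc m) * v i j"
    unfolding 2 by (simp add: mult.assoc 1)
  finally show ?case .
qed

lemma v_L_plus: "\<lbrakk>i + j \<le> d; m < i\<rbrakk> \<Longrightarrow> v i j * L (j + m) = J (inverse Q) 0 m * v i j"
proof (induction m)
  case 0
  then show ?case using v_L by simp
next
  case (Suc m)
  have 1: "T (Suc m) * v i j = v i j * T (Suc (j + m))" using T_v_left[of "Suc m" i j] Suc.prems by (simp add: add.commute)
  have 2: "v i j * L (j + m) = J (inverse Q) 0 m * v i j" using Suc by simp
  have "v i j * L (j + Suc m) = T (Suc m) * (v i j * L (j + m)) * T (Suc (j + m))"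
    by (simp add: L_Suc mult.assoc[symmetric] 1)
  also have "\<dots> = J (inverse Q) 0 (Suc m) * v i j"
    unfolding 2 by (simp add: mult.assoc 1)
  finally show ?case .
qed

text \<open>A root \<open>c\<close> of the quadratic relation may stand for \<open>T 0\<close>, so all
  identities for \<open>L\<close> and \<open>\<phi>\<close> hold for \<open>J\<close> and
  \<open>\<psi>\<close> as well.\<close>
lemma shifted:
  assumes "c = inverse Q \<or> c = - Q"
  shows "hecke_elements (\<lambda>k. if k = 0 then sc c else T (s + k)) sc (d - s) Q q"
proof (unfold_locales, goal_cases)
  case (7 t)
  then show ?case using braid[of "s + t"] by simp
next
  case 8
  show ?case by (simp add: mult.assoc sc_left sc_left')
next
  case (9 t t')
  then have t: "t \<noteq> 0" by simp
  show ?case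
  proof (cases "t' = 0")
    case True
    then show ?thesis using t sc_central[of c] by simp
  next
    case False
    then show ?thesis using t 9 far[of "s + t" "s + t'"] by simp
  qed
next
  case 10
  have "c * c = (inverse Q - Q) * c + 1" using assms nonzero by (auto simp: algebra_simps)
  then have "sc c * sc c = sc (inverse Q - Q) * sc c + 1" by (simp add: sc_mult[symmetric] sc_add sc_one)
  then show ?case by simp
next
  case (11 t)
  then show ?case using quadratic[of "s + t"] by simp
qed (auto simp: sc_add sc_mult sc_one nonzero intro: sc_central)

lemma L_shifted:
  assumes "c = inverse Q \<or> c = - Q"
  shows "hecke_elements.L (\<lambda>k. if k = 0 then sc c else T (s + k)) m = J c s m"
proof -
  interpret h: hecke_elements "\<lambda>k. if k = 0 then sc c else T (s + k)" sc "d - s" Q q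
    by (rule shifted[OF assms])
  show ?thesis by (induction m) (simp_all add: h.L_Suc)
qed

definition \<psi> :: "'k \<Rightarrow> nat \<Rightarrow> nat \<Rightarrow> 'r" where
  "\<psi> c s m = T (Suc (s + m)) * J c s m - J c s m * T (Suc (s + m))"

lemma J_J:
  assumes c: "c = inverse Q \<or> c = - Q" and "s + m < d" "s + r < d"
  shows "J c s m * J c s r = J c s r * J c s m"
  using hecke_elements.L_L[OF shifted[OF c], of m s r] assms(2,3) unfolding L_shifted[OF c] by simp

lemma psi_J:
  assumes c: "c = inverse Q \<or> c = - Q" and "Suc (s + m) < d"
  shows "\<psi> c s m * J c s m = J c s (Suc m) * \<psi> c s m"
  using hecke_elements.phi_X[OF shifted[OF c], of m s] assms(2)
  unfolding hecke_elements.\<phi>_def[OF shifted[OF c]] L_shifted[OF c] \<psi>_def by simp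

lemma psi_psi:
  assumes c: "c = inverse Q \<or> c = - Q" and "Suc (s + m) < d"
  shows "\<psi> c s m * \<psi> c s m
    = - ((J c s m - sc (q\<^sup>2) * J c s (Suc m)) * (J c s m - sc (inverse q ^ 2) * J c s (Suc m)))"
  using hecke_elements.phi_phi[OF shifted[OF c], of m s] assms(2)
  unfolding hecke_elements.\<phi>_def[OF shifted[OF c]] L_shifted[OF c] \<psi>_def by simp

lemma J_commute:
  assumes "\<And>k. s < k \<Longrightarrow> k \<le> s + m \<Longrightarrow> r * T k = T k * r"
  shows "r * J c s m = J c s m * r"
  using assms
proof (induction m)
  case (Suc m)
  have 1: "r * T (Suc (s + m)) = T (Suc (s + m)) * r" and 2: "r * J c s m = J c s m * r" using Suc by simp_all
  show ?case by (simp add: mult.assoc mult_shift[OF 1] mult_shift[OF 2] 1)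
qed (simp add: sc_central)

lemma J_J_disjoint:
  assumes "m < i \<or> m = 0" "i + l < d \<or> l = 0"
  shows "J c 0 m * J c' i l = J c' i l * J c 0 m"
proof (rule J_commute)
  fix k assume k: "i < k" "k \<le> i + l"
  have "T k * J c 0 m = J c 0 m * T k"
  proof (rule J_commute)
    fix h assume "0 < h" "h \<le> 0 + m"
    then show "T k * T h = T h * T k" using far[of k h] k assms by auto
  qed
  then show "J c 0 m * T k = T k * J c 0 m" by simp
qed

section \<open>Sign sequences\<close>

text \<open>A sign sequence is a list of truth values, \<open>True\<close> for plus. A descent is a plus
  followed by a minus; removing descents by \<open>sw\<close> leads to the sequence with all minus signs
  first.\<close>
definition desc :: "bool list \<Rightarrow> nat \<Rightarrow> bool" where
  "desc \<epsilon> p \<longleftrightarrow> Suc p < length \<epsilon> \<and> \<epsilon> ! p \<and> \<not> \<epsilon> ! Suc p"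

definition sw :: "nat \<Rightarrow> bool list \<Rightarrow> bool list" where
  "sw p \<epsilon> = \<epsilon>[p := \<epsilon> ! Suc p, Suc p := \<epsilon> ! p]"

text \<open>For \<open>\<epsilon>\<close> with \<open>i\<close> plus signs let the pluses be numbered
  \<open>0, 1, \<dots>\<close> and the minuses \<open>i, i + 1, \<dots>\<close> from left to right:
  \<open>S \<epsilon> p\<close> is the number of the sign at \<open>p\<close>, the position in a word of
  the piece \<open>X i\<close> that corresponds to \<open>p\<close>, and \<open>D \<epsilon> p\<close>
  is what \<open>L p\<close> becomes when it is moved across \<open>f \<epsilon>\<close>.\<close>
definition S :: "bool list \<Rightarrow> nat \<Rightarrow> nat" where
  "S \<epsilon> p = (if \<epsilon> ! p then count_list (take p \<epsilon>) True
     else count_list \<epsilon> True + count_list (take p \<epsilon>) False)"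

definition D :: "bool list \<Rightarrow> nat \<Rightarrow> 'r" where
  "D \<epsilon> p = (if \<epsilon> ! p then J (inverse Q) 0 (count_list (take p \<epsilon>) True)
     else J (- Q) (count_list \<epsilon> True) (count_list (take p \<epsilon>) False))"

primrec inversions :: "bool list \<Rightarrow> nat" where
  "inversions [] = 0"
| "inversions (x # xs) = (if x then count_list xs False else 0) + inversions xs"

lemma inversions_append:
  "inversions (xs @ ys) = inversions xs + inversions ys + count_list xs True * count_list ys False"
  by (induction xs) auto

lemma desc_split:
  assumes "desc \<epsilon> p"
  obtains xs ys where "\<epsilon> = xs @ True # False # ys" "length xs = p" "sw p \<epsilon> = xs @ False # True # ys"
proof -
  have p: "Suc p < length \<epsilon>" "\<epsilon> ! p" "\<not> \<epsilon> ! Suc p" using assms unfolding desc_def by auto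
  have e: "\<epsilon> = take p \<epsilon> @ True # False # drop (Suc (Suc p)) \<epsilon>"
    using p id_take_nth_drop[of p \<epsilon>] Cons_nth_drop_Suc[of "Suc p" \<epsilon>] by simp
  let ?xs = "take p \<epsilon>" and ?ys = "drop (Suc (Suc p)) \<epsilon>"
  have l: "length ?xs = p" using p by simp
  have "sw p (?xs @ True # False # ?ys) = ?xs @ False # True # ?ys"
    using l unfolding sw_def by (simp add: nth_append list_update_append)
  then show thesis using that e l by metis
qed

lemma desc_sw:
  assumes "desc \<epsilon> p"
  shows "inversions (sw p \<epsilon>) < inversions \<epsilon>" "length (sw p \<epsilon>) = length \<epsilon>"
    "count_list (sw p \<epsilon>) True = count_list \<epsilon> True"
    "\<not> sw p \<epsilon> ! p" "sw p \<epsilon> ! Suc p"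
    "\<lbrakk>r \<noteq> p; r \<noteq> Suc p\<rbrakk> \<Longrightarrow> sw p \<epsilon> ! r = \<epsilon> ! r"
    "S (sw p \<epsilon>) p = S \<epsilon> (Suc p)" "S (sw p \<epsilon>) (Suc p) = S \<epsilon> p"
    "\<lbrakk>r \<noteq> p; r \<noteq> Suc p\<rbrakk> \<Longrightarrow> S (sw p \<epsilon>) r = S \<epsilon> r"
    "D (sw p \<epsilon>) p = D \<epsilon> (Suc p)" "D (sw p \<epsilon>) (Suc p) = D \<epsilon> p"
    "\<lbrakk>r \<noteq> p; r \<noteq> Suc p\<rbrakk> \<Longrightarrow> D (sw p \<epsilon>) r = D \<epsilon> r"
proof -
  obtain xs ys where e: "\<epsilon> = xs @ True # False # ys" "length xs = p" "sw p \<epsilon> = xs @ False # True # ys"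
    by (rule desc_split[OF assms])
  have nth: "(xs @ a # b # ys) ! r = (if r < p then xs ! r else if r = p then a else if r = Suc p then b else ys ! (r - Suc (Suc p)))"
    for a b r
  proof -
    have "r < p \<or> r = p \<or> r = Suc p \<or> (\<exists>k. r = Suc (Suc (p + k)))" by presburger
    then consider "r < p" | "r = p" | "r = Suc p" | k where "r = Suc (Suc (p + k))" by blast
    then show ?thesis by cases (use e(2) in \<open>auto simp: nth_append\<close>)
  qed
  have cnt: "count_list (take r (xs @ a # b # ys)) x = (if r \<le> p then count_list (take r xs) x
     else if r = Suc p then count_list xs x + (if a = x then 1 else 0)
     else count_list xs x + (if a = x then 1 else 0) + (if b = x then 1 else 0) + count_list (take (r - Suc (Suc p)) ys) x)"
    for a b x r
  proof -
    have "r \<le> p \<or> r = Suc p \<or> (\<exists>k. r = Suc (Suc (p + k)))" by presburger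
    then consider "r \<le> p" | "r = Suc p" | k where "r = Suc (Suc (p + k))" by blast
    then show ?thesis by cases (use e(2) in \<open>auto\<close>)
  qed
  show "inversions (sw p \<epsilon>) < inversions \<epsilon>" unfolding e(3) unfolding e(1) by (simp add: inversions_append)
  show "length (sw p \<epsilon>) = length \<epsilon>" unfolding e(3) unfolding e(1) by simp
  show c: "count_list (sw p \<epsilon>) True = count_list \<epsilon> True" unfolding e(3) unfolding e(1) by simp
  show "\<not> sw p \<epsilon> ! p" "sw p \<epsilon> ! Suc p" unfolding e(3) by (simp_all add: nth)
  show "sw p \<epsilon> ! r = \<epsilon> ! r" if "r \<noteq> p" "r \<noteq> Suc p" for r
    unfolding e(3) unfolding e(1) nth using that by simp
  show "S (sw p \<epsilon>) p = S \<epsilon> (Suc p)" "S (sw p \<epsilon>) (Suc p) = S \<epsilon> p"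
    "D (sw p \<epsilon>) p = D \<epsilon> (Suc p)" "D (sw p \<epsilon>) (Suc p) = D \<epsilon> p"
    unfolding S_def D_def c unfolding e(3) unfolding e(1) nth cnt using e(2) by simp_all
  show "S (sw p \<epsilon>) r = S \<epsilon> r" "D (sw p \<epsilon>) r = D \<epsilon> r" if "r \<noteq> p" "r \<noteq> Suc p" for r
    unfolding S_def D_def c unfolding e(3) unfolding e(1) nth cnt using that by simp_all
qed

lemma count_list_replicate: "count_list (replicate m x) y = (if x = y then m else 0)"
  by (induction m) auto

lemma sorted_if_no_desc:
  assumes "\<And>p. \<not> desc \<epsilon> p"
  shows "\<epsilon> = replicate (count_list \<epsilon> False) False @ replicate (count_list \<epsilon> True) True"
proof -
  have "sorted \<epsilon>" unfolding sorted_iff_nth_Suc using assms unfolding desc_def by auto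
  then show ?thesis
  proof (induction \<epsilon>)
    case (Cons x \<epsilon>)
    then have IH: "\<epsilon> = replicate (count_list \<epsilon> False) False @ replicate (count_list \<epsilon> True) True" by simp
    show ?case
    proof (cases x)
      case True
      then have "count_list \<epsilon> False = 0" using Cons.prems by (auto simp: count_list_0_iff)
      then show ?thesis using IH True by simp
    next
      case False
      then show ?thesis using IH by simp
    qed
  qed simp
qed

text \<open>\<open>f\<close> is \<open>v\<close> for the sequence without descents, and a descent at
  \<open>p\<close> contributes a factor \<open>\<phi> p\<close> on the right. The definition takes the
  first descent; since intertwiners at distant positions commute, any descent may be taken
  (\<open>f_desc\<close>).\<close>
function f :: "bool list \<Rightarrow> 'r" where
  "f \<epsilon> = (if \<exists>p. desc \<epsilon> p then f (sw (LEAST p. desc \<epsilon> p) \<epsilon>) * \<phi> (LEAST p. desc \<epsilon> p)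
     else v (count_list \<epsilon> True) (count_list \<epsilon> False))"
  by auto
termination
  by (relation "measure inversions") (auto intro: desc_sw LeastI)

declare f.simps [simp del]

lemma desc_sw_far:
  assumes "desc \<epsilon> p" "desc \<epsilon> r" "p \<noteq> r"
  shows "Suc p < r \<or> Suc r < p" "desc (sw p \<epsilon>) r" "sw p (sw r \<epsilon>) = sw r (sw p \<epsilon>)"
proof -
  show far: "Suc p < r \<or> Suc r < p"
    using assms unfolding desc_def by (metis Suc_lessI linorder_neqE_nat)
  show "desc (sw p \<epsilon>) r"
    using assms far desc_sw[OF assms(1)] unfolding desc_def by auto
  show "sw p (sw r \<epsilon>) = sw r (sw p \<epsilon>)"
    using far assms unfolding sw_def desc_def
    by (intro nth_equalityI) (auto simp: nth_list_update)
qed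

lemma f_desc:
  assumes "length \<epsilon> = d" "desc \<epsilon> p"
  shows "f \<epsilon> = f (sw p \<epsilon>) * \<phi> p"
  using assms
proof (induction "inversions \<epsilon>" arbitrary: \<epsilon> p rule: less_induct)
  case less
  define r where "r = (LEAST p. desc \<epsilon> p)"
  have r: "desc \<epsilon> r" unfolding r_def using less.prems(2) by (rule LeastI)
  have fr: "f \<epsilon> = f (sw r \<epsilon>) * \<phi> r"
    using less.prems(2) by (subst f.simps) (auto simp: r_def)
  show ?case
  proof (cases "p = r")
    case False
    have 1: "f (sw r \<epsilon>) = f (sw p (sw r \<epsilon>)) * \<phi> p"
      using less.hyps[of "sw r \<epsilon>" p] desc_sw[OF r] desc_sw_far[OF r less.prems(2)] False less.prems by auto
    have 2: "f (sw p \<epsilon>) = f (sw r (sw p \<epsilon>)) * \<phi> r"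
      using less.hyps[of "sw p \<epsilon>" r] desc_sw[OF less.prems(2)] desc_sw_far[OF less.prems(2) r] False less.prems by auto
    have 3: "\<phi> p * \<phi> r = \<phi> r * \<phi> p"
      using phi_phi_far[of p r] phi_phi_far[of r p] desc_sw_far(1)[OF less.prems(2) r False] less.prems r
      unfolding desc_def by auto
    show ?thesis
      unfolding fr 1 2 desc_sw_far(3)[OF less.prems(2) r False] by (simp add: mult.assoc 3)
  qed (use fr in simp)
qed

lemma f_base: "(\<And>p. \<not> desc \<epsilon> p) \<Longrightarrow> f \<epsilon> = v (count_list \<epsilon> True) (count_list \<epsilon> False)"
  by (subst f.simps) auto

lemma count_bool: "count_list \<epsilon> True + count_list \<epsilon> False = length \<epsilon>"
  by (induction \<epsilon>) auto

text \<open>An induction on inversions: \<open>\<phi>\<close> exchanges neighbouring Jucys-Murphy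
  elements just as \<open>sw\<close> exchanges the signs, and at the end \<open>v_L_minus\<close> and
  \<open>v_L_plus\<close> apply.\<close>
lemma f_L:
  assumes "length \<epsilon> = d" "p < d"
  shows "f \<epsilon> * L p = D \<epsilon> p * f \<epsilon>"
  using assms
proof (induction "inversions \<epsilon>" arbitrary: \<epsilon> p rule: less_induct)
  case less
  show ?case
  proof (cases "\<exists>r. desc \<epsilon> r")
    case True
    then obtain r where r: "desc \<epsilon> r" by auto
    note s = desc_sw[OF r]
    have rd: "Suc r < d" using r less.prems unfolding desc_def by simp
    have IH: "f (sw r \<epsilon>) * L p' = D (sw r \<epsilon>) p' * f (sw r \<epsilon>)" if "p' < d" for p'
      using less.hyps[of "sw r \<epsilon>" p'] s less.prems that by simp
    note fr = f_desc[OF less.prems(1) r]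
    consider "p = r" | "p = Suc r" | "p \<noteq> r" "p \<noteq> Suc r" by blast
    then show ?thesis
    proof cases
      case 1
      show ?thesis unfolding fr 1
        using IH[of "Suc r"] s rd by (simp add: mult.assoc phi_X) (simp add: mult.assoc[symmetric])
    next
      case 2
      show ?thesis unfolding fr 2
        using IH[of r] s rd by (simp add: mult.assoc phi_Y) (simp add: mult.assoc[symmetric])
    next
      case 3
      show ?thesis unfolding fr
        using IH[of p] s 3 rd less.prems by (simp add: mult.assoc phi_L_far) (simp add: mult.assoc[symmetric])
    qed
  next
    case False
    define i j where "i = count_list \<epsilon> True" and "j = count_list \<epsilon> False"
    have e: "\<epsilon> = replicate j False @ replicate i True" using sorted_if_no_desc False unfolding i_def j_def by blast
    have ij: "i + j = d" using count_bool[of \<epsilon>] less.prems unfolding i_def j_def by simp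
    have fv: "f \<epsilon> = v i j" using f_base False unfolding i_def j_def by blast
    show ?thesis
    proof (cases "p < j")
      case True
      then have "D \<epsilon> p = J (- Q) i p" unfolding D_def by (simp add: e nth_append count_list_replicate)
      then show ?thesis using v_L_minus[of i j p] True ij fv by simp
    next
      case F: False
      then obtain m where m: "p = j + m" using le_Suc_ex by (metis not_less)
      then have "D \<epsilon> p = J (inverse Q) 0 m" using ij less.prems unfolding D_def by (simp add: e nth_append min_def count_list_replicate)
      then show ?thesis using v_L_plus[of i j m] m less.prems ij fv by simp
    qed
  qed
qed

text \<open>If a descent overlaps the pair of equal signs, then removing it creates a second one that
  overlaps too, and the product of the two intertwiners carries \<open>T (p + 1)\<close> to a neighbour
  by \<open>phi_phi_T\<close> or \<open>phi_phi_T'\<close>. The intertwiners of all other descents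
  commute with \<open>T (p + 1)\<close>.\<close>
lemma f_T:
  assumes "length \<epsilon> = d" "Suc p < d" "\<epsilon> ! p = \<epsilon> ! Suc p"
  shows "f \<epsilon> * T (Suc p) = T (S \<epsilon> (Suc p)) * f \<epsilon>"
  using assms
proof (induction "inversions \<epsilon>" arbitrary: \<epsilon> p rule: less_induct)
  case less
  show ?case
  proof (cases "\<exists>r. desc \<epsilon> r")
    case True
    then obtain r where r: "desc \<epsilon> r" by auto
    note s = desc_sw[OF r]
    have rd: "Suc r < d" using r less.prems unfolding desc_def by simp
    note fr = f_desc[OF less.prems(1) r]
    have "r \<noteq> p" using r less.prems unfolding desc_def by auto
    then consider "r = Suc p" | "p = Suc r" | "r < p" "p \<noteq> Suc r" | "Suc p < r" by linarith
    then show ?thesis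
    proof cases
      case 1
      have r': "desc (sw r \<epsilon>) p" using s r less.prems 1 unfolding desc_def by auto
      note s' = desc_sw[OF r']
      have f2: "f \<epsilon> = f (sw p (sw r \<epsilon>)) * (\<phi> p * \<phi> (Suc p))"
        unfolding fr using f_desc[OF _ r'] s less.prems 1 by (simp add: mult.assoc)
      have IH: "f (sw p (sw r \<epsilon>)) * T (Suc (Suc p)) = T (S \<epsilon> (Suc p)) * f (sw p (sw r \<epsilon>))"
        using less.hyps[of "sw p (sw r \<epsilon>)" "Suc p"] s s' rd 1 less.prems by simp
      show ?thesis unfolding f2 mult.assoc phi_phi_T[OF rd[unfolded 1], unfolded mult.assoc]
        using mult_shift[OF IH] by simp
    next
      case 2
      have r': "desc (sw r \<epsilon>) p" using s r less.prems 2 unfolding desc_def by auto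
      note s' = desc_sw[OF r']
      have f2: "f \<epsilon> = f (sw p (sw r \<epsilon>)) * (\<phi> (Suc r) * \<phi> r)"
        unfolding fr using f_desc[OF _ r'] s less.prems 2 by (simp add: mult.assoc)
      have IH: "f (sw p (sw r \<epsilon>)) * T (Suc r) = T (S \<epsilon> (Suc p)) * f (sw p (sw r \<epsilon>))"
        using less.hyps[of "sw p (sw r \<epsilon>)" r] s s' rd 2 less.prems by simp
      have "Suc (Suc r) < d" using less.prems 2 by simp
      note pp = phi_phi_T'[OF this]
      show ?thesis unfolding f2 2 mult.assoc pp[unfolded mult.assoc]
        using mult_shift[OF IH] 2 by simp
    next
      case 3
      have c: "\<phi> r * T (Suc p) = T (Suc p) * \<phi> r" using phi_T_far[of r "Suc p"] 3 less.prems rd by simp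
      have IH: "f (sw r \<epsilon>) * T (Suc p) = T (S \<epsilon> (Suc p)) * f (sw r \<epsilon>)"
        using less.hyps[of "sw r \<epsilon>" p] s 3 less.prems by simp
      show ?thesis unfolding fr by (simp add: mult.assoc c mult_shift[OF IH])
    next
      case 4
      have c: "\<phi> r * T (Suc p) = T (Suc p) * \<phi> r" using phi_T_far[of r "Suc p"] 4 less.prems rd by simp
      have IH: "f (sw r \<epsilon>) * T (Suc p) = T (S \<epsilon> (Suc p)) * f (sw r \<epsilon>)"
        using less.hyps[of "sw r \<epsilon>" p] s 4 less.prems by simp
      show ?thesis unfolding fr by (simp add: mult.assoc c mult_shift[OF IH])
    qed
  next
    case False
    define i j where "i = count_list \<epsilon> True" and "j = count_list \<epsilon> False"
    have e: "\<epsilon> = replicate j False @ replicate i True" using sorted_if_no_desc False unfolding i_def j_def by blast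
    have ij: "i + j = d" using count_bool[of \<epsilon>] less.prems unfolding i_def j_def by simp
    have fv: "f \<epsilon> = v i j" using f_base False unfolding i_def j_def by blast
    have nth: "r < d \<Longrightarrow> \<epsilon> ! r \<longleftrightarrow> \<not> r < j" for r using ij by (auto simp: e nth_append)
    show ?thesis
    proof (cases "Suc p < j")
      case True
      then have "S \<epsilon> (Suc p) = i + Suc p" unfolding S_def by (simp add: e nth_append count_list_replicate)
      then show ?thesis using T_v_right[of i j "Suc p"] True ij fv by simp
    next
      case F: False
      then have "\<not> p < j" using nth[of p] nth[of "Suc p"] less.prems by simp
      then obtain m where m: "p = j + m" using le_Suc_ex by (metis not_less)
      then have "S \<epsilon> (Suc p) = Suc m" using ij less.prems unfolding S_def by (simp add: e nth_append min_def count_list_replicate)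
      then show ?thesis using T_v_left[of "Suc m" i j] m less.prems ij fv by (simp add: add.commute)
    qed
  qed
qed

end

section \<open>Modules with separated parameters\<close>

text \<open>The assumption \<open>separated\<close> is the nonvanishing of \<open>f_B\<close>: the
  scalars \<open>inverse Q * q powi (2 * a)\<close> and \<open>- Q * q powi (2 * b)\<close> differ if
  \<open>\<bar>a - b\<bar> < d\<close>.\<close>
locale hecke_module = hecke_elements T sc d Q q
  for T :: "nat \<Rightarrow> 'r::ring_1" and sc :: "'k::field \<Rightarrow> 'r" and d :: nat and Q q :: 'k +
  fixes act :: "'v::ab_group_add \<Rightarrow> 'r \<Rightarrow> 'v" (infixl "\<cdot>" 70)
  assumes act_add_left: "(x + y) \<cdot> r = x \<cdot> r + y \<cdot> r"
    and act_add_right: "x \<cdot> (r + s) = x \<cdot> r + x \<cdot> s"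
    and act_mult: "x \<cdot> (r * s) = x \<cdot> r \<cdot> s"
    and act_one: "x \<cdot> 1 = x"
    and separated: "\<bar>e\<bar> < int d \<Longrightarrow> inverse Q + q powi (2 * e) * Q \<noteq> 0"
begin

declare J.simps(2) [simp del]

lemma act_zero_left: "0 \<cdot> r = 0"
  using act_add_left[of 0 0 r] by simp

lemma act_zero_right: "x \<cdot> 0 = 0"
  using act_add_right[of x 0 0] by simp

lemma act_minus_right: "x \<cdot> (- r) = - (x \<cdot> r)"
  using act_add_right[of x r "- r"] act_zero_right by (simp add: eq_neg_iff_add_eq_0 add.commute)

lemma act_minus_left: "(- x) \<cdot> r = - (x \<cdot> r)"
  using act_add_left[of x "- x" r] act_zero_left by (simp add: eq_neg_iff_add_eq_0 add.commute)

lemma act_diff_right: "x \<cdot> (r - s) = x \<cdot> r - x \<cdot> s"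
  using act_add_right[of x r "- s"] act_minus_right by simp

lemma act_diff_left: "(x - y) \<cdot> r = x \<cdot> r - y \<cdot> r"
  using act_add_left[of x "- y" r] act_minus_left by simp

lemma act_sum_left: "(\<Sum>i\<in>I. g i) \<cdot> r = (\<Sum>i\<in>I. g i \<cdot> r)"
  by (induction I rule: infinite_finite_induct) (auto simp: act_zero_left act_add_left)

text \<open>In place of invertibility, which would need finite dimension, the arguments of this section
  use elements that act injectively.\<close>
definition cancel :: "'r \<Rightarrow> bool" where
  "cancel r \<longleftrightarrow> (\<forall>x. x \<cdot> r = 0 \<longrightarrow> x = 0)"

lemma cancel_mult: "\<lbrakk>cancel r; cancel s\<rbrakk> \<Longrightarrow> cancel (r * s)"
  unfolding cancel_def by (metis act_mult)

lemma cancel_sc: "c \<noteq> 0 \<Longrightarrow> cancel (sc c)"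
  unfolding cancel_def
  by (metis act_mult act_one act_zero_left right_inverse sc_mult sc_one)

lemma cancel_flip:
  assumes "c \<noteq> 0" "cancel (r - sc c * s)"
  shows "cancel (s - sc (inverse c) * r)"
proof -
  have "s - sc (inverse c) * r = sc (- inverse c) * (r - sc c * s)"
  proof -
    have "sc (inverse c) * (sc c * s) = s"
      using assms(1) by (simp add: mult.assoc[symmetric] sc_mult[symmetric] sc_one)
    then show ?thesis by (simp add: sc_uminus right_diff_distrib)
  qed
  then show ?thesis using cancel_mult[OF cancel_sc[of "- inverse c"] assms(2)] assms(1) by simp
qed

lemma qq_inverse: "sc (q\<^sup>2) * (sc (inverse q ^ 2) * r) = r"
proof -
  have "q\<^sup>2 * inverse q ^ 2 = 1" using nonzero by (simp add: power_mult_distrib[symmetric])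
  then show ?thesis by (simp add: mult.assoc[symmetric] sc_mult[symmetric] sc_one)
qed

lemma sc_sc: "sc x * sc y = sc (x * y)" "sc x * (sc y * r) = sc (x * y) * r"
  by (simp_all add: sc_mult mult.assoc)

text \<open>If \<open>x\<close> is killed by \<open>Y - c N\<close>, then \<open>x u\<close> is killed
  by \<open>X - c N\<close>, so \<open>x u = 0\<close> and hence \<open>x u\<^sup>2 = 0\<close>. On
  \<open>x\<close> one may replace \<open>Y\<close> by \<open>c N\<close> in the formula for
  \<open>u\<^sup>2\<close>, and the two resulting factors act injectively. This replaces the argument
  that passing from \<open>X\<close> to \<open>Y\<close> multiplies eigenvalues by
  \<open>q\<^sup>2\<close>, \<open>1\<close> or \<open>q\<^sup>-\<^sup>2\<close>.\<close>
lemma cancel_step: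
  assumes psi: "u * X = Y * u" "u * u = - ((X - sc (q\<^sup>2) * Y) * (X - sc (inverse q ^ 2) * Y))"
    and comm: "X * Y = Y * X" "N * u = u * N" "N * X = X * N" "N * Y = Y * N"
    and c0: "cancel (X - sc c * N)" and c1: "cancel (X - sc (q\<^sup>2 * c) * N)"
    and c2: "cancel (X - sc (inverse q ^ 2 * c) * N)"
  shows "cancel (Y - sc c * N)"
  unfolding cancel_def
proof (intro allI impI)
  fix x assume x: "x \<cdot> (Y - sc c * N) = 0"
  let ?a = "sc (q\<^sup>2)" and ?b = "sc (inverse q ^ 2)"
  define M where "M = sc c * N"
  have M: "M * u = u * M" "M * X = X * M" "M * Y = Y * M"
    unfolding M_def by (simp_all add: mult.assoc comm sc_left')
  have "u * (X - M) = (Y - M) * u"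
    by (simp add: right_diff_distrib left_diff_distrib psi M)
  then have "x \<cdot> u \<cdot> (X - M) = 0"
    using x unfolding M_def[symmetric] act_mult[symmetric] by (simp add: act_mult act_zero_left)
  then have "x \<cdot> u = 0" using c0 unfolding cancel_def M_def by blast
  then have 1: "x \<cdot> ((X - ?a * Y) * (X - ?b * Y)) = 0"
    using psi(2) by (metis act_minus_right act_mult act_zero_left neg_equal_0_iff_equal)
  have "(X - ?a * Y) * (X - ?b * Y)
      = (X - ?a * M) * (X - ?b * M) - (Y - M) * (?a * (X - ?b * M) + ?b * (X - ?a * Y))"
    by (simp add: right_diff_distrib left_diff_distrib distrib_left mult.assoc sc_left' comm M sc_sc
        mult.commute[of "inverse q ^ 2"])
  then have "x \<cdot> ((X - ?a * M) * (X - ?b * M)) = 0"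
    using 1 x unfolding M_def[symmetric] by (simp add: act_diff_right act_mult act_zero_left)
  moreover have "cancel ((X - ?a * M) * (X - ?b * M))"
    using cancel_mult[OF c1 c2] unfolding M_def by (simp add: sc_mult mult.assoc)
  ultimately show "x = 0" unfolding cancel_def by blast
qed

lemma powi_shift: "q\<^sup>2 * q powi (2 * e) = q powi (2 * (e + 1))"
  "inverse q ^ 2 * q powi (2 * e) = q powi (2 * (e - 1))"
  using nonzero by (simp_all add: power_int_add power_int_diff algebra_simps power_inverse divide_inverse)

lemma cancel_J_base:
  "\<lbrakk>m < i \<or> m = 0; i \<le> d; \<bar>e\<bar> + int m < int d\<rbrakk> \<Longrightarrow>
    cancel (J (inverse Q) 0 m - sc (q powi (2 * e)) * sc (- Q))"
proof (induction m arbitrary: e)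
  case 0
  have "J (inverse Q) 0 0 - sc (q powi (2 * e)) * sc (- Q) = sc (inverse Q + q powi (2 * e) * Q)"
    by (simp add: sc_add sc_mult[symmetric] sc_uminus)
  then show ?case using cancel_sc[OF separated[of e]] 0 by simp
next
  case (Suc m)
  have md: "Suc (0 + m) < d" using Suc.prems by simp
  show ?case
  proof (rule cancel_step[of "\<psi> (inverse Q) 0 m" "J (inverse Q) 0 m"])
    show "J (inverse Q) 0 m * J (inverse Q) 0 (Suc m) = J (inverse Q) 0 (Suc m) * J (inverse Q) 0 m"
      using J_J[of "inverse Q" 0 m "Suc m"] md by simp
    show "cancel (J (inverse Q) 0 m - sc (q powi (2 * e)) * sc (- Q))"
      using Suc by simp
    show "cancel (J (inverse Q) 0 m - sc (q\<^sup>2 * q powi (2 * e)) * sc (- Q))"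
      unfolding powi_shift using Suc.IH[of "e + 1"] Suc.prems by simp
    show "cancel (J (inverse Q) 0 m - sc (inverse q ^ 2 * q powi (2 * e)) * sc (- Q))"
      unfolding powi_shift using Suc.IH[of "e - 1"] Suc.prems by simp
  qed (use psi_J[OF _ md] psi_psi[OF _ md] sc_central in \<open>blast+\<close>)
qed

text \<open>Each step \<open>m \<mapsto> m + 1\<close> or \<open>l \<mapsto> l + 1\<close> changes the
  exponent \<open>e\<close> by at most one, so \<open>\<bar>e\<bar> + m + l\<close> stays below
  \<open>d\<close> all the way down to the scalars, where \<open>separated\<close> applies.\<close>
lemma cancel_J:
  "\<lbrakk>m < i \<or> m = 0; i + l < d \<or> l = 0; i \<le> d; \<bar>e\<bar> + int m + int l < int d\<rbrakk> \<Longrightarrow>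
    cancel (J (inverse Q) 0 m - sc (q powi (2 * e)) * J (- Q) i l)"
proof (induction l arbitrary: e)
  case 0
  then show ?case using cancel_J_base[of m i e] by simp
next
  case (Suc l)
  have ld: "Suc (i + l) < d" using Suc.prems by simp
  let ?N = "J (inverse Q) 0 m" and ?X = "J (- Q) i l" and ?Y = "J (- Q) i (Suc l)"
  have pw: "inverse (q powi (2 * e)) = q powi (2 * (- e))" for e by (simp add: power_int_minus)
  have pw0: "q powi (2 * e) \<noteq> 0" for e using nonzero by simp
  have IH: "cancel (?X - sc (q powi (2 * e')) * ?N)" if "\<bar>e'\<bar> \<le> \<bar>e\<bar> + 1" for e'
    using cancel_flip[OF pw0 Suc.IH[of "- e'"]] that Suc.prems unfolding pw by simp
  have NX: "?N * ?X = ?X * ?N" using J_J_disjoint[of m i l] Suc.prems by simp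
  have NY: "?N * ?Y = ?Y * ?N" using J_J_disjoint[of m i "Suc l"] Suc.prems by simp
  have NT: "?N * T (Suc (i + l)) = T (Suc (i + l)) * ?N"
    by (rule J_commute[symmetric]) (use far[of "Suc (i + l)"] ld Suc.prems in auto)
  have "cancel (?Y - sc (q powi (2 * (- e))) * ?N)"
  proof (rule cancel_step[of "\<psi> (- Q) i l" ?X])
    show "?X * ?Y = ?Y * ?X" using J_J[of "- Q" i l "Suc l"] ld by simp
    show "?N * \<psi> (- Q) i l = \<psi> (- Q) i l * ?N"
      unfolding \<psi>_def right_diff_distrib left_diff_distrib
      by (simp add: mult.assoc NX mult_shift[OF NX] NT mult_shift[OF NT])
    show "cancel (?X - sc (q powi (2 * (- e))) * ?N)"
      using IH[of "- e"] by simp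
    show "cancel (?X - sc (q\<^sup>2 * q powi (2 * (- e))) * ?N)"
      unfolding powi_shift using IH[of "- e + 1"] by simp
    show "cancel (?X - sc (inverse q ^ 2 * q powi (2 * (- e))) * ?N)"
      unfolding powi_shift using IH[of "- e - 1"] by simp
  qed (use psi_J[OF _ ld] psi_psi[OF _ ld] NX NY in \<open>blast+\<close>)
  from cancel_flip[OF pw0 this] show ?case unfolding pw by simp
qed

text \<open>The polynomial with roots \<open>c * q powi (2 * k)\<close> for \<open>k\<close> in
  \<open>cs\<close>, evaluated at \<open>X\<close>.\<close>
definition P :: "'k \<Rightarrow> int list \<Rightarrow> 'r \<Rightarrow> 'r" where
  "P c cs X = prod_list (map (\<lambda>k. X - sc (c * q powi (2 * k))) cs)"

lemma P_simps [simp]: "P c [] X = 1" "P c (k # cs) X = (X - sc (c * q powi (2 * k))) * P c cs X"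
  unfolding P_def by simp_all

lemma P_append: "P c (cs @ cs') X = P c cs X * P c cs' X"
  unfolding P_def by simp

lemma P_intertwine: "r * X = Y * r \<Longrightarrow> r * P c cs X = P c cs Y * r"
proof (induction cs)
  case (Cons k cs)
  have "r * (X - sc (c * q powi (2 * k))) = (Y - sc (c * q powi (2 * k))) * r"
    using Cons.prems by (simp add: left_diff_distrib right_diff_distrib sc_central)
  from mult_shift[OF this] Cons show ?case by (simp add: mult.assoc)
qed simp

lemma P_P: "X * Y = Y * X \<Longrightarrow> P c cs X * P c' cs' Y = P c' cs' Y * P c cs X"
  by (metis P_intertwine)

text \<open>The root \<open>\<alpha> = c q\<^sup>2\<^sup>k\<close> of the polynomial of \<open>X\<close>
  is replaced by the roots \<open>\<alpha> q\<^sup>-\<^sup>2\<close> and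
  \<open>\<alpha> q\<^sup>2\<close> of \<open>Y\<close>, coming from the square of the intertwiner with
  \<open>X\<close> set to \<open>\<alpha>\<close>, together with the roots \<open>cs\<close> that the
  intertwiner carries over.\<close>
lemma annihilate_step:
  assumes comm: "X * Y = Y * X"
    and G: "P c cs Y * ((X - sc (q\<^sup>2) * Y) * (X - sc (inverse q ^ 2) * Y)) = 0"
    and r: "r * P c ks X = 0"
  shows "r * P c (concat (map (\<lambda>k. cs @ [k - 1, k + 1]) ks)) Y = 0"
  using r
proof (induction ks arbitrary: r)
  case (Cons k ks)
  let ?a = "sc (q\<^sup>2)" and ?b = "sc (inverse q ^ 2)" and ?\<alpha> = "c * q powi (2 * k)"
  let ?F = "P c (cs @ [k - 1, k + 1]) Y" and ?R = "P c (concat (map (\<lambda>k. cs @ [k - 1, k + 1]) ks)) Y"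
  define y where "y = r * ?R"
  have XR: "(X - sc ?\<alpha>) * ?R = ?R * (X - sc ?\<alpha>)"
    using P_intertwine[of X Y Y] comm by (simp add: left_diff_distrib right_diff_distrib sc_central)
  have "r * (X - sc ?\<alpha>) * ?R = 0"
    using Cons.IH[of "r * (X - sc ?\<alpha>)"] Cons.prems by (simp add: mult.assoc)
  then have y: "y * (X - sc ?\<alpha>) = 0" unfolding y_def using XR by (simp add: mult.assoc)
  have G': "P c cs Y * X = X * P c cs Y" using P_intertwine[of X Y Y c cs] comm by simp
  have F: "?F = P c cs Y * ((sc ?\<alpha> - ?a * Y) * (sc ?\<alpha> - ?b * Y))"
  proof -
    have "?\<alpha> = q\<^sup>2 * (c * q powi (2 * (k - 1)))"
      using powi_shift(1)[of "k - 1"] by (simp add: mult.left_commute)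
    then have 1: "sc ?\<alpha> - ?a * Y = - ?a * (Y - sc (c * q powi (2 * (k - 1))))"
      by (simp only: sc_mult) (simp add: right_diff_distrib)
    have "?\<alpha> = inverse q ^ 2 * (c * q powi (2 * (k + 1)))"
      using powi_shift(2)[of "k + 1"] by (simp add: mult.left_commute)
    then have 2: "sc ?\<alpha> - ?b * Y = - ?b * (Y - sc (c * q powi (2 * (k + 1))))"
      by (simp only: sc_mult) (simp add: right_diff_distrib)
    have 3: "- ?a * A * (- ?b * B) = A * B" for A B
      using qq_inverse[of "A * B"] by (simp add: mult.assoc sc_left')
    show ?thesis unfolding 1 2 3 by (simp add: P_append)
  qed
  have e: "(X - ?a * Y) * (X - ?b * Y)
      = (sc ?\<alpha> - ?a * Y) * (sc ?\<alpha> - ?b * Y) + (X - sc ?\<alpha>) * ((X - ?b * Y) + (sc ?\<alpha> - ?a * Y))"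
    by (simp add: right_diff_distrib left_diff_distrib distrib_left mult.assoc sc_left sc_left' comm sc_sc
        mult.commute mult.left_commute)
  have "0 = y * P c cs Y * ((X - ?a * Y) * (X - ?b * Y))"
    using G by (simp add: mult.assoc)
  also have "\<dots> = y * ?F + y * (P c cs Y * (X - sc ?\<alpha>)) * ((X - ?b * Y) + (sc ?\<alpha> - ?a * Y))"
    unfolding e F by (simp add: distrib_left mult.assoc)
  also have "P c cs Y * (X - sc ?\<alpha>) = (X - sc ?\<alpha>) * P c cs Y"
    using G' by (simp add: left_diff_distrib right_diff_distrib sc_central)
  also have "y * ((X - sc ?\<alpha>) * P c cs Y) = 0" using y by (simp add: mult.assoc[symmetric])
  finally have "y * ?F = 0" by simp
  moreover have "P c (concat (map (\<lambda>k. cs @ [k - 1, k + 1]) (k # ks))) Y = ?F * ?R"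
    by (simp only: list.map concat.simps P_append)
  moreover have "?F * ?R = ?R * ?F" by (rule P_P) simp
  ultimately show ?case unfolding y_def by (simp add: mult.assoc)
qed simp

lemma annihilate_J:
  assumes c: "c = inverse Q \<or> c = - Q"
  shows "s + m < d \<or> m = 0 \<Longrightarrow> \<exists>cs. (\<forall>k\<in>set cs. \<bar>k\<bar> \<le> int m) \<and> P c cs (J c s m) = 0"
proof (induction m)
  case 0
  show ?case by (rule exI[of _ "[0]"]) simp
next
  case (Suc m)
  then have md: "Suc (s + m) < d" by simp
  obtain cs where cs: "\<forall>k\<in>set cs. \<bar>k\<bar> \<le> int m" "P c cs (J c s m) = 0" using Suc by auto
  let ?X = "J c s m" and ?Y = "J c s (Suc m)"
  have "P c cs ?Y * (\<psi> c s m * \<psi> c s m) = 0"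
    using P_intertwine[OF psi_J[OF c md], of c cs] cs(2) by (simp add: mult.assoc[symmetric])
  then have G: "P c cs ?Y * ((?X - sc (q\<^sup>2) * ?Y) * (?X - sc (inverse q ^ 2) * ?Y)) = 0"
    unfolding psi_psi[OF c md] by simp
  have "?X * ?Y = ?Y * ?X" using J_J[OF c, of s m "Suc m"] md by simp
  from annihilate_step[OF this G, of 1 cs] cs(2)
  have "P c (concat (map (\<lambda>k. cs @ [k - 1, k + 1]) cs)) ?Y = 0" by simp
  moreover have "\<forall>k\<in>set (concat (map (\<lambda>k. cs @ [k - 1, k + 1]) cs)). \<bar>k\<bar> \<le> int (Suc m)"
    using cs(1) by (auto simp: abs_le_iff)
  ultimately show ?case by blast
qed

lemma cancel_P: "(\<And>k. k \<in> set cs \<Longrightarrow> cancel (X - sc (c * q powi (2 * k)))) \<Longrightarrow> cancel (P c cs X)"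
proof (induction cs)
  case Nil
  then show ?case unfolding cancel_def by (simp add: act_one)
qed (simp add: cancel_mult)

lemma count_take: "\<lbrakk>p < length \<epsilon>; \<epsilon> ! p = b\<rbrakk> \<Longrightarrow> count_list (take p \<epsilon>) b < count_list \<epsilon> b"
proof -
  assume a: "p < length \<epsilon>" "\<epsilon> ! p = b"
  have "count_list \<epsilon> b = count_list (take p \<epsilon> @ \<epsilon> ! p # drop (Suc p) \<epsilon>) b"
    using id_take_nth_drop[OF a(1)] by simp
  then show ?thesis using a(2) by simp
qed

text \<open>At the first position \<open>p\<close> where the signs differ, the same number
  \<open>m\<close> of pluses and \<open>l\<close> of minuses precede in both sequences. So
  \<open>D\<close> is built from \<open>inverse Q\<close> in \<open>m\<close> steps for one sequence and
  from \<open>- Q\<close> in \<open>l\<close> steps for the other, and \<open>m + l = p < d\<close>.\<close>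
lemma separation:
  assumes "length \<epsilon> = d" "length \<epsilon>' = d" "\<epsilon> \<noteq> \<epsilon>'"
  shows "\<exists>p c cs. p < d \<and> P c cs (D \<epsilon> p) = 0 \<and> cancel (P c cs (D \<epsilon>' p))"
proof -
  define p where "p = (LEAST p. \<epsilon> ! p \<noteq> \<epsilon>' ! p)"
  obtain r where r: "r < d" "\<epsilon> ! r \<noteq> \<epsilon>' ! r" using assms by (auto simp: list_eq_iff_nth_eq)
  have p: "\<epsilon> ! p \<noteq> \<epsilon>' ! p" unfolding p_def by (rule LeastI[of "\<lambda>p. \<epsilon> ! p \<noteq> \<epsilon>' ! p", OF r(2)])
  have "p \<le> r" unfolding p_def by (rule Least_le[of "\<lambda>p. \<epsilon> ! p \<noteq> \<epsilon>' ! p", OF r(2)])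
  then have pd: "p < d" using r by simp
  have t: "take p \<epsilon>' = take p \<epsilon>"
  proof (rule nth_equalityI)
    fix k assume "k < length (take p \<epsilon>')"
    then have "k < p" by simp
    from not_less_Least[OF this[unfolded p_def]] show "take p \<epsilon>' ! k = take p \<epsilon> ! k"
      using \<open>k < p\<close> by simp
  qed (use assms in simp)
  define m l where "m = count_list (take p \<epsilon>) True" and "l = count_list (take p \<epsilon>) False"
  have ml: "m + l = p" using count_bool[of "take p \<epsilon>"] pd assms unfolding m_def l_def by simp
  have pw0: "q powi (2 * e) \<noteq> 0" for e using nonzero by simp
  have sw: "sc x * sc y = sc y * sc x" for x y by (rule sc_central)
  show ?thesis
  proof (cases "\<epsilon> ! p")
    case True
    then have F: "\<not> \<epsilon>' ! p" using p by simp
    have D1: "D \<epsilon> p = J (inverse Q) 0 m" using True unfolding D_def m_def by simp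
    let ?i = "count_list \<epsilon>' True"
    have D2: "D \<epsilon>' p = J (- Q) ?i l" using F t unfolding D_def l_def by simp
    have "l < count_list \<epsilon>' False" using count_take[of p \<epsilon>' False] F pd assms t unfolding l_def by simp
    then have il: "?i + l < d" using count_bool[of \<epsilon>'] assms by simp
    obtain cs where cs: "\<forall>k\<in>set cs. \<bar>k\<bar> \<le> int m" "P (inverse Q) cs (J (inverse Q) 0 m) = 0"
      using annihilate_J[of "inverse Q" 0 m] ml pd by auto
    have "cancel (P (inverse Q) cs (J (- Q) ?i l))"
    proof (rule cancel_P)
      fix k assume k: "k \<in> set cs"
      have "cancel (J (inverse Q) 0 0 - sc (q powi (2 * (- k))) * J (- Q) ?i l)"
        by (rule cancel_J) (use il ml pd cs(1) k in force)+
      from cancel_flip[OF pw0 this]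
      show "cancel (J (- Q) ?i l - sc (inverse Q * q powi (2 * k)))"
        by (simp add: power_int_minus sc_mult sw)
    qed
    then show ?thesis using cs(2) pd D1 D2 by metis
  next
    case False
    then have T: "\<epsilon>' ! p" using p by simp
    let ?i = "count_list \<epsilon> True" and ?i' = "count_list \<epsilon>' True"
    have D1: "D \<epsilon> p = J (- Q) ?i l" using False unfolding D_def l_def by simp
    have D2: "D \<epsilon>' p = J (inverse Q) 0 m" using T t unfolding D_def m_def by simp
    have m: "m < ?i'" using count_take[of p \<epsilon>' True] T pd assms t unfolding m_def by simp
    have i': "?i' \<le> d" using count_bool[of \<epsilon>'] assms by simp
    have "l < count_list \<epsilon> False" using count_take[of p \<epsilon> False] False pd assms unfolding l_def by simp
    then have il: "?i + l < d" using count_bool[of \<epsilon>] assms by simp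
    obtain cs where cs: "\<forall>k\<in>set cs. \<bar>k\<bar> \<le> int l" "P (- Q) cs (J (- Q) ?i l) = 0"
      using annihilate_J[of "- Q" ?i l] il by auto
    have "cancel (P (- Q) cs (J (inverse Q) 0 m))"
    proof (rule cancel_P)
      fix k assume k: "k \<in> set cs"
      have "cancel (J (inverse Q) 0 m - sc (q powi (2 * k)) * J (- Q) ?i' 0)"
        by (rule cancel_J) (use i' m ml pd cs(1) k in force)+
      then show "cancel (J (inverse Q) 0 m - sc (- Q * q powi (2 * k)))"
        by (simp only: J.simps sc_mult sw)
    qed
    then show ?thesis using cs(2) pd D1 D2 by metis
  qed
qed

lemma cancel_D:
  assumes "length \<epsilon> = d" "Suc p < d" "\<not> \<epsilon> ! p" "\<epsilon> ! Suc p" "\<bar>e\<bar> \<le> 1"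
  shows "cancel (D \<epsilon> p - sc (q powi (2 * e)) * D \<epsilon> (Suc p))"
proof -
  let ?i = "count_list \<epsilon> True"
  define m l where "m = count_list (take p \<epsilon>) True" and "l = count_list (take p \<epsilon>) False"
  have ml: "m + l = p" using count_bool[of "take p \<epsilon>"] assms unfolding m_def l_def by simp
  have t: "count_list (take (Suc p) \<epsilon>) True = m"
    using assms by (simp add: take_Suc_conv_app_nth m_def)
  have D1: "D \<epsilon> p = J (- Q) ?i l" using assms unfolding D_def l_def by simp
  have D2: "D \<epsilon> (Suc p) = J (inverse Q) 0 m" using assms t unfolding D_def by simp
  have m: "m < ?i" using count_take[of "Suc p" \<epsilon> True] assms t by simp
  have "l < count_list \<epsilon> False" using count_take[of p \<epsilon> False] assms unfolding l_def by simp
  then have il: "?i + l < d" using count_bool[of \<epsilon>] assms by simp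
  have "cancel (J (inverse Q) 0 m - sc (q powi (2 * (- e))) * J (- Q) ?i l)"
    by (rule cancel_J) (use m il ml assms in auto)
  from cancel_flip[OF _ this] show ?thesis
    unfolding D1 D2 using nonzero by (simp add: power_int_minus)
qed

text \<open>The subalgebra generated by \<open>T k\<close> for \<open>k \<in> ks\<close>;
  \<open>K i\<close> below names the generators of the parabolic subalgebra that preserves the piece
  \<open>X i\<close>.\<close>
inductive_set alg :: "nat set \<Rightarrow> 'r set" for ks where
  gen: "k \<in> ks \<Longrightarrow> T k \<in> alg ks"
| scalar: "sc c \<in> alg ks"
| add: "\<lbrakk>r \<in> alg ks; s \<in> alg ks\<rbrakk> \<Longrightarrow> r + s \<in> alg ks"
| mult: "\<lbrakk>r \<in> alg ks; s \<in> alg ks\<rbrakk> \<Longrightarrow> r * s \<in> alg ks"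

lemma alg_one: "1 \<in> alg ks"
  using alg.scalar[of 1] by (simp add: sc_one)

lemma alg_uminus: "r \<in> alg ks \<Longrightarrow> - r \<in> alg ks"
  using alg.mult[OF alg.scalar[of "- 1"]] by (simp add: sc_uminus sc_one)

lemma alg_diff: "\<lbrakk>r \<in> alg ks; s \<in> alg ks\<rbrakk> \<Longrightarrow> r - s \<in> alg ks"
  using alg.add[OF _ alg_uminus] by fastforce

lemmas alg_intros = alg.intros alg_one alg_uminus alg_diff

lemma alg_P: "X \<in> alg ks \<Longrightarrow> P c cs X \<in> alg ks"
  by (induction cs) (auto intro!: alg_intros)

lemma alg_L: "p < d \<Longrightarrow> L p \<in> alg {..<d}"
  by (induction p) (auto intro!: alg_intros simp: L_Suc)

lemma alg_phi: "Suc p < d \<Longrightarrow> \<phi> p \<in> alg {..<d}"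
  unfolding \<phi>_def by (auto intro!: alg_intros alg_L)

lemma alg_U: "i \<le> d \<Longrightarrow> U c i \<in> alg {..<d}"
  by (induction i) (auto intro!: alg_intros alg_L)

lemma alg_R: "s + m < d \<or> m = 0 \<Longrightarrow> R s m \<in> alg {..<d}"
  by (induction m) (auto intro!: alg_intros)

lemma alg_W: "i + j \<le> d \<Longrightarrow> W i j \<in> alg {..<d}"
  by (induction i) (auto intro!: alg_intros alg_R)

lemma alg_v: "i + j \<le> d \<Longrightarrow> v i j \<in> alg {..<d}"
  unfolding v_def by (auto intro!: alg_intros alg_U alg_W)

lemma alg_f: "length \<epsilon> = d \<Longrightarrow> f \<epsilon> \<in> alg {..<d}"
proof (induction "inversions \<epsilon>" arbitrary: \<epsilon> rule: less_induct)
  case less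
  show ?case
  proof (cases "\<exists>p. desc \<epsilon> p")
    case True
    then obtain p where p: "desc \<epsilon> p" by auto
    then have "Suc p < d" using less.prems unfolding desc_def by simp
    moreover have "f (sw p \<epsilon>) \<in> alg {..<d}" using less.hyps desc_sw[OF p] less.prems by simp
    ultimately show ?thesis unfolding f_desc[OF less.prems p] by (intro alg_intros alg_phi)
  next
    case False
    then show ?thesis using f_base[of \<epsilon>] alg_v count_bool[of \<epsilon>] less.prems by simp
  qed
qed

definition K :: "nat \<Rightarrow> nat set" where
  "K i = {1..<d} - {i}"

lemma alg_J: "(\<And>k. s < k \<Longrightarrow> k \<le> s + m \<Longrightarrow> k \<in> ks) \<Longrightarrow> J c s m \<in> alg ks"
  by (induction m) (auto intro!: alg_intros simp: J.simps(2))

lemma alg_D: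
  assumes "length \<epsilon> = d" "p < d"
  shows "D \<epsilon> p \<in> alg (K (count_list \<epsilon> True))"
  unfolding D_def K_def
  using count_take[of p \<epsilon> True] count_take[of p \<epsilon> False] count_bool[of \<epsilon>] assms
  by (auto intro!: alg_J)

text \<open>Signs of the same kind in neighbouring positions have consecutive numbers, so the generator
  \<open>T (S \<epsilon> (p + 1))\<close> never exchanges the blocks of pluses and minuses.\<close>
lemma S_mem:
  assumes "length \<epsilon> = d" "Suc p < d" "\<epsilon> ! p = \<epsilon> ! Suc p"
  shows "S \<epsilon> (Suc p) \<in> K (count_list \<epsilon> True)"
proof -
  have t: "take (Suc p) \<epsilon> = take p \<epsilon> @ [\<epsilon> ! p]" using assms by (simp add: take_Suc_conv_app_nth)
  show ?thesis
    unfolding S_def K_def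
    using count_take[of "Suc p" \<epsilon> True] count_take[of "Suc p" \<epsilon> False] count_bool[of \<epsilon>] assms
    by (auto simp: t)
qed

definition endo :: "'v set \<Rightarrow> nat set \<Rightarrow> ('v \<Rightarrow> 'v) \<Rightarrow> bool" where
  "endo A ks g \<longleftrightarrow> (\<forall>x\<in>A. g x \<in> A) \<and> (\<forall>x\<in>A. \<forall>y\<in>A. g (x + y) = g x + g y) \<and>
    (\<forall>c. \<forall>x\<in>A. g (x \<cdot> sc c) = g x \<cdot> sc c) \<and> (\<forall>k\<in>ks. \<forall>x\<in>A. g (x \<cdot> T k) = g x \<cdot> T k)"

definition invariant :: "'v set \<Rightarrow> nat set \<Rightarrow> bool" where
  "invariant A ks \<longleftrightarrow> 0 \<in> A \<and> (\<forall>x\<in>A. \<forall>y\<in>A. x + y \<in> A) \<and> (\<forall>c. \<forall>x\<in>A. x \<cdot> sc c \<in> A) \<and>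
    (\<forall>k\<in>ks. \<forall>x\<in>A. x \<cdot> T k \<in> A)"

lemma invariant_alg:
  assumes "invariant A ks" "r \<in> alg ks" "x \<in> A"
  shows "x \<cdot> r \<in> A"
  using assms(2,3)
  by (induction r arbitrary: x rule: alg.induct)
     (use assms(1) in \<open>auto simp: invariant_def act_add_right act_mult\<close>)

lemma invariant_zero: "invariant A ks \<Longrightarrow> 0 \<in> A"
  unfolding invariant_def by blast

lemma invariant_add: "\<lbrakk>invariant A ks; x \<in> A; y \<in> A\<rbrakk> \<Longrightarrow> x + y \<in> A"
  unfolding invariant_def by blast

lemma invariant_uminus: "\<lbrakk>invariant A ks; x \<in> A\<rbrakk> \<Longrightarrow> - x \<in> A"
  using invariant_alg[OF _ alg_uminus[OF alg_one], of A ks x] by (simp add: act_minus_right act_one)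

lemma invariant_diff: "\<lbrakk>invariant A ks; x \<in> A; y \<in> A\<rbrakk> \<Longrightarrow> x - y \<in> A"
  using invariant_add[of A ks x "- y"] invariant_uminus[of A ks y] by simp

lemma invariant_sum: "\<lbrakk>invariant A ks; \<And>i. i \<in> I \<Longrightarrow> g i \<in> A\<rbrakk> \<Longrightarrow> (\<Sum>i\<in>I. g i) \<in> A"
  by (induction I rule: infinite_finite_induct) (auto simp: invariant_zero invariant_add)

lemma endo_alg:
  assumes "invariant A ks" "endo A ks g" "r \<in> alg ks" "x \<in> A"
  shows "g (x \<cdot> r) = g x \<cdot> r"
  using assms(3,4)
proof (induction r arbitrary: x rule: alg.induct)
  case (add r s)
  then have "x \<cdot> r \<in> A" "x \<cdot> s \<in> A" using invariant_alg[OF assms(1)] by blast+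
  then show ?case using add assms(2) unfolding act_add_right endo_def by auto
next
  case (mult r s)
  then have "x \<cdot> r \<in> A" using invariant_alg[OF assms(1)] by blast
  then show ?case using mult unfolding act_mult by auto
qed (use assms(2) in \<open>auto simp: endo_def\<close>)

lemma endo_zero: "\<lbrakk>invariant A ks; endo A ks g\<rbrakk> \<Longrightarrow> g 0 = 0"
  unfolding invariant_def endo_def by (metis add_cancel_right_right)

lemma endo_sum:
  assumes "invariant A ks" "endo A ks g" "\<And>i. i \<in> I \<Longrightarrow> h i \<in> A"
  shows "g (\<Sum>i\<in>I. h i) = (\<Sum>i\<in>I. g (h i))"
  using assms(3)
proof (induction I rule: infinite_finite_induct)
  case (insert i I)
  then have "(\<Sum>i\<in>I. h i) \<in> A" using invariant_sum[OF assms(1), of I h] by simp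
  then show ?case using insert assms(2) unfolding endo_def by simp
qed (use endo_zero[OF assms(1,2)] in auto)

definition \<E> :: "bool list set" where
  "\<E> = {\<epsilon>. length \<epsilon> = d}"

lemma finite_\<E>: "finite \<E>"
  using finite_lists_length_eq[of "UNIV :: bool set" d] unfolding \<E>_def by simp

abbreviation npos :: "bool list \<Rightarrow> nat" where
  "npos \<epsilon> \<equiv> count_list \<epsilon> True"

lemma npos_le: "\<epsilon> \<in> \<E> \<Longrightarrow> npos \<epsilon> \<le> d"
  using count_bool[of \<epsilon>] unfolding \<E>_def by simp

end

section \<open>Independence of the pieces\<close>

text \<open>\<open>E\<close> is the whole module; the subspace \<open>X i\<close> is stable under the
  parabolic subalgebra \<open>K i\<close>, and the pieces are the images of
  \<open>X (npos \<epsilon>)\<close> under \<open>f \<epsilon>\<close>.\<close>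
locale hecke_pieces = hecke_module T sc d Q q act
  for T :: "nat \<Rightarrow> 'r::ring_1" and sc :: "'k::field \<Rightarrow> 'r" and d Q q
    and act :: "'v::ab_group_add \<Rightarrow> 'r \<Rightarrow> 'v" (infixl "\<cdot>" 70) +
  fixes E :: "'v set" and X :: "nat \<Rightarrow> 'v set"
  assumes E: "invariant E {..<d}"
    and X: "i \<le> d \<Longrightarrow> invariant (X i) (K i)"
    and X_E: "i \<le> d \<Longrightarrow> X i \<subseteq> E"
    and v_injective: "\<lbrakk>i \<le> d; x \<in> X i; x \<cdot> v i (d - i) = 0\<rbrakk> \<Longrightarrow> x = 0"
begin

text \<open>\<open>f \<epsilon>\<close> times \<open>\<phi> p\<close> is
  \<open>f (sw p \<epsilon>)\<close> times the square of the intertwiner, which moves to the left as a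
  product of two differences of the kind treated in \<open>cancel_D\<close>.\<close>
lemma f_injective:
  "\<lbrakk>\<epsilon> \<in> \<E>; x \<in> X (npos \<epsilon>); x \<cdot> f \<epsilon> = 0\<rbrakk> \<Longrightarrow> x = 0"
proof (induction "inversions \<epsilon>" arbitrary: \<epsilon> x rule: less_induct)
  case less
  have len: "length \<epsilon> = d" using less.prems unfolding \<E>_def by simp
  have i: "npos \<epsilon> \<le> d" by (rule npos_le[OF less.prems(1)])
  show ?case
  proof (cases "\<exists>p. desc \<epsilon> p")
    case True
    then obtain p where p: "desc \<epsilon> p" by auto
    note s = desc_sw[OF p]
    have pd: "Suc p < d" using p len unfolding desc_def by simp
    let ?\<epsilon> = "sw p \<epsilon>"
    have len': "length ?\<epsilon> = d" using s len by simp
    let ?r = "D ?\<epsilon> p - sc (q\<^sup>2) * D ?\<epsilon> (Suc p)" and ?s = "D ?\<epsilon> p - sc (inverse q ^ 2) * D ?\<epsilon> (Suc p)"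
    have rs: "?r * ?s \<in> alg (K (npos \<epsilon>))"
      using alg_D[OF len'] pd s(3) by (auto intro!: alg_intros)
    have "f ?\<epsilon> * (\<phi> p * \<phi> p) = - (?r * ?s * f ?\<epsilon>)"
    proof -
      have 1: "f ?\<epsilon> * L p = D ?\<epsilon> p * f ?\<epsilon>" "f ?\<epsilon> * L (Suc p) = D ?\<epsilon> (Suc p) * f ?\<epsilon>"
        using f_L[OF len'] pd by simp_all
      have 2: "f ?\<epsilon> * (L p - sc c * L (Suc p)) = (D ?\<epsilon> p - sc c * D ?\<epsilon> (Suc p)) * f ?\<epsilon>" for c
        by (simp add: right_diff_distrib left_diff_distrib 1 sc_left' mult.assoc)
      show ?thesis unfolding phi_phi[OF pd] by (simp add: mult.assoc 2 mult_shift[OF 2])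
    qed
    then have "x \<cdot> (?r * ?s) \<cdot> f ?\<epsilon> = - (x \<cdot> f \<epsilon> \<cdot> \<phi> p)"
      unfolding f_desc[OF len p] by (simp add: act_mult[symmetric] act_minus_right[symmetric] mult.assoc)
    also have "\<dots> = 0" using less.prems by (simp add: act_zero_left)
    finally have "x \<cdot> (?r * ?s) = 0"
      using less.hyps[of ?\<epsilon> "x \<cdot> (?r * ?s)"] s len' invariant_alg[OF X[OF i] rs] less.prems
      unfolding \<E>_def by simp
    moreover have "cancel (?r * ?s)"
      using cancel_D[OF len' pd s(4,5), of 1] cancel_D[OF len' pd s(4,5), of "-1"]
      by (intro cancel_mult) (simp_all add: power_int_minus power_inverse)
    ultimately show ?thesis unfolding cancel_def by blast
  next
    case False
    have "f \<epsilon> = v (npos \<epsilon>) (d - npos \<epsilon>)"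
      using f_base[of \<epsilon>] False count_bool[of \<epsilon>] len by (metis add_diff_cancel_left')
    then show ?thesis using v_injective[OF i] less.prems by simp
  qed
qed

text \<open>The product of the polynomials from \<open>separation\<close>, one for each
  \<open>\<epsilon>\<close> in \<open>F\<close>, each evaluated at its \<open>L p\<close>: it kills
  these pieces and acts injectively on the piece of \<open>\<epsilon>0\<close>.\<close>
lemma isolate:
  assumes "F \<subseteq> \<E>" "\<epsilon>0 \<in> \<E>" "\<epsilon>0 \<notin> F"
  shows "\<exists>Z Z0. (\<forall>p<d. Z * L p = L p * Z) \<and> (\<forall>\<epsilon>\<in>F. f \<epsilon> * Z = 0) \<and>
    f \<epsilon>0 * Z = Z0 * f \<epsilon>0 \<and> cancel Z0 \<and> Z0 \<in> alg (K (npos \<epsilon>0))"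
  using finite_subset[OF assms(1) finite_\<E>] assms
proof (induction F rule: finite_induct)
  case empty
  show ?case by (rule exI[of _ 1], rule exI[of _ 1]) (auto simp: cancel_def act_one alg_one)
next
  case (insert \<epsilon> F)
  then obtain Z Z0 where Z: "\<forall>p<d. Z * L p = L p * Z" "\<forall>\<epsilon>\<in>F. f \<epsilon> * Z = 0"
    "f \<epsilon>0 * Z = Z0 * f \<epsilon>0" "cancel Z0" "Z0 \<in> alg (K (npos \<epsilon>0))" by auto
  have len: "length \<epsilon> = d" "length \<epsilon>0 = d" "\<epsilon> \<noteq> \<epsilon>0" using insert unfolding \<E>_def by auto
  obtain p c cs where p: "p < d" "P c cs (D \<epsilon> p) = 0" "cancel (P c cs (D \<epsilon>0 p))"
    using separation[OF len] by blast
  have ZP: "Z * P c cs (L p) = P c cs (L p) * Z" using P_intertwine Z(1) p(1) by blast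
  have fP: "f \<epsilon> * P c cs (L p) = P c cs (D \<epsilon> p) * f \<epsilon>" "f \<epsilon>0 * P c cs (L p) = P c cs (D \<epsilon>0 p) * f \<epsilon>0"
    using P_intertwine f_L len p(1) by blast+
  show ?case
  proof (rule exI[of _ "P c cs (L p) * Z"], rule exI[of _ "P c cs (D \<epsilon>0 p) * Z0"], intro conjI allI impI ballI)
    fix r assume r: "r < d"
    have "P c cs (L p) * L r = L r * P c cs (L p)" using P_intertwine[of "L r" "L p" "L p"] L_L r p(1) by simp
    then show "P c cs (L p) * Z * L r = L r * (P c cs (L p) * Z)"
      using Z(1)[rule_format, OF r] by (simp add: mult.assoc mult_shift[OF \<open>P c cs (L p) * L r = _\<close>])
  next
    fix \<epsilon>' assume "\<epsilon>' \<in> insert \<epsilon> F"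
    then consider "\<epsilon>' = \<epsilon>" | "\<epsilon>' \<in> F" by blast
    then show "f \<epsilon>' * (P c cs (L p) * Z) = 0"
    proof cases
      case 1
      then show ?thesis using mult_shift[OF fP(1)] p(2) by simp
    next
      case 2
      then show ?thesis unfolding ZP[symmetric] mult.assoc[symmetric] using Z(2) by simp
    qed
  next
    show "f \<epsilon>0 * (P c cs (L p) * Z) = P c cs (D \<epsilon>0 p) * Z0 * f \<epsilon>0"
      by (simp add: mult_shift[OF fP(2)] Z(3) mult.assoc)
  qed (use Z p alg_D[OF len(2) p(1)] in \<open>auto intro!: cancel_mult alg_intros alg_P\<close>)
qed

lemma independent_pieces:
  assumes \<xi>: "\<And>\<epsilon>. \<epsilon> \<in> \<E> \<Longrightarrow> \<xi> \<epsilon> \<in> X (npos \<epsilon>)" and zero: "(\<Sum>\<epsilon>\<in>\<E>. \<xi> \<epsilon> \<cdot> f \<epsilon>) = 0" and \<epsilon>0: "\<epsilon>0 \<in> \<E>"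
  shows "\<xi> \<epsilon>0 = 0"
proof -
  obtain Z Z0 where Z: "\<forall>\<epsilon>\<in>\<E> - {\<epsilon>0}. f \<epsilon> * Z = 0"
    "f \<epsilon>0 * Z = Z0 * f \<epsilon>0" "cancel Z0" "Z0 \<in> alg (K (npos \<epsilon>0))"
    using isolate[of "\<E> - {\<epsilon>0}" \<epsilon>0] \<epsilon>0 by blast
  have "0 = (\<Sum>\<epsilon>\<in>\<E>. \<xi> \<epsilon> \<cdot> f \<epsilon>) \<cdot> Z" using zero by (simp add: act_zero_left)
  also have "\<dots> = (\<Sum>\<epsilon>\<in>\<E>. \<xi> \<epsilon> \<cdot> (f \<epsilon> * Z))" by (simp add: act_sum_left act_mult)
  also have "\<dots> = \<xi> \<epsilon>0 \<cdot> (f \<epsilon>0 * Z) + (\<Sum>\<epsilon>\<in>\<E> - {\<epsilon>0}. \<xi> \<epsilon> \<cdot> (f \<epsilon> * Z))"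
    by (rule sum.remove[OF finite_\<E> \<epsilon>0])
  also have "\<dots> = \<xi> \<epsilon>0 \<cdot> Z0 \<cdot> f \<epsilon>0" using Z by (simp add: act_zero_right act_mult)
  finally have "\<xi> \<epsilon>0 \<cdot> Z0 = 0"
    using f_injective[OF \<epsilon>0, of "\<xi> \<epsilon>0 \<cdot> Z0"] invariant_alg[OF X[OF npos_le[OF \<epsilon>0]] Z(4) \<xi>[OF \<epsilon>0]] by simp
  then show ?thesis using Z(3) unfolding cancel_def by blast
qed

end

section \<open>Endomorphisms are glued from the pieces\<close>

text \<open>Here the pieces exhaust the module and injective elements of the parabolic subalgebras act
  surjectively on \<open>X i\<close>, as they do in finite dimension.\<close>
locale hecke_decomposition = hecke_pieces T sc d Q q act E X
  for T :: "nat \<Rightarrow> 'r::ring_1" and sc :: "'k::field \<Rightarrow> 'r" and d Q q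
    and act :: "'v::ab_group_add \<Rightarrow> 'r \<Rightarrow> 'v" (infixl "\<cdot>" 70) and E X +
  assumes X_surj: "\<lbrakk>i \<le> d; r \<in> alg (K i); cancel r; x \<in> X i\<rbrakk> \<Longrightarrow> \<exists>x'\<in>X i. x = x' \<cdot> r"
    and spanning: "y \<in> E \<Longrightarrow> \<exists>\<xi>. (\<forall>\<epsilon>\<in>\<E>. \<xi> \<epsilon> \<in> X (npos \<epsilon>)) \<and> y = (\<Sum>\<epsilon>\<in>\<E>. \<xi> \<epsilon> \<cdot> f \<epsilon>)"
begin

definition part :: "'v \<Rightarrow> bool list \<Rightarrow> 'v" where
  "part y = (SOME \<xi>. (\<forall>\<epsilon>\<in>\<E>. \<xi> \<epsilon> \<in> X (npos \<epsilon>)) \<and> y = (\<Sum>\<epsilon>\<in>\<E>. \<xi> \<epsilon> \<cdot> f \<epsilon>))"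

lemma part:
  assumes "y \<in> E"
  shows "\<epsilon> \<in> \<E> \<Longrightarrow> part y \<epsilon> \<in> X (npos \<epsilon>)" "(\<Sum>\<epsilon>\<in>\<E>. part y \<epsilon> \<cdot> f \<epsilon>) = y"
proof -
  have "(\<forall>\<epsilon>\<in>\<E>. part y \<epsilon> \<in> X (npos \<epsilon>)) \<and> y = (\<Sum>\<epsilon>\<in>\<E>. part y \<epsilon> \<cdot> f \<epsilon>)"
    unfolding part_def by (rule someI_ex[OF spanning[OF assms]])
  then show "\<epsilon> \<in> \<E> \<Longrightarrow> part y \<epsilon> \<in> X (npos \<epsilon>)" "(\<Sum>\<epsilon>\<in>\<E>. part y \<epsilon> \<cdot> f \<epsilon>) = y" by auto
qed

lemma X_invariant: "\<epsilon> \<in> \<E> \<Longrightarrow> invariant (X (npos \<epsilon>)) (K (npos \<epsilon>))"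
  using X npos_le by blast

lemma part_unique:
  assumes "\<And>\<epsilon>. \<epsilon> \<in> \<E> \<Longrightarrow> \<xi> \<epsilon> \<in> X (npos \<epsilon>)" "y = (\<Sum>\<epsilon>\<in>\<E>. \<xi> \<epsilon> \<cdot> f \<epsilon>)" "y \<in> E" "\<epsilon> \<in> \<E>"
  shows "part y \<epsilon> = \<xi> \<epsilon>"
proof -
  have "part y \<epsilon> - \<xi> \<epsilon> = 0"
  proof (rule independent_pieces[of "\<lambda>\<epsilon>. part y \<epsilon> - \<xi> \<epsilon>"])
    show "(\<Sum>\<epsilon>\<in>\<E>. (part y \<epsilon> - \<xi> \<epsilon>) \<cdot> f \<epsilon>) = 0"
      unfolding act_diff_left sum_subtractf part(2)[OF assms(3)] assms(2)[symmetric] by simp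
  qed (use assms part X_invariant invariant_diff in blast)+
  then show ?thesis by simp
qed

lemma f_maps_into_E: "\<lbrakk>\<epsilon> \<in> \<E>; x \<in> X (npos \<epsilon>)\<rbrakk> \<Longrightarrow> x \<cdot> f \<epsilon> \<in> E"
  using invariant_alg[OF E alg_f] X_E[OF npos_le] unfolding \<E>_def by blast

lemma part_f:
  assumes "\<epsilon> \<in> \<E>" "x \<in> X (npos \<epsilon>)" "\<epsilon>' \<in> \<E>"
  shows "part (x \<cdot> f \<epsilon>) \<epsilon>' = (if \<epsilon>' = \<epsilon> then x else 0)"
proof (rule part_unique)
  show "x \<cdot> f \<epsilon> = (\<Sum>\<epsilon>'\<in>\<E>. (if \<epsilon>' = \<epsilon> then x else 0) \<cdot> f \<epsilon>')"
    using assms by (simp add: if_distrib[of "\<lambda>x. x \<cdot> _"] act_zero_left finite_\<E> cong: if_cong)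
qed (use assms f_maps_into_E invariant_zero[OF X_invariant] in auto)

lemma part_add:
  assumes "x \<in> E" "y \<in> E" "\<epsilon> \<in> \<E>" shows "part (x + y) \<epsilon> = part x \<epsilon> + part y \<epsilon>"
proof (rule part_unique)
  show "x + y = (\<Sum>\<epsilon>\<in>\<E>. (part x \<epsilon> + part y \<epsilon>) \<cdot> f \<epsilon>)"
    unfolding act_add_left sum.distrib part(2)[OF assms(1)] part(2)[OF assms(2)] ..
qed (use assms part in \<open>auto intro!: invariant_add[OF X_invariant] invariant_add[OF E]\<close>)

lemma part_alg:
  assumes "y \<in> E" "r \<in> alg {..<d}" "\<And>\<epsilon>. \<epsilon> \<in> \<E> \<Longrightarrow> f \<epsilon> * r = g \<epsilon> * f \<epsilon>"
    "\<And>\<epsilon>. \<epsilon> \<in> \<E> \<Longrightarrow> g \<epsilon> \<in> alg (K (npos \<epsilon>))" "\<epsilon> \<in> \<E>"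
  shows "part (y \<cdot> r) \<epsilon> = part y \<epsilon> \<cdot> g \<epsilon>"
proof (rule part_unique)
  have "y \<cdot> r = (\<Sum>\<epsilon>\<in>\<E>. part y \<epsilon> \<cdot> (f \<epsilon> * r))"
    by (subst part(2)[OF assms(1), symmetric]) (simp add: act_sum_left act_mult)
  also have "\<dots> = (\<Sum>\<epsilon>\<in>\<E>. part y \<epsilon> \<cdot> g \<epsilon> \<cdot> f \<epsilon>)"
    by (rule sum.cong) (simp_all add: assms(3) act_mult)
  finally show "y \<cdot> r = (\<Sum>\<epsilon>\<in>\<E>. part y \<epsilon> \<cdot> g \<epsilon> \<cdot> f \<epsilon>)" .
qed (use assms part in \<open>auto intro!: invariant_alg[OF X_invariant] invariant_alg[OF E assms(2)]\<close>)

lemma part_sc: "\<lbrakk>y \<in> E; \<epsilon> \<in> \<E>\<rbrakk> \<Longrightarrow> part (y \<cdot> sc c) \<epsilon> = part y \<epsilon> \<cdot> sc c"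
  by (rule part_alg) (auto intro: alg_intros simp: sc_central)

text \<open>The components \<open>\<theta> i\<close> act on all pieces with \<open>i\<close> plus signs
  in the same way.\<close>
definition glue :: "(nat \<Rightarrow> 'v \<Rightarrow> 'v) \<Rightarrow> 'v \<Rightarrow> 'v" where
  "glue \<theta> y = (\<Sum>\<epsilon>\<in>\<E>. \<theta> (npos \<epsilon>) (part y \<epsilon>) \<cdot> f \<epsilon>)"

lemma additive_eq_on_pieces:
  assumes "endo E {} g" "endo E {} h"
    and "\<And>\<epsilon> x. \<lbrakk>\<epsilon> \<in> \<E>; x \<in> X (npos \<epsilon>)\<rbrakk> \<Longrightarrow> g (x \<cdot> f \<epsilon>) = h (x \<cdot> f \<epsilon>)" "y \<in> E"
  shows "g y = h y"
proof -
  have E': "invariant E {}" using E unfolding invariant_def by simp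
  have "g (\<Sum>\<epsilon>\<in>\<E>. part y \<epsilon> \<cdot> f \<epsilon>) = (\<Sum>\<epsilon>\<in>\<E>. g (part y \<epsilon> \<cdot> f \<epsilon>))"
    by (rule endo_sum[OF E' assms(1)]) (use f_maps_into_E part(1)[OF assms(4)] in blast)
  also have "\<dots> = (\<Sum>\<epsilon>\<in>\<E>. h (part y \<epsilon> \<cdot> f \<epsilon>))"
    by (rule sum.cong) (use assms part in auto)
  also have "\<dots> = h (\<Sum>\<epsilon>\<in>\<E>. part y \<epsilon> \<cdot> f \<epsilon>)"
    by (rule endo_sum[OF E' assms(2), symmetric]) (use f_maps_into_E part(1)[OF assms(4)] in blast)
  finally show ?thesis unfolding part(2)[OF assms(4)] .
qed

context
  fixes \<theta>
  assumes \<theta>: "\<And>i. i \<le> d \<Longrightarrow> endo (X i) (K i) (\<theta> i)"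
begin

lemma \<theta>': "\<epsilon> \<in> \<E> \<Longrightarrow> endo (X (npos \<epsilon>)) (K (npos \<epsilon>)) (\<theta> (npos \<epsilon>))"
  using \<theta> npos_le by blast

lemma glue_f: "\<lbrakk>\<epsilon> \<in> \<E>; x \<in> X (npos \<epsilon>)\<rbrakk> \<Longrightarrow> glue \<theta> (x \<cdot> f \<epsilon>) = \<theta> (npos \<epsilon>) x \<cdot> f \<epsilon>"
proof -
  assume a: "\<epsilon> \<in> \<E>" "x \<in> X (npos \<epsilon>)"
  have "glue \<theta> (x \<cdot> f \<epsilon>) = (\<Sum>\<epsilon>'\<in>\<E>. (if \<epsilon>' = \<epsilon> then \<theta> (npos \<epsilon>) x \<cdot> f \<epsilon> else 0))"
    unfolding glue_def
    by (rule sum.cong) (use a part_f endo_zero[OF X_invariant \<theta>'] in \<open>auto simp: act_zero_left\<close>)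
  then show ?thesis using a finite_\<E> by simp
qed

lemma glue_linear: "endo E {} (glue \<theta>)"
  unfolding endo_def
proof (intro conjI ballI allI)
  fix x assume x: "x \<in> E"
  show "glue \<theta> x \<in> E"
    unfolding glue_def
    by (rule invariant_sum[OF E]) (use x part f_maps_into_E \<theta>' in \<open>auto simp: endo_def\<close>)
  show "glue \<theta> (x + y) = glue \<theta> x + glue \<theta> y" if y: "y \<in> E" for y
    unfolding glue_def sum.distrib[symmetric]
    by (rule sum.cong) (use x y part \<theta>' in \<open>auto simp: part_add endo_def act_add_left\<close>)
  show "glue \<theta> (x \<cdot> sc c) = glue \<theta> x \<cdot> sc c" for c
    unfolding glue_def act_sum_left
  proof (rule sum.cong)
    fix \<epsilon> assume e: "\<epsilon> \<in> \<E>"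
    have "\<theta> (npos \<epsilon>) (part (x \<cdot> sc c) \<epsilon>) = \<theta> (npos \<epsilon>) (part x \<epsilon>) \<cdot> sc c"
      using part_sc[OF x e] part(1)[OF x e] \<theta>'[OF e] unfolding endo_def by simp
    then show "\<theta> (npos \<epsilon>) (part (x \<cdot> sc c) \<epsilon>) \<cdot> f \<epsilon> = \<theta> (npos \<epsilon>) (part x \<epsilon>) \<cdot> f \<epsilon> \<cdot> sc c"
      by (simp add: act_mult[symmetric] sc_central)
  qed simp
qed simp

text \<open>For equal signs, and for \<open>T 0\<close>, the generator moves across
  \<open>f \<epsilon>\<close> into the parabolic subalgebra, with which \<open>\<theta>\<close>
  commutes. For different signs,
  \<open>(L (p + 1) - L p) * T (p + 1) = \<phi> p + z * L (p + 1)\<close>: the difference acts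
  invertibly on the piece, and the right-hand side maps it into the piece itself and the one with the
  two signs exchanged.\<close>
lemma glue_T_f:
  assumes t: "t < d" and \<epsilon>: "\<epsilon> \<in> \<E>" and x: "x \<in> X (npos \<epsilon>)"
  shows "glue \<theta> (x \<cdot> f \<epsilon> \<cdot> T t) = \<theta> (npos \<epsilon>) x \<cdot> f \<epsilon> \<cdot> T t"
proof -
  let ?i = "npos \<epsilon>"
  have len: "length \<epsilon> = d" using \<epsilon> unfolding \<E>_def by simp
  note en = endo_alg[OF X_invariant[OF \<epsilon>] \<theta>'[OF \<epsilon>]] and cl = invariant_alg[OF X_invariant[OF \<epsilon>]]
  have tx: "\<theta> ?i y \<in> X ?i" if "y \<in> X ?i" for y using \<theta>'[OF \<epsilon>] that unfolding endo_def by simp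
  have easy: "glue \<theta> (x \<cdot> f \<epsilon> \<cdot> r) = \<theta> ?i x \<cdot> f \<epsilon> \<cdot> r"
    if "f \<epsilon> * r = s * f \<epsilon>" "s \<in> alg (K ?i)" for r s
    using glue_f[OF \<epsilon> cl[OF that(2) x]] en[OF that(2) x] that(1)
    by (metis act_mult)
  show ?thesis
  proof (cases t)
    case 0
    then show ?thesis using easy[OF _ alg_D[OF len t]] f_L[OF len t] by simp
  next
    case (Suc p)
    then have pd: "Suc p < d" using t by simp
    show ?thesis
    proof (cases "\<epsilon> ! p = \<epsilon> ! Suc p")
      case True
      show ?thesis
        unfolding Suc using easy[OF f_T[OF len pd True] alg.gen[OF S_mem[OF len pd True]]] .
    next
      case False
      let ?G = "D \<epsilon> (Suc p) - D \<epsilon> p"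
      have G: "?G \<in> alg (K ?i)" using alg_D[OF len] pd by (auto intro!: alg_intros)
      have cG: "cancel ?G"
      proof (cases "\<epsilon> ! p")
        case True
        then have de: "desc \<epsilon> p" using False len pd unfolding desc_def by simp
        note s = desc_sw[OF de]
        have "cancel (D (sw p \<epsilon>) p - sc (q powi (2 * 0)) * D (sw p \<epsilon>) (Suc p))"
          by (rule cancel_D) (use s len pd in auto)
        then show ?thesis using s by (simp add: sc_one)
      next
        case F: False
        have "cancel (D \<epsilon> p - sc (q powi (2 * 0)) * D \<epsilon> (Suc p))"
          by (rule cancel_D) (use False F len pd in auto)
        then have "cancel (D \<epsilon> p - sc 1 * D \<epsilon> (Suc p))" by simp
        from cancel_flip[OF _ this] show ?thesis by (simp add: sc_one)
      qed
      \<comment> \<open>Dividing \<open>x\<close> by the difference makes the identity for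
        \<open>(L (p + 1) - L p) * T (p + 1)\<close> applicable.\<close>
      obtain x' where x': "x' \<in> X ?i" "x = x' \<cdot> ?G" using X_surj[OF npos_le[OF \<epsilon>] G cG x] by auto
      obtain \<epsilon>2 s where s: "\<epsilon>2 \<in> \<E>" "npos \<epsilon>2 = ?i" "f \<epsilon> * \<phi> p = s * f \<epsilon>2" "s \<in> alg (K ?i)"
      proof (cases "\<epsilon> ! p")
        case True
        then have de: "desc \<epsilon> p" using False len pd unfolding desc_def by simp
        note s = desc_sw[OF de]
        let ?\<epsilon> = "sw p \<epsilon>"
        have len': "length ?\<epsilon> = d" using s len by simp
        have 1: "f ?\<epsilon> * L p = D ?\<epsilon> p * f ?\<epsilon>" "f ?\<epsilon> * L (Suc p) = D ?\<epsilon> (Suc p) * f ?\<epsilon>"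
          using f_L[OF len'] pd by simp_all
        have 2: "f ?\<epsilon> * (L p - sc c * L (Suc p)) = (D ?\<epsilon> p - sc c * D ?\<epsilon> (Suc p)) * f ?\<epsilon>" for c
          by (simp add: right_diff_distrib left_diff_distrib 1 sc_left' mult.assoc)
        have fs: "f \<epsilon> * \<phi> p = - ((D ?\<epsilon> p - sc (q\<^sup>2) * D ?\<epsilon> (Suc p)) * (D ?\<epsilon> p - sc (inverse q ^ 2) * D ?\<epsilon> (Suc p))) * f ?\<epsilon>"
          unfolding f_desc[OF len de] mult.assoc phi_phi[OF pd] by (simp add: mult.assoc 2 mult_shift[OF 2])
        have Ds: "D ?\<epsilon> p \<in> alg (K ?i)" "D ?\<epsilon> (Suc p) \<in> alg (K ?i)"
          using alg_D[OF len', of p] alg_D[OF len', of "Suc p"] pd s(3) by auto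
        show thesis
          by (rule that[OF _ s(3) fs]) (use len' Ds in \<open>auto simp: \<E>_def intro!: alg_intros\<close>)
      next
        case F: False
        let ?\<epsilon> = "\<epsilon>[p := True, Suc p := False]"
        have T: "\<epsilon> ! Suc p" using False F by simp
        have de: "desc ?\<epsilon> p" using len pd unfolding desc_def by simp
        have sw: "sw p ?\<epsilon> = \<epsilon>"
          unfolding sw_def using len pd F T by (intro nth_equalityI) (auto simp: nth_list_update)
        have "f ?\<epsilon> = f \<epsilon> * \<phi> p" using f_desc[OF _ de] len sw by simp
        moreover have "npos ?\<epsilon> = ?i" using desc_sw(3)[OF de] sw by simp
        ultimately show thesis using that[of ?\<epsilon> 1] len alg_one unfolding \<E>_def by auto
      qed
      let ?h = "z * D \<epsilon> (Suc p)"
      have h: "?h \<in> alg (K ?i)" using alg_D[OF len] pd by (auto intro!: alg_intros)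
      have fL: "f \<epsilon> * L p = D \<epsilon> p * f \<epsilon>" "f \<epsilon> * L (Suc p) = D \<epsilon> (Suc p) * f \<epsilon>"
        using f_L[OF len] pd by simp_all
      have key: "?G * (f \<epsilon> * T (Suc p)) = s * f \<epsilon>2 + ?h * f \<epsilon>"
      proof -
        have "s * f \<epsilon>2 = f \<epsilon> * ((L (Suc p) - L p) * T (Suc p)) - f \<epsilon> * (z * L (Suc p))"
          unfolding s(3)[symmetric] phi_alt'[OF pd] right_diff_distrib ..
        also have "f \<epsilon> * (z * L (Suc p)) = ?h * f \<epsilon>"
          using fL(2) by (simp add: sc_left' mult.assoc)
        also have "f \<epsilon> * ((L (Suc p) - L p) * T (Suc p)) = ?G * (f \<epsilon> * T (Suc p))"
          by (simp add: left_diff_distrib right_diff_distrib mult.assoc[symmetric] fL)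
        finally show ?thesis by simp
      qed
      have expand: "y \<cdot> ?G \<cdot> f \<epsilon> \<cdot> T (Suc p) = y \<cdot> s \<cdot> f \<epsilon>2 + y \<cdot> ?h \<cdot> f \<epsilon>" for y
        by (metis key act_add_right act_mult)
      have in1: "x' \<cdot> s \<in> X (npos \<epsilon>2)" and in2: "x' \<cdot> ?h \<in> X ?i"
        using cl[OF s(4) x'(1)] cl[OF h x'(1)] s(2) by simp_all
      have "glue \<theta> (x \<cdot> f \<epsilon> \<cdot> T t) = glue \<theta> (x' \<cdot> s \<cdot> f \<epsilon>2) + glue \<theta> (x' \<cdot> ?h \<cdot> f \<epsilon>)"
        unfolding Suc x'(2) expand using glue_linear f_maps_into_E[OF s(1) in1] f_maps_into_E[OF \<epsilon> in2]
        unfolding endo_def by blast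
      also have "\<dots> = \<theta> ?i x' \<cdot> s \<cdot> f \<epsilon>2 + \<theta> ?i x' \<cdot> ?h \<cdot> f \<epsilon>"
        unfolding glue_f[OF s(1) in1] glue_f[OF \<epsilon> in2] s(2) en[OF s(4) x'(1)] en[OF h x'(1)] ..
      also have "\<dots> = \<theta> ?i x' \<cdot> ?G \<cdot> f \<epsilon> \<cdot> T (Suc p)" unfolding expand ..
      also have "\<theta> ?i x' \<cdot> ?G = \<theta> ?i x" unfolding x'(2) en[OF G x'(1)] ..
      finally show ?thesis unfolding Suc .
    qed
  qed
qed

lemma glue_endo: "endo E {..<d} (glue \<theta>)"
proof -
  have "glue \<theta> (y \<cdot> T t) = glue \<theta> y \<cdot> T t" if t: "t < d" and y: "y \<in> E" for t y
  proof -
    have E': "invariant E {}" using E unfolding invariant_def by simp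
    have T: "T t \<in> alg {..<d}" using t by (auto intro: alg_intros)
    have "glue \<theta> (y \<cdot> T t) = glue \<theta> (\<Sum>\<epsilon>\<in>\<E>. part y \<epsilon> \<cdot> f \<epsilon> \<cdot> T t)"
      by (subst (1) part(2)[OF y, symmetric]) (simp add: act_sum_left)
    also have "\<dots> = (\<Sum>\<epsilon>\<in>\<E>. glue \<theta> (part y \<epsilon> \<cdot> f \<epsilon> \<cdot> T t))"
      by (rule endo_sum[OF E' glue_linear]) (use invariant_alg[OF E T] f_maps_into_E part(1)[OF y] in blast)
    also have "\<dots> = (\<Sum>\<epsilon>\<in>\<E>. \<theta> (npos \<epsilon>) (part y \<epsilon>) \<cdot> f \<epsilon> \<cdot> T t)"
      by (rule sum.cong) (use glue_T_f t part(1)[OF y] in auto)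
    finally show ?thesis unfolding glue_def act_sum_left .
  qed
  then show ?thesis using glue_linear unfolding endo_def by auto
qed

end

lemma f_replicate: "i \<le> d \<Longrightarrow> f (replicate (d - i) False @ replicate i True) = v i (d - i)"
  by (subst f_base) (auto simp: desc_def nth_append count_list_replicate)

text \<open>An endomorphism preserves every piece, because the polynomials of \<open>separation\<close>
  in the Jucys-Murphy elements distinguish them. Transporting along intertwiners shows that it acts on
  all pieces with \<open>i\<close> plus signs as it does on the image of \<open>v\<close>, and the
  relations of \<open>v\<close> show that this action commutes with the parabolic subalgebra.\<close>
lemma restrict_endo:
  assumes g: "endo E {..<d} g"
  shows "\<exists>\<theta>. (\<forall>i\<le>d. endo (X i) (K i) (\<theta> i)) \<and>
    (\<forall>\<epsilon>\<in>\<E>. \<forall>x\<in>X (npos \<epsilon>). g (x \<cdot> f \<epsilon>) = \<theta> (npos \<epsilon>) x \<cdot> f \<epsilon>)"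
proof -
  note en = endo_alg[OF E g]
  define \<theta>0 where "\<theta>0 \<epsilon> x = part (g (x \<cdot> f \<epsilon>)) \<epsilon>" for \<epsilon> x
  have gE: "g y \<in> E" if "y \<in> E" for y using g that unfolding endo_def by simp
  have gf: "g (x \<cdot> f \<epsilon>) = \<theta>0 \<epsilon> x \<cdot> f \<epsilon>" and \<theta>0X: "\<theta>0 \<epsilon> x \<in> X (npos \<epsilon>)"
    if \<epsilon>: "\<epsilon> \<in> \<E>" and x: "x \<in> X (npos \<epsilon>)" for \<epsilon> x
  proof -
    have xf: "x \<cdot> f \<epsilon> \<in> E" by (rule f_maps_into_E[OF \<epsilon> x])
    have zero: "part (g (x \<cdot> f \<epsilon>)) \<epsilon>' = 0" if \<epsilon>': "\<epsilon>' \<in> \<E>" "\<epsilon>' \<noteq> \<epsilon>" for \<epsilon>'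
    proof -
      obtain p c cs where p: "p < d" "P c cs (D \<epsilon> p) = 0" "cancel (P c cs (D \<epsilon>' p))"
        using separation[of \<epsilon> \<epsilon>'] \<epsilon> \<epsilon>' unfolding \<E>_def by auto
      have fP: "f \<epsilon> * P c cs (L p) = P c cs (D \<epsilon> p) * f \<epsilon>" if "\<epsilon> \<in> \<E>" for \<epsilon>
        using P_intertwine f_L that p(1) unfolding \<E>_def by blast
      have PA: "P c cs (L p) \<in> alg {..<d}" by (intro alg_P alg_L p)
      have "part (g (x \<cdot> f \<epsilon>)) \<epsilon>' \<cdot> P c cs (D \<epsilon>' p) = part (g (x \<cdot> f \<epsilon>) \<cdot> P c cs (L p)) \<epsilon>'"
        by (rule part_alg[symmetric, where g = "\<lambda>\<epsilon>. P c cs (D \<epsilon> p)"])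
           (use gE xf PA fP \<epsilon>' alg_D[OF _ p(1)] in \<open>auto simp: \<E>_def intro!: alg_P\<close>)
      also have "g (x \<cdot> f \<epsilon>) \<cdot> P c cs (L p) = g (x \<cdot> (f \<epsilon> * P c cs (L p)))"
        using en[OF PA xf] by (simp add: act_mult)
      also have "\<dots> = 0" unfolding fP[OF \<epsilon>] p(2) using endo_zero[OF E g] by (simp add: act_zero_right)
      also have "part 0 \<epsilon>' = 0"
        using part_f[OF \<epsilon>' (1) invariant_zero[OF X_invariant[OF \<epsilon>'(1)]] \<epsilon>'(1)] by (simp add: act_zero_left)
      finally show ?thesis using p(3) unfolding cancel_def by blast
    qed
    have "g (x \<cdot> f \<epsilon>) = (\<Sum>\<epsilon>'\<in>\<E>. part (g (x \<cdot> f \<epsilon>)) \<epsilon>' \<cdot> f \<epsilon>')"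
      using part(2)[OF gE[OF xf]] by simp
    also have "\<dots> = part (g (x \<cdot> f \<epsilon>)) \<epsilon> \<cdot> f \<epsilon> + (\<Sum>\<epsilon>'\<in>\<E> - {\<epsilon>}. part (g (x \<cdot> f \<epsilon>)) \<epsilon>' \<cdot> f \<epsilon>')"
      by (rule sum.remove[OF finite_\<E> \<epsilon>])
    also have "\<dots> = \<theta>0 \<epsilon> x \<cdot> f \<epsilon>"
      using zero by (simp add: \<theta>0_def act_zero_left)
    finally show "g (x \<cdot> f \<epsilon>) = \<theta>0 \<epsilon> x \<cdot> f \<epsilon>" .
    show "\<theta>0 \<epsilon> x \<in> X (npos \<epsilon>)" unfolding \<theta>0_def by (rule part(1)[OF gE[OF xf] \<epsilon>])
  qed
  have inj: "y = y'" if "\<epsilon> \<in> \<E>" "y \<in> X (npos \<epsilon>)" "y' \<in> X (npos \<epsilon>)" "y \<cdot> f \<epsilon> = y' \<cdot> f \<epsilon>" for \<epsilon> y y'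
    using f_injective[OF that(1) invariant_diff[OF X_invariant[OF that(1)] that(2,3)]] that(4) by (simp add: act_diff_left)
  define base where "base i = replicate (d - i) False @ replicate i True" for i
  have base: "base i \<in> \<E>" "npos (base i) = i" "f (base i) = v i (d - i)" if "i \<le> d" for i
    using that f_replicate[OF that] unfolding base_def \<E>_def by (auto simp: count_list_replicate)
  have \<theta>0_base: "\<theta>0 \<epsilon> x = \<theta>0 (base (npos \<epsilon>)) x" if "\<epsilon> \<in> \<E>" "x \<in> X (npos \<epsilon>)" for \<epsilon> x
    using that
  proof (induction "inversions \<epsilon>" arbitrary: \<epsilon> rule: less_induct)
    case less
    have len: "length \<epsilon> = d" using less.prems unfolding \<E>_def by simp
    show ?case
    proof (cases "\<exists>p. desc \<epsilon> p")
      case True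
      then obtain p where p: "desc \<epsilon> p" by auto
      note s = desc_sw[OF p]
      have pd: "Suc p < d" using p len unfolding desc_def by simp
      have \<epsilon>': "sw p \<epsilon> \<in> \<E>" using s len unfolding \<E>_def by simp
      have x: "x \<in> X (npos (sw p \<epsilon>))" using less.prems s by simp
      have "\<theta>0 \<epsilon> x \<cdot> f \<epsilon> = g (x \<cdot> f (sw p \<epsilon>) \<cdot> \<phi> p)"
        using gf[OF less.prems] f_desc[OF len p] by (simp add: act_mult)
      also have "\<dots> = \<theta>0 (sw p \<epsilon>) x \<cdot> f (sw p \<epsilon>) \<cdot> \<phi> p"
        using en[OF alg_phi[OF pd] f_maps_into_E[OF \<epsilon>' x]] gf[OF \<epsilon>' x] by simp
      also have "\<dots> = \<theta>0 (sw p \<epsilon>) x \<cdot> f \<epsilon>" using f_desc[OF len p] by (simp add: act_mult)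
      finally have "\<theta>0 \<epsilon> x = \<theta>0 (sw p \<epsilon>) x"
        by (rule inj[rotated -1]) (use less.prems \<theta>0X \<theta>0X[OF \<epsilon>' x] s in auto)
      then show ?thesis using less.hyps[OF s(1) \<epsilon>' x] s by simp
    next
      case False
      then have "\<epsilon> = base (npos \<epsilon>)"
        using sorted_if_no_desc[of \<epsilon>] count_bool[of \<epsilon>] len unfolding base_def by (metis add_diff_cancel_left')
      then show ?thesis by simp
    qed
  qed
  define \<theta> where "\<theta> i = \<theta>0 (base i)" for i
  have gv: "g (x \<cdot> v i (d - i)) = \<theta> i x \<cdot> v i (d - i)" and \<theta>X: "\<theta> i x \<in> X i" if "i \<le> d" "x \<in> X i" for i x
    using gf[of "base i" x] \<theta>0X[of "base i" x] base that unfolding \<theta>_def by auto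
  have injv: "y = y'" if "i \<le> d" "y \<in> X i" "y' \<in> X i" "y \<cdot> v i (d - i) = y' \<cdot> v i (d - i)" for i y y'
    using inj[of "base i" y y'] base that by simp
  have "endo (X i) (K i) (\<theta> i)" if i: "i \<le> d" for i
    unfolding endo_def
  proof (intro conjI ballI allI)
    let ?v = "v i (d - i)"
    fix x assume x: "x \<in> X i"
    have xE: "y \<cdot> ?v \<in> E" if "y \<in> X i" for y
      using invariant_alg[OF E alg_v] X_E[OF i] that i by (simp add: subset_iff)
    show "\<theta> i x \<in> X i" by (rule \<theta>X[OF i x])
    show "\<theta> i (x + y) = \<theta> i x + \<theta> i y" if y: "y \<in> X i" for y
    proof (rule injv[OF i])
      have "\<theta> i (x + y) \<cdot> ?v = g (x \<cdot> ?v + y \<cdot> ?v)"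
        using gv[OF i invariant_add[OF X[OF i] x y]] by (simp add: act_add_left)
      also have "\<dots> = g (x \<cdot> ?v) + g (y \<cdot> ?v)" using g xE x y unfolding endo_def by blast
      finally show "\<theta> i (x + y) \<cdot> ?v = (\<theta> i x + \<theta> i y) \<cdot> ?v"
        using gv[OF i] x y by (simp add: act_add_left)
    qed (use \<theta>X[OF i] x y invariant_add[OF X[OF i]] in auto)
    have move: "\<theta> i (x \<cdot> r) = \<theta> i x \<cdot> r" if r: "r \<in> alg (K i)" "r * ?v = ?v * s" "s \<in> alg {..<d}" for r s
    proof (rule injv[OF i])
      have "\<theta> i (x \<cdot> r) \<cdot> ?v = g (x \<cdot> ?v \<cdot> s)"
        using gv[OF i invariant_alg[OF X[OF i] r(1) x]] r(2) by (metis act_mult)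
      also have "\<dots> = \<theta> i x \<cdot> ?v \<cdot> s" using en[OF r(3) xE[OF x]] gv[OF i x] by simp
      finally show "\<theta> i (x \<cdot> r) \<cdot> ?v = \<theta> i x \<cdot> r \<cdot> ?v" using r(2) by (metis act_mult)
    qed (use \<theta>X[OF i] x invariant_alg[OF X[OF i] r(1)] in auto)
    show "\<theta> i (x \<cdot> sc c) = \<theta> i x \<cdot> sc c" for c
      by (rule move[of _ "sc c"]) (auto intro: alg_intros simp: sc_central)
    show "\<theta> i (x \<cdot> T k) = \<theta> i x \<cdot> T k" if k: "k \<in> K i" for k
    proof (cases "k < i")
      case True
      then show ?thesis
        using T_v_left[of k i "d - i"] k i by (intro move[of _ "T (k + (d - i))"] alg.gen) (auto simp: K_def)
    next
      case False
      then show ?thesis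
        using T_v_right[of i "d - i" "k - i"] k i by (intro move[of _ "T (k - i)"] alg.gen) (auto simp: K_def)
    qed
  qed
  moreover have "g (x \<cdot> f \<epsilon>) = \<theta> (npos \<epsilon>) x \<cdot> f \<epsilon>" if "\<epsilon> \<in> \<E>" "x \<in> X (npos \<epsilon>)" for \<epsilon> x
    using gf[OF that] \<theta>0_base[OF that] unfolding \<theta>_def by simp
  ultimately show ?thesis by blast
qed

end

section \<open>Operators on free vector spaces\<close>

lemma lookup_scale: "Poly_Mapping.lookup (scale c x) p = c * Poly_Mapping.lookup x p"
  unfolding scale_def by (simp add: Poly_Mapping.map.rep_eq when_def)

interpretation pm: vector_space "scale :: 'k::field \<Rightarrow> ('x \<Rightarrow>\<^sub>0 'k) \<Rightarrow> ('x \<Rightarrow>\<^sub>0 'k)"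
  by unfold_locales (auto intro!: poly_mapping_eqI simp: lookup_scale lookup_add algebra_simps)

lemma scale_single: "scale c (Poly_Mapping.single p a) = Poly_Mapping.single p (c * a)"
  by (auto intro!: poly_mapping_eqI simp: lookup_scale lookup_single when_def)

lemma keys_scale: "Poly_Mapping.keys (scale c x) \<subseteq> Poly_Mapping.keys x"
  by (auto simp: in_keys_iff lookup_scale)

abbreviation e :: "'x \<Rightarrow> ('x \<Rightarrow>\<^sub>0 'k::field)" where
  "e p \<equiv> Poly_Mapping.single p 1"

lemma lin_ext_superset:
  "\<lbrakk>finite A; Poly_Mapping.keys x \<subseteq> A\<rbrakk> \<Longrightarrow> lin_ext f x = (\<Sum>p\<in>A. scale (Poly_Mapping.lookup x p) (f p))"
  unfolding lin_ext_def by (rule sum.mono_neutral_left) (auto simp: in_keys_iff)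

lemma lin_ext_add: "lin_ext f (x + y) = lin_ext f x + lin_ext f y"
proof -
  let ?A = "Poly_Mapping.keys x \<union> Poly_Mapping.keys y"
  have "Poly_Mapping.keys (x + y) \<subseteq> ?A" by (rule keys_add)
  then show ?thesis
    by (simp add: lin_ext_superset[of ?A] lookup_add pm.scale_left_distrib sum.distrib)
qed

lemma lin_ext_scale: "lin_ext f (scale c x) = scale c (lin_ext f x)"
  using keys_scale[of c x]
  by (simp add: lin_ext_superset[of "Poly_Mapping.keys x"] lookup_scale pm.scale_sum_right)

lemma lin_ext_single: "lin_ext f (Poly_Mapping.single p c) = scale c (f p)"
  by (simp add: lin_ext_superset[of "{p}"])

lemma lin_ext_zero: "lin_ext f 0 = 0"
  by (simp add: lin_ext_def)

lemma lin_ext_e: "lin_ext f (e p) = f p"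
  by (simp add: lin_ext_single)

lemma lin_ext_id: "lin_ext e x = x"
  by (rule poly_mapping_eqI) (auto simp: lin_ext_def lookup_sum lookup_scale lookup_single when_def in_keys_iff
      if_distrib[of "\<lambda>a. _ * a"] cong: if_cong)

lemma poly_sum: "x = (\<Sum>p\<in>Poly_Mapping.keys x. scale (Poly_Mapping.lookup x p) (e p))"
  using lin_ext_id[of x] by (simp add: lin_ext_def)

text \<open>Linear operators acting from the right form a ring whose product \<open>r * s\<close>
  applies \<open>r\<close> first, so a right module structure is a homomorphism into this ring.\<close>
typedef (overloaded) ('x, 'k) lop =
  "{f :: ('x \<Rightarrow>\<^sub>0 'k::field) \<Rightarrow> ('x \<Rightarrow>\<^sub>0 'k). (\<forall>x y. f (x + y) = f x + f y) \<and> (\<forall>c x. f (scale c x) = scale c (f x))}"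
  by (rule exI[of _ id]) simp

setup_lifting type_definition_lop

definition app :: "('x \<Rightarrow>\<^sub>0 'k) \<Rightarrow> ('x, 'k::field) lop \<Rightarrow> ('x \<Rightarrow>\<^sub>0 'k)" (infixl "\<triangleleft>" 70) where
  "x \<triangleleft> r = Rep_lop r x"

lemma app_add: "(x + y) \<triangleleft> r = x \<triangleleft> r + y \<triangleleft> r"
  unfolding app_def using Rep_lop[of r] by simp

lemma app_scale: "scale c x \<triangleleft> r = scale c (x \<triangleleft> r)"
  unfolding app_def using Rep_lop[of r] by simp

lemma app_diff: "(x - y) \<triangleleft> r = x \<triangleleft> r - y \<triangleleft> r"
  using app_add[of "x - y" y r] by (simp add: algebra_simps)

lemma app_zero: "0 \<triangleleft> r = 0"
  using app_scale[of 0 0 r] by simp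

lemma app_sum: "(\<Sum>i\<in>I. g i) \<triangleleft> r = (\<Sum>i\<in>I. g i \<triangleleft> r)"
  by (induction I rule: infinite_finite_induct) (auto simp: app_zero app_add)

lemma app_eq_lin_ext: "x \<triangleleft> r = lin_ext (\<lambda>p. e p \<triangleleft> r) x"
  by (subst (1) poly_sum[of x]) (simp add: app_sum app_scale lin_ext_def)

lemma lop_eqI:
  assumes "\<And>p. e p \<triangleleft> r = e p \<triangleleft> s" shows "r = s"
proof -
  have "x \<triangleleft> r = x \<triangleleft> s" for x unfolding app_eq_lin_ext[of x] assms ..
  then show ?thesis unfolding app_def by (simp add: Rep_lop_inject[symmetric] ext)
qed

lift_definition lop_of :: "('x \<Rightarrow> ('x \<Rightarrow>\<^sub>0 'k::field)) \<Rightarrow> ('x, 'k) lop" is lin_ext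
  by (simp add: lin_ext_add lin_ext_scale)

lemma app_lop_of: "x \<triangleleft> lop_of f = lin_ext f x"
  unfolding app_def by (simp add: lop_of.rep_eq)

instantiation lop :: (type, field) ring_1
begin

lift_definition zero_lop :: "('a, 'b) lop" is "\<lambda>_. 0" by simp
lift_definition one_lop :: "('a, 'b) lop" is "\<lambda>x. x" by simp
lift_definition plus_lop :: "('a, 'b) lop \<Rightarrow> ('a, 'b) lop \<Rightarrow> ('a, 'b) lop" is "\<lambda>f g x. f x + g x"
  by (simp add: pm.scale_right_distrib)
lift_definition minus_lop :: "('a, 'b) lop \<Rightarrow> ('a, 'b) lop \<Rightarrow> ('a, 'b) lop" is "\<lambda>f g x. f x - g x"
  by (simp add: pm.scale_right_diff_distrib)
lift_definition uminus_lop :: "('a, 'b) lop \<Rightarrow> ('a, 'b) lop" is "\<lambda>f x. - f x"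
  by (simp add: pm.scale_minus_right)
lift_definition times_lop :: "('a, 'b) lop \<Rightarrow> ('a, 'b) lop \<Rightarrow> ('a, 'b) lop" is "\<lambda>f g x. g (f x)"
  by simp

instance
proof
  show "(0 :: ('a, 'b) lop) \<noteq> 1"
  proof
    assume "(0 :: ('a, 'b) lop) = 1"
    then have "\<And>x :: 'a \<Rightarrow>\<^sub>0 'b. 0 = x" by transfer meson
    from this[of "e undefined"] show False by (metis lookup_single_eq lookup_zero zero_neq_one)
  qed
qed (transfer, simp add: algebra_simps)+

end

lift_definition sc :: "'k::field \<Rightarrow> ('x, 'k) lop" is scale
  by (simp add: pm.scale_right_distrib mult.commute)

lemma app_mult: "x \<triangleleft> (r * s) = x \<triangleleft> r \<triangleleft> s"
  unfolding app_def by (simp add: times_lop.rep_eq)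

lemma app_plus: "x \<triangleleft> (r + s) = x \<triangleleft> r + x \<triangleleft> s"
  unfolding app_def by (simp add: plus_lop.rep_eq)

lemma app_minus: "x \<triangleleft> (r - s) = x \<triangleleft> r - x \<triangleleft> s"
  unfolding app_def by (simp add: minus_lop.rep_eq)

lemma app_one: "x \<triangleleft> 1 = x"
  unfolding app_def by (simp add: one_lop.rep_eq)

lemma app_sc: "x \<triangleleft> sc c = scale c x"
  unfolding app_def by (simp add: sc.rep_eq)

section \<open>The Hecke operators on words\<close>

text \<open>On words whose length is not \<open>d\<close> the operator is a root of its quadratic
  relation, so that the Hecke relations hold on the whole free space on words and no invariant subspace
  has to be carried along.\<close>
definition TB :: "nat \<Rightarrow> 'k::field \<Rightarrow> 'k \<Rightarrow> nat \<Rightarrow> int list \<Rightarrow> (int list \<Rightarrow>\<^sub>0 'k)" where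
  "TB d Q q t \<mu> = (if length \<mu> = d then T_basis Q q t \<mu> else scale (inverse (if t = 0 then Q else q)) (e \<mu>))"

definition opT :: "nat \<Rightarrow> 'k::field \<Rightarrow> 'k \<Rightarrow> nat \<Rightarrow> (int list, 'k) lop" where
  "opT d Q q t = lop_of (TB d Q q t)"

text \<open>The defining cases of the action, for words split at the letters that are exchanged. The
  relations below are verified on basis vectors by going through the relative order of the letters
  involved.\<close>
lemma T_e0:
  assumes "length \<mu> = d" "\<mu> = a # r"
  shows "e \<mu> \<triangleleft> opT d Q q 0 = (if a > 0 then e (- a # r) else if a = 0 then scale (inverse Q) (e \<mu>)
    else e (- a # r) + scale (inverse Q - Q) (e \<mu>))"
  using assms unfolding opT_def app_lop_of lin_ext_e TB_def T_basis_def word_swap_def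
  by (auto simp: scale_single)

lemma T_e:
  assumes "length \<mu> = d" "\<mu> = u @ a # b # r" "length u = p"
  shows "e \<mu> \<triangleleft> opT d Q q (Suc p) = (if a < b then e (u @ b # a # r) else if a = b then scale (inverse q) (e \<mu>)
    else e (u @ b # a # r) + scale (inverse q - q) (e \<mu>))"
  using assms unfolding opT_def app_lop_of lin_ext_e TB_def T_basis_def word_swap_def
  by (auto simp: scale_single nth_append list_update_append)

lemma T_e_invalid:
  "length \<mu> \<noteq> d \<Longrightarrow> e \<mu> \<triangleleft> opT d Q q t = scale (inverse (if t = 0 then Q else q)) (e \<mu>)"
  unfolding opT_def app_lop_of lin_ext_e TB_def by simp

lemma split1: assumes "p < length \<mu>" obtains u a r where "\<mu> = u @ a # r" "length u = p"
  using that[of "take p \<mu>" "\<mu> ! p" "drop (Suc p) \<mu>"] assms id_take_nth_drop by fastforce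

lemma split2: assumes "Suc p < length \<mu>" obtains u a b r where "\<mu> = u @ a # b # r" "length u = p"
proof -
  obtain u a r where 1: "\<mu> = u @ a # r" "length u = p" using split1[of p \<mu>] assms by auto
  then obtain b r' where "r = b # r'" using assms by (cases r) auto
  then show thesis using that 1 by blast
qed

lemma split3: assumes "Suc (Suc p) < length \<mu>" obtains u a b c r where "\<mu> = u @ a # b # c # r" "length u = p"
proof -
  obtain u a b r where 1: "\<mu> = u @ a # b # r" "length u = p" by (rule split2[of p \<mu>]) (use assms in auto)
  then obtain c r' where "r = c # r'" using assms by (cases r) auto
  then show thesis using that 1 by blast
qed

lemma field_cancel: "(q::'k::field) \<noteq> 0 \<Longrightarrow> q * (inverse q * r) = r" "q \<noteq> 0 \<Longrightarrow> inverse q * (q * r) = r"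
  "q \<noteq> 0 \<Longrightarrow> q * (r * inverse q) = r" "q \<noteq> 0 \<Longrightarrow> q * (r * (s * inverse q)) = r * s"
  by (simp_all add: mult.assoc[symmetric])

lemma opT_quadratic:
  assumes "q \<noteq> 0" "1 \<le> t" "t < d"
  shows "opT d Q q t * opT d Q q t = sc (inverse q - q) * opT d Q q t + 1"
proof (rule lop_eqI)
  fix \<mu>
  obtain p where t: "t = Suc p" using assms by (cases t) auto
  show "e \<mu> \<triangleleft> (opT d Q q t * opT d Q q t) = e \<mu> \<triangleleft> (sc (inverse q - q) * opT d Q q t + 1)"
  proof (cases "length \<mu> = d")
    case True
    obtain u a b r where \<mu>: "\<mu> = u @ a # b # r" "length u = p" by (rule split2[of p \<mu>]) (use True assms t in auto)
    have l: "length (u @ x # y # r) = d" for x y using True \<mu> by simp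
    note R = T_e[OF l refl \<mu>(2)]
    show ?thesis unfolding t \<mu>(1)
      by (cases a b rule: linorder_cases)
         (simp_all add: app_mult app_plus app_minus app_one app_sc R app_add app_diff app_scale pm.scale_right_distrib
           pm.scale_left_diff_distrib pm.scale_right_diff_distrib assms algebra_simps field_cancel)
  next
    case False
    then show ?thesis using t assms
      by (simp add: app_mult app_plus app_one app_sc T_e_invalid app_scale app_diff
        pm.scale_left_diff_distrib pm.scale_right_diff_distrib algebra_simps field_cancel)
  qed
qed

lemma opT_quadratic_0:
  assumes "Q \<noteq> 0" "0 < d"
  shows "opT d Q q 0 * opT d Q q 0 = sc (inverse Q - Q) * opT d Q q 0 + 1"
proof (rule lop_eqI)
  fix \<mu>
  show "e \<mu> \<triangleleft> (opT d Q q 0 * opT d Q q 0) = e \<mu> \<triangleleft> (sc (inverse Q - Q) * opT d Q q 0 + 1)"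
  proof (cases "length \<mu> = d")
    case True
    then obtain a r where \<mu>: "\<mu> = a # r" using assms by (cases \<mu>) auto
    have l: "length (x # r) = d" for x using True \<mu> by simp
    note R = T_e0[OF l refl]
    show ?thesis unfolding \<mu>
      by (cases a "0::int" rule: linorder_cases)
         (simp_all add: app_mult app_plus app_minus app_one app_sc R app_add app_diff app_scale pm.scale_right_distrib
           pm.scale_left_diff_distrib pm.scale_right_diff_distrib assms algebra_simps field_cancel)
  next
    case False
    then show ?thesis using assms
      by (simp add: app_mult app_plus app_one app_sc T_e_invalid app_scale app_diff
        pm.scale_left_diff_distrib pm.scale_right_diff_distrib algebra_simps field_cancel)
  qed
qed

lemma opT_braid:
  assumes "q \<noteq> 0" "1 \<le> t" "Suc t < d"
  shows "opT d Q q t * opT d Q q (Suc t) * opT d Q q t = opT d Q q (Suc t) * opT d Q q t * opT d Q q (Suc t)"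
proof (rule lop_eqI)
  fix \<mu>
  obtain p where t: "t = Suc p" using assms by (cases t) auto
  show "e \<mu> \<triangleleft> (opT d Q q t * opT d Q q (Suc t) * opT d Q q t) = e \<mu> \<triangleleft> (opT d Q q (Suc t) * opT d Q q t * opT d Q q (Suc t))"
  proof (cases "length \<mu> = d")
    case True
    obtain u a b c r where \<mu>: "\<mu> = u @ a # b # c # r" "length u = p" by (rule split3[of p \<mu>]) (use True assms t in auto)
    have l: "length (u @ x # y # z # r) = d" for x y z using True \<mu> by simp
    have R1: "e (u @ x # y # z # r) \<triangleleft> opT d Q q (Suc p) = (if x < y then e (u @ y # x # z # r)
       else if x = y then scale (inverse q) (e (u @ x # y # z # r))
       else e (u @ y # x # z # r) + scale (inverse q - q) (e (u @ x # y # z # r)))" for x y z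
      by (rule T_e[OF l refl \<mu>(2)])
    have R2: "e (u @ x # y # z # r) \<triangleleft> opT d Q q (Suc (Suc p)) = (if y < z then e (u @ x # z # y # r)
       else if y = z then scale (inverse q) (e (u @ x # y # z # r))
       else e (u @ x # z # y # r) + scale (inverse q - q) (e (u @ x # y # z # r)))" for x y z
      using T_e[OF l, of x y z "u @ [x]" y z r "Suc p" Q q] \<mu>(2) by simp
    show ?thesis unfolding t \<mu>(1)
      by (cases a b rule: linorder_cases; cases b c rule: linorder_cases; cases a c rule: linorder_cases)
         (simp_all add: app_mult R1 R2 app_add app_diff app_scale pm.scale_right_distrib
           pm.scale_left_diff_distrib pm.scale_right_diff_distrib assms algebra_simps field_cancel)
  next
    case False
    then show ?thesis using t by (simp add: app_mult T_e_invalid app_scale)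
  qed
qed

lemma opT_far:
  assumes "t < d" "Suc s < t"
  shows "opT d Q q s * opT d Q q t = opT d Q q t * opT d Q q s"
proof (rule lop_eqI)
  fix \<mu>
  obtain p where t: "t = Suc p" using assms by (cases t) auto
  show "e \<mu> \<triangleleft> (opT d Q q s * opT d Q q t) = e \<mu> \<triangleleft> (opT d Q q t * opT d Q q s)"
  proof (cases "length \<mu> = d")
    case True
    obtain u x y r where \<mu>: "\<mu> = u @ x # y # r" "length u = p" by (rule split2[of p \<mu>]) (use True assms t in auto)
    show ?thesis
    proof (cases s)
      case 0
      then obtain a u' where u: "u = a # u'" using \<mu> assms t by (cases u) auto
      have l: "length (a # u' @ x # y # r) = d" for a x y using True \<mu> u by simp
      have R1: "e (a # u' @ x # y # r) \<triangleleft> opT d Q q (Suc p) = (if x < y then e (a # u' @ y # x # r)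
         else if x = y then scale (inverse q) (e (a # u' @ x # y # r))
         else e (a # u' @ y # x # r) + scale (inverse q - q) (e (a # u' @ x # y # r)))" for a x y
        using T_e[OF l, of a x y "a # u'" x y r p Q q] \<mu>(2) u by simp
      note R2 = T_e0[OF l refl]
      show ?thesis unfolding t 0 \<mu>(1) u append_Cons
        by (cases a "0::int" rule: linorder_cases; cases x y rule: linorder_cases)
           (simp_all add: app_mult R1 R2 app_add app_diff app_scale algebra_simps pm.scale_right_distrib pm.scale_right_diff_distrib
             pm.scale_left_diff_distrib)
    next
      case (Suc p')
      obtain u' a b r' where u: "u = u' @ a # b # r'" "length u' = p'" by (rule split2[of p' u]) (use \<mu> Suc assms t in auto)
      have l: "length (u' @ a # b # r' @ x # y # r) = d" for a b x y using True \<mu> u by simp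
      have R1: "e (u' @ a # b # r' @ x # y # r) \<triangleleft> opT d Q q (Suc p) = (if x < y then e (u' @ a # b # r' @ y # x # r)
         else if x = y then scale (inverse q) (e (u' @ a # b # r' @ x # y # r))
         else e (u' @ a # b # r' @ y # x # r) + scale (inverse q - q) (e (u' @ a # b # r' @ x # y # r)))" for a b x y
        using T_e[OF l, of a b x y "u' @ a # b # r'" x y r p Q q] \<mu>(2) u by simp
      note R2 = T_e[OF l refl u(2)]
      show ?thesis unfolding t Suc \<mu>(1) u append_Cons append_assoc
        by (cases a b rule: linorder_cases; cases x y rule: linorder_cases)
           (simp_all add: app_mult R1 R2 app_add app_diff app_scale algebra_simps pm.scale_right_distrib pm.scale_right_diff_distrib
             pm.scale_left_diff_distrib)
    qed
  next
    case False
    then show ?thesis using t by (simp add: app_mult T_e_invalid app_scale mult.commute)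
  qed
qed

lemma opT_braid_B:
  assumes "q \<noteq> 0" "Q \<noteq> 0" "1 < d"
  shows "opT d Q q 0 * opT d Q q 1 * opT d Q q 0 * opT d Q q 1 = opT d Q q 1 * opT d Q q 0 * opT d Q q 1 * opT d Q q 0"
proof (rule lop_eqI)
  fix \<mu>
  show "e \<mu> \<triangleleft> (opT d Q q 0 * opT d Q q 1 * opT d Q q 0 * opT d Q q 1)
      = e \<mu> \<triangleleft> (opT d Q q 1 * opT d Q q 0 * opT d Q q 1 * opT d Q q 0)"
  proof (cases "length \<mu> = d")
    case True
    obtain a b r where \<mu>: "\<mu> = a # b # r" by (rule split2[of 0 \<mu>]) (use True assms in auto)
    have l: "length (x # y # r) = d" for x y using True \<mu> by simp
    have R1: "e (x # y # r) \<triangleleft> opT d Q q (Suc 0) = (if x < y then e (y # x # r)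
       else if x = y then scale (inverse q) (e (x # y # r))
       else e (y # x # r) + scale (inverse q - q) (e (x # y # r)))" for x y
      using T_e[OF l, of x y "[]" x y r 0 Q q] by simp
    note R2 = T_e0[OF l refl]
    show ?thesis unfolding \<mu> One_nat_def
      by (cases a "0::int" rule: linorder_cases; cases b "0::int" rule: linorder_cases;
          cases a b rule: linorder_cases; cases a "- b" rule: linorder_cases)
         (simp_all add: app_mult R1 R2 app_add app_diff app_scale pm.scale_right_distrib
           pm.scale_left_diff_distrib pm.scale_right_diff_distrib assms algebra_simps field_cancel)
  next
    case False
    then show ?thesis by (simp add: app_mult T_e_invalid app_scale mult.commute mult.left_commute)
  qed
qed

section \<open>Finite-dimensional arguments\<close>

definition vecs :: "'x set \<Rightarrow> ('x \<Rightarrow>\<^sub>0 'k::field) set" where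
  "vecs A = {x. Poly_Mapping.keys x \<subseteq> A}"

lemma vecs_zero: "0 \<in> vecs A" unfolding vecs_def by simp
lemma vecs_add: "\<lbrakk>x \<in> vecs A; y \<in> vecs A\<rbrakk> \<Longrightarrow> x + y \<in> vecs A"
  unfolding vecs_def using keys_add[of x y] by blast
lemma vecs_scale: "x \<in> vecs A \<Longrightarrow> scale c x \<in> vecs A"
  unfolding vecs_def using keys_scale[of c x] by blast
lemma vecs_e: "p \<in> A \<Longrightarrow> e p \<in> vecs A" unfolding vecs_def by simp
lemma vecs_sum: "(\<And>i. i \<in> I \<Longrightarrow> g i \<in> vecs A) \<Longrightarrow> sum g I \<in> vecs A"
  by (induction I rule: infinite_finite_induct) (auto simp: vecs_zero vecs_add)
lemma vecs_mono: "A \<subseteq> B \<Longrightarrow> vecs A \<subseteq> vecs B" unfolding vecs_def by auto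
lemma vecs_eq_zero: "\<lbrakk>x \<in> vecs A; \<And>p. p \<in> A \<Longrightarrow> Poly_Mapping.lookup x p = 0\<rbrakk> \<Longrightarrow> x = 0"
  unfolding vecs_def by (intro poly_mapping_eqI) (auto simp: in_keys_iff)
lemma vecs_lin_ext: "\<lbrakk>x \<in> vecs A; \<And>p. p \<in> A \<Longrightarrow> f p \<in> vecs B\<rbrakk> \<Longrightarrow> lin_ext f x \<in> vecs B"
  unfolding lin_ext_def by (rule vecs_sum, rule vecs_scale) (auto simp: vecs_def)
lemma vecs_app: "\<lbrakk>x \<in> vecs A; \<And>p. p \<in> A \<Longrightarrow> e p \<triangleleft> r \<in> vecs B\<rbrakk> \<Longrightarrow> x \<triangleleft> r \<in> vecs B"
  by (subst app_eq_lin_ext) (rule vecs_lin_ext)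

text \<open>Dimension count: otherwise the images of the basis vectors of \<open>A\<close> together with
  \<open>y\<close> would be more than \<open>card B\<close> independent vectors in the span of
  \<open>B\<close>.\<close>
lemma inj_imp_surj:
  fixes r :: "('x, 'k::field) lop" and A B :: "'x set"
  assumes fin: "finite A" "finite B" and card: "card B \<le> card A"
    and into: "\<And>p. p \<in> A \<Longrightarrow> e p \<triangleleft> r \<in> vecs B"
    and inj: "\<And>x. \<lbrakk>x \<in> vecs A; x \<triangleleft> r = 0\<rbrakk> \<Longrightarrow> x = 0"
    and y: "y \<in> vecs B"
  shows "\<exists>x\<in>vecs A. y = x \<triangleleft> r"
proof (rule ccontr)
  assume n: "\<not> (\<exists>x\<in>vecs A. y = x \<triangleleft> r)"
  let ?b = "\<lambda>p. e p \<triangleleft> r"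
  have comb: "(\<Sum>p\<in>A. scale (c p) (?b p)) = (\<Sum>p\<in>A. scale (c p) (e p)) \<triangleleft> r" for c
    by (simp add: app_sum app_scale)
  have in_A: "(\<Sum>p\<in>A. scale (c p) (e p)) \<in> vecs A" for c
    by (rule vecs_sum, rule vecs_scale, rule vecs_e)
  have lk: "Poly_Mapping.lookup (\<Sum>p\<in>A. scale (c p) (e p)) p = c p" if "p \<in> A" for c p
    using that fin(1) by (simp add: lookup_sum lookup_scale lookup_single when_def if_distrib cong: if_cong)
  have zero: "\<forall>p\<in>A. c p = 0" if "(\<Sum>p\<in>A. scale (c p) (?b p)) = 0" for c
  proof -
    have "(\<Sum>p\<in>A. scale (c p) (e p)) = 0" by (rule inj[OF in_A]) (use that comb in simp)
    then show ?thesis using lk[of _ c] by (metis lookup_zero)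
  qed
  have inj_b: "inj_on ?b A"
  proof (rule inj_onI)
    fix p p' assume p: "p \<in> A" "p' \<in> A" "?b p = ?b p'"
    have "e p + scale (- 1) (e p') \<in> vecs A" by (intro vecs_add vecs_scale vecs_e p)
    moreover have "(e p + scale (- 1) (e p')) \<triangleleft> r = 0"
      using p(3) by (simp add: app_diff app_add app_scale pm.scale_minus_left)
    ultimately have "e p + scale (- 1) (e p') = (0 :: 'x \<Rightarrow>\<^sub>0 'k)" by (rule inj)
    then have "Poly_Mapping.lookup (e p + scale (- 1) (e p') :: 'x \<Rightarrow>\<^sub>0 'k) p = 0" by simp
    then show "p = p'" unfolding lookup_add lookup_scale lookup_single by (auto simp: when_def split: if_splits)
  qed
  have ind: "pm.independent (?b ` A)"
    unfolding pm.independent_explicit_finite_subsets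
  proof (intro allI impI ballI)
    fix S u v assume S: "S \<subseteq> ?b ` A" "finite S" "(\<Sum>v\<in>S. scale (u v) v) = 0" "v \<in> S"
    let ?c = "\<lambda>p. if ?b p \<in> S then u (?b p) else 0"
    have "(\<Sum>p\<in>A. scale (?c p) (?b p)) = (\<Sum>v\<in>?b ` A. scale (if v \<in> S then u v else 0) v)"
      by (subst sum.reindex[OF inj_b]) simp
    also have "\<dots> = (\<Sum>v\<in>S. scale (u v) v)"
      using S(1) fin by (intro sum.mono_neutral_cong_right) (auto simp: pm.scale_zero_left)
    finally have "\<forall>p\<in>A. ?c p = 0" using zero[of ?c] S(3) by simp
    moreover obtain p where "p \<in> A" "v = ?b p" using S(1,4) by blast
    ultimately show "u v = 0" using S(4) by force
  qed
  have span_b: "pm.span (?b ` A) \<subseteq> {x \<triangleleft> r | x. x \<in> vecs A}"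
  proof (rule pm.span_minimal)
    show "pm.subspace {x \<triangleleft> r | x. x \<in> vecs A}"
      unfolding pm.subspace_def
    proof (intro conjI ballI allI)
      show "0 \<in> {x \<triangleleft> r | x. x \<in> vecs A}" using vecs_zero[of A] app_zero[of r] by (metis (mono_tags, lifting) mem_Collect_eq)
      fix y z assume y: "y \<in> {x \<triangleleft> r | x. x \<in> vecs A}"
      then show "scale c y \<in> {x \<triangleleft> r | x. x \<in> vecs A}" for c
        by (auto simp: app_scale[symmetric] intro: vecs_scale)
      assume "z \<in> {x \<triangleleft> r | x. x \<in> vecs A}"
      with y show "y + z \<in> {x \<triangleleft> r | x. x \<in> vecs A}" by (auto simp: app_add[symmetric] intro: vecs_add)
    qed
  qed (auto intro: vecs_e)
  then have "y \<notin> pm.span (?b ` A)" using n by blast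
  then have ind': "pm.independent (insert y (?b ` A))" using ind by (simp add: pm.independent_insert)
  have span_B: "vecs B \<subseteq> pm.span ((e :: 'x \<Rightarrow> 'x \<Rightarrow>\<^sub>0 'k) ` B)"
  proof
    fix x :: "'x \<Rightarrow>\<^sub>0 'k" assume x: "x \<in> vecs B"
    have "(\<Sum>p\<in>Poly_Mapping.keys x. scale (Poly_Mapping.lookup x p) (e p)) \<in> pm.span (e ` B)"
      by (rule pm.span_sum, rule pm.span_scale, rule pm.span_base) (use x in \<open>auto simp: vecs_def\<close>)
    then show "x \<in> pm.span (e ` B)" using poly_sum[of x] by simp
  qed
  have "insert y (?b ` A) \<subseteq> pm.span (e ` B)" using y into span_B by auto
  moreover have "finite ((e :: 'x \<Rightarrow> 'x \<Rightarrow>\<^sub>0 'k) ` B)" using fin by simp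
  ultimately have "card (insert y (?b ` A)) \<le> card ((e :: 'x \<Rightarrow> 'x \<Rightarrow>\<^sub>0 'k) ` B)"
    using pm.independent_span_bound[OF _ ind'] by blast
  also have "\<dots> \<le> card A" using card_image_le[OF fin(2), of "e :: 'x \<Rightarrow> 'x \<Rightarrow>\<^sub>0 'k"] card by simp
  finally have "card (insert y (?b ` A)) \<le> card (?b ` A)" using card_image[OF inj_b] by simp
  moreover have "y \<notin> ?b ` A"
  proof
    assume "y \<in> ?b ` A"
    then obtain p where "p \<in> A" "y = e p \<triangleleft> r" by (elim imageE)
    then show False using n vecs_e[of p A] by blast
  qed
  then have "card (insert y (?b ` A)) = Suc (card (?b ` A))" by (rule card_insert_disjoint[OF finite_imageI[OF fin(1)]])
  ultimately show False by simp
qed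

text \<open>A right inverse on the span of \<open>B\<close> is injective, hence surjective onto the span
  of \<open>A\<close>.\<close>
lemma surj_imp_inj:
  fixes r :: "('x, 'k::field) lop"
  assumes fin: "finite A" "finite B" and card: "card A \<le> card B"
    and surj: "\<And>p. p \<in> B \<Longrightarrow> \<exists>x\<in>vecs A. x \<triangleleft> r = e p"
    and x: "x \<in> vecs A" "x \<triangleleft> r = 0"
  shows "x = 0"
proof -
  obtain g where g: "\<And>p. p \<in> B \<Longrightarrow> g p \<in> vecs A \<and> g p \<triangleleft> r = e p" using surj by metis
  have inv: "lin_ext g y \<triangleleft> r = y" if "y \<in> vecs B" for y
  proof -
    have "lin_ext g y \<triangleleft> r = (\<Sum>p\<in>Poly_Mapping.keys y. scale (Poly_Mapping.lookup y p) (g p \<triangleleft> r))"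
      by (simp add: lin_ext_def app_sum app_scale)
    also have "\<dots> = (\<Sum>p\<in>Poly_Mapping.keys y. scale (Poly_Mapping.lookup y p) (e p))"
      by (rule sum.cong) (use g that in \<open>auto simp: vecs_def\<close>)
    finally show ?thesis using poly_sum[of y] by simp
  qed
  have "\<exists>y\<in>vecs B. x = y \<triangleleft> lop_of g"
  proof (rule inj_imp_surj[OF fin(2,1) card])
    show "y = 0" if "y \<in> vecs B" "y \<triangleleft> lop_of g = 0" for y
      using inv[OF that(1)] that(2) by (simp add: app_lop_of app_zero)
  qed (use g x in \<open>auto simp: app_lop_of lin_ext_e\<close>)
  then obtain y where y: "y \<in> vecs B" "x = y \<triangleleft> lop_of g" by blast
  then show ?thesis using inv[OF y(1)] x(2) by (simp add: app_lop_of lin_ext_zero)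
qed

section \<open>Tensor space\<close>

definition words :: "nat \<Rightarrow> int set \<Rightarrow> int list set" where
  "words d I = {\<mu>. length \<mu> = d \<and> set \<mu> \<subseteq> I}"

lemma tensor_space_words: "tensor_space n d = vecs (words d (index_set n))"
  unfolding tensor_space_def vecs_def words_def ..

lemma finite_index_set: "finite (index_set n)"
  unfolding index_set_def by simp

lemma finite_words: "finite I \<Longrightarrow> finite (words d I)"
  unfolding words_def using finite_lists_length_eq[of I d] by (simp add: conj_commute)

text \<open>The parameters of the theorem, with the condition on \<open>f_B\<close> in the form in which
  it is used.\<close>
locale schur_parameters =
  fixes Q q :: "'k::field" and n d :: nat
  assumes nz: "q \<noteq> 0" "Q \<noteq> 0"
    and sep: "\<bar>k\<bar> < int d \<Longrightarrow> inverse Q + q powi (2 * k) * Q \<noteq> 0"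
begin

sublocale hecke_module "opT d Q q" sc d Q q app
proof (unfold_locales, goal_cases)
  case 1 show ?case by (rule lop_eqI) (simp add: app_plus app_sc pm.scale_left_distrib)
next
  case 2 show ?case by (rule lop_eqI) (simp add: app_mult app_sc mult.commute)
next
  case 3 show ?case by (rule lop_eqI) (simp add: app_one app_sc)
next
  case 4 show ?case by (rule lop_eqI) (simp add: app_mult app_sc app_scale)
qed (use nz sep opT_braid opT_braid_B opT_far opT_quadratic opT_quadratic_0
       app_add app_plus app_mult app_one in auto)

abbreviation I :: "int set" where "I \<equiv> index_set n"

text \<open>The words spanning \<open>X i\<close>; zero, which is a letter for odd \<open>n\<close>, may
  occur in the first block only.\<close>
definition XW :: "nat \<Rightarrow> int list set" where
  "XW i = {\<mu>. length \<mu> = d \<and> set (take i \<mu>) \<subseteq> I \<inter> {0..} \<and> set (drop i \<mu>) \<subseteq> I \<inter> {0<..}}"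

lemma I_uminus: "x \<in> I \<Longrightarrow> - x \<in> I"
  unfolding index_set_def by (auto split: if_splits)

lemma invariant_vecs:
  assumes "\<And>k \<mu>. \<lbrakk>k \<in> ks; \<mu> \<in> A\<rbrakk> \<Longrightarrow> e \<mu> \<triangleleft> opT d Q q k \<in> vecs A"
  shows "invariant (vecs A) ks"
  unfolding invariant_def
  by (auto simp: vecs_zero vecs_add app_sc vecs_scale intro!: vecs_app assms)

lemma T_e_mem:
  assumes "length \<mu> = d" "\<mu> = u @ a # b # r" "\<mu> \<in> A" "u @ b # a # r \<in> A"
  shows "e \<mu> \<triangleleft> opT d Q q (Suc (length u)) \<in> vecs A"
  using assms unfolding T_e[OF assms(1,2) refl] by (auto intro!: vecs_add vecs_scale vecs_e)

lemma invariant_tensor_space: "invariant (tensor_space n d) {..<d}"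
  unfolding tensor_space_words
proof (rule invariant_vecs)
  fix k \<mu> assume k: "k \<in> {..<d}" and \<mu>: "\<mu> \<in> words d I"
  have l: "length \<mu> = d" using \<mu> unfolding words_def by simp
  show "e \<mu> \<triangleleft> opT d Q q k \<in> vecs (words d I)"
  proof (cases k)
    case 0
    then obtain a r where \<mu>': "\<mu> = a # r" using k l by (cases \<mu>) auto
    then have "- a # r \<in> words d I" using \<mu> I_uminus[of a] unfolding words_def by auto
    then show ?thesis using \<mu> unfolding 0 T_e0[OF l \<mu>'] by (auto intro!: vecs_add vecs_scale vecs_e)
  next
    case (Suc p)
    obtain u a b r where \<mu>': "\<mu> = u @ a # b # r" "length u = p"
      by (rule split2[of p \<mu>]) (use Suc k l in auto)
    have "u @ b # a # r \<in> words d I" using \<mu> \<mu>' unfolding words_def by auto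
    then show ?thesis using T_e_mem[OF l \<mu>'(1) \<mu>] \<mu>'(2) Suc by simp
  qed
qed

lemma invariant_XW: "i \<le> d \<Longrightarrow> invariant (vecs (XW i)) (K i)"
proof (rule invariant_vecs)
  fix k \<mu> assume i: "i \<le> d" and k: "k \<in> K i" and \<mu>: "\<mu> \<in> XW i"
  have l: "length \<mu> = d" using \<mu> unfolding XW_def by simp
  obtain p where p: "k = Suc p" using k unfolding K_def by (cases k) auto
  obtain u a b r where \<mu>': "\<mu> = u @ a # b # r" "length u = p"
    by (rule split2[of p \<mu>]) (use p k l in \<open>auto simp: K_def\<close>)
  have "u @ b # a # r \<in> XW i"
  proof (cases "k < i")
    case True
    then obtain m where "i = Suc (Suc (p + m))" using p by (metis add_Suc less_iff_Suc_add)
    then show ?thesis using \<mu> \<mu>' unfolding XW_def by auto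
  next
    case False
    then have "i \<le> p" using k p unfolding K_def by auto
    then have "take i (u @ b # a # r) = take i \<mu>" "set (drop i (u @ b # a # r)) = set (drop i \<mu>)"
      using \<mu>' by auto
    then show ?thesis using \<mu> \<mu>' unfolding XW_def by auto
  qed
  then show "e \<mu> \<triangleleft> opT d Q q k \<in> vecs (XW i)" using T_e_mem[OF l \<mu>'(1) \<mu>] \<mu>'(2) p by simp
qed

lemma XW_words: "XW i \<subseteq> words d I"
proof
  fix \<mu> assume \<mu>: "\<mu> \<in> XW i"
  have "set \<mu> = set (take i \<mu>) \<union> set (drop i \<mu>)" by (metis append_take_drop_id set_append)
  then show "\<mu> \<in> words d I" using \<mu> unfolding XW_def words_def by auto
qed

lemma finite_XW: "finite (XW i)"
  using finite_subset[OF XW_words finite_words[OF finite_index_set]] .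

section \<open>Leading terms\<close>

abbreviation nonpos :: "int list \<Rightarrow> nat" where
  "nonpos \<mu> \<equiv> length (filter (\<lambda>c. c \<le> 0) \<mu>)"

text \<open>Words are filtered by the number of nonpositive letters. The operators \<open>T k\<close>
  with \<open>k > 0\<close> preserve the filtration and each \<open>L p\<close> raises it by at most
  one, which controls the lower terms in the expansion of \<open>v\<close>.\<close>
definition F :: "nat \<Rightarrow> (int list \<Rightarrow>\<^sub>0 'k) set" where
  "F m = vecs {\<mu>. length \<mu> = d \<and> nonpos \<mu> < m}"

lemma F_mono: "m \<le> m' \<Longrightarrow> F m \<subseteq> F m'"
  unfolding F_def by (rule vecs_mono) auto

lemma invariant_F: "invariant (F m) {1..<d}"
  unfolding F_def
proof (rule invariant_vecs)
  fix k \<mu> assume k: "k \<in> {1..<d}" and \<mu>: "\<mu> \<in> {\<mu>. length \<mu> = d \<and> nonpos \<mu> < m}"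
  obtain p where p: "k = Suc p" using k by (cases k) auto
  obtain u a b r where \<mu>': "\<mu> = u @ a # b # r" "length u = p"
    by (rule split2[of p \<mu>]) (use p k \<mu> in auto)
  have sw: "u @ b # a # r \<in> {\<mu>. length \<mu> = d \<and> nonpos \<mu> < m}" using \<mu> \<mu>'(1) by (auto split: if_splits)
  show "e \<mu> \<triangleleft> opT d Q q k \<in> vecs {\<mu>. length \<mu> = d \<and> nonpos \<mu> < m}"
    using T_e_mem[OF _ \<mu>'(1) \<mu>] \<mu> \<mu>'(2) p sw by simp
qed

lemma F_T0: "\<lbrakk>0 < d; x \<in> F m\<rbrakk> \<Longrightarrow> x \<triangleleft> opT d Q q 0 \<in> F (Suc m)"
  unfolding F_def
proof (erule vecs_app)
  fix \<mu> assume d: "0 < d" and \<mu>: "\<mu> \<in> {\<mu>. length \<mu> = d \<and> nonpos \<mu> < m}"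
  then obtain a r where \<mu>': "\<mu> = a # r" by (cases \<mu>) auto
  have l: "length \<mu> = d" using \<mu> by simp
  show "e \<mu> \<triangleleft> opT d Q q 0 \<in> vecs {\<mu>. length \<mu> = d \<and> nonpos \<mu> < Suc m}"
    unfolding T_e0[OF l \<mu>'] using \<mu> \<mu>' by (auto intro!: vecs_add vecs_scale vecs_e split: if_splits)
qed

lemma F_L: "\<lbrakk>p < d; x \<in> F m\<rbrakk> \<Longrightarrow> x \<triangleleft> L p \<in> F (Suc m)"
proof (induction p arbitrary: x)
  case 0
  then show ?case using F_T0 by simp
next
  case (Suc p)
  have T: "opT d Q q (Suc p) \<in> alg {1..<d}" using Suc.prems by (auto intro: alg.gen)
  have "x \<triangleleft> opT d Q q (Suc p) \<triangleleft> L p \<triangleleft> opT d Q q (Suc p) \<in> F (Suc m)"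
    using invariant_alg[OF invariant_F T] Suc by simp
  then show ?case by (simp add: L_Suc app_mult)
qed

lemma F_scale: "x \<in> F m \<Longrightarrow> scale c x \<in> F m" unfolding F_def by (rule vecs_scale)
lemma F_add: "\<lbrakk>x \<in> F m; y \<in> F m\<rbrakk> \<Longrightarrow> x + y \<in> F m" unfolding F_def by (rule vecs_add)

lemma F_L_diff: "\<lbrakk>p < d; x \<in> F m\<rbrakk> \<Longrightarrow> x \<triangleleft> (L p - sc c) \<in> F (Suc m)"
proof -
  assume a: "p < d" "x \<in> F m"
  have "x \<triangleleft> L p + scale (- c) x \<in> F (Suc m)"
    by (intro F_add F_scale) (use F_L[OF a] F_mono[of m "Suc m"] a in auto)
  then show ?thesis by (simp add: app_minus app_sc pm.scale_minus_left)
qed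

text \<open>\<open>L p\<close> moves the letter \<open>c\<close> to the front, changes its sign and
  moves it back. It passes letters between \<open>- c\<close> and \<open>0\<close>, so at each step the
  result is a single word up to a nonzero scalar.\<close>
lemma L_lead:
  assumes "length (u @ c # r) = d" "c > 0" "\<And>y. y \<in> set u \<Longrightarrow> y \<le> 0 \<and> - c \<le> y"
  shows "\<exists>s. s \<noteq> 0 \<and> e (u @ c # r) \<triangleleft> L (length u) = scale s (e (u @ (- c) # r))"
  using assms
proof (induction u arbitrary: r rule: rev_induct)
  case Nil
  then show ?case using T_e0[of "c # r" d c r Q q] by (auto intro: exI[of _ 1])
next
  case (snoc y u)
  let ?T = "opT d Q q (Suc (length u))"
  have l: "length (u @ a # b # r) = d" for a b using snoc.prems by simp
  have y: "y \<le> 0" "- c \<le> y" using snoc.prems(3)[of y] by auto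
  have 1: "e ((u @ [y]) @ c # r) \<triangleleft> ?T = e (u @ c # y # r)"
    using T_e[OF l refl refl, where Q = Q and q = q] y snoc.prems(2) by simp
  obtain s where s: "s \<noteq> 0" "e (u @ c # y # r) \<triangleleft> L (length u) = scale s (e (u @ (- c) # y # r))"
    using snoc.IH[of "y # r"] snoc.prems by auto
  obtain s' where s': "s' \<noteq> 0" "e (u @ (- c) # y # r) \<triangleleft> ?T = scale s' (e ((u @ [y]) @ (- c) # r))"
  proof (cases "- c = y")
    case True
    then show ?thesis using that[of "inverse q"] T_e[OF l refl refl, where Q = Q and q = q] nz by simp
  next
    case False
    then show ?thesis using that[of 1] T_e[OF l refl refl, where Q = Q and q = q] y by simp
  qed
  have "e ((u @ [y]) @ c # r) \<triangleleft> L (length (u @ [y])) = scale (s * s') (e ((u @ [y]) @ (- c) # r))"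
    using 1 s s' by (simp add: L_Suc app_mult app_scale)
  then show ?case using s s' by (intro exI[of _ "s * s'"]) simp
qed

text \<open>On zeros \<open>T 0\<close> and \<open>T k\<close> act as the scalars
  \<open>inverse Q\<close> and \<open>inverse q\<close>.\<close>
lemma L_zeros:
  assumes "length (replicate p 0 @ 0 # r) = d"
  shows "e (replicate p 0 @ 0 # r) \<triangleleft> L p = scale (inverse Q * q powi (- 2 * int p)) (e (replicate p 0 @ 0 # r))"
  using assms
proof (induction p arbitrary: r)
  case 0
  then show ?case using T_e0[of "0 # r" d 0 r Q q] by simp
next
  case (Suc p)
  let ?T = "opT d Q q (Suc p)"
  have w: "replicate (Suc p) 0 @ 0 # r = replicate p 0 @ 0 # 0 # r"
    by (simp add: replicate_app_Cons_same)
  have l: "length (replicate p 0 @ 0 # 0 # r) = d" using Suc.prems w by simp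
  have 1: "e (replicate p 0 @ 0 # 0 # r) \<triangleleft> ?T = scale (inverse q) (e (replicate p 0 @ 0 # 0 # r))"
    using T_e[OF l refl, of p Q q] by simp
  have "q powi (- 2 * int (Suc p)) = inverse q * q powi (- 2 * int p) * inverse q"
    using nz by (simp add: power_int_diff power_int_minus divide_inverse power2_eq_square algebra_simps)
  then show ?case
    unfolding w using Suc.IH[OF l] 1 by (simp add: L_Suc app_mult app_scale mult.assoc mult.left_commute mult.commute)
qed

text \<open>The letters of \<open>s\<close> become nonpositive one after the other. As \<open>s\<close>
  is sorted, the letters before position \<open>p\<close> are by then between \<open>- s ! p\<close> and
  \<open>0\<close>, as \<open>L_lead\<close> requires. On a letter zero the factor
  \<open>L p + Q\<close> acts as the scalar \<open>inverse Q * q powi (- 2 * p) + Q\<close>, nonzero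
  because the parameters are separated.\<close>
lemma U_lead:
  assumes "length (s @ r) = d" "sorted s" "\<And>x. x \<in> set s \<Longrightarrow> 0 \<le> x" "0 \<notin> set s \<or> c = - Q" "p \<le> length s"
  shows "\<exists>a low. a \<noteq> 0 \<and> low \<in> F (nonpos r + p) \<and>
    e (s @ r) \<triangleleft> U c p = scale a (e (map uminus (take p s) @ drop p s @ r)) + low"
  using assms(5)
proof (induction p)
  case 0
  show ?case by (rule exI[of _ 1], rule exI[of _ 0]) (simp add: app_one F_def vecs_zero)
next
  case (Suc p)
  then obtain a low where IH: "a \<noteq> 0" "low \<in> F (nonpos r + p)"
    "e (s @ r) \<triangleleft> U c p = scale a (e (map uminus (take p s) @ drop p s @ r)) + low" by auto
  let ?x = "s ! p" and ?u = "map uminus (take p s)" and ?r = "drop (Suc p) s @ r"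
  have ps: "p < length s" "p < d" using Suc.prems assms(1) by auto
  have dr: "drop p s = ?x # drop (Suc p) s" using ps by (simp add: Cons_nth_drop_Suc)
  have len: "length (?u @ ?x # ?r) = d" using assms(1) ps by simp
  have lu: "length ?u = p" using ps by simp
  have new: "map uminus (take (Suc p) s) @ drop (Suc p) s @ r = ?u @ (- ?x) # ?r"
    using ps by (simp add: take_Suc_conv_app_nth)
  have le: "y \<le> ?x \<and> 0 \<le> y" if "y \<in> set (take p s)" for y
  proof -
    obtain k where "k < length (take p s)" "take p s ! k = y" using \<open>y \<in> set (take p s)\<close> by (meson in_set_conv_nth)
    then have "k < p" "y = s ! k" by auto
    then show ?thesis using sorted_nth_mono[OF assms(2), of k p] assms(3)[of y] ps by auto
  qed
  have low: "low \<triangleleft> (L p - sc c) \<in> F (nonpos r + Suc p)"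
    using F_L_diff[OF ps(2) IH(2)] by simp
  have e: "e (s @ r) \<triangleleft> U c (Suc p) = scale a (e (?u @ ?x # ?r) \<triangleleft> (L p - sc c)) + low \<triangleleft> (L p - sc c)"
    using IH(3) dr by (simp add: app_mult app_add app_scale)
  show ?case
  proof (cases "?x = 0")
    case True
    have "?u = replicate p 0"
      by (rule replicate_eqI) (use le True ps in \<open>force+\<close>)
    then have L0: "e (?u @ ?x # ?r) \<triangleleft> L p = scale (inverse Q * q powi (- 2 * int p)) (e (?u @ ?x # ?r))"
      using L_zeros[of p ?r] True len by simp
    have c: "c = - Q" using assms(4) True ps nth_mem by metis
    have "e (?u @ ?x # ?r) \<triangleleft> (L p - sc c) = scale (inverse Q * q powi (- 2 * int p) - c) (e (?u @ ?x # ?r))"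
      by (simp add: app_minus app_sc L0 pm.scale_left_diff_distrib)
    moreover have "inverse Q * q powi (- 2 * int p) - c \<noteq> 0"
    proof
      assume "inverse Q * q powi (- 2 * int p) - c = 0"
      then have "q powi (2 * int p) * (inverse Q * q powi (- 2 * int p) + Q) = 0" using c by simp
      then have "inverse Q * (q powi (2 * int p) * q powi (- (2 * int p))) + q powi (2 * int p) * Q = 0"
        by (simp add: algebra_simps)
      then show False using sep[of "int p"] ps nz by (simp add: power_int_minus)
    qed
    ultimately show ?thesis
      unfolding new e using True low IH(1)
      by (intro exI[of _ "a * (inverse Q * q powi (- 2 * int p) - c)"] exI[of _ "low \<triangleleft> (L p - sc c)"]) simp
  next
    case False
    then have pos: "?x > 0" using assms(3)[of ?x] ps by simp
    obtain b where b: "b \<noteq> 0" "e (?u @ ?x # ?r) \<triangleleft> L p = scale b (e (?u @ (- ?x) # ?r))"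
      using L_lead[OF len pos] le unfolding lu by fastforce
    have "filter (\<lambda>c. c \<le> 0) (?x # drop (Suc p) s) = []"
      unfolding dr[symmetric] filter_empty_conv
    proof
      fix y assume "y \<in> set (drop p s)"
      then obtain k where "k < length s - p" "y = s ! (p + k)" by (auto simp: in_set_conv_nth)
      moreover have "p + k < length s" using \<open>k < length s - p\<close> by simp
      ultimately show "\<not> y \<le> 0" using sorted_nth_mono[OF assms(2), of p "p + k"] pos by auto
    qed
    then have "nonpos (?u @ ?x # ?r) < nonpos r + Suc p"
      using length_filter_le[of "\<lambda>c. c \<le> 0" ?u] lu by (auto split: if_splits)
    then have eF: "e (?u @ ?x # ?r) \<in> F (nonpos r + Suc p)"
      unfolding F_def using len by (intro vecs_e) simp
    have "e (s @ r) \<triangleleft> U c (Suc p) = scale (a * b) (e (?u @ (- ?x) # ?r))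
        + (scale (- a * c) (e (?u @ ?x # ?r)) + low \<triangleleft> (L p - sc c))"
      unfolding e by (simp add: app_minus app_sc b pm.scale_right_diff_distrib pm.scale_minus_left)
    then show ?thesis
      unfolding new using IH(1) b(1) F_add[OF F_scale[OF eF] low] by (metis mult_eq_0_iff)
  qed
qed

lemma R_lead:
  assumes "length (u @ y # t @ r) = d" "\<And>c. c \<in> set t \<Longrightarrow> y < c"
  shows "e (u @ y # t @ r) \<triangleleft> R (length u) (length t) = e (u @ t @ y # r)"
  using assms
proof (induction t arbitrary: r rule: rev_induct)
  case Nil
  then show ?case by (simp add: app_one)
next
  case (snoc c t)
  have "e (u @ y # t @ c # r) \<triangleleft> R (length u) (length t) = e (u @ t @ y # c # r)"
    using snoc.IH[of "c # r"] snoc.prems by simp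
  moreover have "e ((u @ t) @ y # c # r) \<triangleleft> opT d Q q (Suc (length (u @ t))) = e ((u @ t) @ c # y # r)"
    using T_e[OF _ refl refl, of "u @ t" y c r d Q q] snoc.prems by auto
  ultimately show ?case by (simp add: app_mult)
qed

lemma W_lead:
  assumes "length (u @ t @ r) = d" "\<And>y c. \<lbrakk>y \<in> set u; c \<in> set t\<rbrakk> \<Longrightarrow> y < c"
  shows "e (u @ t @ r) \<triangleleft> W (length u) (length t) = e (t @ u @ r)"
  using assms
proof (induction u arbitrary: r rule: rev_induct)
  case Nil
  then show ?case by (simp add: app_one)
next
  case (snoc y u)
  have "e (u @ y # t @ r) \<triangleleft> R (length u) (length t) = e (u @ t @ y # r)"
    by (rule R_lead) (use snoc.prems in auto)
  moreover have "e (u @ t @ y # r) \<triangleleft> W (length u) (length t) = e (t @ u @ y # r)"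
    using snoc.IH[of "y # r"] snoc.prems by simp
  ultimately show ?case by (simp add: app_mult)
qed

lemma F_U: "\<lbrakk>x \<in> F m; p \<le> d\<rbrakk> \<Longrightarrow> x \<triangleleft> U c p \<in> F (m + p)"
proof (induction p)
  case 0
  then show ?case by (simp add: app_one)
next
  case (Suc p)
  then have "x \<triangleleft> U c p \<in> F (m + p)" by simp
  from F_L_diff[OF _ this, of p c] Suc.prems show ?case by (simp add: app_mult)
qed

lemma alg_W': "i + j \<le> d \<Longrightarrow> W i j \<in> alg {1..<d}"
proof -
  have R: "R s m \<in> alg {1..<d}" if "s + m < d \<or> m = 0" for s m
    using that by (induction m) (auto intro!: alg_intros)
  show "i + j \<le> d \<Longrightarrow> W i j \<in> alg {1..<d}"
  proof (induction i)
    case (Suc i)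
    then show ?case unfolding W.simps by (intro alg.mult R) auto
  qed (simp add: alg_one)
qed

text \<open>The first \<open>i\<close> letters change sign, the blocks change places, and the remaining
  \<open>j\<close> letters change sign; everything else has fewer than \<open>d\<close> nonpositive
  letters.\<close>
lemma v_lead:
  assumes "length s = i" "length t = j" "i + j = d" "sorted s" "sorted t"
    "\<And>x. x \<in> set s \<Longrightarrow> 0 \<le> x" "\<And>x. x \<in> set t \<Longrightarrow> 0 < x"
  shows "\<exists>a low. a \<noteq> 0 \<and> low \<in> F d \<and> e (s @ t) \<triangleleft> v i j = scale a (e (map uminus t @ map uminus s)) + low"
proof -
  have t0: "filter (\<lambda>c. c \<le> 0) t = []" using assms(7) by (force simp: filter_empty_conv)
  have s0: "filter (\<lambda>c. c \<le> 0) (map uminus s) = map uminus s" using assms(6) by (auto simp: filter_id_conv)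
  obtain a low where 1: "a \<noteq> 0" "low \<in> F i" "e (s @ t) \<triangleleft> U (- Q) i = scale a (e (map uminus s @ t)) + low"
    using U_lead[of s t "- Q" i] assms t0 by auto
  have W: "e (map uminus s @ t) \<triangleleft> W i j = e (t @ map uminus s)"
    using W_lead[of "map uminus s" t "[]"] assms by force
  obtain b low' where 2: "b \<noteq> 0" "low' \<in> F (i + j)"
    "e (t @ map uminus s) \<triangleleft> U (inverse Q) j = scale b (e (map uminus t @ map uminus s)) + low'"
    using U_lead[of t "map uminus s" "inverse Q" j] assms s0 by force
  have low: "low \<triangleleft> W i j \<triangleleft> U (inverse Q) j \<in> F (i + j)"
    by (rule F_U[OF invariant_alg[OF invariant_F alg_W' 1(2)]]) (use assms in auto)
  have "e (s @ t) \<triangleleft> v i j = scale (a * b) (e (map uminus t @ map uminus s)) + (scale a low' + low \<triangleleft> W i j \<triangleleft> U (inverse Q) j)"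
    unfolding v_def by (simp add: app_mult 1(3) app_add app_scale W 2(3) pm.scale_right_distrib)
  moreover have "scale a low' + low \<triangleleft> W i j \<triangleleft> U (inverse Q) j \<in> F d"
    using F_add[OF F_scale[OF 2(2)] low] assms(3) by simp
  ultimately show ?thesis using 1(1) 2(1) by (metis mult_eq_0_iff)
qed

end

text \<open>Adjacent transpositions generate the symmetric group.\<close>
lemma adjacent_swaps:
  assumes "\<And>u a b r. P (u @ a # b # r) \<Longrightarrow> P (u @ b # a # r)" "P s" "mset s' = mset s"
  shows "P s'"
  using assms
proof (induction s' arbitrary: s P)
  case Nil
  then show ?case by simp
next
  case (Cons x s')
  have "x \<in> set s" using Cons.prems(3) by (metis list.set_intros(1) mset_eq_setD)
  then obtain u r where s: "s = u @ x # r" by (meson split_list)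
  have front: "P (x # u @ r)" if "P (u @ x # r)" for u r
    using that
  proof (induction u arbitrary: r rule: rev_induct)
    case (snoc y u)
    then show ?case using Cons.prems(1)[of u y x r] by simp
  qed simp
  have "P (x # u @ r)" using front Cons.prems(2) s by simp
  moreover have "mset s' = mset (u @ r)" using Cons.prems(3) s by simp
  ultimately show ?case
    using Cons.IH[of "\<lambda>w. P (x # w)" "u @ r"] Cons.prems(1)[of "x # _"] by auto
qed

context schur_parameters
begin

text \<open>This projection kills the lower terms of \<open>v_lead\<close>, and it commutes with
  \<open>T k\<close> for \<open>k > 0\<close>, since these permute letters.\<close>
definition top_part :: "(int list, 'k) lop" where
  "top_part = lop_of (\<lambda>\<mu>. if length \<mu> = d \<and> nonpos \<mu> = d then e \<mu> else 0)"

lemma top_part_e: "e \<mu> \<triangleleft> top_part = (if length \<mu> = d \<and> nonpos \<mu> = d then e \<mu> else 0)"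
  unfolding top_part_def app_lop_of lin_ext_e ..

lemma top_part_F: "x \<in> F d \<Longrightarrow> x \<triangleleft> top_part = 0"
  unfolding app_eq_lin_ext[of x] lin_ext_def F_def vecs_def
  by (rule sum.neutral) (auto simp: top_part_e)

lemma top_part_T: "k \<in> {1..<d} \<Longrightarrow> top_part * opT d Q q k = opT d Q q k * top_part"
proof (rule lop_eqI)
  fix \<mu> assume k: "k \<in> {1..<d}"
  obtain p where p: "k = Suc p" using k by (cases k) auto
  show "e \<mu> \<triangleleft> (top_part * opT d Q q k) = e \<mu> \<triangleleft> (opT d Q q k * top_part)"
  proof (cases "length \<mu> = d")
    case True
    obtain u a b r where \<mu>: "\<mu> = u @ a # b # r" "length u = p"
      by (rule split2[of p \<mu>]) (use True p k in auto)
    have l: "length (u @ x # y # r) = d" for x y using True \<mu> by simp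
    define C where "C \<longleftrightarrow> nonpos (u @ a # b # r) = d"
    have tp: "e (u @ a # b # r) \<triangleleft> top_part = (if C then e (u @ a # b # r) else 0)"
      "e (u @ b # a # r) \<triangleleft> top_part = (if C then e (u @ b # a # r) else 0)"
      unfolding top_part_e C_def using l by auto
    show ?thesis
      unfolding \<mu>(1) p app_mult tp using tp
      by (cases C; cases "a = b") (simp_all add: T_e[OF l refl \<mu>(2)] app_zero app_add app_scale)
  next
    case False
    then show ?thesis by (simp add: app_mult top_part_e T_e_invalid app_zero app_scale)
  qed
qed

text \<open>Apply \<open>v\<close> and keep the top part. By \<open>v_lead\<close> the image contains,
  for sorted blocks, the word with negated and exchanged blocks. It is stable under the parabolic
  subalgebra because \<open>v\<close> intertwines, so it contains all words with these blocks permuted.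
  These are as many words as span \<open>X i\<close>, so the map, being surjective onto their span, is
  injective.\<close>
lemma v_injective_on_words:
  assumes i: "i \<le> d" and x: "x \<in> vecs (XW i)" "x \<triangleleft> v i (d - i) = 0"
  shows "x = 0"
proof -
  define j where "j = d - i"
  have ij: "i + j = d" using i unfolding j_def by simp
  define target where "target = (\<lambda>\<mu>. map uminus (drop i \<mu>) @ map uminus (take i \<mu>)) ` XW i"
  have inj: "inj_on (\<lambda>\<mu>. map uminus (drop i \<mu>) @ map uminus (take i \<mu>)) (XW i)"
  proof (rule inj_onI)
    fix \<mu> \<mu>' assume a: "\<mu> \<in> XW i" "\<mu>' \<in> XW i"
      "map uminus (drop i \<mu>) @ map uminus (take i \<mu>) = map uminus (drop i \<mu>') @ map uminus (take i \<mu>')"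
    have "length (map uminus (drop i \<mu>)) = length (map uminus (drop i \<mu>'))" using a unfolding XW_def by simp
    then have "map uminus (drop i \<mu>) = map uminus (drop i \<mu>')" "map uminus (take i \<mu>) = map uminus (take i \<mu>')"
      using a(3) by simp_all
    then have "drop i \<mu> = drop i \<mu>'" "take i \<mu> = take i \<mu>'"
      by (auto simp: inj_map_eq_map inj_def)
    then show "\<mu> = \<mu>'" by (metis append_take_drop_id)
  qed
  define Im where "Im = {x \<triangleleft> (v i j * top_part) | x. x \<in> vecs (XW i)}"
  have Im_add: "y + y' \<in> Im" if "y \<in> Im" "y' \<in> Im" for y y'
    using that unfolding Im_def by (auto simp: app_add[symmetric] intro: vecs_add)
  have Im_scale: "scale c y \<in> Im" if "y \<in> Im" for y c
    using that unfolding Im_def by (auto simp: app_scale[symmetric] intro: vecs_scale)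
  have Im_T: "y \<triangleleft> opT d Q q k' \<in> Im"
    if "k \<in> K i" "k' \<in> {1..<d}" "opT d Q q k * v i j = v i j * opT d Q q k'" "y \<in> Im" for y k k'
  proof -
    obtain x where x: "x \<in> vecs (XW i)" "y = x \<triangleleft> (v i j * top_part)" using \<open>y \<in> Im\<close> unfolding Im_def by blast
    have "v i j * top_part * opT d Q q k' = opT d Q q k * (v i j * top_part)"
      by (simp only: mult.assoc top_part_T[OF that(2)] mult_shift[OF that(3)])
    then have "y \<triangleleft> opT d Q q k' = x \<triangleleft> opT d Q q k \<triangleleft> (v i j * top_part)" unfolding x(2) by (simp only: app_mult[symmetric])
    moreover have "x \<triangleleft> opT d Q q k \<in> vecs (XW i)"
      using invariant_alg[OF invariant_XW[OF i] alg.gen[OF that(1)] x(1)] .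
    ultimately show ?thesis unfolding Im_def by blast
  qed
  have swap: "e (u @ b # a # r) \<in> Im"
    if w: "e (u @ a # b # r) \<in> Im" "length (u @ a # b # r) = d" "Suc (length u) \<noteq> j" for u a b r
  proof -
    let ?k' = "Suc (length u)"
    define k where "k = (if ?k' < j then i + ?k' else ?k' - j)"
    have k: "k \<in> K i" unfolding k_def K_def using w(2,3) ij by auto
    have tv: "opT d Q q k * v i j = v i j * opT d Q q ?k'"
      using T_v_right[of i j ?k'] T_v_left[of "?k' - j" i j] w(2,3) ij unfolding k_def by auto
    have "e (u @ a # b # r) \<triangleleft> opT d Q q ?k' \<in> Im"
      by (rule Im_T[OF k _ tv w(1)]) (use w(2) in auto)
    then have m: "a \<noteq> b \<Longrightarrow> e (u @ b # a # r) + scale (if a < b then 0 else inverse q - q) (e (u @ a # b # r)) \<in> Im"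
      unfolding T_e[OF w(2) refl refl] by (auto simp: pm.scale_zero_left split: if_splits)
    show ?thesis
    proof (cases "a = b")
      case False
      from Im_add[OF m[OF this] Im_scale[OF w(1), of "- (if a < b then 0 else inverse q - q)"]]
      show ?thesis by (simp add: pm.scale_minus_left)
    qed (use w in simp)
  qed
  have "x' \<in> Im" if x': "x' = e \<nu>" "\<nu> \<in> target" for x' \<nu>
  proof -
    obtain \<mu> where \<mu>: "\<mu> \<in> XW i" "\<nu> = map uminus (drop i \<mu>) @ map uminus (take i \<mu>)"
      using x' unfolding target_def by blast
    let ?s = "sort (take i \<mu>)" and ?t = "sort (drop i \<mu>)"
    have len: "length ?s = i" "length ?t = j" using \<mu>(1) i unfolding XW_def j_def by auto
    have pos: "0 \<le> y" if "y \<in> set ?s" for y using \<mu>(1) that unfolding XW_def by auto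
    have pos': "0 < y" if "y \<in> set ?t" for y using \<mu>(1) that unfolding XW_def by auto
    have st: "?s @ ?t \<in> XW i" using \<mu>(1) len unfolding XW_def by auto
    obtain a low where al: "a \<noteq> 0" "low \<in> F d" "e (?s @ ?t) \<triangleleft> v i j = scale a (e (map uminus ?t @ map uminus ?s)) + low"
      using v_lead[OF len ij sorted_sort sorted_sort pos pos'] by blast
    have np: "nonpos (map uminus ?t @ map uminus ?s) = d"
    proof -
      have "filter (\<lambda>c. c \<le> 0) (map uminus ?t @ map uminus ?s) = map uminus ?t @ map uminus ?s"
        unfolding filter_id_conv using pos pos' by force
      then show ?thesis using len ij by simp
    qed
    have ln: "length (map uminus ?t @ map uminus ?s) = d" using len ij by simp
    have "e (?s @ ?t) \<triangleleft> (v i j * top_part) = scale a (e (map uminus ?t @ map uminus ?s))"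
      unfolding app_mult al(3) app_add app_scale top_part_F[OF al(2)] top_part_e using np ln by simp
    then have "scale a (e (map uminus ?t @ map uminus ?s)) \<in> Im"
      unfolding Im_def using vecs_e[OF st] by force
    from Im_scale[OF this, of "inverse a"] have start: "e (map uminus ?t @ map uminus ?s) \<in> Im"
      using al(1) by simp
    define P1 where "P1 t \<longleftrightarrow> length t = j \<and> e (t @ map uminus ?s) \<in> Im" for t
    have "P1 (map uminus (drop i \<mu>))"
    proof (rule adjacent_swaps[of P1 "map uminus ?t"])
      show "P1 (u @ b # a # r)" if "P1 (u @ a # b # r)" for u a b r
        using swap[of u a b "r @ map uminus ?s"] that len ij unfolding P1_def by auto
    qed (use start len in \<open>auto simp: P1_def\<close>)
    define P2 where "P2 t \<longleftrightarrow> length t = i \<and> e (map uminus (drop i \<mu>) @ t) \<in> Im" for t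
    have dj: "length (drop i \<mu>) = j" using len by simp
    have "P2 (map uminus (take i \<mu>))"
    proof (rule adjacent_swaps[of P2 "map uminus ?s"])
      show "P2 (u @ b # a # r)" if "P2 (u @ a # b # r)" for u a b r
        using swap[of "map uminus (drop i \<mu>) @ u" a b r] that dj ij unfolding P2_def by auto
    qed (use \<open>P1 _\<close> len in \<open>auto simp: P1_def P2_def\<close>)
    then show ?thesis unfolding x'(1) \<mu>(2) P2_def by blast
  qed
  then have surj: "\<exists>x\<in>vecs (XW i). x \<triangleleft> (v i j * top_part) = e \<nu>" if "\<nu> \<in> target" for \<nu>
    using that unfolding Im_def by force
  show ?thesis
  proof (rule surj_imp_inj[OF finite_XW _ _ surj x(1)])
    show "finite target" unfolding target_def using finite_XW by simp
    show "card (XW i) \<le> card target" unfolding target_def using card_image[OF inj] by simp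
    show "x \<triangleleft> (v i j * top_part) = 0" using x(2) unfolding j_def by (simp add: app_mult app_zero)
  qed
qed

sublocale hecke_pieces "opT d Q q" sc d Q q app "tensor_space n d" "\<lambda>i. vecs (XW i)"
proof
  show "\<And>i. i \<le> d \<Longrightarrow> vecs (XW i) \<subseteq> tensor_space n d"
    unfolding tensor_space_words using vecs_mono[OF XW_words] .
qed (use invariant_tensor_space invariant_XW v_injective_on_words in auto)

section \<open>The pieces span\<close>

text \<open>A word is determined by its sign sequence and by the word in which its nonnegative letters
  come first, followed by the negated negative ones. So tensor space has as many basis vectors as all
  pieces together.\<close>
definition signs :: "int list \<Rightarrow> bool list" where
  "signs \<nu> = map (\<lambda>c. 0 \<le> c) \<nu>"

definition unshuffle :: "int list \<Rightarrow> int list" where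
  "unshuffle \<nu> = filter (\<lambda>c. 0 \<le> c) \<nu> @ map uminus (filter (\<lambda>c. c < 0) \<nu>)"

lemma unshuffle_lengths:
  "length (filter (\<lambda>c. 0 \<le> c) \<nu>) = npos (signs \<nu>)"
  "length (filter (\<lambda>c. 0 \<le> c) \<nu>) + length (filter (\<lambda>c. c < 0) \<nu>) = length \<nu>"
  unfolding signs_def by (induction \<nu>) auto

lemma unshuffle_XW: "\<nu> \<in> words d I \<Longrightarrow> unshuffle \<nu> \<in> XW (npos (signs \<nu>))"
  using unshuffle_lengths[of \<nu>] I_uminus unfolding XW_def words_def unshuffle_def by auto

lemma unshuffle_inj: "\<lbrakk>signs \<nu> = signs \<nu>'; unshuffle \<nu> = unshuffle \<nu>'\<rbrakk> \<Longrightarrow> \<nu> = \<nu>'"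
proof -
  assume s: "signs \<nu> = signs \<nu>'" and u: "unshuffle \<nu> = unshuffle \<nu>'"
  have l: "length \<nu> = length \<nu>'" using arg_cong[OF s, of length] unfolding signs_def by simp
  have f1: "filter (\<lambda>c. 0 \<le> c) \<nu> = filter (\<lambda>c. 0 \<le> c) \<nu>'"
    and f2: "map uminus (filter (\<lambda>c. c < 0) \<nu>) = map uminus (filter (\<lambda>c. c < 0) \<nu>')"
    using u unshuffle_lengths(1)[of \<nu>] unshuffle_lengths(1)[of \<nu>'] s unfolding unshuffle_def by (simp_all add: append_eq_append_conv)
  have f3: "filter (\<lambda>c. c < 0) \<nu> = filter (\<lambda>c. c < 0) \<nu>'" using f2 by (simp add: inj_map_eq_map inj_def)
  show ?thesis using l s f1 f3 unfolding signs_def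
    by (induction \<nu> \<nu>' rule: list_induct2) (auto split: if_splits)
qed

text \<open>The map \<open>g\<close> sends the word with signs \<open>\<epsilon>\<close> and unshuffled
  form \<open>\<mu>\<close> to \<open>e \<mu> \<triangleleft> f \<epsilon>\<close>. It is injective by
  the independence of the pieces, hence surjective.\<close>
lemma pieces_span:
  assumes "y \<in> tensor_space n d"
  shows "\<exists>\<xi>. (\<forall>\<epsilon>\<in>\<E>. \<xi> \<epsilon> \<in> vecs (XW (npos \<epsilon>))) \<and> y = (\<Sum>\<epsilon>\<in>\<E>. \<xi> \<epsilon> \<triangleleft> f \<epsilon>)"
proof -
  let ?W = "words d I"
  define g where "g = lop_of (\<lambda>\<nu>. e (unshuffle \<nu>) \<triangleleft> f (signs \<nu>))"
  define \<xi> where "\<xi> x \<epsilon> = lin_ext (\<lambda>\<nu>. if signs \<nu> = \<epsilon> then e (unshuffle \<nu>) else 0) x" for x :: "int list \<Rightarrow>\<^sub>0 'k" and \<epsilon>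
  have fin: "finite ?W" by (rule finite_words[OF finite_index_set])
  have signs: "signs \<nu> \<in> \<E>" if "\<nu> \<in> ?W" for \<nu>
    using that unfolding \<E>_def words_def signs_def by simp
  have \<xi>X: "\<xi> x \<epsilon> \<in> vecs (XW (npos \<epsilon>))" if "x \<in> vecs ?W" for x \<epsilon>
    unfolding \<xi>_def by (rule vecs_lin_ext[OF that]) (use unshuffle_XW in \<open>auto intro: vecs_e vecs_zero\<close>)
  have split: "x \<triangleleft> g = (\<Sum>\<epsilon>\<in>\<E>. \<xi> x \<epsilon> \<triangleleft> f \<epsilon>)" if x: "x \<in> vecs ?W" for x
  proof -
    have k: "Poly_Mapping.keys x \<subseteq> ?W" using x unfolding vecs_def by simp
    have "(\<Sum>\<epsilon>\<in>\<E>. \<xi> x \<epsilon> \<triangleleft> f \<epsilon>) = (\<Sum>\<epsilon>\<in>\<E>. \<Sum>\<nu>\<in>?W. scale (Poly_Mapping.lookup x \<nu>) (if signs \<nu> = \<epsilon> then e (unshuffle \<nu>) \<triangleleft> f \<epsilon> else 0))"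
      unfolding \<xi>_def lin_ext_superset[OF fin k] app_sum app_scale
      by (intro sum.cong refl arg_cong[where f = "scale _"]) (simp add: app_zero)
    also have "\<dots> = (\<Sum>\<nu>\<in>?W. \<Sum>\<epsilon>\<in>\<E>. scale (Poly_Mapping.lookup x \<nu>) (if signs \<nu> = \<epsilon> then e (unshuffle \<nu>) \<triangleleft> f \<epsilon> else 0))"
      by (rule sum.swap)
    also have "\<dots> = (\<Sum>\<nu>\<in>?W. scale (Poly_Mapping.lookup x \<nu>) (e (unshuffle \<nu>) \<triangleleft> f (signs \<nu>)))"
      by (rule sum.cong) (simp_all add: pm.scale_sum_right[symmetric] finite_\<E> signs)
    also have "\<dots> = x \<triangleleft> g" unfolding g_def app_lop_of lin_ext_superset[OF fin k] ..
    finally show ?thesis ..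
  qed
  have inj: "x = 0" if x: "x \<in> vecs ?W" "x \<triangleleft> g = 0" for x
  proof (rule vecs_eq_zero[OF x(1)])
    fix \<nu> assume \<nu>: "\<nu> \<in> ?W"
    have k: "Poly_Mapping.keys x \<subseteq> ?W" using x unfolding vecs_def by simp
    have "\<xi> x (signs \<nu>) = 0"
      by (rule independent_pieces[of "\<xi> x"]) (use \<xi>X[OF x(1)] split[OF x(1)] x(2) signs[OF \<nu>] in auto)
    then have "0 = Poly_Mapping.lookup (\<xi> x (signs \<nu>)) (unshuffle \<nu>)" by simp
    also have "\<dots> = (\<Sum>\<nu>'\<in>?W. if \<nu>' = \<nu> then Poly_Mapping.lookup x \<nu>' else 0)"
      unfolding \<xi>_def lin_ext_superset[OF fin k] lookup_sum lookup_scale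
      using unshuffle_inj[of _ \<nu>] by (intro sum.cong refl) (auto simp: lookup_single when_def)
    also have "\<dots> = Poly_Mapping.lookup x \<nu>" using \<nu> fin by simp
    finally show "Poly_Mapping.lookup x \<nu> = 0" by simp
  qed
  have "\<exists>x\<in>vecs ?W. y = x \<triangleleft> g"
  proof (rule inj_imp_surj[OF fin fin order.refl _ inj])
    fix \<nu> assume \<nu>: "\<nu> \<in> ?W"
    show "e \<nu> \<triangleleft> g \<in> vecs ?W"
      using invariant_alg[OF E alg_f, of "signs \<nu>" "e (unshuffle \<nu>)"] signs[OF \<nu>] unshuffle_XW[OF \<nu>] XW_words
      unfolding \<E>_def g_def app_lop_of lin_ext_e tensor_space_words by (auto intro: vecs_e)
  qed (use assms tensor_space_words in auto)
  then obtain x where "x \<in> vecs ?W" "y = x \<triangleleft> g" by blast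
  then show ?thesis using split \<xi>X by blast
qed

sublocale hecke_decomposition "opT d Q q" sc d Q q app "tensor_space n d" "\<lambda>i. vecs (XW i)"
proof
  fix i :: nat and r :: "(int list, 'k) lop" and x :: "int list \<Rightarrow>\<^sub>0 'k"
  assume a: "i \<le> d" "r \<in> alg (K i)" "cancel r" "x \<in> vecs (XW i)"
  have "e p \<triangleleft> r \<in> vecs (XW i)" if "p \<in> XW i" for p
    using invariant_alg[OF invariant_XW[OF a(1)] a(2)] vecs_e[OF that] by blast
  then show "\<exists>x'\<in>vecs (XW i). x = x' \<triangleleft> r"
    using inj_imp_surj[OF finite_XW finite_XW order.refl _ _ a(4), of r] a(3) unfolding cancel_def by blast
qed (use pieces_span in blast)

end

section \<open>Bases of algebras over a field\<close>

lemma k_linear_iff: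
  "f \<in> k_linear A B \<longleftrightarrow> (\<forall>x\<in>carrier A. f x \<in> carrier B) \<and>
    (\<forall>x\<in>carrier A. \<forall>y\<in>carrier A. f (x \<oplus>\<^bsub>A\<^esub> y) = f x \<oplus>\<^bsub>B\<^esub> f y) \<and>
    (\<forall>c. \<forall>x\<in>carrier A. f (c \<odot>\<^bsub>A\<^esub> x) = c \<odot>\<^bsub>B\<^esub> f x)"
  unfolding LinearCombinations.module_hom_def by auto

lemma k_algebraI:
  fixes A :: "('k::field, 'a, 'm) module_scheme" (structure)
  assumes "ring A"
    and "\<And>c x. x \<in> carrier A \<Longrightarrow> c \<odot> x \<in> carrier A"
    and "\<And>c d x. x \<in> carrier A \<Longrightarrow> (c + d) \<odot> x = c \<odot> x \<oplus> d \<odot> x"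
    and "\<And>c x y. \<lbrakk>x \<in> carrier A; y \<in> carrier A\<rbrakk> \<Longrightarrow> c \<odot> (x \<oplus> y) = c \<odot> x \<oplus> c \<odot> y"
    and "\<And>c d x. x \<in> carrier A \<Longrightarrow> (c * d) \<odot> x = c \<odot> (d \<odot> x)"
    and "\<And>x. x \<in> carrier A \<Longrightarrow> 1 \<odot> x = x"
    and "\<And>c x y. \<lbrakk>x \<in> carrier A; y \<in> carrier A\<rbrakk> \<Longrightarrow> (c \<odot> x) \<otimes> y = c \<odot> (x \<otimes> y)"
    and "\<And>c x y. \<lbrakk>x \<in> carrier A; y \<in> carrier A\<rbrakk> \<Longrightarrow> x \<otimes> (c \<odot> y) = c \<odot> (x \<otimes> y)"
  shows "k_algebra A"
proof (rule k_algebra.intro)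
  interpret ring A by fact
  have "module (class_ring :: 'k ring) A"
    by (rule moduleI) (use assms class_cring.cring_axioms abelian_group_axioms in auto)
  then show "vectorspace (class_ring :: 'k ring) A"
    unfolding vectorspace_def using class_field.field_axioms by blast
qed (use assms in auto)

context k_algebra
begin

interpretation ring A by (rule ring)
interpretation vs: vectorspace "class_ring :: 'k ring" A by (rule vectorspace)

lemma abelian_group: "abelian_group A" by unfold_locales

lemma smult_closed: "x \<in> carrier A \<Longrightarrow> c \<odot> x \<in> carrier A"
  using vs.smult_closed[of c x] by simp
lemma smult_l_distr: "x \<in> carrier A \<Longrightarrow> (c + d) \<odot> x = c \<odot> x \<oplus> d \<odot> x"
  using vs.smult_l_distr[of c d x] by simp
lemma smult_r_distr: "\<lbrakk>x \<in> carrier A; y \<in> carrier A\<rbrakk> \<Longrightarrow> c \<odot> (x \<oplus> y) = c \<odot> x \<oplus> c \<odot> y"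
  using vs.smult_r_distr[of c x y] by simp
lemma smult_assoc: "x \<in> carrier A \<Longrightarrow> (c * d) \<odot> x = c \<odot> (d \<odot> x)"
  using vs.smult_assoc1[of c d x] by simp
lemma smult_one: "x \<in> carrier A \<Longrightarrow> 1 \<odot> x = x"
  using vs.smult_one[of x] by simp
lemma smult_zero: "x \<in> carrier A \<Longrightarrow> 0 \<odot> x = \<zero>"
  using smult_l_distr[of x 0 0] smult_closed[of x 0] by (simp add: add.l_cancel_one')
lemma smult_zero_right: "c \<odot> \<zero> = \<zero>"
  using smult_r_distr[of \<zero> \<zero> c] smult_closed[of \<zero> c] by (simp add: add.l_cancel_one')
lemma smult_minus_one: "x \<in> carrier A \<Longrightarrow> (- 1) \<odot> x = \<ominus> x"
  using smult_l_distr[of x "- 1" 1] smult_zero[of x] smult_closed[of x "- 1"] smult_one[of x]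
  by (metis add.inv_equality add.left_inverse)

lemma smult_finsum:
  "g \<in> J \<rightarrow> carrier A \<Longrightarrow> c \<odot> (\<Oplus>i\<in>J. g i) = (\<Oplus>i\<in>J. c \<odot> g i)"
  by (induction J rule: infinite_finite_induct)
     (auto simp: smult_zero_right smult_r_distr smult_closed Pi_def)

end

text \<open>Bases are handled as families for which this is a bijection (\<open>basis_iff_comb\<close>),
  which covers injectivity of the family, independence and spanning at once.\<close>
definition comb :: "('k::field, 'a, 'm) module_scheme \<Rightarrow> ('i \<Rightarrow> 'a) \<Rightarrow> ('i \<Rightarrow>\<^sub>0 'k) \<Rightarrow> 'a" where
  "comb A b c = (\<Oplus>\<^bsub>A\<^esub>i\<in>Poly_Mapping.keys c. Poly_Mapping.lookup c i \<odot>\<^bsub>A\<^esub> b i)"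

lemma vecs_induct [consumes 1, case_names zero add e]:
  assumes "c \<in> vecs I" "P 0" "\<And>x y. \<lbrakk>x \<in> vecs I; y \<in> vecs I; P x; P y\<rbrakk> \<Longrightarrow> P (x + y)"
    and "\<And>a i. i \<in> I \<Longrightarrow> P (scale a (e i))"
  shows "P c"
proof -
  have "P (\<Sum>i\<in>J. scale (Poly_Mapping.lookup c i) (e i)) \<and> (\<Sum>i\<in>J. scale (Poly_Mapping.lookup c i) (e i)) \<in> vecs I"
    if "finite J" "J \<subseteq> I" for J
    using that
    by (induction J rule: finite_induct) (auto simp: assms(2) vecs_zero intro!: assms(3,4) vecs_add vecs_scale vecs_e)
  from this[of "Poly_Mapping.keys c"] show ?thesis
    using assms(1) poly_sum[of c] unfolding vecs_def by simp
qed

context k_algebra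
begin

interpretation ring A by (rule ring)
interpretation vs: vectorspace "class_ring :: 'k ring" A by (rule vectorspace)

lemma comb_superset:
  assumes "finite J" "Poly_Mapping.keys c \<subseteq> J" "b \<in> J \<rightarrow> carrier A"
  shows "comb A b c = (\<Oplus>i\<in>J. Poly_Mapping.lookup c i \<odot> b i)"
  unfolding comb_def
  by (rule add.finprod_mono_neutral_cong_left)
     (use assms in \<open>auto simp: in_keys_iff smult_zero Pi_iff intro!: smult_closed\<close>)

lemma comb_closed: "\<lbrakk>c \<in> vecs I; b \<in> I \<rightarrow> carrier A\<rbrakk> \<Longrightarrow> comb A b c \<in> carrier A"
  unfolding comb_def vecs_def by (rule finsum_closed) (auto intro!: smult_closed)

lemma comb_zero: "comb A b 0 = \<zero>"
  unfolding comb_def by simp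

lemma comb_add:
  assumes "c \<in> vecs I" "c' \<in> vecs I" "b \<in> I \<rightarrow> carrier A"
  shows "comb A b (c + c') = comb A b c \<oplus> comb A b c'"
proof -
  let ?J = "Poly_Mapping.keys c \<union> Poly_Mapping.keys c'"
  have J: "finite ?J" "b \<in> ?J \<rightarrow> carrier A" using assms unfolding vecs_def by auto
  have k: "Poly_Mapping.keys (c + c') \<subseteq> ?J" by (rule keys_add)
  have "comb A b (c + c') = (\<Oplus>i\<in>?J. Poly_Mapping.lookup c i \<odot> b i \<oplus> Poly_Mapping.lookup c' i \<odot> b i)"
    unfolding comb_superset[OF J(1) k J(2)]
    by (rule finsum_cong') (use J in \<open>auto simp: lookup_add smult_l_distr Pi_iff intro!: smult_closed\<close>)
  also have "\<dots> = (\<Oplus>i\<in>?J. Poly_Mapping.lookup c i \<odot> b i) \<oplus> (\<Oplus>i\<in>?J. Poly_Mapping.lookup c' i \<odot> b i)"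
    by (rule finsum_addf) (use J in \<open>auto intro!: smult_closed\<close>)
  also have "\<dots> = comb A b c \<oplus> comb A b c'" using comb_superset[OF J(1) _ J(2)] by simp
  finally show ?thesis .
qed

lemma comb_scale:
  assumes "c \<in> vecs I" "b \<in> I \<rightarrow> carrier A"
  shows "comb A b (scale a c) = a \<odot> comb A b c"
proof -
  let ?J = "Poly_Mapping.keys c"
  have J: "finite ?J" "b \<in> ?J \<rightarrow> carrier A" using assms unfolding vecs_def by auto
  have "comb A b (scale a c) = (\<Oplus>i\<in>?J. a \<odot> (Poly_Mapping.lookup c i \<odot> b i))"
    unfolding comb_superset[OF J(1) keys_scale J(2)]
    by (rule finsum_cong') (use J in \<open>auto simp: lookup_scale smult_assoc Pi_iff intro!: smult_closed\<close>)
  also have "\<dots> = a \<odot> comb A b c"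
    unfolding comb_def by (rule smult_finsum[symmetric]) (use J in \<open>auto intro!: smult_closed\<close>)
  finally show ?thesis .
qed

lemma comb_e: "b i \<in> carrier A \<Longrightarrow> comb A b (e i) = b i"
  unfolding comb_def by (simp add: smult_one Pi_def)

lemma comb_linear_map:
  assumes "k_algebra B" "f \<in> k_linear A B" "c \<in> vecs I" "b \<in> I \<rightarrow> carrier A"
  shows "f (comb A b c) = comb B (\<lambda>i. f (b i)) c"
proof -
  interpret B: k_algebra B by fact
  interpret RB: ring B by (rule B.ring)
  have fb: "(\<lambda>i. f (b i)) \<in> I \<rightarrow> carrier B" using assms(2,4) unfolding k_linear_iff by auto
  have f0: "f \<zero> = \<zero>\<^bsub>B\<^esub>"
    using assms(2) smult_zero[of \<zero>] B.smult_zero[of "f \<zero>"] unfolding k_linear_iff by (metis zero_closed)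
  from assms(3) show ?thesis
  proof (induction c rule: vecs_induct)
    case zero
    then show ?case by (simp add: comb_zero B.comb_zero f0)
  next
    case (add x y)
    then show ?case
      using assms(2) comb_add[OF add(1,2) assms(4)] B.comb_add[OF add(1,2) fb] comb_closed[OF _ assms(4)]
      unfolding k_linear_iff by simp
  next
    case (e a i)
    then have bi: "b i \<in> carrier A" "f (b i) \<in> carrier B" using assms(4) fb by auto
    show ?case
      using assms(2) comb_scale[OF vecs_e[OF e] assms(4)] B.comb_scale[OF vecs_e[OF e] fb] bi
      unfolding k_linear_iff by (simp add: comb_e B.comb_e)
  qed
qed

lemma comb_k_linear: "b \<in> I \<rightarrow> carrier A \<Longrightarrow> \<lbrakk>c \<in> vecs I; c' \<in> vecs I\<rbrakk> \<Longrightarrow> comb A b (c - c') = comb A b c \<ominus> comb A b c'"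
proof -
  assume b: "b \<in> I \<rightarrow> carrier A" and c: "c \<in> vecs I" "c' \<in> vecs I"
  have "comb A b (c + scale (- 1) c') = comb A b c \<ominus> comb A b c'"
    unfolding comb_add[OF c(1) vecs_scale[OF c(2)] b] comb_scale[OF c(2) b]
      smult_minus_one[OF comb_closed[OF c(2) b]] a_minus_def ..
  moreover have "c + scale (- 1) c' = c - c'" by (simp add: pm.scale_minus_left)
  ultimately show ?thesis by simp
qed

lemma span_eq_comb:
  assumes "b \<in> I \<rightarrow> carrier A"
  shows "LinearCombinations.module.span (class_ring :: 'k ring) A (b ` I) = comb A b ` vecs I"
proof
  show "vs.span (b ` I) \<subseteq> comb A b ` vecs I"
  proof
    fix x assume "x \<in> vs.span (b ` I)"
    then obtain a S where x: "x = vs.lincomb a S" "finite S" "S \<subseteq> b ` I" unfolding vs.span_def by auto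
    have "\<exists>c\<in>vecs I. vs.lincomb a S = comb A b c" using x(2,3)
    proof (induction S rule: finite_induct)
      case empty
      show ?case by (rule bexI[OF _ vecs_zero]) (simp add: vs.lincomb_def comb_zero)
    next
      case (insert v S)
      then obtain c where c: "c \<in> vecs I" "vs.lincomb a S = comb A b c" by auto
      obtain i where i: "i \<in> I" "v = b i" using insert by auto
      have "vs.lincomb a (insert v S) = a v \<odot> v \<oplus> vs.lincomb a S"
        unfolding vs.lincomb_def by (rule finsum_insert) (use insert assms in \<open>auto intro!: smult_closed\<close>)
      also have "\<dots> = comb A b (scale (a v) (e i) + c)"
        using comb_add[OF vecs_scale[OF vecs_e[OF i(1)]] c(1) assms] comb_scale[OF vecs_e[OF i(1)] assms] i c assms
        by (simp add: comb_e Pi_def)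
      finally show ?case using vecs_add[OF vecs_scale[OF vecs_e[OF i(1)]] c(1)] by blast
    qed
    then show "x \<in> comb A b ` vecs I" using x(1) by blast
  qed
  show "comb A b ` vecs I \<subseteq> vs.span (b ` I)"
  proof
    fix x assume "x \<in> comb A b ` vecs I"
    then obtain c where c: "c \<in> vecs I" "x = comb A b c" by blast
    have sub: "submodule (class_ring :: 'k ring) (vs.span (b ` I)) A"
      by (rule vs.span_is_submodule) (use assms in auto)
    from c(1) have "comb A b c \<in> vs.span (b ` I)"
    proof (induction c rule: vecs_induct)
      case zero
      show ?case unfolding comb_zero vs.span_def
        by (rule CollectI, rule exI[of _ "\<lambda>_. 0"], rule exI[of _ "{}"]) (simp add: vs.lincomb_def)
    next
      case (add x y)
      then show ?case using sub unfolding comb_add[OF add(1,2) assms] submodule_def by blast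
    next
      case (e a i)
      have "b i \<in> vs.span (b ` I)" using vs.in_own_span[of "b ` I"] assms e by auto
      then show ?case
        using sub e assms unfolding comb_scale[OF vecs_e[OF e] assms] submodule_def by (simp add: comb_e Pi_def)
    qed
    then show "x \<in> vs.span (b ` I)" using c by simp
  qed
qed

lemma basis_iff_comb:
  assumes "b \<in> I \<rightarrow> carrier A"
  shows "inj_on b I \<and> vectorspace.basis (class_ring :: 'k ring) A (b ` I) \<longleftrightarrow> bij_betw (comb A b) (vecs I) (carrier A)"
proof
  assume a: "inj_on b I \<and> vs.basis (b ` I)"
  have im: "comb A b ` vecs I = carrier A"
    using a span_eq_comb[OF assms] unfolding vs.basis_def by simp
  have "inj_on (comb A b) (vecs I)"
  proof (rule inj_onI)
    fix c c' assume c: "c \<in> vecs I" "c' \<in> vecs I" "comb A b c = comb A b c'"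
    define g where "g = c - c'"
    have g: "g \<in> vecs I" using vecs_add[OF c(1) vecs_scale[OF c(2), of "- 1"]] unfolding g_def
      by (simp add: pm.scale_minus_left)
    have z: "comb A b g = \<zero>"
      unfolding g_def comb_k_linear[OF assms c(1,2)] c(3) using comb_closed[OF c(2) assms] by (simp add: a_minus_def r_neg)
    have inj: "inj_on b (Poly_Mapping.keys g)" using a g unfolding vecs_def by (auto intro: inj_on_subset)
    let ?a = "\<lambda>v. Poly_Mapping.lookup g (the_inv_into (Poly_Mapping.keys g) b v)"
    have "vs.lincomb ?a (b ` Poly_Mapping.keys g) = (\<Oplus>i\<in>Poly_Mapping.keys g. ?a (b i) \<odot> b i)"
      unfolding vs.lincomb_def
      by (rule finsum_reindex) (use g assms inj in \<open>auto simp: vecs_def intro!: smult_closed\<close>)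
    also have "\<dots> = comb A b g"
      unfolding comb_def
      by (rule finsum_cong') (use g assms inj in \<open>auto simp: vecs_def the_inv_into_f_f intro!: smult_closed\<close>)
    finally have l: "vs.lincomb ?a (b ` Poly_Mapping.keys g) = \<zero>" using z by simp
    have "Poly_Mapping.keys g = {}"
    proof (rule ccontr)
      assume "Poly_Mapping.keys g \<noteq> {}"
      then obtain i where i: "i \<in> Poly_Mapping.keys g" by blast
      have "vs.lin_dep (b ` I)"
        unfolding vs.lin_dep_def
        by (rule exI[of _ "b ` Poly_Mapping.keys g"], rule exI[of _ ?a], rule exI[of _ "b i"])
           (use i g inj l in \<open>auto simp: vecs_def the_inv_into_f_f in_keys_iff\<close>)
      then show False using a unfolding vs.basis_def by simp
    qed
    then have "g = 0" by simp
    then show "c = c'" unfolding g_def by simp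
  qed
  then show "bij_betw (comb A b) (vecs I) (carrier A)" using im unfolding bij_betw_def by blast
next
  assume bij: "bij_betw (comb A b) (vecs I) (carrier A)"
  have inj: "inj_on (comb A b) (vecs I)" and im: "comb A b ` vecs I = carrier A" using bij unfolding bij_betw_def by auto
  have injb: "inj_on b I"
  proof (rule inj_onI)
    fix i j assume i: "i \<in> I" "j \<in> I" "b i = b j"
    have "comb A b (e i) = comb A b (e j)" using i assms by (simp add: comb_e Pi_def)
    then have "e i = (e j :: _ \<Rightarrow>\<^sub>0 'k)" using inj vecs_e[OF i(1)] vecs_e[OF i(2)] by (auto dest: inj_onD)
    then show "i = j" by (metis lookup_single_eq lookup_single_not_eq zero_neq_one)
  qed
  have "\<not> vs.lin_dep (b ` I)"
  proof
    assume "vs.lin_dep (b ` I)"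
    then obtain S a v where S: "finite S" "S \<subseteq> b ` I" "vs.lincomb a S = \<zero>" "v \<in> S" "a v \<noteq> 0"
      unfolding vs.lin_dep_def by auto
    let ?J = "{i \<in> I. b i \<in> S}"
    have J: "finite ?J" using finite_vimage_IntI[OF S(1) injb] by (simp add: vimage_def Int_def conj_commute)
    have bJ: "b ` ?J = S" using S(2) by auto
    define c where "c = (\<Sum>i\<in>?J. scale (a (b i)) (e i))"
    have c: "c \<in> vecs I" unfolding c_def by (rule vecs_sum, rule vecs_scale, rule vecs_e) auto
    have lk: "Poly_Mapping.lookup c i = (if i \<in> ?J then a (b i) else 0)" for i
      unfolding c_def lookup_sum lookup_scale lookup_single
      using J by (simp add: when_def if_distrib cong: if_cong)
    have "comb A b c = (\<Oplus>i\<in>?J. a (b i) \<odot> b i)"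
      by (subst comb_superset[OF J])
         (use assms lk in \<open>auto simp: in_keys_iff intro!: finsum_cong' smult_closed split: if_splits\<close>)
    also have "\<dots> = vs.lincomb a (b ` ?J)"
      unfolding vs.lincomb_def
      by (rule finsum_reindex[symmetric]) (use assms injb in \<open>auto intro!: smult_closed intro: inj_on_subset\<close>)
    finally have "comb A b c = comb A b 0" using S(3) bJ by (simp add: comb_zero)
    then have "c = 0" using inj c vecs_zero by (auto dest: inj_onD)
    have "v \<in> b ` ?J" using S(4) bJ by simp
    then obtain i where "v = b i" "i \<in> ?J" by (rule imageE)
    then show False using lk[of i] \<open>c = 0\<close> S(5) by simp
  qed
  then show "inj_on b I \<and> vs.basis (b ` I)"
    using injb im span_eq_comb[OF assms] assms unfolding vs.basis_def by (intro conjI) (simp_all add: funcset_image)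
qed

end

section \<open>Monoid algebras and quotients\<close>

text \<open>The bilinear map sending the pair of basis vectors \<open>i\<close>, \<open>j\<close> to the
  basis vector \<open>\<pi> i j\<close>. It describes the product of a monoid algebra, tensor products
  of coordinate vectors, and concatenation of words.\<close>
definition tens :: "('i \<Rightarrow> 'j \<Rightarrow> 'l) \<Rightarrow> ('i \<Rightarrow>\<^sub>0 'k::field) \<Rightarrow> ('j \<Rightarrow>\<^sub>0 'k) \<Rightarrow> ('l \<Rightarrow>\<^sub>0 'k)" where
  "tens \<pi> x y = lin_ext (\<lambda>i. lin_ext (\<lambda>j. e (\<pi> i j)) y) x"

lemma tens_add_left: "tens \<pi> (x + x') y = tens \<pi> x y + tens \<pi> x' y"
  unfolding tens_def by (rule lin_ext_add)

lemma tens_scale_left: "tens \<pi> (scale c x) y = scale c (tens \<pi> x y)"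
  unfolding tens_def by (rule lin_ext_scale)

lemma tens_add_right: "tens \<pi> x (y + y') = tens \<pi> x y + tens \<pi> x y'"
  unfolding tens_def lin_ext_add by (simp add: lin_ext_def pm.scale_right_distrib sum.distrib)

lemma tens_scale_right: "tens \<pi> x (scale c y) = scale c (tens \<pi> x y)"
  unfolding tens_def lin_ext_scale by (simp add: lin_ext_def pm.scale_sum_right mult.left_commute)

lemma tens_e: "tens \<pi> (e i) (e j) = e (\<pi> i j)"
  unfolding tens_def lin_ext_e ..

lemma tens_zero: "tens \<pi> 0 y = 0" "tens \<pi> x 0 = 0"
  unfolding tens_def lin_ext_zero by (simp_all add: lin_ext_def)

lemmas tens_simps = tens_add_left tens_scale_left tens_add_right tens_scale_right tens_e tens_zero

lemma tens_vecs:
  "\<lbrakk>x \<in> vecs I; y \<in> vecs J; \<And>i j. \<lbrakk>i \<in> I; j \<in> J\<rbrakk> \<Longrightarrow> \<pi> i j \<in> B\<rbrakk> \<Longrightarrow> tens \<pi> x y \<in> vecs B"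
  unfolding tens_def by (intro vecs_lin_ext vecs_e) auto

lemma monoid_alg_mult: "x \<otimes>\<^bsub>monoid_alg G\<^esub> y = tens (mult G) x y"
proof -
  have "Poly_Mapping.single (p \<otimes>\<^bsub>G\<^esub> r) (a * b) = scale a (scale b (e (p \<otimes>\<^bsub>G\<^esub> r)))" for p r and a b :: 'b
    by (simp add: scale_single)
  then show ?thesis
    unfolding monoid_alg_def tens_def lin_ext_def by (simp add: pm.scale_sum_right)
qed

lemma monoid_alg_simps:
  "carrier (monoid_alg G) = vecs (carrier G)" "one (monoid_alg G) = e \<one>\<^bsub>G\<^esub>" "zero (monoid_alg G) = 0"
  "add (monoid_alg G) = (+)" "smult (monoid_alg G) = scale"
  unfolding monoid_alg_def vecs_def by simp_all

lemma k_algebra_monoid_alg: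
  assumes "Group.monoid G" shows "k_algebra (monoid_alg G :: ('k::field, _) module)"
proof -
  interpret G: Group.monoid G by fact
  let ?F = "monoid_alg G :: ('k, _) module"
  let ?V = "vecs (carrier G) :: ('a \<Rightarrow>\<^sub>0 'k) set"
  have closed: "tens (mult G) x y \<in> ?V" if "x \<in> ?V" "y \<in> ?V" for x y
    by (rule tens_vecs[OF that]) simp
  have assoc: "tens (mult G) (tens (mult G) x y) z = tens (mult G) x (tens (mult G) y z)"
    if x: "x \<in> ?V" and y: "y \<in> ?V" and z: "z \<in> ?V" for x y z
    using x
  proof (induction x rule: vecs_induct)
    case (e a p)
    from y show ?case
    proof (induction y rule: vecs_induct)
      case (e b r)
      from z show ?case
        by (induction z rule: vecs_induct)
           (use e \<open>p \<in> carrier G\<close> in \<open>simp_all add: tens_simps G.m_assoc mult.commute mult.left_commute del: pm.scale_cancel_left\<close>)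
    qed (simp_all add: tens_simps pm.scale_right_distrib del: pm.scale_cancel_left)
  qed (simp_all add: tens_simps del: pm.scale_cancel_left)
  have one: "tens (mult G) (e \<one>\<^bsub>G\<^esub>) x = x" "tens (mult G) x (e \<one>\<^bsub>G\<^esub>) = x" if "x \<in> ?V" for x
    using that by (induction x rule: vecs_induct) (simp_all add: tens_simps)
  have um: "- x \<in> ?V" if "x \<in> ?V" for x
    using vecs_scale[OF that, of "- 1"] by (simp add: pm.scale_minus_left)
  have "ring ?F"
  proof (rule ringI)
    show "abelian_group ?F"
      by (rule abelian_groupI) (auto simp: monoid_alg_simps vecs_zero vecs_add ac_simps intro!: bexI[OF _ um])
    show "Group.monoid ?F"
      by (rule monoidI) (auto simp: monoid_alg_simps monoid_alg_mult closed assoc one vecs_e)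
  qed (auto simp: monoid_alg_simps monoid_alg_mult tens_simps)
  then show ?thesis
    by (rule k_algebraI) (auto simp: monoid_alg_simps monoid_alg_mult tens_simps vecs_scale pm.scale_left_distrib
        pm.scale_right_distrib)
qed

lemma (in k_algebra) ideal_smult:
  assumes "ideal I A" "x \<in> I" shows "c \<odot> x \<in> I"
proof -
  interpret ring A by (rule ring)
  interpret ideal I A by fact
  have "c \<odot> \<one> \<otimes> x \<in> I" using I_l_closed[OF assms(2) smult_closed] by simp
  then show ?thesis using smult_mult_left[of \<one> x c] a_subset assms(2) by auto
qed

lemma quot_alg_simps:
  "carrier (quot_alg A I) = a_rcosets\<^bsub>A\<^esub> I" "mult (quot_alg A I) = rcoset_mult A I"
  "one (quot_alg A I) = I +>\<^bsub>A\<^esub> \<one>\<^bsub>A\<^esub>" "zero (quot_alg A I) = I" "add (quot_alg A I) = (<+>\<^bsub>A\<^esub>)"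
  unfolding quot_alg_def FactRing_def by simp_all

lemma quot_alg_carrier: "X \<in> carrier (quot_alg A I) \<longleftrightarrow> (\<exists>x\<in>carrier A. X = I +>\<^bsub>A\<^esub> x)"
  unfolding quot_alg_simps A_RCOSETS_def' by auto

context k_algebra
begin

interpretation ring A by (rule ring)

lemma quot_alg_ops:
  assumes I: "ideal I A" and x: "x \<in> carrier A" and y: "y \<in> carrier A"
  shows "(I +> x) \<otimes>\<^bsub>quot_alg A I\<^esub> (I +> y) = I +> (x \<otimes> y)"
    "(I +> x) \<oplus>\<^bsub>quot_alg A I\<^esub> (I +> y) = I +> (x \<oplus> y)"
    "c \<odot>\<^bsub>quot_alg A I\<^esub> (I +> x) = I +> (c \<odot> x)"
proof -
  interpret I: ideal I A by fact
  show "(I +> x) \<otimes>\<^bsub>quot_alg A I\<^esub> (I +> y) = I +> (x \<otimes> y)"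
    unfolding quot_alg_simps by (rule I.rcoset_mult_add[OF x y])
  show "(I +> x) \<oplus>\<^bsub>quot_alg A I\<^esub> (I +> y) = I +> (x \<oplus> y)"
    unfolding quot_alg_simps by (rule I.a_rcos_sum[OF x y])
  have "I +> (c \<odot> x') = I +> (c \<odot> x)" if "x' \<in> I +> x" for x'
  proof -
    obtain i where i: "i \<in> I" "x' = i \<oplus> x" using \<open>x' \<in> I +> x\<close> unfolding a_r_coset_def' by auto
    have ic: "i \<in> carrier A" using i I.a_subset by auto
    have "c \<odot> x' = c \<odot> i \<oplus> c \<odot> x" using i ic x by (simp add: smult_r_distr)
    then have "c \<odot> x' \<in> I +> (c \<odot> x)" using ideal_smult[OF I i(1)] unfolding a_r_coset_def' by auto
    then show ?thesis using I.a_repr_independence'[of "c \<odot> x'" "c \<odot> x"] smult_closed[OF x] by simp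
  qed
  then have "(\<Union>x'\<in>I +> x. I +> (c \<odot> x')) = I +> (c \<odot> x)"
    by (intro UN_constant_eq[OF I.a_rcos_self[OF x]] ballI)
  then show "c \<odot>\<^bsub>quot_alg A I\<^esub> (I +> x) = I +> (c \<odot> x)" by (simp add: quot_alg_def)
qed

lemma k_algebra_quot_alg:
  assumes I: "ideal I A" shows "k_algebra (quot_alg A I)"
proof (rule k_algebraI)
  interpret I: ideal I A by fact
  note ops = quot_alg_ops[OF I]
  have zero: "zero (quot_alg A I) = I +> \<zero>"
    unfolding quot_alg_simps using a_coset_add_zero[OF I.a_subset] by simp
  have one: "one (quot_alg A I) = I +> \<one>" by (rule quot_alg_simps)
  show "ring (quot_alg A I)"
  proof (rule ringI)
    show "abelian_group (quot_alg A I)"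
    proof (rule abelian_groupI)
      fix X assume "X \<in> carrier (quot_alg A I)"
      then obtain x where x: "x \<in> carrier A" "X = I +> x" unfolding quot_alg_carrier by blast
      show "\<exists>Y\<in>carrier (quot_alg A I). Y \<oplus>\<^bsub>quot_alg A I\<^esub> X = \<zero>\<^bsub>quot_alg A I\<^esub>"
        by (rule bexI[of _ "I +> (\<ominus> x)"]) (use x in \<open>auto simp: ops zero quot_alg_carrier l_neg\<close>)
    qed (auto simp: quot_alg_carrier ops zero a_ac)
    show "Group.monoid (quot_alg A I)"
      by (rule monoidI) (auto simp: quot_alg_carrier ops one m_assoc)
  qed (auto simp: quot_alg_carrier ops l_distr r_distr)
qed (auto simp: quot_alg_carrier quot_alg_ops[OF I] smult_closed smult_l_distr smult_r_distr smult_assoc smult_one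
      smult_mult_left smult_mult_right)

end

section \<open>Tensor products\<close>

lemma lin_ext_sum: "lin_ext f (\<Sum>p\<in>J. h p) = (\<Sum>p\<in>J. lin_ext f (h p))"
  by (induction J rule: infinite_finite_induct) (auto simp: lin_ext_zero lin_ext_add)

lemma lin_ext_lin_ext: "lin_ext f (lin_ext g x) = lin_ext (\<lambda>p. lin_ext f (g p)) x"
  unfolding lin_ext_def[of _ x] by (simp add: lin_ext_sum lin_ext_scale)

lemma lin_ext_cong_vecs: "\<lbrakk>x \<in> vecs I; \<And>p. p \<in> I \<Longrightarrow> f p = g p\<rbrakk> \<Longrightarrow> lin_ext f x = lin_ext g x"
  unfolding lin_ext_def vecs_def by (intro sum.cong refl arg_cong[where f = "scale _"]) auto

lemma vecs_uminus: "x \<in> vecs I \<Longrightarrow> - x \<in> vecs I"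
  using vecs_scale[of x I "- 1"] by (simp add: pm.scale_minus_left)

lemma vecs_diff: "\<lbrakk>x \<in> vecs I; y \<in> vecs I\<rbrakk> \<Longrightarrow> x - y \<in> vecs I"
  using vecs_add[of x I "- y"] vecs_uminus[of y I] by simp

lemma lin_ext_uminus: "lin_ext f (- x) = - lin_ext f x"
  using lin_ext_scale[of f "- 1" x] by (simp add: pm.scale_minus_left)

lemma lin_ext_diff: "lin_ext f (x - y) = lin_ext f x - lin_ext f y"
  using lin_ext_add[of f x "- y"] lin_ext_uminus[of f y] by simp

text \<open>Maps with values in a free vector space are enough to separate the elements of a tensor
  product, since coordinates are of this kind.\<close>
definition bilin ::
    "('k::field, 'a, 'm) module_scheme \<Rightarrow> ('k, 'b, 'n) module_scheme \<Rightarrow> ('a \<Rightarrow> 'b \<Rightarrow> ('y \<Rightarrow>\<^sub>0 'k)) \<Rightarrow> bool" where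
  "bilin A B \<beta> \<longleftrightarrow>
    (\<forall>a\<in>carrier A. \<forall>a'\<in>carrier A. \<forall>b\<in>carrier B. \<beta> (a \<oplus>\<^bsub>A\<^esub> a') b = \<beta> a b + \<beta> a' b) \<and>
    (\<forall>a\<in>carrier A. \<forall>b\<in>carrier B. \<forall>b'\<in>carrier B. \<beta> a (b \<oplus>\<^bsub>B\<^esub> b') = \<beta> a b + \<beta> a b') \<and>
    (\<forall>c. \<forall>a\<in>carrier A. \<forall>b\<in>carrier B. \<beta> (c \<odot>\<^bsub>A\<^esub> a) b = scale c (\<beta> a b)) \<and>
    (\<forall>c. \<forall>a\<in>carrier A. \<forall>b\<in>carrier B. \<beta> a (c \<odot>\<^bsub>B\<^esub> b) = scale c (\<beta> a b))"

lemma coordinates: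
  fixes A :: "('k::field, 'c, 'l) module_scheme"
  assumes "k_algebra A" "b \<in> I \<rightarrow> carrier A" "bij_betw (comb A b) (vecs I) (carrier A)"
  defines "\<kappa> \<equiv> inv_into (vecs I) (comb A b)"
  shows "a \<in> carrier A \<Longrightarrow> \<kappa> a \<in> vecs I" "a \<in> carrier A \<Longrightarrow> comb A b (\<kappa> a) = a"
    "x \<in> vecs I \<Longrightarrow> \<kappa> (comb A b x) = x"
    "\<lbrakk>a \<in> carrier A; a' \<in> carrier A\<rbrakk> \<Longrightarrow> \<kappa> (a \<oplus>\<^bsub>A\<^esub> a') = \<kappa> a + \<kappa> a'"
    "a \<in> carrier A \<Longrightarrow> \<kappa> (c \<odot>\<^bsub>A\<^esub> a) = scale c (\<kappa> a)"
proof -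
  interpret A: k_algebra A by fact
  show 1: "a \<in> carrier A \<Longrightarrow> \<kappa> a \<in> vecs I" for a
    using assms(3) unfolding \<kappa>_def bij_betw_def by (metis inv_into_into)
  show 2: "a \<in> carrier A \<Longrightarrow> comb A b (\<kappa> a) = a" for a
    using assms(3) unfolding \<kappa>_def bij_betw_def by (metis f_inv_into_f)
  show 3: "x \<in> vecs I \<Longrightarrow> \<kappa> (comb A b x) = x" for x
    using assms(3) unfolding \<kappa>_def bij_betw_def by (metis inv_into_f_f)
  show "\<kappa> (a \<oplus>\<^bsub>A\<^esub> a') = \<kappa> a + \<kappa> a'" if "a \<in> carrier A" "a' \<in> carrier A"
    using 3[OF vecs_add[OF 1[OF that(1)] 1[OF that(2)]]] A.comb_add[OF 1[OF that(1)] 1[OF that(2)] assms(2)] 2 that by simp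
  show "\<kappa> (c \<odot>\<^bsub>A\<^esub> a) = scale c (\<kappa> a)" if "a \<in> carrier A"
    using 3[OF vecs_scale[OF 1[OF that]]] A.comb_scale[OF 1[OF that] assms(2)] 2 that by simp
qed

locale algebra_pair = A: k_algebra A + B: k_algebra B
  for A :: "('k::field, 'a, 'm) module_scheme" and B :: "('k, 'b, 'n) module_scheme"
begin

interpretation RA: ring A by (rule A.ring)
interpretation RB: ring B by (rule B.ring)

abbreviation FF :: "('k, ('a \<times> 'b) \<Rightarrow>\<^sub>0 'k) module" where
  "FF \<equiv> monoid_alg (A \<times>\<times> B)"

abbreviation AB :: "('a \<times> 'b) set" where
  "AB \<equiv> carrier A \<times> carrier B"

lemma carrier_AB: "carrier (A \<times>\<times> B) = AB"
  by simp

lemma FF_algebra: "k_algebra FF"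
  by (rule k_algebra_monoid_alg, rule DirProd_monoid) unfold_locales

interpretation FF: k_algebra FF by (rule FF_algebra)
interpretation RF: ring FF by (rule FF.ring)

lemma tensor_rels_closed: "tensor_rels A B \<subseteq> carrier FF"
proof -
  have s: "Poly_Mapping.single p c \<in> vecs AB" if "p \<in> AB" for p and c :: 'k
    using that unfolding vecs_def by auto
  show ?thesis
    unfolding tensor_rels_def monoid_alg_simps carrier_AB
    by (auto intro!: vecs_diff s A.smult_closed B.smult_closed)
qed

lemma tensor_ideal: "ideal (tensor_ideal A B) FF"
  unfolding tensor_ideal_def by (rule RF.genideal_ideal[OF tensor_rels_closed])

lemma bilin_mult:
  assumes "bilin A B \<beta>" "a0 \<in> carrier A" "b0 \<in> carrier B"
  shows "bilin A B (\<lambda>a b. \<beta> (a0 \<otimes>\<^bsub>A\<^esub> a) (b0 \<otimes>\<^bsub>B\<^esub> b))" "bilin A B (\<lambda>a b. \<beta> (a \<otimes>\<^bsub>A\<^esub> a0) (b \<otimes>\<^bsub>B\<^esub> b0))"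
  using assms unfolding bilin_def
  by (simp_all add: RA.r_distr RB.r_distr RA.l_distr RB.l_distr A.smult_mult_right B.smult_mult_right
      A.smult_mult_left B.smult_mult_left)

text \<open>The elements killed by \<^emph>\<open>all\<close> bilinear maps form a two-sided ideal,
  because multiplying the arguments of a bilinear map by fixed elements gives a bilinear map. The ideal
  contains the relations. For a single \<open>\<beta>\<close> the kernel would only be a subspace.\<close>
lemma bilin_tensor_ideal:
  fixes \<beta> :: "'a \<Rightarrow> 'b \<Rightarrow> ('y \<Rightarrow>\<^sub>0 'k)"
  assumes "bilin A B \<beta>" "x \<in> tensor_ideal A B"
  shows "lin_ext (case_prod \<beta>) x = 0"
proof -
  define N where "N = {x \<in> vecs AB. \<forall>\<beta> :: 'a \<Rightarrow> 'b \<Rightarrow> ('y \<Rightarrow>\<^sub>0 'k). bilin A B \<beta> \<longrightarrow> lin_ext (case_prod \<beta>) x = 0}"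
  have N0: "0 \<in> N" unfolding N_def by (simp add: vecs_zero lin_ext_zero)
  have N_add: "x + y \<in> N" if "x \<in> N" "y \<in> N" for x y
    using that unfolding N_def by (simp add: vecs_add lin_ext_add)
  have N_scale: "scale c x \<in> N" if "x \<in> N" for x c
    using that unfolding N_def by (simp add: vecs_scale lin_ext_scale)
  have N_left: "tens (mult (A \<times>\<times> B)) y x \<in> N" if x: "x \<in> N" and y: "y \<in> vecs AB" for x y
    using y
  proof (induction y rule: vecs_induct)
    case (e c p)
    obtain a0 b0 where p: "p = (a0, b0)" "a0 \<in> carrier A" "b0 \<in> carrier B" using e by auto
    have "tens (mult (A \<times>\<times> B)) (e p) x \<in> vecs AB"
      by (rule tens_vecs[OF vecs_e]) (use p x in \<open>auto simp: N_def\<close>)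
    moreover have "lin_ext (case_prod \<beta>) (tens (mult (A \<times>\<times> B)) (e p) x) = 0" if "bilin A B \<beta>" for \<beta> :: "'a \<Rightarrow> 'b \<Rightarrow> ('y \<Rightarrow>\<^sub>0 'k)"
    proof -
      have "lin_ext (case_prod \<beta>) (tens (mult (A \<times>\<times> B)) (e p) x)
          = lin_ext (\<lambda>(a, b). \<beta> (a0 \<otimes>\<^bsub>A\<^esub> a) (b0 \<otimes>\<^bsub>B\<^esub> b)) x"
        unfolding tens_def lin_ext_e lin_ext_lin_ext p by (rule arg_cong2[where f = lin_ext]) (auto simp: lin_ext_e)
      then show ?thesis using x bilin_mult(1)[OF that p(2,3)] unfolding N_def by simp
    qed
    ultimately have "tens (mult (A \<times>\<times> B)) (e p) x \<in> N" unfolding N_def by blast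
    then show ?case by (simp add: tens_scale_left N_scale)
  qed (simp_all add: tens_simps N0 N_add)
  have N_right: "tens (mult (A \<times>\<times> B)) x y \<in> N" if x: "x \<in> N" and y: "y \<in> vecs AB" for x y
    using y
  proof (induction y rule: vecs_induct)
    case (e c p)
    obtain a0 b0 where p: "p = (a0, b0)" "a0 \<in> carrier A" "b0 \<in> carrier B" using e by auto
    have "tens (mult (A \<times>\<times> B)) x (e p) \<in> vecs AB"
      by (rule tens_vecs[OF _ vecs_e]) (use p x in \<open>auto simp: N_def\<close>)
    moreover have "lin_ext (case_prod \<beta>) (tens (mult (A \<times>\<times> B)) x (e p)) = 0" if "bilin A B \<beta>" for \<beta> :: "'a \<Rightarrow> 'b \<Rightarrow> ('y \<Rightarrow>\<^sub>0 'k)"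
    proof -
      have "lin_ext (case_prod \<beta>) (tens (mult (A \<times>\<times> B)) x (e p))
          = lin_ext (\<lambda>(a, b). \<beta> (a \<otimes>\<^bsub>A\<^esub> a0) (b \<otimes>\<^bsub>B\<^esub> b0)) x"
        unfolding tens_def lin_ext_e lin_ext_lin_ext p by (rule arg_cong2[where f = lin_ext]) (auto simp: lin_ext_e)
      then show ?thesis using x bilin_mult(2)[OF that p(2,3)] unfolding N_def by simp
    qed
    ultimately have "tens (mult (A \<times>\<times> B)) x (e p) \<in> N" unfolding N_def by blast
    then show ?case by (simp add: tens_scale_right N_scale)
  qed (simp_all add: tens_simps N0 N_add)
  have "ideal N FF"
  proof (rule idealI[OF RF.ring_axioms])
    show "subgroup N (add_monoid FF)"
    proof (rule RF.add.subgroupI)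
      fix x assume x: "x \<in> N"
      have "\<ominus>\<^bsub>FF\<^esub> x = - x"
        by (rule RF.minus_equality) (use x in \<open>auto simp: monoid_alg_simps N_def vecs_uminus\<close>)
      then show "\<ominus>\<^bsub>FF\<^esub> x \<in> N" using N_scale[OF x, of "- 1"] by (simp add: pm.scale_minus_left)
    qed (use N0 N_add in \<open>auto simp: monoid_alg_simps N_def\<close>)
  qed (use N_left N_right in \<open>auto simp: monoid_alg_simps monoid_alg_mult\<close>)
  moreover have "tensor_rels A B \<subseteq> N"
  proof -
    have "lin_ext (case_prod \<beta>) x = 0" if b: "bilin A B \<beta>" and "x \<in> tensor_rels A B" for x and \<beta> :: "'a \<Rightarrow> 'b \<Rightarrow> ('y \<Rightarrow>\<^sub>0 'k)"
      using that(2) b unfolding tensor_rels_def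
      by (auto simp: lin_ext_diff lin_ext_single bilin_def)
    then show ?thesis using tensor_rels_closed unfolding N_def monoid_alg_simps carrier_AB by blast
  qed
  ultimately have "tensor_ideal A B \<subseteq> N"
    unfolding tensor_ideal_def by (rule RF.genideal_minimal)
  then show ?thesis using assms unfolding N_def by blast
qed

abbreviation TT where "TT \<equiv> tensor_alg A B"

abbreviation coset :: "('a \<times> 'b \<Rightarrow>\<^sub>0 'k) \<Rightarrow> ('a \<times> 'b \<Rightarrow>\<^sub>0 'k) set" where
  "coset x \<equiv> tensor_ideal A B +>\<^bsub>FF\<^esub> x"

lemma k_algebra_tensor: "k_algebra TT"
  unfolding tensor_alg_def by (rule FF.k_algebra_quot_alg[OF tensor_ideal])

interpretation TT: k_algebra TT by (rule k_algebra_tensor)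
interpretation RT: ring TT by (rule TT.ring)

lemma coset_ops:
  assumes "x \<in> vecs AB" "y \<in> vecs AB"
  shows "coset x \<otimes>\<^bsub>TT\<^esub> coset y = coset (tens (mult (A \<times>\<times> B)) x y)"
    "coset x \<oplus>\<^bsub>TT\<^esub> coset y = coset (x + y)"
  using FF.quot_alg_ops[OF tensor_ideal, of x y] assms
  unfolding tensor_alg_def by (simp_all add: monoid_alg_simps monoid_alg_mult)

lemma coset_smult: "x \<in> vecs AB \<Longrightarrow> c \<odot>\<^bsub>TT\<^esub> coset x = coset (scale c x)"
  using FF.quot_alg_ops(3)[OF tensor_ideal, of x x c]
  unfolding tensor_alg_def by (simp add: monoid_alg_simps)

lemma tensor_carrier: "X \<in> carrier TT \<longleftrightarrow> (\<exists>x\<in>vecs AB. X = coset x)"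
  unfolding tensor_alg_def quot_alg_carrier by (simp add: monoid_alg_simps)

lemma tensor_elem_coset: "tensor_elem A B a b = coset (e (a, b))"
  unfolding tensor_elem_def ..

lemma tensor_elem_closed: "\<lbrakk>a \<in> carrier A; b \<in> carrier B\<rbrakk> \<Longrightarrow> tensor_elem A B a b \<in> carrier TT"
  unfolding tensor_elem_coset tensor_carrier by (blast intro: vecs_e)

lemma coset_eqI:
  assumes "x \<in> vecs AB" "y \<in> vecs AB" "x - y \<in> tensor_ideal A B"
  shows "coset x = coset y"
proof -
  interpret I: ideal "tensor_ideal A B" FF by (rule tensor_ideal)
  have "x \<in> coset y"
    unfolding a_r_coset_def' using assms by (auto simp: monoid_alg_simps intro!: bexI[of _ "x - y"])
  then show ?thesis using I.a_repr_independence'[of x y] assms by (simp add: monoid_alg_simps)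
qed

lemma rels_in_ideal: "r \<in> tensor_rels A B \<Longrightarrow> r \<in> tensor_ideal A B"
  unfolding tensor_ideal_def using RF.genideal_self[OF tensor_rels_closed] by blast

lemma tensor_elem_add_left:
  assumes "a \<in> carrier A" "a' \<in> carrier A" "b \<in> carrier B"
  shows "tensor_elem A B (a \<oplus>\<^bsub>A\<^esub> a') b = tensor_elem A B a b \<oplus>\<^bsub>TT\<^esub> tensor_elem A B a' b"
proof -
  have "e (a \<oplus>\<^bsub>A\<^esub> a', b) - e (a, b) - e (a', b) \<in> tensor_rels A B"
    using assms unfolding tensor_rels_def by blast
  then have "coset (e (a \<oplus>\<^bsub>A\<^esub> a', b)) = coset (e (a, b) + e (a', b))"
    using assms by (intro coset_eqI vecs_add vecs_e) (auto simp: diff_diff_eq dest: rels_in_ideal)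
  then show ?thesis unfolding tensor_elem_coset using assms by (simp add: coset_ops coset_smult vecs_e)
qed

lemma tensor_elem_add_right:
  assumes "a \<in> carrier A" "b \<in> carrier B" "b' \<in> carrier B"
  shows "tensor_elem A B a (b \<oplus>\<^bsub>B\<^esub> b') = tensor_elem A B a b \<oplus>\<^bsub>TT\<^esub> tensor_elem A B a b'"
proof -
  have "e (a, b \<oplus>\<^bsub>B\<^esub> b') - e (a, b) - e (a, b') \<in> tensor_rels A B"
    using assms unfolding tensor_rels_def by blast
  then have "coset (e (a, b \<oplus>\<^bsub>B\<^esub> b')) = coset (e (a, b) + e (a, b'))"
    using assms by (intro coset_eqI vecs_add vecs_e) (auto simp: diff_diff_eq dest: rels_in_ideal)
  then show ?thesis unfolding tensor_elem_coset using assms by (simp add: coset_ops coset_smult vecs_e)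
qed

lemma tensor_elem_smult_left:
  assumes "a \<in> carrier A" "b \<in> carrier B"
  shows "tensor_elem A B (c \<odot>\<^bsub>A\<^esub> a) b = c \<odot>\<^bsub>TT\<^esub> tensor_elem A B a b"
proof -
  have "e (c \<odot>\<^bsub>A\<^esub> a, b) - Poly_Mapping.single (a, b) c \<in> tensor_rels A B"
    using assms unfolding tensor_rels_def by blast
  then have "coset (e (c \<odot>\<^bsub>A\<^esub> a, b)) = coset (scale c (e (a, b)))"
    using assms by (intro coset_eqI vecs_scale vecs_e) (auto simp: scale_single A.smult_closed dest: rels_in_ideal)
  then show ?thesis unfolding tensor_elem_coset using assms by (simp add: coset_ops coset_smult vecs_e)
qed

lemma tensor_elem_smult_right:
  assumes "a \<in> carrier A" "b \<in> carrier B"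
  shows "tensor_elem A B a (c \<odot>\<^bsub>B\<^esub> b) = c \<odot>\<^bsub>TT\<^esub> tensor_elem A B a b"
proof -
  have "e (a, c \<odot>\<^bsub>B\<^esub> b) - Poly_Mapping.single (a, b) c \<in> tensor_rels A B"
    using assms unfolding tensor_rels_def by blast
  then have "coset (e (a, c \<odot>\<^bsub>B\<^esub> b)) = coset (scale c (e (a, b)))"
    using assms by (intro coset_eqI vecs_scale vecs_e) (auto simp: scale_single B.smult_closed dest: rels_in_ideal)
  then show ?thesis unfolding tensor_elem_coset using assms by (simp add: coset_ops coset_smult vecs_e)
qed

lemma tensor_elem_mult:
  "\<lbrakk>a \<in> carrier A; b \<in> carrier B; a' \<in> carrier A; b' \<in> carrier B\<rbrakk> \<Longrightarrow>
    tensor_elem A B a b \<otimes>\<^bsub>TT\<^esub> tensor_elem A B a' b' = tensor_elem A B (a \<otimes>\<^bsub>A\<^esub> a') (b \<otimes>\<^bsub>B\<^esub> b')"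
  unfolding tensor_elem_coset by (subst coset_ops(1)) (auto intro!: vecs_e simp: tens_e)

lemma tensor_elem_one: "tensor_elem A B \<one>\<^bsub>A\<^esub> \<one>\<^bsub>B\<^esub> = \<one>\<^bsub>TT\<^esub>"
  unfolding tensor_elem_coset tensor_alg_def quot_alg_simps monoid_alg_simps by (simp add: DirProd_def)

lemma tensor_induct [consumes 1, case_names elem add]:
  assumes "X \<in> carrier TT"
    and "\<And>a b. \<lbrakk>a \<in> carrier A; b \<in> carrier B\<rbrakk> \<Longrightarrow> P (tensor_elem A B a b)"
    and "\<And>x y. \<lbrakk>x \<in> carrier TT; y \<in> carrier TT; P x; P y\<rbrakk> \<Longrightarrow> P (x \<oplus>\<^bsub>TT\<^esub> y)"
  shows "P X"
proof -
  obtain x where x: "x \<in> vecs AB" "X = coset x" using assms(1) unfolding tensor_carrier by blast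
  have el: "P (coset (scale c (e p)))" if "p \<in> AB" for c p
  proof -
    obtain a b where p: "p = (a, b)" "a \<in> carrier A" "b \<in> carrier B" using \<open>p \<in> AB\<close> by blast
    have "coset (scale c (e p)) = tensor_elem A B (c \<odot>\<^bsub>A\<^esub> a) b"
      unfolding tensor_elem_smult_left[OF p(2,3)] unfolding tensor_elem_coset p(1)
      by (rule coset_smult[symmetric]) (use p in \<open>auto intro: vecs_e\<close>)
    then show ?thesis using assms(2) A.smult_closed p by simp
  qed
  from x(1) have "P (coset x)"
  proof (induction x rule: vecs_induct)
    case zero
    show ?case using el[of "(\<zero>\<^bsub>A\<^esub>, \<zero>\<^bsub>B\<^esub>)" 0] by simp
  next
    case (add x y)
    then show ?case
      using assms(3)[of "coset x" "coset y"] coset_ops(2)[of x y] unfolding tensor_carrier by auto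
  qed (use el in simp)
  then show ?thesis using x by simp
qed

text \<open>The universal property of the tensor product.\<close>
lemma bilin_extend:
  fixes \<beta> :: "'a \<Rightarrow> 'b \<Rightarrow> ('y \<Rightarrow>\<^sub>0 'k)"
  assumes "bilin A B \<beta>"
  shows "\<exists>h. (\<forall>a\<in>carrier A. \<forall>b\<in>carrier B. h (tensor_elem A B a b) = \<beta> a b) \<and>
    (\<forall>x\<in>carrier TT. \<forall>y\<in>carrier TT. h (x \<oplus>\<^bsub>TT\<^esub> y) = h x + h y) \<and>
    (\<forall>c. \<forall>x\<in>carrier TT. h (c \<odot>\<^bsub>TT\<^esub> x) = scale c (h x))"
proof -
  interpret I: ideal "tensor_ideal A B" FF by (rule tensor_ideal)
  define h where "h X = lin_ext (case_prod \<beta>) (SOME x. x \<in> vecs AB \<and> X = coset x)" for X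
  have h: "h (coset x) = lin_ext (case_prod \<beta>) x" if x: "x \<in> vecs AB" for x
  proof -
    let ?y = "SOME y. y \<in> vecs AB \<and> coset x = coset y"
    have y: "?y \<in> vecs AB \<and> coset x = coset ?y" by (rule someI[of _ x]) (use x in simp)
    then have "?y \<in> coset x" using I.a_rcos_self[of ?y] by (simp add: monoid_alg_simps)
    then obtain i where i: "i \<in> tensor_ideal A B" "?y = i + x"
      unfolding a_r_coset_def' monoid_alg_simps by blast
    then show ?thesis using bilin_tensor_ideal[OF assms i(1)] unfolding h_def i(2) by (simp add: lin_ext_add)
  qed
  show ?thesis
  proof (rule exI[of _ h], intro conjI ballI allI)
    fix a b assume "a \<in> carrier A" "b \<in> carrier B"
    then show "h (tensor_elem A B a b) = \<beta> a b"
      unfolding tensor_elem_coset by (subst h) (auto intro: vecs_e simp: lin_ext_e)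
  next
    fix X Y assume "X \<in> carrier TT" "Y \<in> carrier TT"
    then obtain x y where "x \<in> vecs AB" "X = coset x" "y \<in> vecs AB" "Y = coset y" unfolding tensor_carrier by blast
    then show "h (X \<oplus>\<^bsub>TT\<^esub> Y) = h X + h Y" using h coset_ops(2) by (simp add: vecs_add lin_ext_add)
  next
    fix c X assume "X \<in> carrier TT"
    then obtain x where "x \<in> vecs AB" "X = coset x" unfolding tensor_carrier by blast
    then show "h (c \<odot>\<^bsub>TT\<^esub> X) = scale c (h X)" using h coset_smult by (simp add: vecs_scale lin_ext_scale)
  qed
qed

text \<open>The index map \<open>\<pi>\<close> lets the tensor basis be indexed as a cell datum
  requires, with the entries of the two indices interleaved.\<close>
lemma tensor_elem_comb:
  assumes b1: "b1 \<in> I \<rightarrow> carrier A" and b2: "b2 \<in> J \<rightarrow> carrier B"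
    and bb: "\<And>i j. \<lbrakk>i \<in> I; j \<in> J\<rbrakk> \<Longrightarrow> bb (\<pi> i j) = tensor_elem A B (b1 i) (b2 j)"
    and x: "x \<in> vecs I" and y: "y \<in> vecs J"
  shows "tensor_elem A B (comb A b1 x) (comb B b2 y) = comb TT bb (tens \<pi> x y)"
proof -
  let ?K = "case_prod \<pi> ` (I \<times> J)"
  have bbK: "bb \<in> ?K \<rightarrow> carrier TT"
    using bb tensor_elem_closed b1 b2 by (auto simp: Pi_iff)
  have tv: "tens \<pi> x y \<in> vecs ?K" if "x \<in> vecs I" "y \<in> vecs J" for x y
    by (rule tens_vecs[OF that]) auto
  have zl: "tensor_elem A B \<zero>\<^bsub>A\<^esub> b = \<zero>\<^bsub>TT\<^esub>" if "b \<in> carrier B" for b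
    using tensor_elem_smult_left[of "\<zero>\<^bsub>A\<^esub>" b 0] TT.smult_zero[OF tensor_elem_closed] A.smult_zero that by simp
  have zr: "tensor_elem A B a \<zero>\<^bsub>B\<^esub> = \<zero>\<^bsub>TT\<^esub>" if "a \<in> carrier A" for a
    using tensor_elem_smult_right[of a "\<zero>\<^bsub>B\<^esub>" 0] TT.smult_zero[OF tensor_elem_closed] B.smult_zero that by simp
  note yc = B.comb_closed[OF y b2]
  from x show ?thesis
  proof (induction x rule: vecs_induct)
    case zero
    show ?case using zl yc by (simp add: A.comb_zero TT.comb_zero tens_simps)
  next
    case (add x x')
    then show ?case
      using A.comb_closed[OF _ b1] yc
      by (simp add: A.comb_add[OF _ _ b1] tensor_elem_add_left tens_simps TT.comb_add[OF tv[OF add(1) y] tv[OF add(2) y] bbK])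
  next
    case (e c i)
    note i = e
    have b1i: "b1 i \<in> carrier A" using b1 e by auto
    from y have "tensor_elem A B (b1 i) (comb B b2 y) = comb TT bb (tens \<pi> (e i) y)"
    proof (induction y rule: vecs_induct)
      case zero
      show ?case using zr b1i by (simp add: B.comb_zero TT.comb_zero tens_simps)
    next
      case (add y y')
      then show ?case
        using B.comb_closed[OF _ b2] b1i
        by (simp add: B.comb_add[OF _ _ b2] tensor_elem_add_right tens_simps
            TT.comb_add[OF tv[OF vecs_e[OF i] add(1)] tv[OF vecs_e[OF i] add(2)] bbK])
    next
      case (e c j)
      then have b2j: "b2 j \<in> carrier B" using b2 by auto
      have ij: "\<pi> i j \<in> ?K" using i e by auto
      show ?case
        using b1i b2j bb[OF i e] B.comb_scale[OF vecs_e[OF e] b2] TT.comb_scale[OF vecs_e[OF ij] bbK] tensor_elem_closed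
        by (simp add: B.comb_e TT.comb_e tensor_elem_smult_right tens_simps)
    qed
    then show ?case
      using b1i yc A.comb_scale[OF vecs_e[OF e] b1] TT.comb_scale[OF tv[OF vecs_e[OF e] y] bbK]
      by (simp add: A.comb_e tensor_elem_smult_left tens_simps)
  qed
qed

text \<open>The linear map extending \<open>tens \<pi>\<close> on coordinates is a left inverse of
  forming combinations.\<close>
lemma tensor_basis:
  assumes b1: "b1 \<in> I \<rightarrow> carrier A" "bij_betw (comb A b1) (vecs I) (carrier A)"
    and b2: "b2 \<in> J \<rightarrow> carrier B" "bij_betw (comb B b2) (vecs J) (carrier B)"
    and bb: "\<And>i j. \<lbrakk>i \<in> I; j \<in> J\<rbrakk> \<Longrightarrow> bb (\<pi> i j) = tensor_elem A B (b1 i) (b2 j)"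
  shows "bij_betw (comb TT bb) (vecs (case_prod \<pi> ` (I \<times> J))) (carrier TT)"
proof -
  let ?K = "case_prod \<pi> ` (I \<times> J)"
  have bbK: "bb \<in> ?K \<rightarrow> carrier TT"
    using bb tensor_elem_closed b1 b2 by (auto simp: Pi_iff)
  let ?\<kappa>1 = "inv_into (vecs I) (comb A b1)" and ?\<kappa>2 = "inv_into (vecs J) (comb B b2)"
  note c1 = coordinates[OF A.k_algebra_axioms b1] and c2 = coordinates[OF B.k_algebra_axioms b2]
  have "bilin A B (\<lambda>a b. tens \<pi> (?\<kappa>1 a) (?\<kappa>2 b))"
    unfolding bilin_def by (simp add: c1 c2 tens_simps)
  then obtain h where h: "\<And>a b. \<lbrakk>a \<in> carrier A; b \<in> carrier B\<rbrakk> \<Longrightarrow> h (tensor_elem A B a b) = tens \<pi> (?\<kappa>1 a) (?\<kappa>2 b)"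
    "\<And>x y. \<lbrakk>x \<in> carrier TT; y \<in> carrier TT\<rbrakk> \<Longrightarrow> h (x \<oplus>\<^bsub>TT\<^esub> y) = h x + h y"
    "\<And>c x. x \<in> carrier TT \<Longrightarrow> h (c \<odot>\<^bsub>TT\<^esub> x) = scale c (h x)"
    using bilin_extend[of "\<lambda>a b. tens \<pi> (?\<kappa>1 a) (?\<kappa>2 b)"] by blast
  have inv: "h (comb TT bb c) = c" if "c \<in> vecs ?K" for c
    using that
  proof (induction c rule: vecs_induct)
    case zero
    have "h \<zero>\<^bsub>TT\<^esub> = 0" using h(2)[of "\<zero>\<^bsub>TT\<^esub>" "\<zero>\<^bsub>TT\<^esub>"] by simp
    then show ?case by (simp add: TT.comb_zero)
  next
    case (add x y)
    then show ?case using TT.comb_closed[OF _ bbK] by (simp add: TT.comb_add[OF _ _ bbK] h(2))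
  next
    case (e c k)
    then obtain i j where k: "i \<in> I" "j \<in> J" "k = \<pi> i j" by auto
    have bc: "b1 i \<in> carrier A" "b2 j \<in> carrier B" using b1 b2 k by auto
    have "?\<kappa>1 (b1 i) = e i" using c1(3)[OF vecs_e[OF k(1)]] bc by (simp add: A.comb_e)
    moreover have "?\<kappa>2 (b2 j) = e j" using c2(3)[OF vecs_e[OF k(2)]] bc by (simp add: B.comb_e)
    ultimately have "h (bb k) = e k" using bb[OF k(1,2)] h(1)[OF bc] k(3) by (simp add: tens_e)
    moreover have "bb k \<in> carrier TT" using bbK e by auto
    ultimately show ?case using TT.comb_scale[OF vecs_e[OF e] bbK] h(3) by (simp add: TT.comb_e)
  qed
  have "inj_on (comb TT bb) (vecs ?K)" using inv by (metis inj_onI)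
  moreover have "comb TT bb ` vecs ?K = carrier TT"
  proof
    show "comb TT bb ` vecs ?K \<subseteq> carrier TT" using TT.comb_closed[OF _ bbK] by blast
    show "carrier TT \<subseteq> comb TT bb ` vecs ?K"
    proof
      fix X assume "X \<in> carrier TT"
      then show "X \<in> comb TT bb ` vecs ?K"
      proof (induction X rule: tensor_induct)
        case (elem a b)
        have "tensor_elem A B (comb A b1 (?\<kappa>1 a)) (comb B b2 (?\<kappa>2 b)) = comb TT bb (tens \<pi> (?\<kappa>1 a) (?\<kappa>2 b))"
          by (rule tensor_elem_comb[where bb = bb and \<pi> = \<pi>, OF b1(1) b2(1) bb c1(1)[OF elem(1)] c2(1)[OF elem(2)]])
        moreover have "tens \<pi> (?\<kappa>1 a) (?\<kappa>2 b) \<in> vecs ?K"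
          by (rule tens_vecs[OF c1(1)[OF elem(1)] c2(1)[OF elem(2)]]) auto
        ultimately show ?case using c1(2)[OF elem(1)] c2(2)[OF elem(2)] by auto
      next
        case (add x y)
        then obtain u w where "u \<in> vecs ?K" "x = comb TT bb u" "w \<in> vecs ?K" "y = comb TT bb w" by blast
        then show ?case using TT.comb_add[of u ?K w bb] bbK vecs_add[of u ?K w] by (metis imageI)
      qed
    qed
  qed
  ultimately show ?thesis unfolding bij_betw_def by blast
qed

end

section \<open>Direct sums\<close>

locale algebra_family =
  fixes I :: "'i set" and A :: "'i \<Rightarrow> ('k::field, 'a, 'm) module_scheme"
  assumes algebra: "i \<in> I \<Longrightarrow> k_algebra (A i)" and finite: "finite I"
begin

abbreviation DD where "DD \<equiv> dirsum_alg I A"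

lemma dirsum_simps:
  "x \<in> carrier DD \<longleftrightarrow> x \<in> extensional I \<and> (\<forall>i\<in>I. x i \<in> carrier (A i))"
  "i \<in> I \<Longrightarrow> (x \<otimes>\<^bsub>DD\<^esub> y) i = x i \<otimes>\<^bsub>A i\<^esub> y i" "i \<in> I \<Longrightarrow> (x \<oplus>\<^bsub>DD\<^esub> y) i = x i \<oplus>\<^bsub>A i\<^esub> y i"
  "i \<in> I \<Longrightarrow> \<one>\<^bsub>DD\<^esub> i = \<one>\<^bsub>A i\<^esub>" "i \<in> I \<Longrightarrow> \<zero>\<^bsub>DD\<^esub> i = \<zero>\<^bsub>A i\<^esub>" "i \<in> I \<Longrightarrow> (c \<odot>\<^bsub>DD\<^esub> x) i = c \<odot>\<^bsub>A i\<^esub> x i"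
  unfolding dirsum_alg_def by (auto simp: PiE_iff)

lemma dirsum_ext:
  "x \<otimes>\<^bsub>DD\<^esub> y \<in> extensional I" "x \<oplus>\<^bsub>DD\<^esub> y \<in> extensional I" "\<one>\<^bsub>DD\<^esub> \<in> extensional I"
  "\<zero>\<^bsub>DD\<^esub> \<in> extensional I" "c \<odot>\<^bsub>DD\<^esub> x \<in> extensional I"
  unfolding dirsum_alg_def by simp_all

lemma dirsum_eqI:
  "\<lbrakk>x \<in> extensional I; y \<in> extensional I; \<And>i. i \<in> I \<Longrightarrow> x i = y i\<rbrakk> \<Longrightarrow> x = y"
  by (rule extensionalityI)

lemma ring_component: "i \<in> I \<Longrightarrow> ring (A i)"
  using algebra k_algebra.ring by blast

lemma k_algebra_dirsum: "k_algebra DD"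
proof (rule k_algebraI)
  note ab = ring.is_abelian_group[OF ring_component]
  note ring_facts = ring.ring_simprules[OF ring_component]
  show "ring DD"
  proof (rule ringI)
    show "abelian_group DD"
    proof (rule abelian_groupI)
      fix x assume x: "x \<in> carrier DD"
      show "\<exists>y\<in>carrier DD. y \<oplus>\<^bsub>DD\<^esub> x = \<zero>\<^bsub>DD\<^esub>"
        by (rule bexI[of _ "\<lambda>i\<in>I. \<ominus>\<^bsub>A i\<^esub> x i"])
           (use x in \<open>auto intro!: dirsum_eqI dirsum_ext simp: dirsum_simps ring_facts\<close>)
    qed (auto intro!: dirsum_eqI dirsum_ext simp: dirsum_simps ring_facts)
    show "Group.monoid DD"
      by (rule monoidI)
         (auto intro!: dirsum_eqI dirsum_ext simp: dirsum_simps ring_facts monoid.r_one[OF ring.is_monoid[OF ring_component]])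
  qed (auto intro!: dirsum_eqI dirsum_ext simp: dirsum_simps ring_facts)
qed (auto intro!: dirsum_eqI dirsum_ext simp: dirsum_simps k_algebra.smult_closed[OF algebra]
      k_algebra.smult_l_distr[OF algebra] k_algebra.smult_r_distr[OF algebra] k_algebra.smult_assoc[OF algebra]
      k_algebra.smult_one[OF algebra] k_algebra.smult_mult_left[OF algebra] k_algebra.smult_mult_right[OF algebra])

lemma dirsum_in_simps:
  "dirsum_in I A i x \<in> extensional I" "j \<in> I \<Longrightarrow> dirsum_in I A i x j = (if j = i then x else \<zero>\<^bsub>A j\<^esub>)"
  unfolding dirsum_in_def by auto

lemma dirsum_in_closed: "\<lbrakk>i \<in> I; x \<in> carrier (A i)\<rbrakk> \<Longrightarrow> dirsum_in I A i x \<in> carrier DD"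
  by (auto simp: dirsum_simps dirsum_in_simps ring.ring_simprules[OF ring_component])

lemma dirsum_in_linear: "i \<in> I \<Longrightarrow> dirsum_in I A i \<in> k_linear (A i) DD"
  unfolding k_linear_iff
  by (auto intro!: dirsum_eqI dirsum_ext dirsum_in_closed
      simp: dirsum_simps dirsum_in_simps ring.ring_simprules[OF ring_component] k_algebra.smult_zero_right[OF algebra])

lemma dirsum_component: "\<lbrakk>x \<in> carrier DD; i \<in> I\<rbrakk> \<Longrightarrow> x i \<in> carrier (A i)"
  by (simp add: dirsum_simps)

lemma mult_dirsum_in:
  "\<lbrakk>i \<in> I; x \<in> carrier DD; y \<in> carrier (A i)\<rbrakk> \<Longrightarrow> x \<otimes>\<^bsub>DD\<^esub> dirsum_in I A i y = dirsum_in I A i (x i \<otimes>\<^bsub>A i\<^esub> y)"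
  by (auto intro!: dirsum_eqI dirsum_ext simp: dirsum_simps dirsum_in_simps ring.ring_simprules[OF ring_component])

context
  fixes J :: "'i \<Rightarrow> 'j set" and b :: "'i \<Rightarrow> 'j \<Rightarrow> 'a" and bb :: "'i \<times> 'j \<Rightarrow> 'i \<Rightarrow> 'a"
  assumes b: "\<And>i. i \<in> I \<Longrightarrow> b i \<in> J i \<rightarrow> carrier (A i)"
    and bb: "\<And>i j. \<lbrakk>i \<in> I; j \<in> J i\<rbrakk> \<Longrightarrow> bb (i, j) = dirsum_in I A i (b i j)"
begin

lemma bb_closed: "bb \<in> (SIGMA i:I. J i) \<rightarrow> carrier DD"
  using b bb by (auto simp: Pi_iff intro!: dirsum_in_closed)

lemma dirsum_basis:
  assumes bij: "\<And>i. i \<in> I \<Longrightarrow> bij_betw (comb (A i) (b i)) (vecs (J i)) (carrier (A i))"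
  shows "bij_betw (comb DD bb) (vecs (SIGMA i:I. J i)) (carrier DD)"
proof -
  interpret D: k_algebra DD by (rule k_algebra_dirsum)
  define slice where "slice i c = lin_ext (\<lambda>(i', j). if i' = i then e j else 0) c" for i and c :: "'i \<times> 'j \<Rightarrow>\<^sub>0 'k"
  have slice_vecs: "slice i c \<in> vecs (J i)" if "c \<in> vecs (SIGMA i:I. J i)" for i c
    unfolding slice_def by (rule vecs_lin_ext[OF that]) (auto intro: vecs_e vecs_zero)
  have proj: "(\<lambda>x. x i) \<in> k_linear DD (A i)" if "i \<in> I" for i
    using that unfolding k_linear_iff by (auto simp: dirsum_simps)
  have comp: "comb DD bb c i = comb (A i) (b i) (slice i c)" if c: "c \<in> vecs (SIGMA i:I. J i)" and i: "i \<in> I" for c i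
  proof -
    interpret Ai: k_algebra "A i" by (rule algebra[OF i])
    interpret RAi: ring "A i" by (rule Ai.ring)
    have bi: "b i \<in> J i \<rightarrow> carrier (A i)" by (rule b[OF i])
    have db: "(\<lambda>k. bb k i) \<in> (SIGMA i:I. J i) \<rightarrow> carrier (A i)"
      using bb_closed i by (auto simp: Pi_iff dirsum_simps)
    have "comb DD bb c i = comb (A i) (\<lambda>k. bb k i) c"
      by (rule D.comb_linear_map[OF algebra[OF i] proj[OF i] c bb_closed])
    also have "\<dots> = comb (A i) (b i) (slice i c)"
      using c
    proof (induction c rule: vecs_induct)
      case zero
      show ?case by (simp add: Ai.comb_zero slice_def lin_ext_zero)
    next
      case (add x y)
      have "slice i (x + y) = slice i x + slice i y" unfolding slice_def by (rule lin_ext_add)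
      then show ?case
        using add by (simp add: Ai.comb_add[OF add(1,2) db] Ai.comb_add[OF slice_vecs[OF add(1)] slice_vecs[OF add(2)] bi])
    next
      case (e c k)
      obtain i' j where k: "k = (i', j)" "i' \<in> I" "j \<in> J i'" using e by auto
      have bk: "bb k i = (if i = i' then b i' j else \<zero>\<^bsub>A i\<^esub>)"
        using bb[OF k(2,3)] k(1) i by (simp add: dirsum_in_simps)
      have s: "slice i (scale c (e k)) = (if i = i' then scale c (e j) else 0)"
        unfolding slice_def lin_ext_scale lin_ext_e k(1) by auto
      have bki: "bb k i \<in> carrier (A i)" using db e by auto
      show ?case
      proof (cases "i = i'")
        case True
        have j: "j \<in> J i" using k(3) True by simp
        have "comb (A i) (\<lambda>k. bb k i) (scale c (e k)) = c \<odot>\<^bsub>A i\<^esub> bb k i"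
          unfolding Ai.comb_scale[OF vecs_e[OF e] db] using Ai.comb_e[of "\<lambda>k. bb k i" k] bki by simp
        moreover have "comb (A i) (b i) (scale c (e j)) = c \<odot>\<^bsub>A i\<^esub> b i j"
          unfolding Ai.comb_scale[OF vecs_e[OF j] bi] using Ai.comb_e[of "b i" j, OF funcset_mem[OF bi j]] by simp
        ultimately show ?thesis using s bk True by simp
      next
        case False
        have "comb (A i) (\<lambda>k. bb k i) (scale c (e k)) = c \<odot>\<^bsub>A i\<^esub> bb k i"
          unfolding Ai.comb_scale[OF vecs_e[OF e] db] using Ai.comb_e[of "\<lambda>k. bb k i" k] bki by simp
        then show ?thesis using s bk False by (simp add: Ai.smult_zero_right Ai.comb_zero)
      qed
    qed
    finally show ?thesis .
  qed
  have lk: "Poly_Mapping.lookup (slice i c) j = Poly_Mapping.lookup c (i, j)" for i j and c :: "'i \<times> 'j \<Rightarrow>\<^sub>0 'k"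
  proof -
    have "Poly_Mapping.lookup (slice i c) j = (\<Sum>k\<in>Poly_Mapping.keys c. if k = (i, j) then Poly_Mapping.lookup c k else 0)"
      unfolding slice_def lin_ext_def lookup_sum lookup_scale
      by (rule sum.cong) (auto simp: lookup_single when_def split: if_splits)
    also have "\<dots> = Poly_Mapping.lookup c (i, j)" by (simp add: in_keys_iff)
    finally show ?thesis .
  qed
  have "inj_on (comb DD bb) (vecs (SIGMA i:I. J i))"
  proof (rule inj_onI)
    fix c c' assume c: "c \<in> vecs (SIGMA i:I. J i)" "c' \<in> vecs (SIGMA i:I. J i)" "comb DD bb c = comb DD bb c'"
    show "c = c'"
    proof (rule poly_mapping_eqI)
      fix k :: "'i \<times> 'j"
      obtain i j where k: "k = (i, j)" by (cases k)
      show "Poly_Mapping.lookup c k = Poly_Mapping.lookup c' k"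
      proof (cases "i \<in> I")
        case True
        have "comb (A i) (b i) (slice i c) = comb (A i) (b i) (slice i c')"
          using comp[OF c(1) True] comp[OF c(2) True] c(3) by simp
        then have "slice i c = slice i c'"
          using bij[OF True] slice_vecs c(1,2) unfolding bij_betw_def inj_on_def by blast
        then show ?thesis using lk k by metis
      next
        case False
        then have "k \<notin> Poly_Mapping.keys c" "k \<notin> Poly_Mapping.keys c'" using c(1,2) k unfolding vecs_def by auto
        then show ?thesis by (simp add: in_keys_iff)
      qed
    qed
  qed
  moreover have "comb DD bb ` vecs (SIGMA i:I. J i) = carrier DD"
  proof
    show "comb DD bb ` vecs (SIGMA i:I. J i) \<subseteq> carrier DD" using D.comb_closed[OF _ bb_closed] by blast
    show "carrier DD \<subseteq> comb DD bb ` vecs (SIGMA i:I. J i)"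
    proof
      fix x assume x: "x \<in> carrier DD"
      have "\<exists>c\<in>vecs (J i). comb (A i) (b i) c = x i" if "i \<in> I" for i
        using bij[OF that] dirsum_component[OF x that] unfolding bij_betw_def by (metis imageE)
      then obtain u where u: "\<And>i. i \<in> I \<Longrightarrow> u i \<in> vecs (J i)" "\<And>i. i \<in> I \<Longrightarrow> comb (A i) (b i) (u i) = x i" by metis
      define c where "c = (\<Sum>i\<in>I. lin_ext (\<lambda>j. e (i, j)) (u i))"
      have c: "c \<in> vecs (SIGMA i:I. J i)"
        unfolding c_def by (rule vecs_sum, rule vecs_lin_ext[OF u(1)]) (auto intro: vecs_e)
      have "slice i c = u i" if "i \<in> I" for i
      proof -
        have "slice i c = (\<Sum>i'\<in>I. if i' = i then u i else 0)"
          unfolding slice_def c_def lin_ext_sum lin_ext_lin_ext lin_ext_e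
          by (rule sum.cong) (auto simp: lin_ext_def poly_sum[symmetric])
        then show ?thesis using that finite by simp
      qed
      then have "comb DD bb c = x"
        using comp[OF c] u(2) D.comb_closed[OF c bb_closed] x by (intro dirsum_eqI) (auto simp: dirsum_simps)
      then show "x \<in> comb DD bb ` vecs (SIGMA i:I. J i)" using c by blast
    qed
  qed
  ultimately show ?thesis unfolding bij_betw_def by blast
qed

end

end

section \<open>Cell data in coordinates\<close>

definition cell_index :: "'l set \<Rightarrow> ('l \<Rightarrow> 's set) \<Rightarrow> ('l \<times> 's \<times> 's) set" where
  "cell_index L M = (SIGMA l:L. M l \<times> M l)"

definition lower_index :: "'l set \<Rightarrow> 'l rel \<Rightarrow> ('l \<Rightarrow> 's set) \<Rightarrow> 'l \<Rightarrow> ('l \<times> 's \<times> 's) set" where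
  "lower_index L R M l = {(m, s, t). m \<in> L \<and> (m, l) \<in> R \<and> m \<noteq> l \<and> s \<in> M m \<and> t \<in> M m}"

definition cell_family :: "('l \<Rightarrow> 's \<Rightarrow> 's \<Rightarrow> 'a) \<Rightarrow> 'l \<times> 's \<times> 's \<Rightarrow> 'a" where
  "cell_family C = (\<lambda>(l, s, t). C l s t)"

definition column :: "('l \<Rightarrow> 's set) \<Rightarrow> ('s \<Rightarrow> 's \<Rightarrow> 'k::field) \<Rightarrow> 'l \<Rightarrow> 's \<Rightarrow> 's \<Rightarrow> ('l \<times> 's \<times> 's) \<Rightarrow>\<^sub>0 'k" where
  "column M r l s t = (\<Sum>s'\<in>M l. scale (r s' s) (e (l, s', t)))"

text \<open>The multiplication axiom of a cell datum in coordinates: multiplication by \<open>x\<close>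
  takes \<open>C l s t\<close> to a combination of the \<open>C l s' t\<close>, with coefficients
  independent of \<open>t\<close>, up to a combination \<open>w\<close> with lower indices.\<close>
definition cellular_at ::
    "('k::field, 'a, 'm) module_scheme \<Rightarrow> 'l set \<Rightarrow> 'l rel \<Rightarrow> ('l \<Rightarrow> 's set) \<Rightarrow> ('l \<Rightarrow> 's \<Rightarrow> 's \<Rightarrow> 'a) \<Rightarrow> 'a \<Rightarrow> bool" where
  "cellular_at A L R M C x \<longleftrightarrow> (\<forall>l\<in>L. \<exists>r. \<forall>s\<in>M l. \<forall>t\<in>M l. \<exists>w\<in>vecs (lower_index L R M l).
     x \<otimes>\<^bsub>A\<^esub> C l s t = comb A (cell_family C) (column M r l s t + w))"

lemma lower_index_subset: "lower_index L R M l \<subseteq> cell_index L M"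
  unfolding lower_index_def cell_index_def by auto

lemma column_vecs: "\<lbrakk>l \<in> L; t \<in> M l\<rbrakk> \<Longrightarrow> column M r l s t \<in> vecs (cell_index L M)"
  unfolding column_def by (intro vecs_sum vecs_scale vecs_e) (auto simp: cell_index_def)

lemma (in k_algebra) cellular_law_iff:
  assumes C: "\<And>l s t. \<lbrakk>l \<in> L; s \<in> M l; t \<in> M l\<rbrakk> \<Longrightarrow> C l s t \<in> carrier A"
    and fin: "\<And>l. l \<in> L \<Longrightarrow> finite (M l)" and l: "l \<in> L" and s: "s \<in> M l" and t: "t \<in> M l" and x: "x \<in> carrier A"
  shows "(x \<otimes> C l s t) \<ominus> (\<Oplus>s'\<in>M l. r s' s \<odot> C l s' t) \<in> cell_lower A L R M C l \<longleftrightarrow>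
    (\<exists>w\<in>vecs (lower_index L R M l). x \<otimes> C l s t = comb A (cell_family C) (column M r l s t + w))"
proof -
  interpret ring A by (rule ring)
  have fam: "cell_family C \<in> cell_index L M \<rightarrow> carrier A"
    using C unfolding cell_family_def cell_index_def by auto
  have low: "cell_lower A L R M C l = comb A (cell_family C) ` vecs (lower_index L R M l)"
  proof -
    have "{C m s t | m s t. m \<in> L \<and> (m, l) \<in> R \<and> m \<noteq> l \<and> s \<in> M m \<and> t \<in> M m} = cell_family C ` lower_index L R M l"
      unfolding cell_family_def lower_index_def by (auto simp: image_iff) blast
    then show ?thesis
      unfolding cell_lower_def
      using span_eq_comb[of "cell_family C" "lower_index L R M l"] subsetD[OF Pi_anti_mono[OF lower_index_subset] fam] by simp
  qed
  have lowv: "w \<in> vecs (cell_index L M)" if "w \<in> vecs (lower_index L R M l)" for w :: "_ \<Rightarrow>\<^sub>0 'k"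
    by (rule subsetD[OF vecs_mono[OF lower_index_subset] that])
  have col: "comb A (cell_family C) (column M r l s t) = (\<Oplus>s'\<in>M l. r s' s \<odot> C l s' t)"
  proof -
    have "comb A (cell_family C) (\<Sum>s'\<in>S. scale (r s' s) (e (l, s', t))) = (\<Oplus>s'\<in>S. r s' s \<odot> C l s' t)"
      if "finite S" "S \<subseteq> M l" for S
      using that
    proof (induction S rule: finite_induct)
      case (insert s' S)
      have 1: "e (l, s', t) \<in> vecs (cell_index L M)" "(\<Sum>s'\<in>S. scale (r s' s) (e (l, s', t))) \<in> vecs (cell_index L M)"
        using insert l t by (auto intro!: vecs_sum vecs_scale vecs_e simp: cell_index_def)
      have c: "C l s' t \<in> carrier A" using C insert l t by auto
      have "comb A (cell_family C) (scale (r s' s) (e (l, s', t)) + (\<Sum>s'\<in>S. scale (r s' s) (e (l, s', t))))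
          = r s' s \<odot> C l s' t \<oplus> (\<Oplus>s'\<in>S. r s' s \<odot> C l s' t)"
        using insert comb_add[OF vecs_scale[OF 1(1)] 1(2) fam] comb_scale[OF 1(1) fam] comb_e[of "cell_family C" "(l, s', t)"] c
        by (simp add: cell_family_def)
      also have "\<dots> = (\<Oplus>s'\<in>insert s' S. r s' s \<odot> C l s' t)"
        by (rule finsum_insert[symmetric]) (use insert C l t in \<open>auto intro!: smult_closed\<close>)
      finally show ?case using insert by simp
    qed (simp add: comb_zero)
    then show ?thesis unfolding column_def using fin[OF l] by blast
  qed
  have cv: "column M r l s t \<in> vecs (cell_index L M)" by (rule column_vecs[where M = M, OF l t])
  have cc: "comb A (cell_family C) (column M r l s t) \<in> carrier A" by (rule comb_closed[OF cv fam])
  have xc: "x \<otimes> C l s t \<in> carrier A" using x C l s t by simp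
  have "(x \<otimes> C l s t) \<ominus> comb A (cell_family C) (column M r l s t) = comb A (cell_family C) w \<longleftrightarrow>
      x \<otimes> C l s t = comb A (cell_family C) (column M r l s t + w)" if w: "w \<in> vecs (lower_index L R M l)" for w
  proof -
    have wc: "comb A (cell_family C) w \<in> carrier A" by (rule comb_closed[OF lowv[OF w] fam])
    show ?thesis
      unfolding comb_add[OF cv lowv[OF w] fam]
      using cc xc wc by (metis a_comm a_minus_def add.inv_closed add.inv_solve_right')
  qed
  then show ?thesis unfolding low col[symmetric] by blast
qed

text \<open>With bases as bijections from coordinate vectors, the axioms about spans become conditions
  on coordinates, which are easy to carry along index maps.\<close>
lemma cell_datum_iff:
  fixes A :: "('k::field, 'a, 'm) module_scheme" and L :: "'l set" and M :: "'l \<Rightarrow> 's set"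
  shows
  "cell_datum A L R M C star \<longleftrightarrow> k_algebra A \<and> partial_order_on L R \<and> (\<forall>l\<in>L. finite (M l)) \<and>
    (\<forall>l\<in>L. \<forall>s\<in>M l. \<forall>t\<in>M l. C l s t \<in> carrier A) \<and> star \<in> k_linear A A \<and>
    (\<forall>x\<in>carrier A. star (star x) = x) \<and> (\<forall>x\<in>carrier A. \<forall>y\<in>carrier A. star (x \<otimes>\<^bsub>A\<^esub> y) = star y \<otimes>\<^bsub>A\<^esub> star x) \<and>
    bij_betw (comb A (cell_family C)) (vecs (cell_index L M)) (carrier A) \<and>
    (\<forall>l\<in>L. \<forall>s\<in>M l. \<forall>t\<in>M l. star (C l s t) = C l t s) \<and> (\<forall>x\<in>carrier A. cellular_at A L R M C x)"
  (is "?l \<longleftrightarrow> ?r")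
proof -
  have law: "(\<exists>r :: 's \<Rightarrow> 's \<Rightarrow> 'k. \<forall>s\<in>M l. \<forall>t\<in>M l.
      (x \<otimes>\<^bsub>A\<^esub> C l s t) \<ominus>\<^bsub>A\<^esub> (\<Oplus>\<^bsub>A\<^esub>s'\<in>M l. r s' s \<odot>\<^bsub>A\<^esub> C l s' t) \<in> cell_lower A L R M C l) \<longleftrightarrow>
      (\<exists>r. \<forall>s\<in>M l. \<forall>t\<in>M l. \<exists>w\<in>vecs (lower_index L R M l).
        x \<otimes>\<^bsub>A\<^esub> C l s t = comb A (cell_family C) (column M r l s t + w))"
    if "k_algebra A" "\<forall>l\<in>L. \<forall>s\<in>M l. \<forall>t\<in>M l. C l s t \<in> carrier A" "\<forall>l\<in>L. finite (M l)" "l \<in> L" "x \<in> carrier A" for l x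
    using k_algebra.cellular_law_iff[OF that(1), of L M C l _ _ x _ R] that by simp
  have basis: "inj_on (\<lambda>(l, s, t). C l s t) (SIGMA l:L. M l \<times> M l) \<and>
      vectorspace.basis (class_ring :: 'k ring) A ((\<lambda>(l, s, t). C l s t) ` (SIGMA l:L. M l \<times> M l)) \<longleftrightarrow>
      bij_betw (comb A (cell_family C)) (vecs (cell_index L M)) (carrier A)"
    if "k_algebra A" "\<forall>l\<in>L. \<forall>s\<in>M l. \<forall>t\<in>M l. C l s t \<in> carrier A"
  proof -
    have "cell_family C \<in> cell_index L M \<rightarrow> carrier A"
      using that(2) unfolding cell_family_def cell_index_def by auto
    from k_algebra.basis_iff_comb[OF that(1) this] show ?thesis
      unfolding cell_family_def cell_index_def .
  qed
  show ?thesis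
  proof
    assume ?l
    then interpret cell_datum A L R M C star .
    show ?r
      using k_algebra_axioms poset finite_M C_closed star_linear star_involution star_mult C2
        basis[OF k_algebra_axioms] C1_inj C1_basis law[OF k_algebra_axioms] C3
      unfolding cellular_at_def by simp
  next
    assume r: ?r
    show ?l
      unfolding cell_datum_def cell_datum_axioms_def using r basis law
      unfolding cellular_at_def by simp
  qed
qed

lemma family_closed:
  assumes "cell_family C \<in> cell_index L M \<rightarrow> X" "l \<in> L" "s \<in> M l" "t \<in> M l"
  shows "C l s t \<in> X"
  using funcset_mem[OF assms(1), of "(l, s, t)"] assms(2-) by (simp add: cell_family_def cell_index_def)

context k_algebra
begin

interpretation ring A by (rule ring)

lemma comb_reindex:
  assumes "c \<in> vecs J" "\<And>j. j \<in> J \<Longrightarrow> \<iota> j \<in> K" "b \<in> K \<rightarrow> carrier A"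
  shows "comb A b (lin_ext (\<lambda>j. e (\<iota> j)) c) = comb A (\<lambda>j. b (\<iota> j)) c"
  using assms(1)
proof (induction c rule: vecs_induct)
  case zero
  show ?case by (simp add: comb_zero lin_ext_zero)
next
  case (add x y)
  have v: "lin_ext (\<lambda>j. e (\<iota> j)) x \<in> vecs K" if "x \<in> vecs J" for x :: "_ \<Rightarrow>\<^sub>0 'k"
    by (rule vecs_lin_ext[OF that]) (use assms(2) in \<open>auto intro: vecs_e\<close>)
  have b: "(\<lambda>j. b (\<iota> j)) \<in> J \<rightarrow> carrier A" using assms(2,3) by auto
  show ?case using add by (simp add: lin_ext_add comb_add[OF v v assms(3)] comb_add[OF _ _ b])
next
  case (e a j)
  have b: "(\<lambda>j. b (\<iota> j)) \<in> J \<rightarrow> carrier A" using assms(2,3) by auto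
  have "b (\<iota> j) \<in> carrier A" using b e by auto
  then show ?case
    using comb_scale[OF vecs_e[OF e] b] comb_scale[OF vecs_e[OF assms(2)[OF e]] assms(3)]
      comb_e[of "\<lambda>j. b (\<iota> j)" j] comb_e[of b "\<iota> j"]
    by (simp add: lin_ext_scale lin_ext_e)
qed

lemma reindex_basis:
  assumes "b \<in> \<iota> ` J \<rightarrow> carrier A" "inj_on \<iota> J" "bij_betw (comb A (b \<circ> \<iota>)) (vecs J) (carrier A)"
  shows "bij_betw (comb A b) (vecs (\<iota> ` J)) (carrier A)"
proof -
  have "b \<circ> \<iota> \<in> J \<rightarrow> carrier A" using assms(1) by auto
  from basis_iff_comb[OF this] assms(3) have "inj_on (b \<circ> \<iota>) J" "vectorspace.basis (class_ring :: 'k ring) A (b ` \<iota> ` J)"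
    by (auto simp: image_comp)
  then show ?thesis using basis_iff_comb[OF assms(1)] inj_on_imageI by blast
qed

text \<open>The multiplication axiom is additive in \<open>x\<close>, so in a tensor product it need
  only be checked for pure tensors.\<close>
lemma cellular_at_add:
  assumes C: "cell_family C \<in> cell_index L M \<rightarrow> carrier A"
    and "x \<in> carrier A" "y \<in> carrier A" "cellular_at A L R M C x" "cellular_at A L R M C y"
  shows "cellular_at A L R M C (x \<oplus> y)"
  unfolding cellular_at_def
proof
  fix l assume l: "l \<in> L"
  obtain r where r: "\<forall>s\<in>M l. \<forall>t\<in>M l. \<exists>w\<in>vecs (lower_index L R M l). x \<otimes> C l s t = comb A (cell_family C) (column M r l s t + w)"
    using assms(4) l unfolding cellular_at_def by blast
  obtain r' where r': "\<forall>s\<in>M l. \<forall>t\<in>M l. \<exists>w\<in>vecs (lower_index L R M l). y \<otimes> C l s t = comb A (cell_family C) (column M r' l s t + w)"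
    using assms(5) l unfolding cellular_at_def by blast
  show "\<exists>r. \<forall>s\<in>M l. \<forall>t\<in>M l. \<exists>w\<in>vecs (lower_index L R M l). (x \<oplus> y) \<otimes> C l s t = comb A (cell_family C) (column M r l s t + w)"
  proof (rule exI[of _ "\<lambda>s' s. r s' s + r' s' s"], intro ballI)
    fix s t assume st: "s \<in> M l" "t \<in> M l"
    obtain w where w: "w \<in> vecs (lower_index L R M l)" "x \<otimes> C l s t = comb A (cell_family C) (column M r l s t + w)"
      using r st by blast
    obtain w' where w': "w' \<in> vecs (lower_index L R M l)" "y \<otimes> C l s t = comb A (cell_family C) (column M r' l s t + w')"
      using r' st by blast
    have v: "column M r l s t + w \<in> vecs (cell_index L M)"
      if "w \<in> vecs (lower_index L R M l)" for w and r :: "_ \<Rightarrow> _ \<Rightarrow> 'k"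
      by (rule vecs_add[OF column_vecs[where M = M, OF l st(2)] subsetD[OF vecs_mono[OF lower_index_subset] that]])
    have Cc: "C l s t \<in> carrier A" by (rule family_closed[where M = M, OF C l st])
    have "column M (\<lambda>s' s. r s' s + r' s' s) l s t = column M r l s t + column M r' l s t"
      unfolding column_def by (simp add: pm.scale_left_distrib sum.distrib)
    then have "(x \<oplus> y) \<otimes> C l s t = comb A (cell_family C) (column M (\<lambda>s' s. r s' s + r' s' s) l s t + (w + w'))"
      using comb_add[OF v[OF w(1)] v[OF w'(1)] C, of r r'] w(2) w'(2) assms(2,3) Cc by (simp add: l_distr ac_simps)
    then show "\<exists>w\<in>vecs (lower_index L R M l).
        (x \<oplus> y) \<otimes> C l s t = comb A (cell_family C) (column M (\<lambda>s' s. r s' s + r' s' s) l s t + w)"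
      using vecs_add[OF w(1) w'(1)] by blast
  qed
qed

end

section \<open>Tensor products of cellular algebras\<close>

definition lex_order :: "'l set \<Rightarrow> 'l rel \<Rightarrow> 'm set \<Rightarrow> 'm rel \<Rightarrow> ('l \<times> 'm) rel" where
  "lex_order L R L' R' = {((l, l'), (m, m')). l \<in> L \<and> l' \<in> L' \<and> m \<in> L \<and> m' \<in> L' \<and>
    ((l, m) \<in> R \<and> l \<noteq> m \<or> l = m \<and> (l', m') \<in> R')}"

lemma partial_order_on_lex:
  assumes "partial_order_on L R" "partial_order_on L' R'"
  shows "partial_order_on (L \<times> L') (lex_order L R L' R')"
proof -
  have R: "R \<subseteq> L \<times> L" "\<And>x. x \<in> L \<Longrightarrow> (x, x) \<in> R" "\<And>x y z. (x, y) \<in> R \<Longrightarrow> (y, z) \<in> R \<Longrightarrow> (x, z) \<in> R"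
    "\<And>x y. (x, y) \<in> R \<Longrightarrow> (y, x) \<in> R \<Longrightarrow> x = y"
    using assms(1) unfolding partial_order_on_def preorder_on_def refl_on_def trans_def antisym_def by blast+
  have R': "R' \<subseteq> L' \<times> L'" "\<And>x. x \<in> L' \<Longrightarrow> (x, x) \<in> R'" "\<And>x y z. (x, y) \<in> R' \<Longrightarrow> (y, z) \<in> R' \<Longrightarrow> (x, z) \<in> R'"
    "\<And>x y. (x, y) \<in> R' \<Longrightarrow> (y, x) \<in> R' \<Longrightarrow> x = y"
    using assms(2) unfolding partial_order_on_def preorder_on_def refl_on_def trans_def antisym_def by blast+
  have "lex_order L R L' R' \<subseteq> (L \<times> L') \<times> (L \<times> L')" unfolding lex_order_def by auto
  moreover have "refl_on (L \<times> L') (lex_order L R L' R')"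
    unfolding refl_on_def lex_order_def using R'(2) by auto
  moreover have "trans (lex_order L R L' R')"
    unfolding lex_order_def by (rule transI) (auto dest: R(3,4) R'(3))
  moreover have "antisym (lex_order L R L' R')"
    unfolding lex_order_def by (rule antisymI) (auto dest: R(4) R'(4))
  ultimately show ?thesis unfolding partial_order_on_def preorder_on_def by blast
qed

lemma tens_sum_left: "tens \<pi> (\<Sum>i\<in>I. x i) y = (\<Sum>i\<in>I. tens \<pi> (x i) y)"
  by (induction I rule: infinite_finite_induct) (auto simp: tens_simps)

lemma tens_sum_right: "tens \<pi> x (\<Sum>i\<in>I. y i) = (\<Sum>i\<in>I. tens \<pi> x (y i))"
  by (induction I rule: infinite_finite_induct) (auto simp: tens_simps)

text \<open>On pure tensors the product is a tensor of two columns with lower terms. Expanding, a term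
  with a lower index in the first factor is lower in the lexicographic order whatever the second index
  is, and a term with unchanged first index and lower second index is lower too. The involution is the
  tensor product of the two involutions.\<close>
theorem cell_datum_tensor:
  fixes A :: "('k::field, 'a, 'm) module_scheme" and B :: "('k, 'b, 'n) module_scheme"
    and M1 :: "'l1 \<Rightarrow> 's1 set" and M2 :: "'l2 \<Rightarrow> 's2 set"
  assumes D1: "cell_datum A L1 R1 M1 C1 star1" and D2: "cell_datum B L2 R2 M2 C2 star2"
  shows "\<exists>star. cell_datum (tensor_alg A B) (L1 \<times> L2) (lex_order L1 R1 L2 R2) (\<lambda>(l1, l2). M1 l1 \<times> M2 l2)
    (\<lambda>(l1, l2) (s1, s2) (t1, t2). tensor_elem A B (C1 l1 s1 t1) (C2 l2 s2 t2)) star"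
proof -
  interpret D1: cell_datum A L1 R1 M1 C1 star1 by (rule D1)
  interpret D2: cell_datum B L2 R2 M2 C2 star2 by (rule D2)
  interpret algebra_pair A B by unfold_locales
  interpret TT: k_algebra "tensor_alg A B" by (rule k_algebra_tensor)
  interpret RT: ring "tensor_alg A B" by (rule TT.ring)
  interpret RA: ring A by (rule D1.ring)
  interpret RB: ring B by (rule D2.ring)
  note I1 = D1[unfolded cell_datum_iff] and I2 = D2[unfolded cell_datum_iff]
  define L where "L = L1 \<times> L2"
  define R where "R = lex_order L1 R1 L2 R2"
  define M where "M = (\<lambda>(l1, l2). M1 l1 \<times> M2 l2)"
  define C where "C = (\<lambda>(l1, l2) (s1, s2) (t1, t2). tensor_elem A B (C1 l1 s1 t1) (C2 l2 s2 t2))"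
  define \<pi> where "\<pi> = (\<lambda>(l1 :: 'l1, s1 :: 's1, t1 :: 's1) (l2 :: 'l2, s2 :: 's2, t2 :: 's2). ((l1, l2), (s1, s2), (t1, t2)))"
  let ?f1 = "cell_family C1" and ?f2 = "cell_family C2" and ?f = "cell_family C"
  let ?I1 = "cell_index L1 M1" and ?I2 = "cell_index L2 M2"
  have b1: "?f1 \<in> ?I1 \<rightarrow> carrier A" using D1.C_closed unfolding cell_family_def cell_index_def by auto
  have b2: "?f2 \<in> ?I2 \<rightarrow> carrier B" using D2.C_closed unfolding cell_family_def cell_index_def by auto
  have bj1: "bij_betw (comb A ?f1) (vecs ?I1) (carrier A)" using I1 by blast
  have bj2: "bij_betw (comb B ?f2) (vecs ?I2) (carrier B)" using I2 by blast
  have fam: "?f (\<pi> i j) = tensor_elem A B (?f1 i) (?f2 j)" if "i \<in> ?I1" "j \<in> ?I2" for i j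
    unfolding cell_family_def \<pi>_def C_def by (simp split: prod.split)
  have img: "case_prod \<pi> ` (?I1 \<times> ?I2) = cell_index L M"
    unfolding cell_index_def \<pi>_def L_def M_def by (force simp: image_iff)
  have fC: "?f \<in> cell_index L M \<rightarrow> carrier (tensor_alg A B)"
    unfolding cell_family_def cell_index_def L_def M_def C_def
    using D1.C_closed D2.C_closed by (auto intro!: tensor_elem_closed)
  have basis: "bij_betw (comb (tensor_alg A B) ?f) (vecs (cell_index L M)) (carrier (tensor_alg A B))"
    using tensor_basis[where bb = ?f and \<pi> = \<pi>, OF b1 bj1 b2 bj2 fam] unfolding img .
  have te: "tensor_elem A B (comb A ?f1 x) (comb B ?f2 y) = comb (tensor_alg A B) ?f (tens \<pi> x y)"
    if "x \<in> vecs ?I1" "y \<in> vecs ?I2" for x y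
    by (rule tensor_elem_comb[where bb = ?f and \<pi> = \<pi>, OF b1 b2 fam that])
  note c1 = coordinates[OF D1.k_algebra_axioms b1 bj1] and c2 = coordinates[OF D2.k_algebra_axioms b2 bj2]
  let ?\<kappa>1 = "inv_into (vecs ?I1) (comb A ?f1)" and ?\<kappa>2 = "inv_into (vecs ?I2) (comb B ?f2)"
  have s1: "star1 a \<in> carrier A" "star1 (a \<oplus>\<^bsub>A\<^esub> a') = star1 a \<oplus>\<^bsub>A\<^esub> star1 a'" "star1 (c \<odot>\<^bsub>A\<^esub> a) = c \<odot>\<^bsub>A\<^esub> star1 a"
    if "a \<in> carrier A" "a' \<in> carrier A" for a a' c using D1.star_linear that unfolding k_linear_iff by auto
  have s2: "star2 a \<in> carrier B" "star2 (a \<oplus>\<^bsub>B\<^esub> a') = star2 a \<oplus>\<^bsub>B\<^esub> star2 a'" "star2 (c \<odot>\<^bsub>B\<^esub> a) = c \<odot>\<^bsub>B\<^esub> star2 a"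
    if "a \<in> carrier B" "a' \<in> carrier B" for a a' c using D2.star_linear that unfolding k_linear_iff by auto
  have "bilin A B (\<lambda>a b. tens \<pi> (?\<kappa>1 (star1 a)) (?\<kappa>2 (star2 b)))"
    unfolding bilin_def by (simp add: c1 c2 s1 s2 tens_simps)
  then obtain h where h: "\<And>a b. \<lbrakk>a \<in> carrier A; b \<in> carrier B\<rbrakk> \<Longrightarrow>
      h (tensor_elem A B a b) = tens \<pi> (?\<kappa>1 (star1 a)) (?\<kappa>2 (star2 b))"
    "\<And>x y. \<lbrakk>x \<in> carrier TT; y \<in> carrier TT\<rbrakk> \<Longrightarrow> h (x \<oplus>\<^bsub>TT\<^esub> y) = h x + h y"
    "\<And>c x. x \<in> carrier TT \<Longrightarrow> h (c \<odot>\<^bsub>TT\<^esub> x) = scale c (h x)"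
    using bilin_extend[of "\<lambda>a b. tens \<pi> (?\<kappa>1 (star1 a)) (?\<kappa>2 (star2 b))"] by blast
  have hv: "h X \<in> vecs (cell_index L M)" if "X \<in> carrier TT" for X
    using that
  proof (induction X rule: tensor_induct)
    case (elem a b)
    show ?case unfolding h(1)[OF elem] img[symmetric]
      by (rule tens_vecs[OF c1(1) c2(1)]) (use elem s1 s2 in auto)
  qed (simp add: h(2) vecs_add)
  define star where "star X = comb TT ?f (h X)" for X
  have star_elem: "star (tensor_elem A B a b) = tensor_elem A B (star1 a) (star2 b)" if "a \<in> carrier A" "b \<in> carrier B" for a b
    unfolding star_def h(1)[OF that]
    using te[OF c1(1) c2(1), of "star1 a" "star2 b"] c1(2) c2(2) s1 s2 that by simp
  have star_closed: "star X \<in> carrier TT" if "X \<in> carrier TT" for X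
    unfolding star_def by (rule TT.comb_closed[OF hv[OF that] fC])
  have star_add: "star (X \<oplus>\<^bsub>TT\<^esub> Y) = star X \<oplus>\<^bsub>TT\<^esub> star Y" if "X \<in> carrier TT" "Y \<in> carrier TT" for X Y
    unfolding star_def h(2)[OF that] by (rule TT.comb_add[OF hv[OF that(1)] hv[OF that(2)] fC])
  have star_smult: "star (c \<odot>\<^bsub>TT\<^esub> X) = c \<odot>\<^bsub>TT\<^esub> star X" if "X \<in> carrier TT" for c X
    unfolding star_def h(3)[OF that] by (rule TT.comb_scale[OF hv[OF that] fC])
  have star_star: "star (star X) = X" if "X \<in> carrier TT" for X
    using that
  proof (induction X rule: tensor_induct)
    case (elem a b)
    then show ?case using s1 s2 D1.star_involution D2.star_involution by (simp add: star_elem)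
  qed (simp add: star_add star_closed)
  have star_mult1: "star (tensor_elem A B a b \<otimes>\<^bsub>TT\<^esub> Y) = star Y \<otimes>\<^bsub>TT\<^esub> star (tensor_elem A B a b)"
    if "Y \<in> carrier TT" "a \<in> carrier A" "b \<in> carrier B" for Y a b
    using that(1)
  proof (induction Y rule: tensor_induct)
    case (elem a' b')
    then show ?case
      using that(2,3) s1 s2 D1.star_mult D2.star_mult by (simp add: star_elem tensor_elem_mult)
  next
    case (add x y)
    then show ?case
      using tensor_elem_closed[OF that(2,3)] by (simp add: RT.r_distr RT.l_distr star_add star_closed)
  qed
  have star_mult: "star (X \<otimes>\<^bsub>TT\<^esub> Y) = star Y \<otimes>\<^bsub>TT\<^esub> star X" if "X \<in> carrier TT" "Y \<in> carrier TT" for X Y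
    using that(1)
  proof (induction X rule: tensor_induct)
    case (add x y)
    then show ?case using that(2) by (simp add: RT.r_distr RT.l_distr star_add star_closed)
  qed (rule star_mult1[OF that(2)])
  have cell: "cellular_at TT L R M C X" if "X \<in> carrier TT" for X
    using that
  proof (induction X rule: tensor_induct)
    case (elem a b)
    show ?case
      unfolding cellular_at_def
    proof
      fix l assume "l \<in> L"
      then obtain l1 l2 where l: "l = (l1, l2)" "l1 \<in> L1" "l2 \<in> L2" unfolding L_def by blast
      obtain r1 where r1: "\<forall>s\<in>M1 l1. \<forall>t\<in>M1 l1. \<exists>w\<in>vecs (lower_index L1 R1 M1 l1).
          a \<otimes>\<^bsub>A\<^esub> C1 l1 s t = comb A ?f1 (column M1 r1 l1 s t + w)"
        using I1 elem(1) l(2) unfolding cellular_at_def by blast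
      obtain r2 where r2: "\<forall>s\<in>M2 l2. \<forall>t\<in>M2 l2. \<exists>w\<in>vecs (lower_index L2 R2 M2 l2).
          b \<otimes>\<^bsub>B\<^esub> C2 l2 s t = comb B ?f2 (column M2 r2 l2 s t + w)"
        using I2 elem(2) l(3) unfolding cellular_at_def by blast
      define r where "r = (\<lambda>(s1', s2') (s1, s2). r1 s1' s1 * r2 s2' s2)"
      show "\<exists>r. \<forall>s\<in>M l. \<forall>t\<in>M l. \<exists>w\<in>vecs (lower_index L R M l).
          tensor_elem A B a b \<otimes>\<^bsub>TT\<^esub> C l s t = comb TT ?f (column M r l s t + w)"
      proof (rule exI[of _ r], intro ballI)
        fix s t assume "s \<in> M l" "t \<in> M l"
        then obtain s1 s2 t1 t2 where st: "s = (s1, s2)" "t = (t1, t2)" "s1 \<in> M1 l1" "s2 \<in> M2 l2" "t1 \<in> M1 l1" "t2 \<in> M2 l2"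
          unfolding M_def l by auto
        obtain w1 where w1: "w1 \<in> vecs (lower_index L1 R1 M1 l1)" "a \<otimes>\<^bsub>A\<^esub> C1 l1 s1 t1 = comb A ?f1 (column M1 r1 l1 s1 t1 + w1)"
          using r1 st by blast
        obtain w2 where w2: "w2 \<in> vecs (lower_index L2 R2 M2 l2)" "b \<otimes>\<^bsub>B\<^esub> C2 l2 s2 t2 = comb B ?f2 (column M2 r2 l2 s2 t2 + w2)"
          using r2 st by blast
        let ?c1 = "column M1 r1 l1 s1 t1" and ?c2 = "column M2 r2 l2 s2 t2"
        have cv1: "?c1 \<in> vecs ({l1} \<times> M1 l1 \<times> M1 l1)" unfolding column_def
          by (intro vecs_sum vecs_scale vecs_e) (use st in auto)
        have cv2: "?c2 \<in> vecs ({l2} \<times> M2 l2 \<times> M2 l2)" unfolding column_def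
          by (intro vecs_sum vecs_scale vecs_e) (use st in auto)
        have w1v: "w1 \<in> vecs ?I1" by (rule subsetD[OF vecs_mono[OF lower_index_subset] w1(1)])
        have w2v: "w2 \<in> vecs ?I2" by (rule subsetD[OF vecs_mono[OF lower_index_subset] w2(1)])
        have v1: "?c1 + w1 \<in> vecs ?I1" by (rule vecs_add[OF column_vecs[where M = M1, OF l(2) st(5)] w1v])
        have v2: "?c2 + w2 \<in> vecs ?I2" by (rule vecs_add[OF column_vecs[where M = M2, OF l(3) st(6)] w2v])
        have cc: "tens \<pi> ?c1 ?c2 = column M r l s t"
          unfolding column_def tens_sum_left
          unfolding tens_sum_right tens_simps l st r_def M_def \<pi>_def
          by (simp add: sum.cartesian_product case_prod_beta mult.commute)
        have l1: "tens \<pi> w1 (?c2 + w2) \<in> vecs (lower_index L R M l)"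
          by (rule tens_vecs[OF w1(1) v2])
             (use l in \<open>auto simp: lower_index_def cell_index_def \<pi>_def L_def R_def M_def lex_order_def\<close>)
        have l2: "tens \<pi> ?c1 w2 \<in> vecs (lower_index L R M l)"
          by (rule tens_vecs[OF cv1 w2(1)])
             (use l in \<open>auto simp: lower_index_def \<pi>_def L_def R_def M_def lex_order_def\<close>)
        have "tensor_elem A B a b \<otimes>\<^bsub>TT\<^esub> C l s t = tensor_elem A B (a \<otimes>\<^bsub>A\<^esub> C1 l1 s1 t1) (b \<otimes>\<^bsub>B\<^esub> C2 l2 s2 t2)"
          unfolding C_def l st using elem l st D1.C_closed D2.C_closed by (simp add: tensor_elem_mult)
        also have "\<dots> = comb TT ?f (tens \<pi> (?c1 + w1) (?c2 + w2))"
          unfolding w1(2) w2(2) by (rule te[OF v1 v2])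
        also have "tens \<pi> (?c1 + w1) (?c2 + w2) = column M r l s t + (tens \<pi> ?c1 w2 + tens \<pi> w1 (?c2 + w2))"
          unfolding tens_simps cc by (simp add: ac_simps)
        finally show "\<exists>w\<in>vecs (lower_index L R M l). tensor_elem A B a b \<otimes>\<^bsub>TT\<^esub> C l s t = comb TT ?f (column M r l s t + w)"
          using vecs_add[OF l2 l1] by blast
      qed
    qed
  next
    case (add x y)
    then show ?case by (intro TT.cellular_at_add[OF fC])
  qed
  have "cell_datum TT L R M C star"
    unfolding cell_datum_iff k_linear_iff
  proof (intro conjI ballI allI)
    show "k_algebra TT" by (rule k_algebra_tensor)
    show "partial_order_on L R" unfolding L_def R_def by (rule partial_order_on_lex[OF D1.poset D2.poset])
    show "finite (M l)" if "l \<in> L" for l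
      using that D1.finite_M D2.finite_M unfolding L_def M_def by auto
    show "C l s t \<in> carrier TT" if "l \<in> L" "s \<in> M l" "t \<in> M l" for l s t
      by (rule family_closed[where M = M, OF fC that])
    show "star (C l s t) = C l t s" if "l \<in> L" "s \<in> M l" "t \<in> M l" for l s t
      using that D1.C_closed D2.C_closed D1.C2 D2.C2 unfolding L_def M_def C_def by (auto simp: star_elem)
  qed (use star_closed star_add star_smult star_star star_mult basis cell in auto)
  then show ?thesis unfolding L_def R_def M_def C_def by blast
qed

section \<open>Direct sums and isomorphic images of cellular algebras\<close>

text \<open>Multiplying an element of one summand by \<open>x\<close> only involves the component of
  \<open>x\<close> there, and indices of different summands are not comparable.\<close>
theorem cell_datum_dirsum:
  fixes A :: "'i \<Rightarrow> ('k::field, 'a, 'm) module_scheme" and M :: "'i \<Rightarrow> 'l \<Rightarrow> 's set"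
  assumes fin: "finite I" and D: "\<And>i. i \<in> I \<Longrightarrow> cell_datum (A i) (L i) (R i) (M i) (C i) (star i)"
  shows "cell_datum (dirsum_alg I A) (SIGMA i:I. L i) {((i, l), (j, m)). i = j \<and> i \<in> I \<and> (l, m) \<in> R i}
    (\<lambda>(i, l). M i l) (\<lambda>(i, l) s t. dirsum_in I A i (C i l s t)) (\<lambda>x. \<lambda>i\<in>I. star i (x i))"
proof -
  define L' where "L' = (SIGMA i:I. L i)"
  define R' where "R' = {((i, l), (j, m)). i = j \<and> i \<in> I \<and> (l, m) \<in> R i}"
  define M' where "M' = (\<lambda>(i, l). M i l)"
  define C' where "C' = (\<lambda>(i, l) s t. dirsum_in I A i (C i l s t))"
  note facts = D[unfolded cell_datum_iff]
  have alg: "k_algebra (A i)" if "i \<in> I" for i by (rule conjunct1[OF facts[OF that]])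
  interpret algebra_family I A by (rule algebra_family.intro[OF alg fin])
  interpret DD: k_algebra DD by (rule k_algebra_dirsum)
  let ?J = "\<lambda>i. cell_index (L i) (M i)" and ?b = "\<lambda>i. cell_family (C i)"
  let ?\<iota> = "\<lambda>(i, l, s, t). ((i, l), s, t)"
  have b: "?b i \<in> ?J i \<rightarrow> carrier (A i)" if "i \<in> I" for i
    using facts[OF that] unfolding cell_family_def cell_index_def by auto
  have bij: "bij_betw (comb (A i) (?b i)) (vecs (?J i)) (carrier (A i))" if "i \<in> I" for i
    using facts[OF that] by blast
  have fam: "(cell_family C' \<circ> ?\<iota>) (i, j) = dirsum_in I A i (?b i j)" if "i \<in> I" "j \<in> ?J i" for i j
    unfolding cell_family_def C'_def by (simp split: prod.split)
  have img: "?\<iota> ` (SIGMA i:I. ?J i) = cell_index L' M'"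
  proof (intro equalityI subsetI)
    fix x assume "x \<in> cell_index L' M'"
    then obtain i l s t where "x = ((i, l), s, t)" "i \<in> I" "l \<in> L i" "s \<in> M i l" "t \<in> M i l"
      unfolding cell_index_def L'_def M'_def by auto
    then show "x \<in> ?\<iota> ` (SIGMA i:I. ?J i)" by (intro image_eqI[of _ _ "(i, l, s, t)"]) (auto simp: cell_index_def)
  qed (auto simp: cell_index_def L'_def M'_def)
  have fC: "cell_family C' \<in> cell_index L' M' \<rightarrow> carrier DD"
    unfolding cell_family_def cell_index_def L'_def M'_def C'_def
    using facts by (auto intro!: dirsum_in_closed)
  have \<iota>: "inj_on ?\<iota> (SIGMA i:I. ?J i)" by (auto intro!: inj_onI)
  have "bij_betw (comb DD (cell_family C' \<circ> ?\<iota>)) (vecs (SIGMA i:I. ?J i)) (carrier DD)"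
    by (rule dirsum_basis[OF b fam bij])
  then have basis: "bij_betw (comb DD (cell_family C')) (vecs (cell_index L' M')) (carrier DD)"
    using DD.reindex_basis[of "cell_family C'" ?\<iota> "SIGMA i:I. ?J i"] fC \<iota> unfolding img by blast
  have cell: "cellular_at DD L' R' M' C' x" if x: "x \<in> carrier DD" for x
    unfolding cellular_at_def
  proof
    fix k assume "k \<in> L'"
    then obtain i l where k: "k = (i, l)" "i \<in> I" "l \<in> L i" unfolding L'_def by blast
    interpret Ai: k_algebra "A i" by (rule alg[OF k(2)])
    have "cellular_at (A i) (L i) (R i) (M i) (C i) (x i)"
      using facts[OF k(2)] dirsum_component[OF x k(2)] by blast
    then obtain r where r: "\<forall>s\<in>M i l. \<forall>t\<in>M i l. \<exists>w\<in>vecs (lower_index (L i) (R i) (M i) l).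
        x i \<otimes>\<^bsub>A i\<^esub> C i l s t = comb (A i) (?b i) (column (M i) r l s t + w)"
      using k(3) unfolding cellular_at_def by blast
    show "\<exists>r. \<forall>s\<in>M' k. \<forall>t\<in>M' k. \<exists>w\<in>vecs (lower_index L' R' M' k).
        x \<otimes>\<^bsub>DD\<^esub> C' k s t = comb DD (cell_family C') (column M' r k s t + w)"
    proof (rule exI[of _ r], intro ballI)
      fix s t assume st: "s \<in> M' k" "t \<in> M' k"
      then have st': "s \<in> M i l" "t \<in> M i l" unfolding M'_def k by auto
      then obtain w where w: "w \<in> vecs (lower_index (L i) (R i) (M i) l)"
          "x i \<otimes>\<^bsub>A i\<^esub> C i l s t = comb (A i) (?b i) (column (M i) r l s t + w)" using r by blast
      let ?\<rho> = "\<lambda>(l, s, t). ((i, l), s, t)"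
      have v: "column (M i) r l s t + w \<in> vecs (?J i)"
        by (rule vecs_add[OF column_vecs[where M = "M i", OF k(3) st'(2)] subsetD[OF vecs_mono[OF lower_index_subset] w(1)]])
      have Cc: "C i l s t \<in> carrier (A i)" using facts[OF k(2)] k st' by blast
      have "x \<otimes>\<^bsub>DD\<^esub> C' k s t = dirsum_in I A i (comb (A i) (?b i) (column (M i) r l s t + w))"
        unfolding C'_def k using mult_dirsum_in[OF k(2) x Cc] w(2) by simp
      also have "\<dots> = comb DD (\<lambda>j. dirsum_in I A i (?b i j)) (column (M i) r l s t + w)"
        by (rule Ai.comb_linear_map[OF k_algebra_dirsum dirsum_in_linear[OF k(2)] v b[OF k(2)]])
      also have "(\<lambda>j. dirsum_in I A i (?b i j)) = (\<lambda>j. cell_family C' (?\<rho> j))"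
        unfolding cell_family_def C'_def by (auto split: prod.split)
      also have "comb DD (\<lambda>j. cell_family C' (?\<rho> j)) (column (M i) r l s t + w)
          = comb DD (cell_family C') (lin_ext (\<lambda>j. e (?\<rho> j)) (column (M i) r l s t + w))"
        by (rule DD.comb_reindex[symmetric, OF v _ fC])
           (use k(2) in \<open>auto simp: cell_index_def L'_def M'_def\<close>)
      also have "lin_ext (\<lambda>j. e (?\<rho> j)) (column (M i) r l s t + w) = column M' r k s t + lin_ext (\<lambda>j. e (?\<rho> j)) w"
        unfolding lin_ext_add column_def lin_ext_sum lin_ext_scale lin_ext_e M'_def k by simp
      finally have "x \<otimes>\<^bsub>DD\<^esub> C' k s t = comb DD (cell_family C') (column M' r k s t + lin_ext (\<lambda>j. e (?\<rho> j)) w)" .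
      moreover have "lin_ext (\<lambda>j. e (?\<rho> j)) w \<in> vecs (lower_index L' R' M' k)"
        by (rule vecs_lin_ext[OF w(1)])
           (use k in \<open>auto simp: lower_index_def L'_def R'_def M'_def intro!: vecs_e\<close>)
      ultimately show "\<exists>w\<in>vecs (lower_index L' R' M' k). x \<otimes>\<^bsub>DD\<^esub> C' k s t = comb DD (cell_family C') (column M' r k s t + w)"
        by blast
    qed
  qed
  have st: "star i a \<in> carrier (A i)" "star i (a \<oplus>\<^bsub>A i\<^esub> a') = star i a \<oplus>\<^bsub>A i\<^esub> star i a'"
    "star i (c \<odot>\<^bsub>A i\<^esub> a) = c \<odot>\<^bsub>A i\<^esub> star i a" "star i (star i a) = a" "star i (a \<otimes>\<^bsub>A i\<^esub> a') = star i a' \<otimes>\<^bsub>A i\<^esub> star i a"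
    if "i \<in> I" "a \<in> carrier (A i)" "a' \<in> carrier (A i)" for i a a' c
    using facts[OF that(1)] that(2,3) unfolding k_linear_iff by auto
  have star0: "star i \<zero>\<^bsub>A i\<^esub> = \<zero>\<^bsub>A i\<^esub>" if "i \<in> I" for i
    using st(3)[OF that, of "\<zero>\<^bsub>A i\<^esub>" "\<zero>\<^bsub>A i\<^esub>" 0] k_algebra.smult_zero[OF algebra[OF that]] st(1)[OF that]
      ring.ring_simprules(2)[OF ring_component[OF that]] by simp
  have "cell_datum DD L' R' M' C' (\<lambda>x. \<lambda>i\<in>I. star i (x i))"
    unfolding cell_datum_iff k_linear_iff
  proof (intro conjI ballI allI)
    show "k_algebra DD" by (rule k_algebra_dirsum)
    have po: "R i \<subseteq> L i \<times> L i" "refl_on (L i) (R i)" "trans (R i)" "antisym (R i)" if "i \<in> I" for i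
      using facts[OF that] unfolding partial_order_on_def preorder_on_def by blast+
    have "R' \<subseteq> L' \<times> L'" unfolding R'_def L'_def using po(1) by blast
    moreover have "refl_on L' R'" unfolding R'_def L'_def refl_on_def using po(2) by (auto dest: refl_onD)
    moreover have "trans R'" unfolding R'_def by (rule transI) (auto dest: transD[OF po(3)])
    moreover have "antisym R'" unfolding R'_def by (rule antisymI) (auto dest: antisymD[OF po(4)])
    ultimately show "partial_order_on L' R'" unfolding partial_order_on_def preorder_on_def by blast
    show "finite (M' l)" if "l \<in> L'" for l using that facts unfolding L'_def M'_def by auto
    show "C' l s t \<in> carrier DD" if "l \<in> L'" "s \<in> M' l" "t \<in> M' l" for l s t
      by (rule family_closed[where M = M', OF fC that])
    show "(\<lambda>i\<in>I. star i (C' l s t i)) = C' l t s" if "l \<in> L'" "s \<in> M' l" "t \<in> M' l" for l s t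
      using that facts star0 unfolding L'_def M'_def C'_def
      by (auto intro!: dirsum_eqI simp: dirsum_in_simps)
  qed (use basis cell st in \<open>auto intro!: dirsum_eqI dirsum_ext simp: dirsum_simps\<close>)
  then show ?thesis unfolding L'_def R'_def M'_def C'_def .
qed

theorem cell_datum_transport:
  fixes A :: "('k::field, 'a, 'm) module_scheme" and B :: "('k, 'b, 'n) module_scheme"
    and M :: "'l \<Rightarrow> 's set"
  assumes D: "cell_datum A L R M C star" and B: "k_algebra B" and \<Phi>: "\<Phi> \<in> alg_iso A B"
  shows "cell_datum B L R M (\<lambda>l s t. \<Phi> (C l s t)) (\<lambda>y. \<Phi> (star (inv_into (carrier A) \<Phi> y)))"
proof -
  interpret D: cell_datum A L R M C star by (rule D)
  interpret B: k_algebra B by (rule B)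
  note I = D[unfolded cell_datum_iff]
  have lin: "\<Phi> \<in> k_linear A B" and hom: "\<Phi> \<in> ring_iso A B" using \<Phi> unfolding alg_iso_def by auto
  have \<Phi>': "\<Phi> a \<in> carrier B" "\<Phi> (a \<oplus>\<^bsub>A\<^esub> a') = \<Phi> a \<oplus>\<^bsub>B\<^esub> \<Phi> a'" "\<Phi> (c \<odot>\<^bsub>A\<^esub> a) = c \<odot>\<^bsub>B\<^esub> \<Phi> a"
    "\<Phi> (a \<otimes>\<^bsub>A\<^esub> a') = \<Phi> a \<otimes>\<^bsub>B\<^esub> \<Phi> a'" if "a \<in> carrier A" "a' \<in> carrier A" for a a' c
    using lin ring_hom_mult[of \<Phi> A B a a'] hom that unfolding k_linear_iff ring_iso_def by auto
  have \<Phi>c: "\<Phi> a \<in> carrier B" if "a \<in> carrier A" for a by (rule \<Phi>'(1)[OF that that])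
  have bij: "bij_betw \<Phi> (carrier A) (carrier B)" using hom unfolding ring_iso_def by blast
  let ?\<Psi> = "inv_into (carrier A) \<Phi>"
  have inv: "?\<Psi> (\<Phi> a) = a" if "a \<in> carrier A" for a
    using bij that unfolding bij_betw_def by (simp add: inv_into_f_f)
  have rep: "\<exists>a\<in>carrier A. b = \<Phi> a" if "b \<in> carrier B" for b
    using bij that unfolding bij_betw_def by blast
  have st: "star a \<in> carrier A" "star (a \<oplus>\<^bsub>A\<^esub> a') = star a \<oplus>\<^bsub>A\<^esub> star a'"
    "star (c \<odot>\<^bsub>A\<^esub> a) = c \<odot>\<^bsub>A\<^esub> star a" "star (star a) = a" "star (a \<otimes>\<^bsub>A\<^esub> a') = star a' \<otimes>\<^bsub>A\<^esub> star a"
    if "a \<in> carrier A" "a' \<in> carrier A" for a a' c using I that unfolding k_linear_iff by auto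
  interpret RA: ring A by (rule D.ring)
  have Cc: "C l s t \<in> carrier A" if "l \<in> L" "s \<in> M l" "t \<in> M l" for l s t using D.C_closed that .
  let ?fam = "cell_family (\<lambda>l s t. \<Phi> (C l s t))"
  have fam: "?fam = (\<lambda>j. \<Phi> (cell_family C j))"
    unfolding cell_family_def by (auto split: prod.split)
  have fC: "cell_family C \<in> cell_index L M \<rightarrow> carrier A" using Cc unfolding cell_family_def cell_index_def by auto
  have cb: "comb B ?fam c = \<Phi> (comb A (cell_family C) c)" if "c \<in> vecs (cell_index L M)" for c
    unfolding fam by (rule D.comb_linear_map[symmetric, OF B lin that fC])
  have "bij_betw (\<Phi> \<circ> comb A (cell_family C)) (vecs (cell_index L M)) (carrier B)"
    using I bij bij_betw_trans by blast
  then have basis: "bij_betw (comb B ?fam) (vecs (cell_index L M)) (carrier B)"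
    by (rule iffD1[OF bij_betw_cong, rotated]) (simp add: cb)
  have cell: "cellular_at B L R M (\<lambda>l s t. \<Phi> (C l s t)) (\<Phi> a)" if a: "a \<in> carrier A" for a
    unfolding cellular_at_def
  proof
    fix l assume l: "l \<in> L"
    have "cellular_at A L R M C a" using I a by blast
    then obtain r where r: "\<forall>s\<in>M l. \<forall>t\<in>M l. \<exists>w\<in>vecs (lower_index L R M l). a \<otimes>\<^bsub>A\<^esub> C l s t = comb A (cell_family C) (column M r l s t + w)"
      using l unfolding cellular_at_def by blast
    show "\<exists>r. \<forall>s\<in>M l. \<forall>t\<in>M l. \<exists>w\<in>vecs (lower_index L R M l). \<Phi> a \<otimes>\<^bsub>B\<^esub> \<Phi> (C l s t) = comb B ?fam (column M r l s t + w)"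
    proof (rule exI[of _ r], intro ballI)
      fix s t assume st: "s \<in> M l" "t \<in> M l"
      then obtain w where w: "w \<in> vecs (lower_index L R M l)" "a \<otimes>\<^bsub>A\<^esub> C l s t = comb A (cell_family C) (column M r l s t + w)"
        using r by blast
      have v: "column M r l s t + w \<in> vecs (cell_index L M)"
        by (rule vecs_add[OF column_vecs[where M = M, OF l st(2)] subsetD[OF vecs_mono[OF lower_index_subset] w(1)]])
      show "\<exists>w\<in>vecs (lower_index L R M l). \<Phi> a \<otimes>\<^bsub>B\<^esub> \<Phi> (C l s t) = comb B ?fam (column M r l s t + w)"
        using w(1) cb[OF v] w(2) \<Phi>'(4)[OF a Cc[OF l st]] by metis
    qed
  qed
  show ?thesis
    unfolding cell_datum_iff k_linear_iff
  proof (intro conjI ballI allI)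
    show "\<Phi> (star (?\<Psi> (x \<oplus>\<^bsub>B\<^esub> y))) = \<Phi> (star (?\<Psi> x)) \<oplus>\<^bsub>B\<^esub> \<Phi> (star (?\<Psi> y))"
      if "x \<in> carrier B" "y \<in> carrier B" for x y
      using rep[OF that(1)] rep[OF that(2)] by (auto simp: inv st \<Phi>'(2)[symmetric] \<Phi>'(1))
    show "\<Phi> (star (?\<Psi> (x \<otimes>\<^bsub>B\<^esub> y))) = \<Phi> (star (?\<Psi> y)) \<otimes>\<^bsub>B\<^esub> \<Phi> (star (?\<Psi> x))"
      if "x \<in> carrier B" "y \<in> carrier B" for x y
      using rep[OF that(1)] rep[OF that(2)] by (auto simp: inv st \<Phi>'(4)[symmetric] \<Phi>'(1))
    show "\<Phi> (star (?\<Psi> (c \<odot>\<^bsub>B\<^esub> x))) = c \<odot>\<^bsub>B\<^esub> \<Phi> (star (?\<Psi> x))" if "x \<in> carrier B" for c x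
      using rep[OF that] by (auto simp: inv st \<Phi>'(3)[symmetric] D.smult_closed)
    show "\<Phi> (star (?\<Psi> x)) \<in> carrier B" if "x \<in> carrier B" for x
      using rep[OF that] by (auto simp: inv st \<Phi>'(1))
    show "\<Phi> (star (?\<Psi> (\<Phi> (star (?\<Psi> x))))) = x" if "x \<in> carrier B" for x
      using rep[OF that] by (auto simp: inv st)
    show "cellular_at B L R M (\<lambda>l s t. \<Phi> (C l s t)) x" if "x \<in> carrier B" for x
      using rep[OF that] cell by blast
    show "k_algebra B" by (rule B)
    show "partial_order_on L R" using I by blast
    show "finite (M l)" if "l \<in> L" for l using I that by blast
    show "\<Phi> (C l s t) \<in> carrier B" if "l \<in> L" "s \<in> M l" "t \<in> M l" for l s t by (rule \<Phi>c[OF Cc[OF that]])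
    show "bij_betw (comb B ?fam) (vecs (cell_index L M)) (carrier B)" by (rule basis)
    show "\<Phi> (star (?\<Psi> (\<Phi> (C l s t)))) = \<Phi> (C l t s)" if "l \<in> L" "s \<in> M l" "t \<in> M l" for l s t
      using that Cc I by (simp add: inv)
  qed
qed

section \<open>Commutants of operators\<close>

text \<open>The common form of the Schur algebras of both types and of the commutants on the pieces
  \<open>X i\<close>.\<close>
definition End_of :: "'x set \<Rightarrow> ('x, 'k::field) lop set \<Rightarrow> ('k, ('x \<Rightarrow>\<^sub>0 'k) \<Rightarrow> ('x \<Rightarrow>\<^sub>0 'k)) module" where
  "End_of P G =
    \<lparr>carrier = {\<phi> \<in> vecs P \<rightarrow>\<^sub>E vecs P.
       (\<forall>x\<in>vecs P. \<forall>y\<in>vecs P. \<phi> (x + y) = \<phi> x + \<phi> y) \<and>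
       (\<forall>c. \<forall>x\<in>vecs P. \<phi> (scale c x) = scale c (\<phi> x)) \<and>
       (\<forall>r\<in>G. \<forall>x\<in>vecs P. \<phi> (x \<triangleleft> r) = \<phi> x \<triangleleft> r)},
     mult = compose (vecs P),
     one = (\<lambda>x\<in>vecs P. x),
     zero = (\<lambda>x\<in>vecs P. 0),
     add = (\<lambda>\<phi> \<psi>. \<lambda>x\<in>vecs P. \<phi> x + \<psi> x),
     smult = (\<lambda>c \<phi>. \<lambda>x\<in>vecs P. scale c (\<phi> x))\<rparr>"

definition preserved :: "'x set \<Rightarrow> ('x, 'k::field) lop set \<Rightarrow> bool" where
  "preserved P G \<longleftrightarrow> (\<forall>r\<in>G. \<forall>x\<in>vecs P. x \<triangleleft> r \<in> vecs P)"

lemma End_of_iff: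
  "\<phi> \<in> carrier (End_of P G) \<longleftrightarrow> \<phi> \<in> extensional (vecs P) \<and> (\<forall>x\<in>vecs P. \<phi> x \<in> vecs P) \<and>
    (\<forall>x\<in>vecs P. \<forall>y\<in>vecs P. \<phi> (x + y) = \<phi> x + \<phi> y) \<and> (\<forall>c. \<forall>x\<in>vecs P. \<phi> (scale c x) = scale c (\<phi> x)) \<and>
    (\<forall>r\<in>G. \<forall>x\<in>vecs P. \<phi> (x \<triangleleft> r) = \<phi> x \<triangleleft> r)"
  unfolding End_of_def by (auto simp: PiE_iff)

lemma End_of_ops:
  "x \<in> vecs P \<Longrightarrow> (\<phi> \<otimes>\<^bsub>End_of P G\<^esub> \<psi>) x = \<phi> (\<psi> x)" "x \<in> vecs P \<Longrightarrow> \<one>\<^bsub>End_of P G\<^esub> x = x"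
  "x \<in> vecs P \<Longrightarrow> \<zero>\<^bsub>End_of P G\<^esub> x = 0" "x \<in> vecs P \<Longrightarrow> (\<phi> \<oplus>\<^bsub>End_of P G\<^esub> \<psi>) x = \<phi> x + \<psi> x"
  "x \<in> vecs P \<Longrightarrow> (c \<odot>\<^bsub>End_of P G\<^esub> \<phi>) x = scale c (\<phi> x)"
  unfolding End_of_def by (auto simp: compose_def)

lemma End_of_ext:
  "\<phi> \<otimes>\<^bsub>End_of P G\<^esub> \<psi> \<in> extensional (vecs P)" "\<one>\<^bsub>End_of P G\<^esub> \<in> extensional (vecs P)"
  "\<zero>\<^bsub>End_of P G\<^esub> \<in> extensional (vecs P)" "\<phi> \<oplus>\<^bsub>End_of P G\<^esub> \<psi> \<in> extensional (vecs P)"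
  "c \<odot>\<^bsub>End_of P G\<^esub> \<phi> \<in> extensional (vecs P)"
  unfolding End_of_def by (auto simp: compose_def)

lemma End_of_eqI:
  "\<lbrakk>\<phi> \<in> extensional (vecs P); \<psi> \<in> extensional (vecs P); \<And>x. x \<in> vecs P \<Longrightarrow> \<phi> x = \<psi> x\<rbrakk> \<Longrightarrow> \<phi> = \<psi>"
  by (rule extensionalityI)

lemma End_of_zero: "\<phi> \<in> carrier (End_of P G) \<Longrightarrow> \<phi> 0 = 0"
  unfolding End_of_iff by (metis pm.scale_zero_left vecs_zero)

lemma k_algebra_End_of:
  assumes "preserved P G"
  shows "k_algebra (End_of P G)"
proof (rule k_algebraI)
  have p: "x \<triangleleft> r \<in> vecs P" if "r \<in> G" "x \<in> vecs P" for r x using assms that unfolding preserved_def by blast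
  have neg: "\<exists>\<psi>\<in>carrier (End_of P G). \<psi> \<oplus>\<^bsub>End_of P G\<^esub> \<phi> = \<zero>\<^bsub>End_of P G\<^esub>" if "\<phi> \<in> carrier (End_of P G)" for \<phi>
  proof (rule bexI[of _ "\<lambda>x\<in>vecs P. - \<phi> x"])
    show "(\<lambda>x\<in>vecs P. - \<phi> x) \<oplus>\<^bsub>End_of P G\<^esub> \<phi> = \<zero>\<^bsub>End_of P G\<^esub>"
      by (rule End_of_eqI[where P = P]) (auto simp: End_of_ops End_of_ext)
    have "(- x) \<triangleleft> r = - (x \<triangleleft> r)" for x and r :: "('a, 'b) lop"
      using app_diff[of 0 x r] by (simp add: app_zero)
    then show "(\<lambda>x\<in>vecs P. - \<phi> x) \<in> carrier (End_of P G)"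
      using that p unfolding End_of_iff by (auto simp: vecs_uminus vecs_add vecs_scale pm.scale_minus_right)
  qed
  show "ring (End_of P G)"
  proof (rule ringI)
    show "abelian_group (End_of P G)"
      by (rule abelian_groupI)
         (auto intro!: End_of_eqI neg simp: End_of_iff End_of_ops End_of_ext vecs_zero vecs_add vecs_scale p app_add app_zero pm.scale_right_distrib ac_simps)
    show "Group.monoid (End_of P G)"
      by (rule monoidI)
         (auto intro!: End_of_eqI simp: End_of_iff End_of_ops End_of_ext vecs_add vecs_scale p)
  qed (auto intro!: End_of_eqI simp: End_of_iff End_of_ops End_of_ext vecs_add vecs_scale p)
  have p': "scale c x \<triangleleft> r = scale c (x \<triangleleft> r)" for c x and r :: "('a, 'b) lop" by (rule app_scale)
qed (auto intro!: End_of_eqI simp: End_of_iff End_of_ops End_of_ext vecs_add vecs_scale app_scale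
      pm.scale_left_distrib pm.scale_right_distrib mult.commute assms[unfolded preserved_def, rule_format])

section \<open>Schur algebras as commutants of the Hecke generators\<close>

context schur_parameters
begin

abbreviation Op :: "nat list \<Rightarrow> (int list, 'k) lop" where
  "Op w \<equiv> prod_list (map (opT d Q q) w)"

text \<open>The action of the free algebra by the operators of a word. It is defined on the whole space,
  so that its kernel is a two-sided ideal (\<open>actf_ideal\<close>); this ideal contains the Hecke
  relations, hence the action of a coset does not depend on the representative.\<close>
definition actf :: "(int list \<Rightarrow>\<^sub>0 'k) \<Rightarrow> (nat list \<Rightarrow>\<^sub>0 'k) \<Rightarrow> (int list \<Rightarrow>\<^sub>0 'k)" where
  "actf x y = lin_ext (\<lambda>w. x \<triangleleft> Op w) y"

lemma actf_simps:
  "actf x (y + y') = actf x y + actf x y'" "actf x (scale c y) = scale c (actf x y)" "actf x (y - y') = actf x y - actf x y'"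
  "actf x 0 = 0" "actf x (Poly_Mapping.single w c) = scale c (x \<triangleleft> Op w)"
  unfolding actf_def by (simp_all add: lin_ext_add lin_ext_scale lin_ext_diff lin_ext_zero lin_ext_single)

lemma actf_left: "actf (x + x') y = actf x y + actf x' y" "actf (scale c x) y = scale c (actf x y)" "actf 0 y = 0"
  unfolding actf_def lin_ext_def
  by (simp_all add: app_add app_scale app_zero pm.scale_right_distrib sum.distrib pm.scale_sum_right mult.commute)

lemma actf_mult:
  assumes "y' \<in> vecs UNIV" "y \<in> vecs UNIV"
  shows "actf (actf x y) y' = actf x (tens (@) y y')"
  using assms(2)
proof (induction y rule: vecs_induct)
  case (e a w)
  from assms(1) show ?case
    by (induction y' rule: vecs_induct)
       (simp_all add: tens_simps actf_simps actf_left app_mult app_scale mult.commute pm.scale_right_distrib del: pm.scale_cancel_left)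
qed (simp_all add: tens_simps actf_simps actf_left)

abbreviation HF :: "('k, nat list \<Rightarrow>\<^sub>0 'k) module" where "HF \<equiv> hecke_free d"

lemma HF_simps:
  "carrier HF = vecs (lists {0..<d})" "x \<otimes>\<^bsub>HF\<^esub> y = tens (@) x y" "\<one>\<^bsub>HF\<^esub> = e []" "\<zero>\<^bsub>HF\<^esub> = 0"
  "x \<oplus>\<^bsub>HF\<^esub> y = x + y" "c \<odot>\<^bsub>HF\<^esub> x = scale c x"
  unfolding hecke_free_def monoid_alg_mult by (simp_all add: monoid_alg_simps free_monoid_def)

lemma HF_algebra: "k_algebra HF"
  unfolding hecke_free_def
  by (rule k_algebra_monoid_alg, rule monoidI) (auto simp: free_monoid_def)

lemma vecs_UNIV: "x \<in> vecs UNIV" unfolding vecs_def by simp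

lemma hecke_rels_closed: "hecke_rels Q q d \<subseteq> carrier HF"
proof -
  have s: "Poly_Mapping.single w c \<in> vecs (lists {0..<d})" if "w \<in> lists {0..<d}" for w and c :: 'k
    using that unfolding vecs_def by auto
  show ?thesis
    unfolding hecke_rels_def HF_simps by (auto intro!: vecs_diff s)
qed

lemma actf_rels: "y \<in> hecke_rels Q q d \<Longrightarrow> actf x y = 0"
proof -
  assume y: "y \<in> hecke_rels Q q d"
  have far: "opT d Q q i * opT d Q q j = opT d Q q j * opT d Q q i" if "i < d" "j < d" "1 < \<bar>int i - int j\<bar>" for i j
    using opT_far[of j d i Q q] opT_far[of i d j Q q] that by (cases "i < j") auto
  have eqs: "x \<triangleleft> r \<triangleleft> s = x \<triangleleft> (r * s)" for r s :: "(int list, 'k) lop" by (simp add: app_mult)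
  consider (a) i where "1 \<le> i" "Suc i < d" "y = e [i, Suc i, i] - e [Suc i, i, Suc i]"
    | (b) "1 < d" "y = e [0, 1, 0, 1] - e [1, 0, 1, 0]"
    | (c) i j where "i < d" "j < d" "1 < \<bar>int i - int j\<bar>" "y = e [i, j] - e [j, i]"
    | (d) "0 < d" "y = e [0, 0] - Poly_Mapping.single [0] (inverse Q - Q) - e []"
    | (f) i where "1 \<le> i" "i < d" "y = e [i, i] - Poly_Mapping.single [i] (inverse q - q) - e []"
    using y unfolding hecke_rels_def by (auto split: if_splits)
  then show ?thesis
  proof cases
    case a
    then show ?thesis using opT_braid[OF nz(1) a(1,2), of Q] by (simp add: actf_simps mult.assoc)
  next
    case b
    then show ?thesis using opT_braid_B[OF nz b(1)] by (simp add: actf_simps mult.assoc)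
  next
    case c
    then show ?thesis using far[OF c(1-3)] by (simp add: actf_simps)
  next
    case d
    then show ?thesis using opT_quadratic_0[OF nz(2) d(1), of q]
      by (simp add: actf_simps app_plus app_mult[of x "sc _"] app_sc app_scale app_one del: app_mult)
  next
    case f
    then show ?thesis using opT_quadratic[OF nz(1) f(1,2), of Q]
      by (simp add: actf_simps app_plus app_mult[of x "sc _"] app_sc app_scale app_one del: app_mult)
  qed
qed

lemma hecke_ideal: "ideal (hecke_ideal Q q d) HF"
  unfolding hecke_ideal_def
  by (rule ring.genideal_ideal[OF k_algebra.ring[OF HF_algebra] hecke_rels_closed])

lemma actf_ideal: "y \<in> hecke_ideal Q q d \<Longrightarrow> actf x y = 0"
proof -
  interpret HF: k_algebra HF by (rule HF_algebra)
  interpret RF: ring HF by (rule HF.ring)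
  define N where "N = {y \<in> vecs (lists {0..<d}). \<forall>x. actf x y = 0}"
  have N_tens: "tens (@) y y' \<in> vecs (lists {0..<d})"
    if "y \<in> vecs (lists {0..<d})" "y' \<in> vecs (lists {0..<d})" for y y' :: "nat list \<Rightarrow>\<^sub>0 'k"
    by (rule tens_vecs[OF that]) auto
  have "ideal N HF"
  proof (rule idealI[OF RF.ring_axioms])
    show "subgroup N (add_monoid HF)"
    proof (rule RF.add.subgroupI)
      fix y assume y: "y \<in> N"
      have "\<ominus>\<^bsub>HF\<^esub> y = - y"
        by (rule RF.minus_equality) (use y in \<open>auto simp: HF_simps N_def vecs_uminus\<close>)
      moreover have "actf x (- y) = 0" for x using actf_simps(3)[of x 0 y] y unfolding N_def by (simp add: actf_simps)
      ultimately show "\<ominus>\<^bsub>HF\<^esub> y \<in> N" using y unfolding N_def by (simp add: vecs_uminus)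
    qed (auto simp: HF_simps N_def actf_simps vecs_zero vecs_add intro: exI[of _ 0])
    fix a y assume a: "a \<in> N" "y \<in> carrier HF"
    show "y \<otimes>\<^bsub>HF\<^esub> a \<in> N"
      using a N_tens by (auto simp: N_def HF_simps actf_mult[OF vecs_UNIV vecs_UNIV, symmetric])
    show "a \<otimes>\<^bsub>HF\<^esub> y \<in> N"
      using a N_tens by (auto simp: N_def HF_simps actf_mult[OF vecs_UNIV vecs_UNIV, symmetric] actf_left)
  qed
  moreover have "hecke_rels Q q d \<subseteq> N"
    using hecke_rels_closed actf_rels unfolding N_def HF_simps by blast
  ultimately have "hecke_ideal Q q d \<subseteq> N"
    unfolding hecke_ideal_def by (rule RF.genideal_minimal)
  then show "y \<in> hecke_ideal Q q d \<Longrightarrow> actf x y = 0" unfolding N_def by blast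
qed

abbreviation E :: "(int list \<Rightarrow>\<^sub>0 'k) set" where "E \<equiv> tensor_space n d"

lemma E_T: "\<lbrakk>x \<in> E; t < d\<rbrakk> \<Longrightarrow> x \<triangleleft> opT d Q q t \<in> E"
  using invariant_tensor_space unfolding invariant_def by auto

lemma E_zero: "0 \<in> E" and E_add: "\<lbrakk>x \<in> E; y \<in> E\<rbrakk> \<Longrightarrow> x + y \<in> E" and E_scale: "x \<in> E \<Longrightarrow> scale c x \<in> E"
  unfolding tensor_space_words by (simp_all add: vecs_zero vecs_add vecs_scale)

lemma lin_ext_T_basis: "x \<in> E \<Longrightarrow> lin_ext (T_basis Q q t) x = x \<triangleleft> opT d Q q t"
  unfolding opT_def app_lop_of tensor_space_words
  by (rule lin_ext_cong_vecs) (auto simp: TB_def words_def)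

lemma E_Op: "\<lbrakk>w \<in> lists {0..<d}; x \<in> E\<rbrakk> \<Longrightarrow> x \<triangleleft> Op w \<in> E"
  by (induction w arbitrary: x) (auto simp: app_one app_mult E_T)

lemma act_monomial_eq: "\<lbrakk>w \<in> lists {0..<d}; x \<in> E\<rbrakk> \<Longrightarrow> act_monomial Q q x w = x \<triangleleft> Op w"
  unfolding act_monomial_def
  by (induction w arbitrary: x) (auto simp: app_one app_mult lin_ext_T_basis E_T)

lemma act_coset:
  assumes x: "x \<in> E" and y: "y \<in> carrier HF"
  shows "act Q q x (hecke_ideal Q q d +>\<^bsub>HF\<^esub> y) = actf x y"
proof -
  interpret I: ideal "hecke_ideal Q q d" HF by (rule hecke_ideal)
  have "lin_ext (act_monomial Q q x) y' = actf x y" if y': "y' \<in> hecke_ideal Q q d +>\<^bsub>HF\<^esub> y" for y'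
  proof -
    obtain i where i: "i \<in> hecke_ideal Q q d" "y' = i + y"
      using y' unfolding a_r_coset_def' HF_simps by blast
    then have "y' \<in> vecs (lists {0..<d})" using I.a_subset y unfolding HF_simps by (auto intro!: vecs_add)
    then have "lin_ext (act_monomial Q q x) y' = actf x y'"
      unfolding actf_def by (rule lin_ext_cong_vecs) (rule act_monomial_eq[OF _ x])
    then show ?thesis using actf_ideal[OF i(1)] i(2) by (simp add: actf_simps)
  qed
  moreover have "hecke_ideal Q q d +>\<^bsub>HF\<^esub> y \<noteq> {}" using I.a_rcos_self[OF y] by blast
  ultimately have "lin_ext (act_monomial Q q x) ` (hecke_ideal Q q d +>\<^bsub>HF\<^esub> y) = {actf x y}" by auto
  then show ?thesis unfolding act_def by simp
qed

lemma hecke_B_carrier: "h \<in> carrier (hecke_B Q q d) \<longleftrightarrow> (\<exists>y\<in>carrier HF. h = hecke_ideal Q q d +>\<^bsub>HF\<^esub> y)"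
  unfolding hecke_B_def quot_alg_carrier ..

lemma gen_closed: "t < d \<Longrightarrow> e [t] \<in> carrier HF"
  unfolding HF_simps by (rule vecs_e) simp

lemma act_gen: "\<lbrakk>x \<in> E; t < d\<rbrakk> \<Longrightarrow> act Q q x (hecke_gen Q q d t) = x \<triangleleft> opT d Q q t"
  unfolding hecke_gen_def using act_coset[OF _ gen_closed] by (simp add: actf_simps)

lemma actf_E:
  assumes "y \<in> carrier HF" "x \<in> E" shows "actf x y \<in> E"
  using assms(1)[unfolded HF_simps]
  by (induction y rule: vecs_induct) (auto simp: actf_simps E_zero E_add E_scale E_Op assms(2))

definition linear_on_E :: "((int list \<Rightarrow>\<^sub>0 'k) \<Rightarrow> (int list \<Rightarrow>\<^sub>0 'k)) \<Rightarrow> bool" where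
  "linear_on_E g \<longleftrightarrow> (\<forall>x\<in>E. g x \<in> E) \<and> (\<forall>x\<in>E. \<forall>y\<in>E. g (x + y) = g x + g y) \<and>
    (\<forall>c. \<forall>x\<in>E. g (scale c x) = scale c (g x))"

lemma commute_actf:
  assumes g: "linear_on_E g" and T: "\<And>t x. \<lbrakk>t < d; x \<in> E\<rbrakk> \<Longrightarrow> g (x \<triangleleft> opT d Q q t) = g x \<triangleleft> opT d Q q t"
    and x: "x \<in> E" and y: "y \<in> carrier HF"
  shows "g (actf x y) = actf (g x) y"
  using y[unfolded HF_simps]
proof (induction y rule: vecs_induct)
  case zero
  have "g 0 = 0" using g E_zero unfolding linear_on_E_def by (metis pm.scale_zero_left)
  then show ?case by (simp add: actf_simps)
next
  case (add y y')
  then show ?case using g x actf_E unfolding linear_on_E_def by (simp add: actf_simps HF_simps)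
next
  case (e c w)
  have "g (x \<triangleleft> Op w) = g x \<triangleleft> Op w"
    using e x by (induction w arbitrary: x) (auto simp: app_one app_mult E_T T)
  then show ?case using g E_Op[OF e x] unfolding linear_on_E_def by (simp add: actf_simps)
qed

text \<open>Commuting with the Hecke algebra is commuting with its generators.\<close>
lemma schur_B_eq: "schur_B Q q n d = End_of (words d I) (opT d Q q ` {..<d})"
proof -
  have "(\<forall>h\<in>carrier (hecke_B Q q d). \<forall>x\<in>E. g (act Q q x h) = act Q q (g x) h) \<longleftrightarrow>
      (\<forall>r\<in>opT d Q q ` {..<d}. \<forall>x\<in>E. g (x \<triangleleft> r) = g x \<triangleleft> r)" (is "?l \<longleftrightarrow> ?r") if g: "linear_on_E g" for g
  proof
    assume l: ?l
    have "hecke_gen Q q d t \<in> carrier (hecke_B Q q d)" if "t < d" for t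
      unfolding hecke_B_carrier hecke_gen_def using gen_closed[OF that] by blast
    then have "g (x \<triangleleft> opT d Q q t) = g x \<triangleleft> opT d Q q t" if t: "t < d" and x: "x \<in> E" for t x
    proof -
      have gx: "g x \<in> E" using g x unfolding linear_on_E_def by blast
      have "g (act Q q x (hecke_gen Q q d t)) = act Q q (g x) (hecke_gen Q q d t)"
        using l \<open>\<And>t. t < d \<Longrightarrow> hecke_gen Q q d t \<in> carrier (hecke_B Q q d)\<close>[OF t] x by blast
      then show ?thesis unfolding act_gen[OF x t] act_gen[OF gx t] .
    qed
    then show ?r by blast
  next
    assume r: ?r
    show ?l
    proof (intro ballI)
      fix h x assume h: "h \<in> carrier (hecke_B Q q d)" and x: "x \<in> E"
      obtain y where y: "y \<in> carrier HF" "h = hecke_ideal Q q d +>\<^bsub>HF\<^esub> y" using h unfolding hecke_B_carrier by blast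
      have "g x \<in> E" using g x unfolding linear_on_E_def by blast
      then show "g (act Q q x h) = act Q q (g x) h"
        unfolding y(2) act_coset[OF x y(1)] act_coset[OF \<open>g x \<in> E\<close> y(1)]
        by (intro commute_actf[OF g _ x y(1)]) (use r in auto)
    qed
  qed
  then show ?thesis
    unfolding schur_B_def End_alg_def End_of_def tensor_space_words[symmetric]
    by (auto simp: linear_on_E_def PiE_iff intro!: Collect_cong conj_cong)
qed

text \<open>The elements of the type B algebra that commute with a given map form a subalgebra, which
  contains the hull as soon as it contains the generators \<open>T 1, \<dots>, T (d - 1)\<close>.\<close>
lemma schur_A_eq: "schur_A Q q n d = End_of (words d I) (opT d Q q ` {1..<d})"
proof -
  have gens: "hecke_gen Q q d t \<in> hecke_A Q q d" if "t \<in> {1..<d}" for t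
    unfolding hecke_A_def by (rule subsetD[OF hull_subset imageI[OF that]])
  have "(\<forall>h\<in>hecke_A Q q d. \<forall>x\<in>E. g (act Q q x h) = act Q q (g x) h) \<longleftrightarrow>
      (\<forall>r\<in>opT d Q q ` {1..<d}. \<forall>x\<in>E. g (x \<triangleleft> r) = g x \<triangleleft> r)" (is "?l \<longleftrightarrow> ?r") if g: "linear_on_E g" for g
  proof
    assume l: ?l
    have "g (x \<triangleleft> opT d Q q t) = g x \<triangleleft> opT d Q q t" if t: "t \<in> {1..<d}" and x: "x \<in> E" for t x
    proof -
      have "g x \<in> E" using g x unfolding linear_on_E_def by blast
      then show ?thesis using l gens[OF t] act_gen[of _ t] t x by (metis atLeastLessThan_iff)
    qed
    then show ?r by blast
  next
    assume r: ?r
    interpret HF: k_algebra HF by (rule HF_algebra)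
    interpret HB: k_algebra "hecke_B Q q d" unfolding hecke_B_def by (rule HF.k_algebra_quot_alg[OF hecke_ideal])
    interpret RH: ring "hecke_B Q q d" by (rule HB.ring)
    note ops = HF.quot_alg_ops[OF hecke_ideal, folded hecke_B_def]
    define SS where "SS = {h \<in> carrier (hecke_B Q q d). \<forall>x\<in>E. g (act Q q x h) = act Q q (g x) h}"
    have S_coset: "hecke_ideal Q q d +>\<^bsub>HF\<^esub> y \<in> SS \<longleftrightarrow> (\<forall>x\<in>E. g (actf x y) = actf (g x) y)" if "y \<in> carrier HF" for y
      using that act_coset[OF _ that] g unfolding SS_def hecke_B_carrier linear_on_E_def by auto
    have S_rep: "\<exists>y\<in>carrier HF. h = hecke_ideal Q q d +>\<^bsub>HF\<^esub> y \<and> (\<forall>x\<in>E. g (actf x y) = actf (g x) y)" if "h \<in> SS" for h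
      using that S_coset unfolding SS_def hecke_B_carrier by blast
    have S_smult: "c \<odot>\<^bsub>hecke_B Q q d\<^esub> h \<in> SS" if h: "h \<in> SS" for c h
    proof -
      obtain y where y: "y \<in> carrier HF" "h = hecke_ideal Q q d +>\<^bsub>HF\<^esub> y" "\<forall>x\<in>E. g (actf x y) = actf (g x) y"
        using S_rep[OF h] by blast
      show ?thesis
        unfolding y(2) ops(3)[OF y(1) y(1)]
        using y g actf_E by (subst S_coset) (auto simp: HF.smult_closed, auto simp: HF_simps actf_simps linear_on_E_def)
    qed
    have "subring SS (hecke_B Q q d)"
    proof (rule RH.subringI)
      show "SS \<subseteq> carrier (hecke_B Q q d)" unfolding SS_def by blast
      have "\<one>\<^bsub>hecke_B Q q d\<^esub> = hecke_ideal Q q d +>\<^bsub>HF\<^esub> e []" unfolding hecke_B_def quot_alg_simps HF_simps ..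
      then show "\<one>\<^bsub>hecke_B Q q d\<^esub> \<in> SS" using S_coset[of "e []"] by (auto simp: HF_simps actf_simps app_one intro: vecs_e)
      fix h assume h: "h \<in> SS"
      show "\<ominus>\<^bsub>hecke_B Q q d\<^esub> h \<in> SS"
        using S_smult[OF h, of "- 1"] HB.smult_minus_one[of h] h unfolding SS_def by simp
      fix h' assume h': "h' \<in> SS"
      obtain y where y: "y \<in> carrier HF" "h = hecke_ideal Q q d +>\<^bsub>HF\<^esub> y" "\<forall>x\<in>E. g (actf x y) = actf (g x) y"
        using S_rep[OF h] by blast
      obtain y' where y': "y' \<in> carrier HF" "h' = hecke_ideal Q q d +>\<^bsub>HF\<^esub> y'" "\<forall>x\<in>E. g (actf x y') = actf (g x) y'"
        using S_rep[OF h'] by blast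
      have yz: "tens (@) y y' \<in> carrier HF" "y + y' \<in> carrier HF"
        using y(1) y'(1) unfolding HF_simps by (auto intro!: vecs_add tens_vecs)
      have m: "hecke_ideal Q q d +>\<^bsub>HF\<^esub> tens (@) y y' \<in> SS"
        unfolding S_coset[OF yz(1)] actf_mult[OF vecs_UNIV vecs_UNIV, symmetric]
        using y y' actf_E by simp
      show "h \<otimes>\<^bsub>hecke_B Q q d\<^esub> h' \<in> SS"
        unfolding y(2) y'(2) ops(1)[OF y(1) y'(1)] HF_simps by (rule m)
      have a: "hecke_ideal Q q d +>\<^bsub>HF\<^esub> (y + y') \<in> SS"
        unfolding S_coset[OF yz(2)] actf_simps
        using y y' actf_E g by (simp add: linear_on_E_def)
      show "h \<oplus>\<^bsub>hecke_B Q q d\<^esub> h' \<in> SS"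
        unfolding y(2) y'(2) ops(2)[OF y(1) y'(1)] HF_simps by (rule a)
    qed
    then have "k_subalgebra SS (hecke_B Q q d)" unfolding k_subalgebra_def using S_smult by blast
    moreover have "hecke_gen Q q d t \<in> SS" if "t \<in> {1..<d}" for t
      using S_coset[OF gen_closed[of t]] that r unfolding hecke_gen_def by (auto simp: actf_simps)
    ultimately have "hecke_A Q q d \<subseteq> SS" unfolding hecke_A_def by (intro hull_minimal) auto
    then show ?l unfolding SS_def by blast
  qed
  then show ?thesis
    unfolding schur_A_def End_alg_def End_of_def tensor_space_words[symmetric]
    by (auto simp: linear_on_E_def PiE_iff intro!: Collect_cong conj_cong)
qed

lemma preserved_words: "A \<subseteq> {..<d} \<Longrightarrow> preserved (words d I) (opT d Q q ` A)"
  using E_T unfolding preserved_def tensor_space_words by auto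

end

section \<open>Commutants of tensor products\<close>

lemma lin_ext_add_fun: "lin_ext (\<lambda>p. f p + g p) x = lin_ext f x + lin_ext g x"
  unfolding lin_ext_def by (simp add: pm.scale_right_distrib sum.distrib)

lemma lin_ext_scale_fun: "lin_ext (\<lambda>p. scale c (f p)) x = scale c (lin_ext f x)"
  unfolding lin_ext_def by (simp add: pm.scale_sum_right mult.commute)

lemma End_of_apply:
  assumes "\<phi> \<in> carrier (End_of P G)"
  shows "x \<in> vecs P \<Longrightarrow> \<phi> x \<in> vecs P" "\<lbrakk>x \<in> vecs P; y \<in> vecs P\<rbrakk> \<Longrightarrow> \<phi> (x + y) = \<phi> x + \<phi> y"
    "x \<in> vecs P \<Longrightarrow> \<phi> (scale c x) = scale c (\<phi> x)" "\<lbrakk>r \<in> G; x \<in> vecs P\<rbrakk> \<Longrightarrow> \<phi> (x \<triangleleft> r) = \<phi> x \<triangleleft> r"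
    "\<phi> \<in> extensional (vecs P)"
  using assms unfolding End_of_iff by auto

lemma comb_End_of:
  assumes G: "preserved P G" and b: "b \<in> I \<rightarrow> carrier (End_of P G)" and u: "u \<in> vecs I" and x: "x \<in> vecs P"
  shows "comb (End_of P G) b u x = lin_ext (\<lambda>i. b i x) u"
  using u
proof (induction u rule: vecs_induct)
  interpret k_algebra "End_of P G" by (rule k_algebra_End_of[OF G])
  case zero
  show ?case using x by (simp add: comb_zero End_of_ops lin_ext_zero)
next
  interpret k_algebra "End_of P G" by (rule k_algebra_End_of[OF G])
  case (add u w)
  then show ?case using x by (simp add: comb_add[OF _ _ b] End_of_ops lin_ext_add)
next
  interpret k_algebra "End_of P G" by (rule k_algebra_End_of[OF G])
  case (e a i)
  then show ?case
    using x comb_scale[OF vecs_e[OF e] b] comb_e[of b i, OF funcset_mem[OF b e]] by (simp add: End_of_ops lin_ext_scale lin_ext_e)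
qed

text \<open>The span of \<open>P\<close> is the tensor product of the spans of \<open>P1\<close> and
  \<open>P2\<close>, with \<open>\<mu>\<close> forming the pair of two basis vectors, and the operators
  in \<open>G\<close> are those of \<open>G1\<close> and \<open>G2\<close> acting on one factor.\<close>
locale commutant_pair =
  fixes P1 :: "'x set" and P2 :: "'y set" and P :: "'z set"
    and G1 :: "('x, 'k::field) lop set" and G2 :: "('y, 'k) lop set" and G :: "('z, 'k) lop set"
    and \<mu> :: "'x \<Rightarrow> 'y \<Rightarrow> 'z" and \<mu>1 :: "'z \<Rightarrow> 'x" and \<mu>2 :: "'z \<Rightarrow> 'y"
  assumes fin: "finite P2"
    and preserved1: "preserved P1 G1" and preserved2: "preserved P2 G2"
    and \<mu>_mem: "\<lbrakk>u \<in> P1; w \<in> P2\<rbrakk> \<Longrightarrow> \<mu> u w \<in> P"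
    and \<mu>_inv: "\<lbrakk>u \<in> P1; w \<in> P2\<rbrakk> \<Longrightarrow> \<mu>1 (\<mu> u w) = u" "\<lbrakk>u \<in> P1; w \<in> P2\<rbrakk> \<Longrightarrow> \<mu>2 (\<mu> u w) = w"
    and \<mu>_rep: "p \<in> P \<Longrightarrow> \<mu>1 p \<in> P1" "p \<in> P \<Longrightarrow> \<mu>2 p \<in> P2" "p \<in> P \<Longrightarrow> \<mu> (\<mu>1 p) (\<mu>2 p) = p"
    and G_cases: "r \<in> G \<Longrightarrow>
      (\<exists>s\<in>G1. \<forall>x\<in>vecs P1. \<forall>y\<in>vecs P2. tens \<mu> x y \<triangleleft> r = tens \<mu> (x \<triangleleft> s) y) \<or>
      (\<exists>s\<in>G2. \<forall>x\<in>vecs P1. \<forall>y\<in>vecs P2. tens \<mu> x y \<triangleleft> r = tens \<mu> x (y \<triangleleft> s))"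
    and G1_lift: "s \<in> G1 \<Longrightarrow> \<exists>r\<in>G. \<forall>x\<in>vecs P1. \<forall>y\<in>vecs P2. tens \<mu> x y \<triangleleft> r = tens \<mu> (x \<triangleleft> s) y"
    and G2_lift: "t \<in> G2 \<Longrightarrow> \<exists>r\<in>G. \<forall>x\<in>vecs P1. \<forall>y\<in>vecs P2. tens \<mu> x y \<triangleleft> r = tens \<mu> x (y \<triangleleft> t)"
begin

abbreviation A1 where "A1 \<equiv> End_of P1 G1"
abbreviation A2 where "A2 \<equiv> End_of P2 G2"
abbreviation A where "A \<equiv> End_of P G"

lemma tens_P: "\<lbrakk>x \<in> vecs P1; y \<in> vecs P2\<rbrakk> \<Longrightarrow> tens \<mu> x y \<in> vecs P"
  by (rule tens_vecs) (auto intro: \<mu>_mem)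

lemma pres1: "\<lbrakk>s \<in> G1; x \<in> vecs P1\<rbrakk> \<Longrightarrow> x \<triangleleft> s \<in> vecs P1" and pres2: "\<lbrakk>t \<in> G2; y \<in> vecs P2\<rbrakk> \<Longrightarrow> y \<triangleleft> t \<in> vecs P2"
  using preserved1 preserved2 unfolding preserved_def by auto

lemma vecs_P_induct [consumes 1, case_names zero add tens]:
  fixes z :: "'z \<Rightarrow>\<^sub>0 'k"
  assumes "z \<in> vecs P" "Q 0" "\<And>x y. \<lbrakk>x \<in> vecs P; y \<in> vecs P; Q x; Q y\<rbrakk> \<Longrightarrow> Q (x + y)"
    and "\<And>x y. \<lbrakk>x \<in> vecs P1; y \<in> vecs P2\<rbrakk> \<Longrightarrow> Q (tens \<mu> x y)"
  shows "Q z"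
  using assms(1)
proof (induction z rule: vecs_induct)
  case (e a p)
  have "scale a (e p) = tens \<mu> (scale a (e (\<mu>1 p))) (e (\<mu>2 p))" using \<mu>_rep(3)[OF e] by (simp add: tens_simps)
  then show ?case using assms(4)[of "scale a (e (\<mu>1 p))" "e (\<mu>2 p)"] e by (simp add: vecs_scale vecs_e \<mu>_rep)
qed (use assms in auto)

lemma preserved_P: "preserved P G"
  unfolding preserved_def
proof (intro ballI)
  fix r and z :: "'z \<Rightarrow>\<^sub>0 'k" assume r: "r \<in> G" and z: "z \<in> vecs P"
  show "z \<triangleleft> r \<in> vecs P"
    using z
  proof (induction z rule: vecs_P_induct)
    case (tens x y)
    then show ?case using G_cases[OF r] pres1 pres2 tens_P by metis
  qed (auto simp: app_zero app_add vecs_zero vecs_add)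
qed

sublocale algebra_pair A1 A2
  by (rule algebra_pair.intro) (use k_algebra_End_of preserved1 preserved2 in blast)+

definition box :: "(('x \<Rightarrow>\<^sub>0 'k) \<Rightarrow> ('x \<Rightarrow>\<^sub>0 'k)) \<Rightarrow> (('y \<Rightarrow>\<^sub>0 'k) \<Rightarrow> ('y \<Rightarrow>\<^sub>0 'k)) \<Rightarrow> ('z \<Rightarrow>\<^sub>0 'k) \<Rightarrow> ('z \<Rightarrow>\<^sub>0 'k)" where
  "box a b z = lin_ext (\<lambda>p. tens \<mu> (a (e (\<mu>1 p))) (b (e (\<mu>2 p)))) z"

lemma box_tens:
  assumes a: "a \<in> carrier A1" and b: "b \<in> carrier A2" and x: "x \<in> vecs P1" and y: "y \<in> vecs P2"
  shows "box a b (tens \<mu> x y) = tens \<mu> (a x) (b y)"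
  using x
proof (induction x rule: vecs_induct)
  case (e c u)
  note u = e
  have "box a b (tens \<mu> (e u) y) = tens \<mu> (a (e u)) (b y)"
    using y
  proof (induction y rule: vecs_induct)
    case (e c w)
    then show ?case
      using u by (simp add: box_def tens_simps lin_ext_scale lin_ext_e \<mu>_inv End_of_apply(3)[OF b] vecs_e)
  qed (simp_all add: box_def tens_simps lin_ext_zero lin_ext_add End_of_zero[OF b] End_of_apply(2)[OF b])
  then show ?case using e by (simp add: tens_simps box_def lin_ext_scale End_of_apply(3)[OF a] vecs_e)
qed (simp_all add: box_def tens_simps lin_ext_zero lin_ext_add End_of_zero[OF a] End_of_apply(2)[OF a])

lemma box_bilin:
  assumes "z \<in> vecs P" shows "bilin A1 A2 (\<lambda>a b. box a b z)"
proof -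
  have "box (a \<oplus>\<^bsub>A1\<^esub> a') b z = box a b z + box a' b z" for a a' b
    unfolding box_def lin_ext_add_fun[symmetric]
    by (rule lin_ext_cong_vecs[OF assms]) (simp only: End_of_ops(4) vecs_e \<mu>_rep(1,2) tens_add_left)
  moreover have "box a (b \<oplus>\<^bsub>A2\<^esub> b') z = box a b z + box a b' z" for a b b'
    unfolding box_def lin_ext_add_fun[symmetric]
    by (rule lin_ext_cong_vecs[OF assms]) (simp only: End_of_ops(4) vecs_e \<mu>_rep(1,2) tens_add_right)
  moreover have "box (c \<odot>\<^bsub>A1\<^esub> a) b z = scale c (box a b z)" for a b c
    unfolding box_def lin_ext_scale_fun[symmetric]
    by (rule lin_ext_cong_vecs[OF assms]) (simp only: End_of_ops(5) vecs_e \<mu>_rep(1,2) tens_scale_left)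
  moreover have "box a (c \<odot>\<^bsub>A2\<^esub> b) z = scale c (box a b z)" for a b c
    unfolding box_def lin_ext_scale_fun[symmetric]
    by (rule lin_ext_cong_vecs[OF assms]) (simp only: End_of_ops(5) vecs_e \<mu>_rep(1,2) tens_scale_right)
  ultimately show ?thesis unfolding bilin_def by simp
qed

lemma box_linear: "box a b (z + z') = box a b z + box a b z'" "box a b (scale c z) = scale c (box a b z)" "box a b 0 = 0"
  unfolding box_def by (simp_all add: lin_ext_add lin_ext_scale lin_ext_zero)

lemma box_closed:
  assumes "a \<in> carrier A1" "b \<in> carrier A2" "z \<in> vecs P" shows "box a b z \<in> vecs P"
  unfolding box_def
proof (rule vecs_lin_ext[OF assms(3)])
  fix p assume p: "p \<in> P"
  show "tens \<mu> (a (e (\<mu>1 p))) (b (e (\<mu>2 p))) \<in> vecs P"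
    by (rule tens_P[OF End_of_apply(1)[OF assms(1) vecs_e[OF \<mu>_rep(1)[OF p]]] End_of_apply(1)[OF assms(2) vecs_e[OF \<mu>_rep(2)[OF p]]]])
qed

lemma box_commutes:
  assumes a: "a \<in> carrier A1" and b: "b \<in> carrier A2" and z: "z \<in> vecs P" and r: "r \<in> G"
  shows "box a b (z \<triangleleft> r) = box a b z \<triangleleft> r"
  using z
proof (induction z rule: vecs_P_induct)
  case (tens x y)
  note xy = End_of_apply(1)[OF a tens(1)] End_of_apply(1)[OF b tens(2)]
  from G_cases[OF r] show ?case
  proof (elim disjE bexE)
    fix s assume s: "s \<in> G1" "\<forall>x\<in>vecs P1. \<forall>y\<in>vecs P2. tens \<mu> x y \<triangleleft> r = tens \<mu> (x \<triangleleft> s) y"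
    then show ?thesis using tens xy pres1[OF s(1)] by (simp add: box_tens[OF a b] End_of_apply(4)[OF a])
  next
    fix s assume s: "s \<in> G2" "\<forall>x\<in>vecs P1. \<forall>y\<in>vecs P2. tens \<mu> x y \<triangleleft> r = tens \<mu> x (y \<triangleleft> s)"
    then show ?thesis using tens xy pres2[OF s(1)] by (simp add: box_tens[OF a b] End_of_apply(4)[OF b])
  qed
qed (simp_all add: app_zero app_add box_linear)

text \<open>The coefficient of the basis vector \<open>l\<close> of the second factor.\<close>
definition slice :: "'y \<Rightarrow> ('z \<Rightarrow>\<^sub>0 'k) \<Rightarrow> ('x \<Rightarrow>\<^sub>0 'k)" where
  "slice l z = lin_ext (\<lambda>p. if \<mu>2 p = l then e (\<mu>1 p) else 0) z"

lemma slice_linear: "slice l (z + z') = slice l z + slice l z'" "slice l (scale c z) = scale c (slice l z)" "slice l 0 = 0"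
  unfolding slice_def by (simp_all add: lin_ext_add lin_ext_scale lin_ext_zero)

lemma slice_sum: "slice l (\<Sum>i\<in>F. g i) = (\<Sum>i\<in>F. slice l (g i))"
  unfolding slice_def by (rule lin_ext_sum)

lemma slice_closed: "z \<in> vecs P \<Longrightarrow> slice l z \<in> vecs P1"
  unfolding slice_def by (erule vecs_lin_ext) (auto intro: vecs_e vecs_zero \<mu>_rep)

lemma slice_tens:
  assumes "x \<in> vecs P1" "y \<in> vecs P2" shows "slice l (tens \<mu> x y) = scale (Poly_Mapping.lookup y l) x"
  using assms(1)
proof (induction x rule: vecs_induct)
  case (e c u)
  note u = e
  have "slice l (tens \<mu> (e u) y) = scale (Poly_Mapping.lookup y l) (e u)"
    using assms(2)
  proof (induction y rule: vecs_induct)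
    case (e c w)
    then show ?case
      using u by (auto simp: slice_def tens_simps lin_ext_scale lin_ext_e \<mu>_inv lookup_scale lookup_single)
  qed (simp_all add: tens_simps slice_linear lookup_add pm.scale_left_distrib)
  then show ?case by (simp add: tens_simps slice_linear mult.commute)
qed (simp_all add: tens_simps slice_linear pm.scale_right_distrib)

lemma slices_sum: "z \<in> vecs P \<Longrightarrow> (\<Sum>l\<in>P2. tens \<mu> (slice l z) (e l)) = z"
proof (induction z rule: vecs_induct)
  case (e c p)
  have "(\<Sum>l\<in>P2. tens \<mu> (slice l (e p)) (e l)) = (\<Sum>l\<in>P2. if l = \<mu>2 p then e p else 0 :: 'z \<Rightarrow>\<^sub>0 'k)"
    by (rule sum.cong) (auto simp: slice_def lin_ext_e tens_simps \<mu>_rep e)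
  also have "\<dots> = e p" using \<mu>_rep(2)[OF e] fin by simp
  finally show ?case by (simp add: slice_linear tens_simps pm.scale_sum_right[symmetric])
qed (simp_all add: slice_linear tens_simps sum.distrib)

lemma slice_commutes:
  assumes s: "s \<in> G1" and r: "\<forall>x\<in>vecs P1. \<forall>y\<in>vecs P2. tens \<mu> x y \<triangleleft> r = tens \<mu> (x \<triangleleft> s) y" and z: "z \<in> vecs P"
  shows "slice l (z \<triangleleft> r) = slice l z \<triangleleft> s"
  using z
proof (induction z rule: vecs_P_induct)
  case (tens x y)
  then show ?case using r pres1[OF s] by (simp add: slice_tens app_scale)
qed (simp_all add: slice_linear app_zero app_add)

context
  fixes b1 :: "'i \<Rightarrow> ('x \<Rightarrow>\<^sub>0 'k) \<Rightarrow> ('x \<Rightarrow>\<^sub>0 'k)" and I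
    and b2 :: "'j \<Rightarrow> ('y \<Rightarrow>\<^sub>0 'k) \<Rightarrow> ('y \<Rightarrow>\<^sub>0 'k)" and J
  assumes b1: "b1 \<in> I \<rightarrow> carrier A1" "bij_betw (comb A1 b1) (vecs I) (carrier A1)"
    and b2: "b2 \<in> J \<rightarrow> carrier A2" "bij_betw (comb A2 b2) (vecs J) (carrier A2)"
begin

lemma b1_independent:
  assumes "u \<in> vecs I" "\<And>x. x \<in> vecs P1 \<Longrightarrow> lin_ext (\<lambda>i. b1 i x) u = 0"
  shows "u = 0"
proof -
  have "comb A1 b1 u = \<zero>\<^bsub>A1\<^esub>"
    by (rule End_of_eqI[where P = P1])
       (use assms A.comb_closed[OF assms(1) b1(1)] comb_End_of[OF preserved1 b1(1)] in \<open>auto simp: End_of_apply(5) End_of_ops End_of_ext\<close>)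
  then show ?thesis using b1(2) assms(1) vecs_zero[of I] A.comb_zero[of b1] unfolding bij_betw_def inj_on_def by metis
qed

lemma b2_independent:
  assumes "u \<in> vecs J" "\<And>x. x \<in> vecs P2 \<Longrightarrow> lin_ext (\<lambda>i. b2 i x) u = 0"
  shows "u = 0"
proof -
  have "comb A2 b2 u = \<zero>\<^bsub>A2\<^esub>"
    by (rule End_of_eqI[where P = P2])
       (use assms B.comb_closed[OF assms(1) b2(1)] comb_End_of[OF preserved2 b2(1)] in \<open>auto simp: End_of_apply(5) End_of_ops End_of_ext\<close>)
  then show ?thesis using b2(2) assms(1) vecs_zero[of J] B.comb_zero[of b2] unfolding bij_betw_def inj_on_def by metis
qed

text \<open>For fixed \<open>y\<close> and \<open>l\<close> the map
  \<open>x \<mapsto> slice l (\<phi> (x \<otimes> y))\<close> commutes with \<open>G1\<close>, so it is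
  a combination of the basis \<open>b1\<close> of the first commutant. Its coefficients, collected over
  \<open>l\<close>, are linear maps \<open>\<psi> i\<close> of \<open>y\<close>, and independence of
  \<open>b1\<close> shows that these commute with \<open>G2\<close>.\<close>
lemma commutant_expansion:
  assumes \<phi>: "\<phi> \<in> carrier A"
  shows "\<exists>F \<psi>. finite F \<and> F \<subseteq> I \<and> (\<forall>i\<in>F. \<psi> i \<in> carrier A2) \<and>
    (\<forall>x\<in>vecs P1. \<forall>y\<in>vecs P2. \<phi> (tens \<mu> x y) = (\<Sum>i\<in>F. tens \<mu> (b1 i x) (\<psi> i y)))"
proof -
  let ?\<kappa> = "inv_into (vecs I) (comb A1 b1)"
  note c = coordinates[OF A.k_algebra_axioms b1]
  define \<sigma> where "\<sigma> y l = (\<lambda>x\<in>vecs P1. slice l (\<phi> (tens \<mu> x y)))" for y l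
  have \<sigma>: "\<sigma> y l \<in> carrier A1" if y: "y \<in> vecs P2" for y l
  proof -
    have "slice l (\<phi> (tens \<mu> (x \<triangleleft> s) y)) = slice l (\<phi> (tens \<mu> x y)) \<triangleleft> s" if s: "s \<in> G1" and x: "x \<in> vecs P1" for s x
    proof -
      obtain r where r: "r \<in> G" "\<forall>x\<in>vecs P1. \<forall>y\<in>vecs P2. tens \<mu> x y \<triangleleft> r = tens \<mu> (x \<triangleleft> s) y" using G1_lift[OF s] by blast
      have "\<phi> (tens \<mu> (x \<triangleleft> s) y) = \<phi> (tens \<mu> x y) \<triangleleft> r"
        using r(2) x y End_of_apply(4)[OF \<phi> r(1) tens_P[OF x y]] by simp
      then show ?thesis using slice_commutes[OF s r(2) End_of_apply(1)[OF \<phi> tens_P[OF x y]]] by simp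
    qed
    then show ?thesis
      unfolding End_of_iff \<sigma>_def
      by (auto simp: vecs_add vecs_scale pres1 tens_simps End_of_apply[OF \<phi>] tens_P[OF _ y] slice_linear slice_closed)
  qed
  have \<sigma>_add: "\<sigma> (y + y') l = \<sigma> y l \<oplus>\<^bsub>A1\<^esub> \<sigma> y' l" if "y \<in> vecs P2" "y' \<in> vecs P2" for y y' l
    by (rule End_of_eqI[where P = P1])
       (use that in \<open>auto simp: \<sigma>_def End_of_ops End_of_ext tens_simps End_of_apply[OF \<phi>] tens_P slice_linear\<close>)
  have \<sigma>_scale: "\<sigma> (scale a y) l = a \<odot>\<^bsub>A1\<^esub> \<sigma> y l" if "y \<in> vecs P2" for y l a
    by (rule End_of_eqI[where P = P1])
       (use that in \<open>auto simp: \<sigma>_def End_of_ops End_of_ext tens_simps End_of_apply[OF \<phi>] tens_P slice_linear\<close>)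
  define \<gamma> where "\<gamma> y l = ?\<kappa> (\<sigma> y l)" for y l
  have \<gamma>: "\<gamma> y l \<in> vecs I" "\<gamma> (scale a y) l = scale a (\<gamma> y l)" if "y \<in> vecs P2" for y l a
    using c(1)[OF \<sigma>[OF that]] c(5)[OF \<sigma>[OF that]] \<sigma>_scale[OF that] unfolding \<gamma>_def by auto
  have \<gamma>_add: "\<gamma> (y + y') l = \<gamma> y l + \<gamma> y' l" if "y \<in> vecs P2" "y' \<in> vecs P2" for y y' l
    using c(4)[OF \<sigma>[OF that(1)] \<sigma>[OF that(2)]] \<sigma>_add[OF that] unfolding \<gamma>_def by simp
  define F where "F = (\<Union>p\<in>P2. \<Union>l\<in>P2. Poly_Mapping.keys (\<gamma> (e p) l))"
  have F: "finite F" "F \<subseteq> I"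
    using fin \<gamma>(1)[OF vecs_e] unfolding F_def vecs_def by auto
  have \<gamma>F: "\<gamma> y l \<in> vecs F" if "y \<in> vecs P2" "l \<in> P2" for y l
    using that(1)
  proof (induction y rule: vecs_induct)
    case zero
    have "\<gamma> 0 l = 0" using \<gamma>(2)[OF vecs_zero, of 0 l] by simp
    then show ?case by (simp add: vecs_zero)
  next
    case (add y y')
    then show ?case by (simp add: \<gamma>_add vecs_add)
  next
    case (e a p)
    have "\<gamma> (e p) l \<in> vecs F" unfolding F_def vecs_def using e that(2) by blast
    then show ?case using \<gamma>(2)[OF vecs_e[OF e]] by (simp add: vecs_scale)
  qed
  define \<psi> where "\<psi> i y = (\<Sum>l\<in>P2. scale (Poly_Mapping.lookup (\<gamma> y l) i) (e l))" for i y
  have \<psi>v: "\<psi> i y \<in> vecs P2" for i y unfolding \<psi>_def by (intro vecs_sum vecs_scale vecs_e)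
  have \<psi>_add: "\<psi> i (y + y') = \<psi> i y + \<psi> i y'" if "y \<in> vecs P2" "y' \<in> vecs P2" for i y y'
    unfolding \<psi>_def by (simp add: \<gamma>_add[OF that] lookup_add pm.scale_left_distrib sum.distrib)
  have \<psi>_scale: "\<psi> i (scale a y) = scale a (\<psi> i y)" if "y \<in> vecs P2" for i y a
    unfolding \<psi>_def by (simp add: \<gamma>(2)[OF that] lookup_scale pm.scale_sum_right)
  have expand: "\<phi> (tens \<mu> x y) = (\<Sum>i\<in>F. tens \<mu> (b1 i x) (\<psi> i y))" if x: "x \<in> vecs P1" and y: "y \<in> vecs P2" for x y
  proof -
    have "slice l (\<phi> (tens \<mu> x y)) = (\<Sum>i\<in>F. scale (Poly_Mapping.lookup (\<gamma> y l) i) (b1 i x))" if l: "l \<in> P2" for l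
    proof -
      have "slice l (\<phi> (tens \<mu> x y)) = \<sigma> y l x" using x unfolding \<sigma>_def by simp
      also have "\<sigma> y l = comb A1 b1 (\<gamma> y l)" unfolding \<gamma>_def c(2)[OF \<sigma>[OF y]] ..
      also have "comb A1 b1 (\<gamma> y l) x = lin_ext (\<lambda>i. b1 i x) (\<gamma> y l)"
        by (rule comb_End_of[OF preserved1 b1(1) \<gamma>(1)[OF y] x])
      also have "\<dots> = (\<Sum>i\<in>F. scale (Poly_Mapping.lookup (\<gamma> y l) i) (b1 i x))"
        by (rule lin_ext_superset[OF F(1)]) (use \<gamma>F[OF y l] in \<open>simp add: vecs_def\<close>)
      finally show ?thesis .
    qed
    then have "(\<Sum>l\<in>P2. tens \<mu> (slice l (\<phi> (tens \<mu> x y))) (e l))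
        = (\<Sum>l\<in>P2. \<Sum>i\<in>F. tens \<mu> (b1 i x) (scale (Poly_Mapping.lookup (\<gamma> y l) i) (e l)))"
      by (intro sum.cong refl) (simp add: tens_sum_left tens_simps)
    also have "\<dots> = (\<Sum>i\<in>F. tens \<mu> (b1 i x) (\<psi> i y))"
      unfolding \<psi>_def tens_sum_right by (rule sum.swap)
    finally show ?thesis using slices_sum[OF End_of_apply(1)[OF \<phi> tens_P[OF x y]]] by simp
  qed
  have \<psi>_comm: "\<psi> i (y \<triangleleft> t) = \<psi> i y \<triangleleft> t" if i: "i \<in> F" and t: "t \<in> G2" and y: "y \<in> vecs P2" for i t y
  proof -
    obtain r where r: "r \<in> G" "\<forall>x\<in>vecs P1. \<forall>y\<in>vecs P2. tens \<mu> x y \<triangleleft> r = tens \<mu> x (y \<triangleleft> t)" using G2_lift[OF t] by blast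
    define w where "w i = \<psi> i (y \<triangleleft> t) - \<psi> i y \<triangleleft> t" for i
    have wv: "w i \<in> vecs P2" for i unfolding w_def by (intro vecs_diff \<psi>v pres2[OF t])
    have b1v: "b1 i x \<in> vecs P1" if "i \<in> F" "x \<in> vecs P1" for i x
      using End_of_apply(1)[OF funcset_mem[OF b1(1)]] that F(2) by blast
    have zero: "(\<Sum>i\<in>F. tens \<mu> (b1 i x) (w i)) = 0" if x: "x \<in> vecs P1" for x
    proof -
      have "(\<Sum>i\<in>F. tens \<mu> (b1 i x) (\<psi> i (y \<triangleleft> t))) = \<phi> (tens \<mu> x y) \<triangleleft> r"
        using expand[OF x pres2[OF t y]] r x y End_of_apply(4)[OF \<phi> r(1) tens_P[OF x y]] by simp
      also have "\<dots> = (\<Sum>i\<in>F. tens \<mu> (b1 i x) (\<psi> i y \<triangleleft> t))"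
        unfolding expand[OF x y] app_sum by (rule sum.cong) (use r(2) b1v[OF _ x] \<psi>v in auto)
      finally have "(\<Sum>i\<in>F. tens \<mu> (b1 i x) (w i + \<psi> i y \<triangleleft> t)) = (\<Sum>i\<in>F. tens \<mu> (b1 i x) (\<psi> i y \<triangleleft> t))"
        unfolding w_def by simp
      then show ?thesis by (simp add: tens_simps sum.distrib)
    qed
    have "Poly_Mapping.lookup (w i) l = 0" for l
    proof -
      define u where "u = (\<Sum>i\<in>F. scale (Poly_Mapping.lookup (w i) l) (e i))"
      have u: "u \<in> vecs I" unfolding u_def by (intro vecs_sum vecs_scale vecs_e) (use F in auto)
      have "lin_ext (\<lambda>i. b1 i x) u = 0" if x: "x \<in> vecs P1" for x
      proof -
        have "lin_ext (\<lambda>i. b1 i x) u = (\<Sum>i\<in>F. slice l (tens \<mu> (b1 i x) (w i)))"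
          unfolding u_def lin_ext_sum lin_ext_scale lin_ext_e by (rule sum.cong) (simp_all add: slice_tens b1v x wv)
        then show ?thesis unfolding slice_sum[symmetric] zero[OF x] by (simp add: slice_linear)
      qed
      then have "u = 0" by (rule b1_independent[OF u])
      moreover have "Poly_Mapping.lookup u i = Poly_Mapping.lookup (w i) l"
        unfolding u_def lookup_sum lookup_scale lookup_single using i F(1)
        by (simp add: when_def if_distrib cong: if_cong)
      ultimately show ?thesis by simp
    qed
    then have "w i = 0" by (intro poly_mapping_eqI) simp
    then show ?thesis unfolding w_def by simp
  qed
  have "(\<lambda>y\<in>vecs P2. \<psi> i y) \<in> carrier A2" if "i \<in> F" for i
    unfolding End_of_iff using that
    by (auto simp: \<psi>v \<psi>_add \<psi>_scale vecs_add vecs_scale pres2 \<psi>_comm)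
  moreover have "\<phi> (tens \<mu> x y) = (\<Sum>i\<in>F. tens \<mu> (b1 i x) ((\<lambda>y\<in>vecs P2. \<psi> i y) y))" if "x \<in> vecs P1" "y \<in> vecs P2" for x y
    using expand[OF that] that by simp
  ultimately show ?thesis using F by (intro exI[of _ F] exI[of _ "\<lambda>i. \<lambda>y\<in>vecs P2. \<psi> i y"]) auto
qed

text \<open>\<open>\<Theta>\<close> sends \<open>a \<otimes> b\<close> to the map acting as
  \<open>a\<close> and \<open>b\<close> on the factors. Injectivity follows by evaluating at
  \<open>x \<otimes> y\<close>, slicing, and using the independence of the two bases in turn;
  surjectivity is \<open>commutant_expansion\<close>.\<close>
lemma tensor_commutant_iso: "\<exists>\<Theta>. \<Theta> \<in> alg_iso (tensor_alg A1 A2) A"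
proof -
  interpret TT: k_algebra TT by (rule k_algebra_tensor)
  interpret RT: ring TT by (rule TT.ring)
  interpret AA: k_algebra A by (rule k_algebra_End_of[OF preserved_P])
  have "\<exists>h. (\<forall>a\<in>carrier A1. \<forall>b\<in>carrier A2. h (tensor_elem A1 A2 a b) = box a b z) \<and>
    (\<forall>x\<in>carrier TT. \<forall>y\<in>carrier TT. h (x \<oplus>\<^bsub>TT\<^esub> y) = h x + h y) \<and>
    (\<forall>c. \<forall>x\<in>carrier TT. h (c \<odot>\<^bsub>TT\<^esub> x) = scale c (h x))" if "z \<in> vecs P" for z
    by (rule bilin_extend[OF box_bilin[OF that]])
  then have "\<forall>z\<in>vecs P. \<exists>h. (\<forall>a\<in>carrier A1. \<forall>b\<in>carrier A2. h (tensor_elem A1 A2 a b) = box a b z) \<and>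
    (\<forall>x\<in>carrier TT. \<forall>y\<in>carrier TT. h (x \<oplus>\<^bsub>TT\<^esub> y) = h x + h y) \<and>
    (\<forall>c. \<forall>x\<in>carrier TT. h (c \<odot>\<^bsub>TT\<^esub> x) = scale c (h x))" by (rule ballI)
  from bchoice[OF this] obtain h where h': "\<forall>z\<in>vecs P. (\<forall>a\<in>carrier A1. \<forall>b\<in>carrier A2. h z (tensor_elem A1 A2 a b) = box a b z) \<and>
    (\<forall>x\<in>carrier TT. \<forall>y\<in>carrier TT. h z (x \<oplus>\<^bsub>TT\<^esub> y) = h z x + h z y) \<and>
    (\<forall>c. \<forall>x\<in>carrier TT. h z (c \<odot>\<^bsub>TT\<^esub> x) = scale c (h z x))" ..
  have h: "\<And>z a b. \<lbrakk>z \<in> vecs P; a \<in> carrier A1; b \<in> carrier A2\<rbrakk> \<Longrightarrow> h z (tensor_elem A1 A2 a b) = box a b z"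
    "\<And>z x y. \<lbrakk>z \<in> vecs P; x \<in> carrier TT; y \<in> carrier TT\<rbrakk> \<Longrightarrow> h z (x \<oplus>\<^bsub>TT\<^esub> y) = h z x + h z y"
    "\<And>z c x. \<lbrakk>z \<in> vecs P; x \<in> carrier TT\<rbrakk> \<Longrightarrow> h z (c \<odot>\<^bsub>TT\<^esub> x) = scale c (h z x)"
    using h' by blast+
  define \<Theta> where "\<Theta> X = (\<lambda>z\<in>vecs P. h z X)" for X
  have \<Theta>_elem: "\<Theta> (tensor_elem A1 A2 a b) z = box a b z" if "z \<in> vecs P" "a \<in> carrier A1" "b \<in> carrier A2" for z a b
    unfolding \<Theta>_def using that h by simp
  have \<Theta>_add: "\<Theta> (X \<oplus>\<^bsub>TT\<^esub> Y) = \<Theta> X \<oplus>\<^bsub>A\<^esub> \<Theta> Y" if "X \<in> carrier TT" "Y \<in> carrier TT" for X Y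
    by (rule End_of_eqI[where P = P]) (use that in \<open>auto simp: \<Theta>_def End_of_ext End_of_ops h\<close>)
  have \<Theta>_smult: "\<Theta> (c \<odot>\<^bsub>TT\<^esub> X) = c \<odot>\<^bsub>A\<^esub> \<Theta> X" if "X \<in> carrier TT" for c X
    by (rule End_of_eqI[where P = P]) (use that in \<open>auto simp: \<Theta>_def End_of_ext End_of_ops h\<close>)
  have \<Theta>_box: "\<Theta> (tensor_elem A1 A2 a b) = restrict (box a b) (vecs P)" if "a \<in> carrier A1" "b \<in> carrier A2" for a b
    by (rule End_of_eqI[where P = P]) (use that in \<open>auto simp: \<Theta>_def h\<close>)
  have \<Theta>_closed: "\<Theta> X \<in> carrier A" if "X \<in> carrier TT" for X
    using that
  proof (induction X rule: tensor_induct)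
    case (elem a b)
    have "z \<triangleleft> r \<in> vecs P" if "r \<in> G" "z \<in> vecs P" for r z using preserved_P that unfolding preserved_def by blast
    then show ?case unfolding \<Theta>_box[OF elem] End_of_iff
      by (auto simp: box_closed elem box_linear vecs_add vecs_scale box_commutes)
  next
    case (add x y)
    then show ?case using \<Theta>_add ring.ring_simprules(1)[OF AA.ring] by simp
  qed
  interpret RA: ring A by (rule AA.ring)
  have \<Theta>_mult1: "\<Theta> (tensor_elem A1 A2 a b \<otimes>\<^bsub>TT\<^esub> Y) = \<Theta> (tensor_elem A1 A2 a b) \<otimes>\<^bsub>A\<^esub> \<Theta> Y"
    if "Y \<in> carrier TT" and ab: "a \<in> carrier A1" "b \<in> carrier A2" for Y a b
    using that(1)
  proof (induction Y rule: tensor_induct)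
    case (elem a' b')
    have cl: "a \<otimes>\<^bsub>A1\<^esub> a' \<in> carrier A1" "b \<otimes>\<^bsub>A2\<^esub> b' \<in> carrier A2"
      using ring.ring_simprules(5)[OF A.ring] ring.ring_simprules(5)[OF B.ring] ab elem by auto
    have prod: "box (a \<otimes>\<^bsub>A1\<^esub> a') (b \<otimes>\<^bsub>A2\<^esub> b') z = box a b (box a' b' z)" if "z \<in> vecs P" for z
      using that
    proof (induction z rule: vecs_P_induct)
      case (tens x y)
      then show ?case
        using box_tens[OF cl] box_tens[OF ab] box_tens[OF elem] End_of_apply(1)[OF elem(1)] End_of_apply(1)[OF elem(2)]
        by (simp add: End_of_ops)
    qed (simp_all add: box_linear)
    show ?case
      unfolding tensor_elem_mult[OF ab elem] \<Theta>_box[OF cl] \<Theta>_box[OF ab] \<Theta>_box[OF elem]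
      by (rule End_of_eqI[where P = P, OF restrict_extensional End_of_ext(1)]) (simp add: End_of_ops box_closed elem prod)
  next
    case (add X Y)
    then show ?case
      using tensor_elem_closed[OF ab] \<Theta>_closed by (simp add: RT.r_distr RA.r_distr \<Theta>_add)
  qed
  have \<Theta>_mult: "\<Theta> (X \<otimes>\<^bsub>TT\<^esub> Y) = \<Theta> X \<otimes>\<^bsub>A\<^esub> \<Theta> Y" if "X \<in> carrier TT" and Y: "Y \<in> carrier TT" for X Y
    using that(1)
  proof (induction X rule: tensor_induct)
    case (elem a b)
    then show ?case using \<Theta>_mult1 Y by blast
  next
    case (add X X')
    then show ?case using Y \<Theta>_closed by (simp add: RT.l_distr RA.l_distr \<Theta>_add)
  qed
  have one: "\<one>\<^bsub>A1\<^esub> \<in> carrier A1" "\<one>\<^bsub>A2\<^esub> \<in> carrier A2"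
    using ring.ring_simprules(6)[OF A.ring] ring.ring_simprules(6)[OF B.ring] by auto
  have \<Theta>_one: "\<Theta> \<one>\<^bsub>TT\<^esub> = \<one>\<^bsub>A\<^esub>"
  proof -
    have "box \<one>\<^bsub>A1\<^esub> \<one>\<^bsub>A2\<^esub> z = z" if "z \<in> vecs P" for z
      using that
    proof (induction z rule: vecs_P_induct)
      case (tens x y)
      then show ?case using box_tens[OF one tens] by (simp add: End_of_ops)
    qed (simp_all add: box_linear)
    then show ?thesis
      unfolding tensor_elem_one[symmetric] \<Theta>_box[OF one] by (intro End_of_eqI[where P = P]) (auto simp: End_of_ops End_of_ext)
  qed
  have inj: "inj_on \<Theta> (carrier TT)"
  proof (rule inj_onI)
    define bb where "bb = (\<lambda>(i, j). tensor_elem A1 A2 (b1 i) (b2 j))"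
    have basis: "bij_betw (comb TT bb) (vecs (I \<times> J)) (carrier TT)"
      using tensor_basis[where bb = bb and \<pi> = Pair, OF b1 b2] unfolding bb_def by simp
    have bbc: "bb \<in> I \<times> J \<rightarrow> carrier TT" unfolding bb_def using b1(1) b2(1) by (auto intro!: tensor_elem_closed)
    fix X Y assume X: "X \<in> carrier TT" and Y: "Y \<in> carrier TT" and eq: "\<Theta> X = \<Theta> Y"
    obtain c where c: "c \<in> vecs (I \<times> J)" "X = comb TT bb c" using basis X unfolding bij_betw_def by blast
    obtain c' where c': "c' \<in> vecs (I \<times> J)" "Y = comb TT bb c'" using basis Y unfolding bij_betw_def by blast
    have ev: "\<Theta> (comb TT bb c) (tens \<mu> x y) = lin_ext (\<lambda>(i, j). tens \<mu> (b1 i x) (b2 j y)) c"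
      if "c \<in> vecs (I \<times> J)" and x: "x \<in> vecs P1" and y: "y \<in> vecs P2" for c x y
    proof -
      have "\<Theta> (comb TT bb c) = comb A (\<lambda>k. \<Theta> (bb k)) c"
        by (rule TT.comb_linear_map[OF AA.k_algebra_axioms _ that(1) bbc])
           (use \<Theta>_closed \<Theta>_add \<Theta>_smult in \<open>simp add: k_linear_iff\<close>)
      moreover have "(\<lambda>k. \<Theta> (bb k)) \<in> I \<times> J \<rightarrow> carrier A" using bbc \<Theta>_closed by auto
      ultimately have "\<Theta> (comb TT bb c) (tens \<mu> x y) = lin_ext (\<lambda>k. \<Theta> (bb k) (tens \<mu> x y)) c"
        using comb_End_of[OF preserved_P _ that(1) tens_P[OF x y]] by simp
      also have "\<dots> = lin_ext (\<lambda>(i, j). tens \<mu> (b1 i x) (b2 j y)) c"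
        by (rule lin_ext_cong_vecs[OF that(1)])
           (use b1(1) b2(1) x y in \<open>auto simp: bb_def \<Theta>_box box_tens tens_P Pi_iff\<close>)
      finally show ?thesis .
    qed
    define g where "g = c - c'"
    have g: "g \<in> vecs (I \<times> J)" unfolding g_def by (rule vecs_diff[OF c(1) c'(1)])
    have z: "lin_ext (\<lambda>(i, j). tens \<mu> (b1 i x) (b2 j y)) g = 0" if "x \<in> vecs P1" "y \<in> vecs P2" for x y
      unfolding g_def lin_ext_diff using ev[OF c(1) that] ev[OF c'(1) that] eq c c' by simp
    define row where "row i = lin_ext (\<lambda>(i', j). if i' = i then e j else 0) g" for i
    have row_lookup: "Poly_Mapping.lookup (row i) j = Poly_Mapping.lookup g (i, j)" for i j
    proof -
      have "Poly_Mapping.lookup (row i) j = (\<Sum>k\<in>Poly_Mapping.keys g. if k = (i, j) then Poly_Mapping.lookup g k else 0)"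
        unfolding row_def lin_ext_def lookup_sum lookup_scale
        by (rule sum.cong) (auto simp: lookup_single when_def split: if_splits)
      also have "\<dots> = Poly_Mapping.lookup g (i, j)" by (simp add: in_keys_iff)
      finally show ?thesis .
    qed
    have "row i = 0" for i
    proof (rule b2_independent)
      show "row i \<in> vecs J" unfolding row_def by (rule vecs_lin_ext[OF g]) (auto intro: vecs_e vecs_zero)
      fix y :: "'y \<Rightarrow>\<^sub>0 'k" assume y: "y \<in> vecs P2"
      have "Poly_Mapping.lookup (lin_ext (\<lambda>j. b2 j y) (row i)) l = 0" for l
      proof -
        define u where "u = lin_ext (\<lambda>(i', j). scale (Poly_Mapping.lookup (b2 j y) l) (e i')) g"
        have b1v: "b1 i' x \<in> vecs P1" if "i' \<in> I" "x \<in> vecs P1" for i' x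
          using End_of_apply(1)[OF funcset_mem[OF b1(1)]] that by blast
        have b2v: "b2 j y \<in> vecs P2" if "j \<in> J" for j
          using End_of_apply(1)[OF funcset_mem[OF b2(1)]] that y by blast
        have "u = 0"
        proof (rule b1_independent)
          show "u \<in> vecs I" unfolding u_def by (rule vecs_lin_ext[OF g]) (auto intro!: vecs_scale vecs_e)
          fix x :: "'x \<Rightarrow>\<^sub>0 'k" assume x: "x \<in> vecs P1"
          have "lin_ext (\<lambda>i. b1 i x) u = lin_ext (\<lambda>(i', j). slice l (tens \<mu> (b1 i' x) (b2 j y))) g"
            unfolding u_def lin_ext_lin_ext
            by (rule lin_ext_cong_vecs[OF g]) (auto simp: lin_ext_scale lin_ext_e slice_tens b1v x b2v)
          also have "\<dots> = slice l (lin_ext (\<lambda>(i', j). tens \<mu> (b1 i' x) (b2 j y)) g)"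
            unfolding slice_def lin_ext_lin_ext by (rule arg_cong2[where f = lin_ext]) auto
          finally show "lin_ext (\<lambda>i. b1 i x) u = 0" unfolding z[OF x y] by (simp add: slice_linear)
        qed
        have "Poly_Mapping.lookup (lin_ext (\<lambda>j. b2 j y) (row i)) l = Poly_Mapping.lookup u i"
          unfolding row_def u_def lin_ext_lin_ext unfolding lin_ext_def[of _ g] lookup_sum lookup_scale
          by (rule sum.cong) (auto simp: lin_ext_e lin_ext_zero lookup_scale lookup_single when_def split: if_splits)
        then show ?thesis using \<open>u = 0\<close> by simp
      qed
      then show "lin_ext (\<lambda>j. b2 j y) (row i) = 0" by (intro poly_mapping_eqI) simp
    qed
    then have "Poly_Mapping.lookup g k = 0" for k using row_lookup[of "fst k" "snd k"] by simp
    then have "g = 0" by (intro poly_mapping_eqI) simp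
    then show "X = Y" unfolding g_def using c c' by simp
  qed
  have surj: "\<exists>X\<in>carrier TT. \<Theta> X = \<phi>" if \<phi>: "\<phi> \<in> carrier A" for \<phi>
  proof -
    obtain F \<psi> where F: "finite F" "F \<subseteq> I" "\<And>i. i \<in> F \<Longrightarrow> \<psi> i \<in> carrier A2"
      "\<And>x y. \<lbrakk>x \<in> vecs P1; y \<in> vecs P2\<rbrakk> \<Longrightarrow> \<phi> (tens \<mu> x y) = (\<Sum>i\<in>F. tens \<mu> (b1 i x) (\<psi> i y))"
      using commutant_expansion[OF \<phi>] by blast
    have "\<exists>X\<in>carrier TT. \<forall>x\<in>vecs P1. \<forall>y\<in>vecs P2. \<Theta> X (tens \<mu> x y) = (\<Sum>i\<in>F'. tens \<mu> (b1 i x) (\<psi> i y))"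
      if "F' \<subseteq> F" for F'
      using finite_subset[OF that F(1)] that
    proof (induction F' rule: finite_induct)
      case empty
      have "\<Theta> (tensor_elem A1 A2 \<zero>\<^bsub>A1\<^esub> \<zero>\<^bsub>A2\<^esub>) (tens \<mu> x y) = 0" if "x \<in> vecs P1" "y \<in> vecs P2" for x y
        using that ring.ring_simprules(2)[OF A.ring] ring.ring_simprules(2)[OF B.ring]
        by (simp add: \<Theta>_elem tens_P box_tens End_of_ops tens_simps)
      then show ?case
        using tensor_elem_closed[OF ring.ring_simprules(2)[OF A.ring] ring.ring_simprules(2)[OF B.ring]] by auto
    next
      case (insert i F')
      then obtain X where X: "X \<in> carrier TT" "\<forall>x\<in>vecs P1. \<forall>y\<in>vecs P2. \<Theta> X (tens \<mu> x y) = (\<Sum>i\<in>F'. tens \<mu> (b1 i x) (\<psi> i y))"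
        by auto
      have i: "b1 i \<in> carrier A1" "\<psi> i \<in> carrier A2" using insert F b1(1) by auto
      let ?Y = "tensor_elem A1 A2 (b1 i) (\<psi> i) \<oplus>\<^bsub>TT\<^esub> X"
      have "\<Theta> ?Y (tens \<mu> x y) = (\<Sum>i\<in>insert i F'. tens \<mu> (b1 i x) (\<psi> i y))" if "x \<in> vecs P1" "y \<in> vecs P2" for x y
        unfolding \<Theta>_add[OF tensor_elem_closed[OF i] X(1)]
        using X(2) that insert by (simp add: End_of_ops tens_P \<Theta>_elem i box_tens)
      moreover have "?Y \<in> carrier TT" using X tensor_elem_closed[OF i] by simp
      ultimately show ?case by blast
    qed
    from this[OF subset_refl] obtain X where X: "X \<in> carrier TT"
        "\<And>x y. \<lbrakk>x \<in> vecs P1; y \<in> vecs P2\<rbrakk> \<Longrightarrow> \<Theta> X (tens \<mu> x y) = \<phi> (tens \<mu> x y)"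
      unfolding F(4)[symmetric] by (auto simp: F(4))
    have "\<Theta> X z = \<phi> z" if "z \<in> vecs P" for z
      using that
    proof (induction z rule: vecs_P_induct)
      case zero
      show ?case using End_of_zero[OF \<phi>] End_of_zero[OF \<Theta>_closed[OF X(1)]] by simp
    next
      case (add x y)
      then show ?case using End_of_apply(2)[OF \<phi>, of x y] End_of_apply(2)[OF \<Theta>_closed[OF X(1)], of x y] by simp
    qed (rule X(2))
    then have "\<Theta> X = \<phi>"
      by (intro End_of_eqI[where P = P]) (auto simp: End_of_apply(5)[OF \<phi>] End_of_apply(5)[OF \<Theta>_closed[OF X(1)]])
    then show ?thesis using X(1) by blast
  qed
  have "\<Theta> \<in> ring_iso TT A"
    unfolding ring_iso_def
  proof (intro CollectI conjI)
    show "\<Theta> \<in> Ring.ring_hom TT A" by (rule ring_hom_memI) (simp_all add: \<Theta>_closed \<Theta>_mult \<Theta>_add \<Theta>_one)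
    show "bij_betw \<Theta> (carrier TT) (carrier A)"
      by (rule bij_betw_imageI[OF inj]) (auto intro: \<Theta>_closed dest: surj)
  qed
  moreover have "\<Theta> \<in> k_linear TT A" unfolding k_linear_iff using \<Theta>_closed \<Theta>_add \<Theta>_smult by blast
  ultimately show ?thesis unfolding alg_iso_def by blast
qed

end

end

section \<open>Commutants of the parabolic generators\<close>

text \<open>Relabelling letters by an order isomorphism preserves the action of \<open>T k\<close> for
  \<open>k > 0\<close>, which depends on the relative order of letters only.\<close>
lemma strict_mono_bij_exists:
  fixes A :: "'a::linorder set" and B :: "'b::linorder set"
  assumes "finite A" "finite B" "card A = card B"
  shows "\<exists>g. bij_betw g A B \<and> strict_mono_on A g"
  using assms
proof (induction A arbitrary: B rule: finite_linorder_max_induct)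
  case empty
  then show ?case by (intro exI[of _ "\<lambda>_. undefined"]) (auto simp: bij_betw_def strict_mono_on_def)
next
  case (insert b A)
  have B: "B \<noteq> {}" using insert by auto
  let ?m = "Max B"
  have m: "?m \<in> B" "\<And>y. y \<in> B \<Longrightarrow> y \<le> ?m" using B insert.prems by auto
  have b: "b \<notin> A" using insert.hyps by blast
  have "card A = card (B - {?m})" using insert m b by simp
  then obtain g where g: "bij_betw g A (B - {?m})" "strict_mono_on A g" using insert by blast
  let ?g = "g(b := ?m)"
  have im: "?g ` A = B - {?m}" and inj: "inj_on ?g A"
    using g(1) b unfolding bij_betw_def by (auto simp: inj_on_def)
  have 1: "bij_betw ?g (insert b A) B"
    unfolding bij_betw_def using inj im m(1) b by auto
  have lt: "g a < ?m" if "a \<in> A" for a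
  proof -
    have "g a \<in> B - {?m}" using bij_betwE[OF g(1)] that by blast
    then show ?thesis using m(2) by (simp add: order.not_eq_order_implies_strict)
  qed
  have "strict_mono_on (insert b A) ?g"
    unfolding strict_mono_on_def
    using g(2) insert.hyps(2) b lt by (auto simp: strict_mono_on_def dest: order.asym)
  then show ?case using 1 by blast
qed

lemma card_index_set:
  "card (index_set n) = n" "card (index_set n \<inter> {0..}) = (n + 1) div 2" "card (index_set n \<inter> {0<..}) = n div 2"
proof -
  let ?r = "n div 2"
  have pos: "index_set n \<inter> {0<..} = {1..int ?r}"
    unfolding index_set_def by auto
  show "card (index_set n \<inter> {0<..}) = ?r" unfolding pos by simp
  show "card (index_set n \<inter> {0..}) = (n + 1) div 2"
  proof (cases "odd n")
    case True
    then have "index_set n \<inter> {0..} = {0..int ?r}" unfolding index_set_def by auto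
    then show ?thesis using True by simp
  next
    case False
    then have "index_set n \<inter> {0..} = {1..int ?r}" unfolding index_set_def by auto
    then show ?thesis using False by simp
  qed
  show "card (index_set n) = n"
  proof (cases "odd n")
    case True
    then have "n = 2 * ?r + 1" by (simp add: odd_two_times_div_two_succ)
    moreover have "nat (2 * int ?r + 1) = 2 * ?r + 1" by linarith
    then have "card (index_set n) = 2 * ?r + 1" unfolding index_set_def using True by simp
    ultimately show ?thesis by simp
  next
    case False
    then have "n = 2 * ?r" by simp
    moreover have "nat (2 * int ?r + 1) = 2 * ?r + 1" by linarith
    then have "card (index_set n) = 2 * ?r"
      unfolding index_set_def using False by (simp add: card_Diff_singleton)
    ultimately show ?thesis by simp
  qed
qed

lemma tens_operator_left:
  assumes "\<And>u w. \<lbrakk>u \<in> P1; w \<in> P2\<rbrakk> \<Longrightarrow> e (\<mu> u w) \<triangleleft> r = tens \<mu> (e u \<triangleleft> s) (e w)" and "x \<in> vecs P1" "y \<in> vecs P2"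
  shows "tens \<mu> x y \<triangleleft> r = tens \<mu> (x \<triangleleft> s) y"
  using assms(2)
proof (induction x rule: vecs_induct)
  case (e c u)
  note u = e
  have "tens \<mu> (e u) y \<triangleleft> r = tens \<mu> (e u \<triangleleft> s) y"
    using assms(3) by (induction y rule: vecs_induct) (simp_all add: tens_simps app_zero app_add app_scale assms(1)[OF u])
  then show ?case by (simp add: tens_simps app_scale)
qed (simp_all add: tens_simps app_zero app_add)

lemma tens_operator_right:
  assumes "\<And>u w. \<lbrakk>u \<in> P1; w \<in> P2\<rbrakk> \<Longrightarrow> e (\<mu> u w) \<triangleleft> r = tens \<mu> (e u) (e w \<triangleleft> s)" and "x \<in> vecs P1" "y \<in> vecs P2"
  shows "tens \<mu> x y \<triangleleft> r = tens \<mu> x (y \<triangleleft> s)"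
  using assms(2)
proof (induction x rule: vecs_induct)
  case (e c u)
  note u = e
  have "tens \<mu> (e u) y \<triangleleft> r = tens \<mu> (e u) (y \<triangleleft> s)"
    using assms(3) by (induction y rule: vecs_induct) (simp_all add: tens_simps app_zero app_add app_scale assms(1)[OF u])
  then show ?case by (simp add: tens_simps app_scale)
qed (simp_all add: tens_simps app_zero app_add)

lemma opT_relabel_left:
  assumes g: "strict_mono_on A g" and t: "t \<in> {1..<i}" and u: "u \<in> words i A" and w: "length w = d - i" and i: "i \<le> d"
  shows "e (map g u @ map h w) \<triangleleft> opT d Q q t = tens (\<lambda>u w. map g u @ map h w) (e u \<triangleleft> opT i Q q t) (e w)"
proof -
  have lu: "length u = i" "set u \<subseteq> A" using u unfolding words_def by auto
  obtain p where tp: "t = Suc p" using t by (cases t) auto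
  obtain u1 a b u2 where s: "u = u1 @ a # b # u2" "length u1 = p" by (rule split2[of p u]) (use t tp lu in auto)
  have ab: "g a < g b \<longleftrightarrow> a < b" "g a = g b \<longleftrightarrow> a = b"
    using g lu(2) s(1) by (auto simp: strict_mono_on_less strict_mono_on_eq)
  have l: "length (map g u @ map h w) = d" using lu w i by simp
  have s': "map g u @ map h w = map g u1 @ g a # g b # map g u2 @ map h w" using s(1) by simp
  show ?thesis
    unfolding tp T_e[OF l s', unfolded length_map, OF s(2)] T_e[OF lu(1) s] ab
    by (auto simp: tens_simps s(1))
qed

lemma opT_relabel_right:
  assumes h: "strict_mono_on A h" and t: "t \<in> {1..<d - i}" and w: "w \<in> words (d - i) A" and u: "length u = i" and i: "i \<le> d"
  shows "e (map g u @ map h w) \<triangleleft> opT d Q q (i + t) = tens (\<lambda>u w. map g u @ map h w) (e u) (e w \<triangleleft> opT (d - i) Q q t)"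
proof -
  have lw: "length w = d - i" "set w \<subseteq> A" using w unfolding words_def by auto
  obtain p where tp: "t = Suc p" using t by (cases t) auto
  obtain w1 a b w2 where s: "w = w1 @ a # b # w2" "length w1 = p" by (rule split2[of p w]) (use t tp lw in auto)
  have ab: "h a < h b \<longleftrightarrow> a < b" "h a = h b \<longleftrightarrow> a = b"
    using h lw(2) s(1) by (auto simp: strict_mono_on_less strict_mono_on_eq)
  have l: "length (map g u @ map h w) = d" using lw u i by simp
  have s': "map g u @ map h w = (map g u @ map h w1) @ h a # h b # map h w2" using s(1) by simp
  have p': "length (map g u @ map h w1) = i + p" using u s(2) by simp
  have it: "i + t = Suc (i + p)" using tp by simp
  show ?thesis
    unfolding it unfolding tp T_e[OF l s' p'] T_e[OF lw(1) s] ab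
    by (auto simp: tens_simps s(1))
qed

context schur_parameters
begin

text \<open>Words of the piece \<open>X i\<close> are concatenations of a word in nonnegative and a word
  in positive letters, and there are \<open>\<lceil>n/2\<rceil>\<close> and
  \<open>\<lfloor>n/2\<rfloor>\<close> of these letters. The cell data enter through the bases of the
  two commutants that they contain.\<close>
lemma parabolic_commutant_iso:
  assumes i: "i \<le> d"
    and D1: "cell_datum (schur_A Q q ((n + 1) div 2) i) L1 R1 M1 C1 star1"
    and D2: "cell_datum (schur_A Q q (n div 2) (d - i)) L2 R2 M2 C2 star2"
  shows "\<exists>\<Theta>. \<Theta> \<in> alg_iso (schur_tensor Q q n d i) (End_of (XW i) (opT d Q q ` K i))"
proof -
  let ?m1 = "(n + 1) div 2" and ?m2 = "n div 2"
  let ?N1 = "index_set ?m1" and ?N2 = "index_set ?m2"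
  interpret S1: schur_parameters Q q ?m1 i by unfold_locales (use nz sep i in auto)
  interpret S2: schur_parameters Q q ?m2 "d - i" by unfold_locales (use nz sep i in auto)
  obtain g where g: "bij_betw g ?N1 (I \<inter> {0..})" "strict_mono_on ?N1 g"
    using strict_mono_bij_exists[of ?N1 "I \<inter> {0..}"] finite_index_set card_index_set by (metis finite_Int)
  obtain h where h: "bij_betw h ?N2 (I \<inter> {0<..})" "strict_mono_on ?N2 h"
    using strict_mono_bij_exists[of ?N2 "I \<inter> {0<..}"] finite_index_set card_index_set by (metis finite_Int)
  let ?g' = "inv_into ?N1 g" and ?h' = "inv_into ?N2 h"
  let ?\<mu> = "\<lambda>u w. map g u @ map h w"
  let ?\<mu>1 = "\<lambda>p. map ?g' (take i p)" and ?\<mu>2 = "\<lambda>p. map ?h' (drop i p)"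
  have gg: "?g' (g x) = x" "g x \<in> I \<inter> {0..}" if "x \<in> ?N1" for x
    using g(1) that bij_betwE[OF g(1)] unfolding bij_betw_def by auto
  have hh: "?h' (h x) = x" "h x \<in> I \<inter> {0<..}" if "x \<in> ?N2" for x
    using h(1) that bij_betwE[OF h(1)] unfolding bij_betw_def by auto
  have gg': "g (?g' x) = x" "?g' x \<in> ?N1" if "x \<in> I \<inter> {0..}" for x
    using that bij_betw_inv_into_right[OF g(1)] bij_betwE[OF bij_betw_inv_into[OF g(1)]] by auto
  have hh': "h (?h' x) = x" "?h' x \<in> ?N2" if "x \<in> I \<inter> {0<..}" for x
    using that bij_betw_inv_into_right[OF h(1)] bij_betwE[OF bij_betw_inv_into[OF h(1)]] by auto
  have left: "tens ?\<mu> x y \<triangleleft> opT d Q q t = tens ?\<mu> (x \<triangleleft> opT i Q q t) y"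
    if "t \<in> {1..<i}" "x \<in> vecs (words i ?N1)" "y \<in> vecs (words (d - i) ?N2)" for t x y
    by (rule tens_operator_left[OF opT_relabel_left[OF g(2) that(1) _ _ i] that(2,3)]) (auto simp: words_def)
  have right: "tens ?\<mu> x y \<triangleleft> opT d Q q (i + t) = tens ?\<mu> x (y \<triangleleft> opT (d - i) Q q t)"
    if "t \<in> {1..<d - i}" "x \<in> vecs (words i ?N1)" "y \<in> vecs (words (d - i) ?N2)" for t x y
    by (rule tens_operator_right[OF opT_relabel_right[OF h(2) that(1) _ _ i] that(2,3)]) (auto simp: words_def)
  interpret commutant_pair "words i ?N1" "words (d - i) ?N2" "XW i" "opT i Q q ` {1..<i}" "opT (d - i) Q q ` {1..<d - i}"
    "opT d Q q ` K i" ?\<mu> ?\<mu>1 ?\<mu>2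
  proof
    show "finite (words (d - i) ?N2)" by (rule finite_words[OF finite_index_set])
    show "preserved (words i ?N1) (opT i Q q ` {1..<i})" by (rule S1.preserved_words) auto
    show "preserved (words (d - i) ?N2) (opT (d - i) Q q ` {1..<d - i})" by (rule S2.preserved_words) auto
  next
    fix u w assume u: "u \<in> words i ?N1" and w: "w \<in> words (d - i) ?N2"
    have l: "length u = i" "length w = d - i" "set u \<subseteq> ?N1" "set w \<subseteq> ?N2" using u w unfolding words_def by auto
    show "?\<mu> u w \<in> XW i" using l i gg(2) hh(2) unfolding XW_def by (auto simp: subset_iff)
    show "?\<mu>1 (?\<mu> u w) = u" using l gg(1) by (auto simp: subset_iff intro!: map_idI)
    show "?\<mu>2 (?\<mu> u w) = w" using l hh(1) by (auto simp: subset_iff intro!: map_idI)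
  next
    fix p assume "p \<in> XW i"
    then have p: "length p = d" "set (take i p) \<subseteq> I \<inter> {0..}" "set (drop i p) \<subseteq> I \<inter> {0<..}" unfolding XW_def by auto
    show "?\<mu>1 p \<in> words i ?N1" using p i gg'(2) unfolding words_def by (auto simp: subset_iff)
    show "?\<mu>2 p \<in> words (d - i) ?N2" using p i hh'(2) unfolding words_def by (auto simp: subset_iff)
    have "map g (?\<mu>1 p) = take i p" unfolding map_map using p(2) gg'(1) by (intro map_idI) auto
    moreover have "map h (?\<mu>2 p) = drop i p" unfolding map_map using p(3) hh'(1) by (intro map_idI) auto
    ultimately show "?\<mu> (?\<mu>1 p) (?\<mu>2 p) = p" by simp
  next
    fix r assume "r \<in> opT d Q q ` K i"
    then obtain t where t: "t \<in> K i" "r = opT d Q q t" by blast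
    show "(\<exists>s\<in>opT i Q q ` {1..<i}. \<forall>x\<in>vecs (words i ?N1). \<forall>y\<in>vecs (words (d - i) ?N2). tens ?\<mu> x y \<triangleleft> r = tens ?\<mu> (x \<triangleleft> s) y) \<or>
      (\<exists>s\<in>opT (d - i) Q q ` {1..<d - i}. \<forall>x\<in>vecs (words i ?N1). \<forall>y\<in>vecs (words (d - i) ?N2). tens ?\<mu> x y \<triangleleft> r = tens ?\<mu> x (y \<triangleleft> s))"
    proof (cases "t < i")
      case True
      then have "t \<in> {1..<i}" using t(1) unfolding K_def by auto
      then show ?thesis using left[of t] t(2) by blast
    next
      case False
      then have ti: "t - i \<in> {1..<d - i}" "t = i + (t - i)" using t(1) unfolding K_def by auto
      have "tens ?\<mu> x y \<triangleleft> r = tens ?\<mu> x (y \<triangleleft> opT (d - i) Q q (t - i))"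
        if "x \<in> vecs (words i ?N1)" "y \<in> vecs (words (d - i) ?N2)" for x y
        using right[OF ti(1) that] ti(2) t(2) by simp
      then show ?thesis using ti(1) by blast
    qed
  next
    fix s assume "s \<in> opT i Q q ` {1..<i}"
    then obtain t where t: "t \<in> {1..<i}" "s = opT i Q q t" by blast
    then have "t \<in> K i" using i unfolding K_def by auto
    then show "\<exists>r\<in>opT d Q q ` K i. \<forall>x\<in>vecs (words i ?N1). \<forall>y\<in>vecs (words (d - i) ?N2). tens ?\<mu> x y \<triangleleft> r = tens ?\<mu> (x \<triangleleft> s) y"
      using left[OF t(1)] t(2) by blast
  next
    fix s assume "s \<in> opT (d - i) Q q ` {1..<d - i}"
    then obtain t where t: "t \<in> {1..<d - i}" "s = opT (d - i) Q q t" by blast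
    then have "i + t \<in> K i" unfolding K_def by auto
    then show "\<exists>r\<in>opT d Q q ` K i. \<forall>x\<in>vecs (words i ?N1). \<forall>y\<in>vecs (words (d - i) ?N2). tens ?\<mu> x y \<triangleleft> r = tens ?\<mu> x (y \<triangleleft> s)"
      using right[OF t(1)] t(2) by blast
  qed
  have eq1: "schur_A Q q ?m1 i = A1" by (rule S1.schur_A_eq)
  have eq2: "schur_A Q q ?m2 (d - i) = A2" by (rule S2.schur_A_eq)
  have b1: "cell_family C1 \<in> cell_index L1 M1 \<rightarrow> carrier A1" "bij_betw (comb A1 (cell_family C1)) (vecs (cell_index L1 M1)) (carrier A1)"
    using D1[unfolded cell_datum_iff eq1] unfolding cell_family_def cell_index_def by auto
  have b2: "cell_family C2 \<in> cell_index L2 M2 \<rightarrow> carrier A2" "bij_betw (comb A2 (cell_family C2)) (vecs (cell_index L2 M2)) (carrier A2)"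
    using D2[unfolded cell_datum_iff eq2] unfolding cell_family_def cell_index_def by auto
  show ?thesis
    unfolding schur_tensor_def eq1 eq2 by (rule tensor_commutant_iso[OF b1 b2])
qed

section \<open>Gluing the pieces\<close>

lemma endo_End_of:
  assumes "\<phi>' \<in> carrier (End_of A (opT d Q q ` ks))"
  shows "endo (vecs A) ks \<phi>'"
  using assms unfolding End_of_iff endo_def by (auto simp: app_sc)

lemma End_of_endo:
  assumes "endo (vecs A) ks \<phi>'" "invariant (vecs A) ks"
  shows "restrict \<phi>' (vecs A) \<in> carrier (End_of A (opT d Q q ` ks))"
  using assms unfolding End_of_iff endo_def invariant_def by (auto simp: app_sc vecs_add vecs_scale)

lemma npos_replicate: "i \<le> d \<Longrightarrow> \<exists>\<epsilon>\<in>\<E>. npos \<epsilon> = i"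
  unfolding \<E>_def by (intro bexI[of _ "replicate i True @ replicate (d - i) False"]) (auto simp: count_list_replicate)

text \<open>The isomorphism glues the images of the components. Everything is checked on the pieces,
  which span.\<close>
lemma schur_sum_iso:
  assumes iso: "\<And>i. i \<le> d \<Longrightarrow> \<exists>\<Theta>. \<Theta> \<in> alg_iso (B i) (End_of (XW i) (opT d Q q ` K i))"
    and alg: "\<And>i. i \<le> d \<Longrightarrow> k_algebra (B i)"
  shows "\<exists>\<Phi>. \<Phi> \<in> alg_iso (dirsum_alg {..d} B) (schur_B Q q n d)"
proof -
  let ?D = "dirsum_alg {..d} B"
  let ?W = "\<lambda>i. End_of (XW i) (opT d Q q ` K i)"
  let ?S = "End_of (words d I) (opT d Q q ` {..<d})"
  interpret BF: algebra_family "{..d}" B by (rule algebra_family.intro) (use alg in auto)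
  have "\<forall>i\<in>{..d}. \<exists>\<Theta>. \<Theta> \<in> alg_iso (B i) (?W i)" by (intro ballI iso) simp
  from bchoice[OF this] obtain \<Theta> where "\<forall>i\<in>{..d}. \<Theta> i \<in> alg_iso (B i) (?W i)" ..
  then have \<Theta>: "\<Theta> i \<in> alg_iso (B i) (?W i)" if "i \<le> d" for i using that by blast
  have Et: "E = vecs (words d I)" by (rule tensor_space_words)
  have \<Theta>c: "\<Theta> i x \<in> carrier (?W i)" if "i \<le> d" "x \<in> carrier (B i)" for i x
    using \<Theta>[OF that(1)] that(2) unfolding alg_iso_def Int_iff k_linear_iff by blast
  have \<Theta>_add: "\<Theta> i (x \<oplus>\<^bsub>B i\<^esub> y) = \<Theta> i x \<oplus>\<^bsub>?W i\<^esub> \<Theta> i y" if "i \<le> d" "x \<in> carrier (B i)" "y \<in> carrier (B i)" for i x y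
    using \<Theta>[OF that(1)] that(2,3) unfolding alg_iso_def Int_iff k_linear_iff by blast
  have \<Theta>_smult: "\<Theta> i (c \<odot>\<^bsub>B i\<^esub> x) = c \<odot>\<^bsub>?W i\<^esub> \<Theta> i x" if "i \<le> d" "x \<in> carrier (B i)" for i x c
    using \<Theta>[OF that(1)] that(2) unfolding alg_iso_def Int_iff k_linear_iff by blast
  have hom: "\<Theta> i \<in> Ring.ring_hom (B i) (?W i)" and bij: "bij_betw (\<Theta> i) (carrier (B i)) (carrier (?W i))" if "i \<le> d" for i
    using \<Theta>[OF that] unfolding alg_iso_def ring_iso_def by auto
  have xc: "x i \<in> carrier (B i)" if "x \<in> carrier ?D" "i \<le> d" for x i
    using that by (simp add: BF.dirsum_simps)
  define \<Phi> where "\<Phi> x = (\<lambda>y\<in>vecs (words d I). glue (\<lambda>i. \<Theta> i (x i)) y)" for x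
  have en: "endo (vecs (XW i)) (K i) (\<Theta> i (x i))" if "x \<in> carrier ?D" "i \<le> d" for x i
    by (rule endo_End_of[OF \<Theta>c[OF that(2) xc[OF that]]])
  have glue_en: "endo E {..<d} (glue (\<lambda>i. \<Theta> i (x i)))" if "x \<in> carrier ?D" for x
    by (rule glue_endo[OF en[OF that]])
  have closed: "\<Phi> x \<in> carrier ?S" if "x \<in> carrier ?D" for x
    unfolding \<Phi>_def by (rule End_of_endo[OF glue_en[OF that, unfolded Et] invariant_tensor_space[unfolded Et]])
  have \<Phi>_f: "\<Phi> x (y \<triangleleft> f \<epsilon>) = \<Theta> (npos \<epsilon>) (x (npos \<epsilon>)) y \<triangleleft> f \<epsilon>"
    if "x \<in> carrier ?D" "\<epsilon> \<in> \<E>" "y \<in> vecs (XW (npos \<epsilon>))" for x \<epsilon> y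
    using glue_f[OF en[OF that(1)] that(2,3)] f_maps_into_E[OF that(2,3)] unfolding \<Phi>_def Et by simp
  have eqI: "\<phi>1 = \<phi>2" if "\<phi>1 \<in> carrier ?S" "\<phi>2 \<in> carrier ?S"
      "\<And>\<epsilon> y. \<lbrakk>\<epsilon> \<in> \<E>; y \<in> vecs (XW (npos \<epsilon>))\<rbrakk> \<Longrightarrow> \<phi>1 (y \<triangleleft> f \<epsilon>) = \<phi>2 (y \<triangleleft> f \<epsilon>)" for \<phi>1 \<phi>2
  proof (rule End_of_eqI[OF End_of_apply(5)[OF that(1)] End_of_apply(5)[OF that(2)]])
    fix y :: "int list \<Rightarrow>\<^sub>0 'k" assume "y \<in> vecs (words d I)"
    moreover have "endo E {} \<phi>1" "endo E {} \<phi>2"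
      using endo_End_of[OF that(1)] endo_End_of[OF that(2)] unfolding Et endo_def by auto
    ultimately show "\<phi>1 y = \<phi>2 y" using additive_eq_on_pieces[of \<phi>1 \<phi>2 y] that(3) unfolding Et by blast
  qed
  interpret S: k_algebra ?S by (rule k_algebra_End_of[OF preserved_words]) auto
  interpret RS: ring ?S by (rule S.ring)
  interpret RD: ring ?D by (rule k_algebra.ring[OF BF.k_algebra_dirsum])
  have fE: "y \<triangleleft> f \<epsilon> \<in> vecs (words d I)" if "\<epsilon> \<in> \<E>" "y \<in> vecs (XW (npos \<epsilon>))" for y \<epsilon>
    using f_maps_into_E[OF that] unfolding Et .
  have add: "\<Phi> (x \<oplus>\<^bsub>?D\<^esub> y) = \<Phi> x \<oplus>\<^bsub>?S\<^esub> \<Phi> y" if "x \<in> carrier ?D" "y \<in> carrier ?D" for x y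
  proof (rule eqI)
    fix \<epsilon> and w :: "int list \<Rightarrow>\<^sub>0 'k" assume a: "\<epsilon> \<in> \<E>" "w \<in> vecs (XW (npos \<epsilon>))"
    show "\<Phi> (x \<oplus>\<^bsub>?D\<^esub> y) (w \<triangleleft> f \<epsilon>) = (\<Phi> x \<oplus>\<^bsub>?S\<^esub> \<Phi> y) (w \<triangleleft> f \<epsilon>)"
      using that a npos_le[OF a(1)] fE[OF a]
      by (simp add: \<Phi>_f BF.dirsum_simps(3) \<Theta>_add xc End_of_ops app_add)
  qed (use that closed in auto)
  have smult: "\<Phi> (c \<odot>\<^bsub>?D\<^esub> x) = c \<odot>\<^bsub>?S\<^esub> \<Phi> x" if "x \<in> carrier ?D" for c x
  proof (rule eqI)
    fix \<epsilon> and w :: "int list \<Rightarrow>\<^sub>0 'k" assume a: "\<epsilon> \<in> \<E>" "w \<in> vecs (XW (npos \<epsilon>))"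
    show "\<Phi> (c \<odot>\<^bsub>?D\<^esub> x) (w \<triangleleft> f \<epsilon>) = (c \<odot>\<^bsub>?S\<^esub> \<Phi> x) (w \<triangleleft> f \<epsilon>)"
      using that a npos_le[OF a(1)] fE[OF a] k_algebra.smult_closed[OF BF.k_algebra_dirsum that]
      by (simp add: \<Phi>_f BF.dirsum_simps(6) \<Theta>_smult xc End_of_ops app_scale)
  qed (use that closed S.smult_closed k_algebra.smult_closed[OF BF.k_algebra_dirsum that] in auto)
  have mult: "\<Phi> (x \<otimes>\<^bsub>?D\<^esub> y) = \<Phi> x \<otimes>\<^bsub>?S\<^esub> \<Phi> y" if "x \<in> carrier ?D" "y \<in> carrier ?D" for x y
  proof (rule eqI)
    fix \<epsilon> and w :: "int list \<Rightarrow>\<^sub>0 'k" assume a: "\<epsilon> \<in> \<E>" "w \<in> vecs (XW (npos \<epsilon>))"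
    have m: "\<Theta> (npos \<epsilon>) (x (npos \<epsilon>) \<otimes>\<^bsub>B (npos \<epsilon>)\<^esub> y (npos \<epsilon>)) = \<Theta> (npos \<epsilon>) (x (npos \<epsilon>)) \<otimes>\<^bsub>?W (npos \<epsilon>)\<^esub> \<Theta> (npos \<epsilon>) (y (npos \<epsilon>))"
      by (rule ring_hom_mult[OF hom[OF npos_le[OF a(1)]]]) (use that xc npos_le[OF a(1)] in auto)
    have c: "\<Theta> (npos \<epsilon>) (y (npos \<epsilon>)) w \<in> vecs (XW (npos \<epsilon>))"
      by (rule End_of_apply(1)[OF \<Theta>c[OF npos_le[OF a(1)] xc[OF that(2) npos_le[OF a(1)]]] a(2)])
    show "\<Phi> (x \<otimes>\<^bsub>?D\<^esub> y) (w \<triangleleft> f \<epsilon>) = (\<Phi> x \<otimes>\<^bsub>?S\<^esub> \<Phi> y) (w \<triangleleft> f \<epsilon>)"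
      using that a npos_le[OF a(1)] fE[OF a] c
      by (simp add: \<Phi>_f BF.dirsum_simps(2) m End_of_ops)
  qed (use that closed in auto)
  have one: "\<Phi> \<one>\<^bsub>?D\<^esub> = \<one>\<^bsub>?S\<^esub>"
  proof (rule eqI)
    fix \<epsilon> and w :: "int list \<Rightarrow>\<^sub>0 'k" assume a: "\<epsilon> \<in> \<E>" "w \<in> vecs (XW (npos \<epsilon>))"
    show "\<Phi> \<one>\<^bsub>?D\<^esub> (w \<triangleleft> f \<epsilon>) = \<one>\<^bsub>?S\<^esub> (w \<triangleleft> f \<epsilon>)"
      using a npos_le[OF a(1)] fE[OF a]
      by (simp add: \<Phi>_f BF.dirsum_simps(4) ring_hom_one[OF hom] End_of_ops)
  qed (use closed in auto)
  have inj: "inj_on \<Phi> (carrier ?D)"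
  proof (rule inj_onI)
    fix x y assume x: "x \<in> carrier ?D" and y: "y \<in> carrier ?D" and eq: "\<Phi> x = \<Phi> y"
    show "x = y"
    proof (rule BF.dirsum_eqI)
      fix i assume "i \<in> {..d}"
      then have i: "i \<le> d" by simp
      obtain \<epsilon> where \<epsilon>: "\<epsilon> \<in> \<E>" "npos \<epsilon> = i" using npos_replicate[OF i] by blast
      note cx = \<Theta>c[OF i xc[OF x i]] and cy = \<Theta>c[OF i xc[OF y i]]
      have "\<Theta> i (x i) = \<Theta> i (y i)"
      proof (rule End_of_eqI[OF End_of_apply(5)[OF cx] End_of_apply(5)[OF cy]])
        fix w :: "int list \<Rightarrow>\<^sub>0 'k" assume w: "w \<in> vecs (XW i)"
        have "(\<Theta> i (x i) w - \<Theta> i (y i) w) \<triangleleft> f \<epsilon> = 0"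
          using \<Phi>_f[OF x \<epsilon>(1), of w] \<Phi>_f[OF y \<epsilon>(1), of w] eq w \<epsilon>(2) by (simp add: app_diff)
        then have "\<Theta> i (x i) w - \<Theta> i (y i) w = 0"
          by (rule f_injective[OF \<epsilon>(1), rotated])
             (unfold \<epsilon>(2), rule vecs_diff[OF End_of_apply(1)[OF cx w] End_of_apply(1)[OF cy w]])
        then show "\<Theta> i (x i) w = \<Theta> i (y i) w" by simp
      qed
      then show "x i = y i" using bij[OF i] xc[OF x i] xc[OF y i] unfolding bij_betw_def inj_on_def by blast
    qed (use x y in \<open>auto simp: BF.dirsum_simps(1)\<close>)
  qed
  have surj: "g \<in> \<Phi> ` carrier ?D" if g: "g \<in> carrier ?S" for g
  proof -
    have "endo E {..<d} g" using endo_End_of[OF g] unfolding Et .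
    from restrict_endo[OF this] obtain \<theta> where
      \<theta>: "\<And>i. i \<le> d \<Longrightarrow> endo (vecs (XW i)) (K i) (\<theta> i)"
        "\<And>\<epsilon> x. \<lbrakk>\<epsilon> \<in> \<E>; x \<in> vecs (XW (npos \<epsilon>))\<rbrakk> \<Longrightarrow> g (x \<triangleleft> f \<epsilon>) = \<theta> (npos \<epsilon>) x \<triangleleft> f \<epsilon>" by blast
    define x where "x = (\<lambda>i\<in>{..d}. inv_into (carrier (B i)) (\<Theta> i) (restrict (\<theta> i) (vecs (XW i))))"
    have \<theta>c: "restrict (\<theta> i) (vecs (XW i)) \<in> carrier (?W i)" if "i \<le> d" for i
      by (rule End_of_endo[OF \<theta>(1)[OF that] invariant_XW[OF that]])
    have xi: "x i \<in> carrier (B i)" "\<Theta> i (x i) = restrict (\<theta> i) (vecs (XW i))" if "i \<le> d" for i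
      using \<theta>c[OF that] bij[OF that] that bij_betwE[OF bij_betw_inv_into[OF bij[OF that]]]
        bij_betw_inv_into_right[OF bij[OF that]] unfolding x_def by auto
    have x: "x \<in> carrier ?D" unfolding BF.dirsum_simps(1) using xi(1) by (auto simp: x_def)
    have "\<Phi> x = g"
    proof (rule eqI[OF closed[OF x] g])
      fix \<epsilon> and y :: "int list \<Rightarrow>\<^sub>0 'k" assume a: "\<epsilon> \<in> \<E>" "y \<in> vecs (XW (npos \<epsilon>))"
      show "\<Phi> x (y \<triangleleft> f \<epsilon>) = g (y \<triangleleft> f \<epsilon>)"
        using \<Phi>_f[OF x a] \<theta>(2)[OF a] xi(2)[OF npos_le[OF a(1)]] a(2) by simp
    qed
    then show ?thesis using x by blast
  qed
  have "\<Phi> \<in> ring_iso ?D ?S"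
    unfolding ring_iso_def
  proof (intro CollectI conjI)
    show "\<Phi> \<in> Ring.ring_hom ?D ?S" by (rule ring_hom_memI) (simp_all add: closed mult add one)
    show "bij_betw \<Phi> (carrier ?D) (carrier ?S)"
      by (rule bij_betw_imageI[OF inj]) (use closed surj in blast)
  qed
  moreover have "\<Phi> \<in> k_linear ?D ?S" unfolding k_linear_iff using closed add smult by blast
  ultimately have "\<Phi> \<in> alg_iso ?D ?S" unfolding alg_iso_def by blast
  then show ?thesis unfolding schur_B_eq by blast
qed

lemma k_algebra_schur_B: "k_algebra (schur_B Q q n d)"
  unfolding schur_B_eq by (rule k_algebra_End_of[OF preserved_words]) auto

end

text \<open>The factor \<open>Q\<^sup>-\<^sup>2 + q\<^sup>2\<^sup>k\<close> of \<open>f_B\<close> times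
  \<open>Q\<close> is \<open>inverse Q + q\<^sup>2\<^sup>k Q\<close>.\<close>
lemma f_B_schur_parameters:
  assumes "q \<noteq> 0" "Q \<noteq> 0" "f_B Q q d \<noteq> 0"
  shows "schur_parameters Q q d"
proof
  fix k :: int assume k: "\<bar>k\<bar> < int d"
  then have "k \<in> {1 - int d..int d - 1}" by auto
  then have "Q powi (- 2) + q powi (2 * k) \<noteq> 0" using assms(3) unfolding f_B_def by auto
  then have "Q * (Q powi (- 2) + q powi (2 * k)) \<noteq> 0" using assms(2) by simp
  moreover have "Q * Q powi (- 2) = inverse Q" using assms(2) by (simp add: power_int_minus power2_eq_square)
  ultimately show "inverse Q + q powi (2 * k) * Q \<noteq> 0" by (simp add: distrib_left mult.commute)
qed (use assms in auto)

theorem cell_datum_schur_sum: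
  assumes D: "\<And>N D. cell_datum (schur_A Q q N D) (L N D) (R N D) (M N D) (C N D) (star N D)"
  shows "\<exists>star. cell_datum (schur_sum Q q n d) (L_B L n d) (R_B L R n d) (M_B M n d) (C_B Q q C n d) star"
proof -
  let ?m1 = "(n + 1) div 2" and ?m2 = "n div 2"
  have "\<exists>star. cell_datum (schur_tensor Q q n d i) (L ?m1 i \<times> L ?m2 (d - i))
      (lex_order (L ?m1 i) (R ?m1 i) (L ?m2 (d - i)) (R ?m2 (d - i))) (\<lambda>(l1, l2). M ?m1 i l1 \<times> M ?m2 (d - i) l2)
      (\<lambda>(l1, l2) (s1, s2) (t1, t2). tensor_elem (schur_A Q q ?m1 i) (schur_A Q q ?m2 (d - i))
        (C ?m1 i l1 s1 t1) (C ?m2 (d - i) l2 s2 t2)) star" for i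
    unfolding schur_tensor_def by (rule cell_datum_tensor[OF D D])
  then have "\<forall>i. \<exists>star. cell_datum (schur_tensor Q q n d i) (L ?m1 i \<times> L ?m2 (d - i))
      (lex_order (L ?m1 i) (R ?m1 i) (L ?m2 (d - i)) (R ?m2 (d - i))) (\<lambda>(l1, l2). M ?m1 i l1 \<times> M ?m2 (d - i) l2)
      (\<lambda>(l1, l2) (s1, s2) (t1, t2). tensor_elem (schur_A Q q ?m1 i) (schur_A Q q ?m2 (d - i))
        (C ?m1 i l1 s1 t1) (C ?m2 (d - i) l2 s2 t2)) star" ..
  from choice[OF this] obtain st where st: "\<forall>i. cell_datum (schur_tensor Q q n d i) (L ?m1 i \<times> L ?m2 (d - i))
      (lex_order (L ?m1 i) (R ?m1 i) (L ?m2 (d - i)) (R ?m2 (d - i))) (\<lambda>(l1, l2). M ?m1 i l1 \<times> M ?m2 (d - i) l2)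
      (\<lambda>(l1, l2) (s1, s2) (t1, t2). tensor_elem (schur_A Q q ?m1 i) (schur_A Q q ?m2 (d - i))
        (C ?m1 i l1 s1 t1) (C ?m2 (d - i) l2 s2 t2)) (st i)" ..
  have "L_B L n d = (SIGMA i:{..d}. L ?m1 i \<times> L ?m2 (d - i))" by (rule L_B_def)
  moreover have "R_B L R n d = {((i, l), (j, m)). i = j \<and> i \<in> {..d} \<and>
      (l, m) \<in> lex_order (L ?m1 i) (R ?m1 i) (L ?m2 (d - i)) (R ?m2 (d - i))}"
    unfolding R_B_def L_B_def lex_order_def by auto
  moreover have "M_B M n d = (\<lambda>(i, l). (\<lambda>(l1, l2). M ?m1 i l1 \<times> M ?m2 (d - i) l2) l)"
    by (rule ext) (auto split: prod.split)
  moreover have "C_B Q q C n d = (\<lambda>(i, l) s t. dirsum_in {..d} (schur_tensor Q q n d) i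
      ((\<lambda>(l1, l2) (s1, s2) (t1, t2). tensor_elem (schur_A Q q ?m1 i) (schur_A Q q ?m2 (d - i))
        (C ?m1 i l1 s1 t1) (C ?m2 (d - i) l2 s2 t2)) l s t))"
    by (intro ext) (auto split: prod.split)
  ultimately show ?thesis
    using cell_datum_dirsum[OF finite_atMost st[rule_format], of d] unfolding schur_sum_def by (intro exI) (simp only:)
qed

theorem corollary5p2p1:
  fixes q Q :: "'k::field"
    and n d :: nat
    and L :: "nat \<Rightarrow> nat \<Rightarrow> 'l set"
    and R :: "nat \<Rightarrow> nat \<Rightarrow> 'l rel"
    and M :: "nat \<Rightarrow> nat \<Rightarrow> 'l \<Rightarrow> 's set"
    and C :: "nat \<Rightarrow> nat \<Rightarrow> 'l \<Rightarrow> 's \<Rightarrow> 's \<Rightarrow> 'k endo"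
    and star :: "nat \<Rightarrow> nat \<Rightarrow> 'k endo \<Rightarrow> 'k endo"
  assumes "q \<noteq> 0" and "Q \<noteq> 0" and "n \<ge> 1" and "d \<ge> 1"
    and "f_B Q q d \<noteq> 0"
    and "\<And>N D. cell_datum (schur_A Q q N D) (L N D) (R N D) (M N D) (C N D) (star N D)"
  shows "(\<exists>\<Phi>. \<Phi> \<in> alg_iso (schur_sum Q q n d) (schur_B Q q n d)) \<and>
    (\<forall>\<Phi> \<in> alg_iso (schur_sum Q q n d) (schur_B Q q n d).
      \<exists>star_B \<in> k_linear (schur_B Q q n d) (schur_B Q q n d).
        (\<forall>l \<in> L_B L n d. \<forall>s \<in> M_B M n d l. \<forall>t \<in> M_B M n d l.
          star_B (\<Phi> (C_B Q q C n d l s t)) = \<Phi> (C_B Q q C n d l t s)) \<and>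
        cell_datum (schur_B Q q n d) (L_B L n d) (R_B L R n d) (M_B M n d)
          (\<lambda>l s t. \<Phi> (C_B Q q C n d l s t)) star_B)"
proof
  interpret schur_parameters Q q n d by (rule f_B_schur_parameters[OF assms(1,2,5)])
  note D = assms(6)
  have alg: "k_algebra (schur_tensor Q q n d i)" for i
    unfolding schur_tensor_def
    by (rule algebra_pair.k_algebra_tensor, rule algebra_pair.intro) (use D cell_datum_iff in blast)+
  show "\<exists>\<Phi>. \<Phi> \<in> alg_iso (schur_sum Q q n d) (schur_B Q q n d)"
    unfolding schur_sum_def by (rule schur_sum_iso[OF parabolic_commutant_iso[OF _ D D] alg])
  obtain star' where S: "cell_datum (schur_sum Q q n d) (L_B L n d) (R_B L R n d) (M_B M n d) (C_B Q q C n d) star'"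
    using cell_datum_schur_sum[OF D] by blast
  show "\<forall>\<Phi> \<in> alg_iso (schur_sum Q q n d) (schur_B Q q n d).
      \<exists>star_B \<in> k_linear (schur_B Q q n d) (schur_B Q q n d).
        (\<forall>l \<in> L_B L n d. \<forall>s \<in> M_B M n d l. \<forall>t \<in> M_B M n d l.
          star_B (\<Phi> (C_B Q q C n d l s t)) = \<Phi> (C_B Q q C n d l t s)) \<and>
        cell_datum (schur_B Q q n d) (L_B L n d) (R_B L R n d) (M_B M n d)
          (\<lambda>l s t. \<Phi> (C_B Q q C n d l s t)) star_B"
  proof
    fix \<Phi> assume \<Phi>: "\<Phi> \<in> alg_iso (schur_sum Q q n d) (schur_B Q q n d)"
    interpret B: cell_datum "schur_B Q q n d" "L_B L n d" "R_B L R n d" "M_B M n d" "\<lambda>l s t. \<Phi> (C_B Q q C n d l s t)"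
      "\<lambda>y. \<Phi> (star' (inv_into (carrier (schur_sum Q q n d)) \<Phi> y))"
      by (rule cell_datum_transport[OF S k_algebra_schur_B \<Phi>])
    show "\<exists>star_B \<in> k_linear (schur_B Q q n d) (schur_B Q q n d).
        (\<forall>l \<in> L_B L n d. \<forall>s \<in> M_B M n d l. \<forall>t \<in> M_B M n d l.
          star_B (\<Phi> (C_B Q q C n d l s t)) = \<Phi> (C_B Q q C n d l t s)) \<and>
        cell_datum (schur_B Q q n d) (L_B L n d) (R_B L R n d) (M_B M n d)
          (\<lambda>l s t. \<Phi> (C_B Q q C n d l s t)) star_B"
      by (rule bexI[OF _ B.star_linear], rule conjI[OF _ B.cell_datum_axioms], intro ballI, rule B.C2)
  qed
qed

end
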